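(* Let $E$ be a topological space with Borel $\sigma$-field $\mathcal{E}$, $p\ge1$ an integer, $\gamma$ a measure on $E$, $f:[0,1]\times E^{p+1}\to[0,\infty)$ measurable, and let $R_u(\mathbf{x},A)=\int_Af(u,\mathbf{x},y)\gamma(dy)$, $u\in[0,1]$, be probability kernels from $E^p$ to $E$. Let $Q_u$, $Y_{n,t}$, $X_{n,t}=(Y_{n,t-p+1},\ldots,Y_{n,t})$ be as in the context. Let $\phi:E\to[1,\infty)$ be measurable and assume: (SCp1) There exist a real number $d_0\ge1$ and positive real numbers $\alpha_0$ and $\alpha_{1,u},\ldots,\alpha_{p,u}$ ($u\in[0,1]$) with $\sup_{u\in[0,1]}\sum_{i=1}^p\alpha_{i,u}<1$ and $R_u\phi^{d_0}(\mathbf{x})\le\sum_{i=1}^p\alpha_{i,u}\phi^{d_0}(x_i)+\alpha_0$ for all $\mathbf{x}\in E^p$, $u\in[0,1]$. Moreover, for each $r>0$ there exist $\eta_r>0$ and a probability measure $\nu_r$ on $E$ such that $R_u(\mathbf{x},A)\ge\eta_r\nu_r(A)$ for all $u\in[0,1]$, $A\in\mathcal{E}$ and all $\mathbf{x}$ with $\max_{1\le i\le p}\phi(x_i)^{d_0}\le r$. (SCp2) There is an integer $k\ge1$ such that for all $(\mathbf{x},y)\in E^p\times E$ the function $u\mapsto f(u,\mathbf{x},y)$ is $k$-times continuously differentiable, with $\ell$-th derivative $\partial_1^{(\ell)}f$. (SCp3) There exist real numbers $d_1>0$, $q\ge0$, $C>0$ such that $d_1+kq\le d_0$ and, for all $1\le\ell\le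 k$, $0\le d\le d_1+(k-\ell)q$, $u\in[0,1]$, $\mathbf{x}\in E^p$, $$\int\phi^d(y)\,|\partial_1^{(\ell)}f(u,\mathbf{x},y)|\,\gamma(dy)\le C\sum_{i=1}^p\phi^{d+q\ell}(x_i).$$ Moreover, for $s=0,\ldots,k$, $u\in[0,1]$, $\mathbf{x}\in E^p$, $$\lim_{h\to0}\int\phi^{d_1+qs}(y)\,|\partial_1^{(k-s)}f(u+h,\mathbf{x},y)-\partial_1^{(k-s)}f(u,\mathbf{x},y)|\,\gamma(dy)=0.$$ Then the triangular array of Markov chains $\{X_{n,t}:1\le t\le n,n\ge1\}$ is $V_0$-locally stationary with $V_0(x_1,\ldots,x_p)=\sum_{i=1}^p\phi^{d_1}(x_i)$. Moreover, for each integer $j\ge1$, the map $u\mapsto\pi_{u,j}$ ($j$-dimensional distribution of the stationary Markov chain with transition $Q_u$) is $k$-times continuously differentiable from $[0,1]$ to $\mathcal{M}_{V_0}(E^{pj})$.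
   Context: $R_ug(\mathbf{x})=\int R_u(\mathbf{x},dy)g(y)$. $Q_u$ is the Markov kernel on $E^p$ given by $Q_u(\mathbf{x},d\mathbf{y})=R_u(\mathbf{x},dy_p)\prod_{i=1}^{p-1}\delta_{x_{i+1}}(dy_i)$. For each $n\ge1$, $(Y_{n,t})_{t\le n}$ is a process such that $\mathbb{P}(Y_{n,t}\in A\mid Y_{n,t-1},Y_{n,t-2},\ldots)=R_{t/n}(Y_{n,t-p},\ldots,Y_{n,t-1},A)$ for $1\le t\le n$, and $(Y_{n,t})_{t\le0}$ is a stationary time-homogeneous $p$-order Markov process with transition kernel $R_0$. Hence $X_{n,t}=(Y_{n,t-p+1},\ldots,Y_{n,t})$ satisfies $\mathbb{P}(X_{n,t}\in A\mid X_{n,t-1})=Q_{t/n}(X_{n,t-1},A)$, $1\le t\le n$, and $X_{n,0}$ has law $\pi_0$, where $\pi_u$ denotes the invariant probability measure of $Q_u$ (assumed unique). For measurable $V:E^p\to[1,\infty)$ and $j\ge1$, $\mathcal{M}_V(E^{pj})$ is the Banach space of signed measures $\mu$ on $(E^p)^j=E^{pj}$ with $\|\mu\|_V:=\sup\{\int g\,d\mu: g\text{ measurable},\ |g(\mathbf{x}_1,\ldots,\mathbf{x}_j)|\le V(\mathbf{x}_1)+\cdots+V(\mathbf{x}_j)\}<\infty$, where $\mathbf{x}_i\in E^p$. $\pi_{u,j}(d\mathbf{x}_1,\ldots,d\mathbf{x}_j)=\pi_u(d\mathbf{x}_1)Q_u(\mathbf{x}_1,d\mathbf{x}_2)\cdots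 Q_u(\mathbf{x}_{j-1},d\mathbf{x}_j)$, and $\pi^{(n)}_{t,j}$ is the law of $(X_{n,t},\ldots,X_{n,t+j-1})$. The array is $V$-locally stationary if for every $j\ge1$ there is $C_j>0$, not depending on $u,n,t$, such that $\|\pi^{(n)}_{t,j}-\pi_{u,j}\|_V\le C_j\left[|u-\frac tn|+\frac1n\right]$ for all $u\in[0,1]$, $n\ge1$, $1\le t\le n-j+1$. Derivatives and limits at the endpoints of $[0,1]$ are one-sided. *)

theory Defs
  imports "HOL-Probability.Probability"
begin

section \<open>Kernels and Markov chains\<close>

text \<open>Points of \<open>E^p\<close> are extensional functions on \<open>{1..p}\<close>, and \<open>(E^p)^j\<close> is an iterated product.\<close>

abbreviation E_pow :: "nat \<Rightarrow> (nat \<Rightarrow> 'e::topological_space) measure" where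
  "E_pow p \<equiv> PiM {1..p} (\<lambda>_. borel)"

abbreviation E_pow_pow :: "nat \<Rightarrow> nat \<Rightarrow> (nat \<Rightarrow> nat \<Rightarrow> 'e::topological_space) measure" where
  "E_pow_pow p j \<equiv> PiM {1..j} (\<lambda>_. E_pow p)"

definition R_kernel ::
  "'e measure \<Rightarrow> (real \<Rightarrow> (nat \<Rightarrow> 'e) \<Rightarrow> 'e \<Rightarrow> real) \<Rightarrow> real \<Rightarrow> (nat \<Rightarrow> 'e) \<Rightarrow> 'e measure" where
  "R_kernel \<gamma> f u x = density \<gamma> (\<lambda>y. ennreal (f u x y))"

definition Q_kernel ::
  "nat \<Rightarrow> (real \<Rightarrow> (nat \<Rightarrow> 'e) \<Rightarrow> 'e measure) \<Rightarrow> real \<Rightarrow> (nat \<Rightarrow> 'e::topological_space) \<Rightarrow> (nat \<Rightarrow> 'e) measure"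
where
  "Q_kernel p R u x = PiM {1..p} (\<lambda>i. if i = p then R u x else return borel (x (i + 1)))"

definition invariant_prob :: "'a measure \<Rightarrow> ('a \<Rightarrow> 'a measure) \<Rightarrow> 'a measure \<Rightarrow> bool" where
  "invariant_prob N K \<mu> \<longleftrightarrow> prob_space \<mu> \<and> sets \<mu> = sets N \<and> \<mu> \<bind> K = \<mu>"

text \<open>
  The law \<open>\<mu>(dx_1) K(x_1, dx_2) \<dots> K(x_{j-1}, dx_j)\<close> on the \<open>j\<close>-fold power of \<open>N\<close>,
  started from the point mass at the only element of the empty power.
\<close>

primrec path_law ::
  "'a measure \<Rightarrow> 'a measure \<Rightarrow> ('a \<Rightarrow> 'a measure) \<Rightarrow> nat \<Rightarrow> (nat \<Rightarrow> 'a) measure" where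
  "path_law N \<mu> K 0 = return (PiM {} (\<lambda>_. N)) (\<lambda>_. undefined)"
| "path_law N \<mu> K (Suc j) =
     path_law N \<mu> K j \<bind>
       (\<lambda>z. distr (if j = 0 then \<mu> else K (z j)) (PiM {1..Suc j} (\<lambda>_. N)) (\<lambda>y. z(Suc j := y)))"

section \<open>Processes\<close>

text \<open>The block \<open>(Y_{t-p+1}, \<dots>, Y_t)\<close>.\<close>

definition block :: "nat \<Rightarrow> (int \<Rightarrow> 'w \<Rightarrow> 'e) \<Rightarrow> int \<Rightarrow> 'w \<Rightarrow> (nat \<Rightarrow> 'e)" where
  "block p Y t \<omega> = (\<lambda>i\<in>{1..p}. Y (t - int p + int i) \<omega>)"

definition past_algebra ::
  "'w measure \<Rightarrow> (int \<Rightarrow> 'w \<Rightarrow> 'e::topological_space) \<Rightarrow> int \<Rightarrow> 'w measure" where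
  "past_algebra M Y t =
     vimage_algebra (space M) (\<lambda>\<omega>. \<lambda>s\<in>{..<t}. Y s \<omega>) (PiM {..<t} (\<lambda>_. borel))"

definition transition_at ::
  "nat \<Rightarrow> 'w measure \<Rightarrow> (int \<Rightarrow> 'w \<Rightarrow> 'e::topological_space) \<Rightarrow> ((nat \<Rightarrow> 'e) \<Rightarrow> 'e measure) \<Rightarrow> int \<Rightarrow> bool"
where
  "transition_at p M Y K t \<longleftrightarrow>
     (\<forall>A\<in>sets borel. AE \<omega> in M.
        real_cond_exp M (past_algebra M Y t) (indicator {\<omega> \<in> space M. Y t \<omega> \<in> A}) \<omega>
          = measure (K (block p Y (t - 1) \<omega>)) A)"

definition stationary_past :: "'w measure \<Rightarrow> (int \<Rightarrow> 'w \<Rightarrow> 'e::topological_space) \<Rightarrow> bool" where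
  "stationary_past M Y \<longleftrightarrow>
     (\<forall>m::nat. distr M (PiM {..0} (\<lambda>_. borel)) (\<lambda>\<omega>. \<lambda>s\<in>{..0}. Y (s - int m) \<omega>)
             = distr M (PiM {..0} (\<lambda>_. borel)) (\<lambda>\<omega>. \<lambda>s\<in>{..0}. Y s \<omega>))"

definition block_path_law ::
  "nat \<Rightarrow> 'w measure \<Rightarrow> (int \<Rightarrow> 'w \<Rightarrow> 'e::topological_space) \<Rightarrow> int \<Rightarrow> nat \<Rightarrow> (nat \<Rightarrow> nat \<Rightarrow> 'e) measure"
where
  "block_path_law p M Y t j =
     distr M (E_pow_pow p j) (\<lambda>\<omega>. \<lambda>i\<in>{1..j}. block p Y (t + int i - 1) \<omega>)"

section \<open>Weighted spaces of signed measures\<close>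

text \<open>
  Signed measures are real-valued (hence finite) countably additive set functions. Like
  \<^const>\<open>measure\<close>, they are set to zero off the \<open>\<sigma>\<close>-field, so that equality
  of signed measures is equality of functions.
\<close>

definition signed_measure :: "'a measure \<Rightarrow> ('a set \<Rightarrow> real) \<Rightarrow> bool" where
  "signed_measure N \<mu> \<longleftrightarrow>
     (\<forall>A. A \<notin> sets N \<longrightarrow> \<mu> A = 0) \<and> \<mu> {} = 0 \<and>
     (\<forall>A::nat \<Rightarrow> 'a set. range A \<subseteq> sets N \<longrightarrow> disjoint_family A \<longrightarrow>
        (\<lambda>i. \<mu> (A i)) sums \<mu> (\<Union>i. A i))"

text \<open>The positive part in the Jordan decomposition; the negative part is that of \<open>- \<mu>\<close>.\<close>

definition jordan_pos :: "'a measure \<Rightarrow> ('a set \<Rightarrow> real) \<Rightarrow> 'a measure" where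
  "jordan_pos N \<mu> =
     measure_of (space N) (sets N) (\<lambda>A. SUP B\<in>{B \<in> sets N. B \<subseteq> A}. ennreal (\<mu> B))"

definition signed_integral :: "'a measure \<Rightarrow> ('a set \<Rightarrow> real) \<Rightarrow> ('a \<Rightarrow> real) \<Rightarrow> real" where
  "signed_integral N \<mu> g =
     (LINT x|jordan_pos N \<mu>. g x) - (LINT x|jordan_pos N (\<lambda>A. - \<mu> A). g x)"

text \<open>
  If \<open>g\<close> is not integrable for the total variation of \<open>\<mu>\<close>, then some summand above may be a
  junk value; this does not affect the following supremum, which is then infinite because of
  the truncations of the weight \<open>W\<close>.
\<close>

definition weighted_norm :: "'a measure \<Rightarrow> ('a \<Rightarrow> real) \<Rightarrow> ('a set \<Rightarrow> real) \<Rightarrow> ereal" where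
  "weighted_norm N W \<mu> =
     (SUP g\<in>{g \<in> borel_measurable N. \<forall>x\<in>space N. \<bar>g x\<bar> \<le> W x}. ereal (signed_integral N \<mu> g))"

definition weighted_measures :: "'a measure \<Rightarrow> ('a \<Rightarrow> real) \<Rightarrow> ('a set \<Rightarrow> real) set" where
  "weighted_measures N W = {\<mu>. signed_measure N \<mu> \<and> weighted_norm N W \<mu> < \<infinity>}"

definition sum_weight :: "nat \<Rightarrow> ('a \<Rightarrow> real) \<Rightarrow> (nat \<Rightarrow> 'a) \<Rightarrow> real" where
  "sum_weight j V z = (\<Sum>i=1..j. V (z i))"

section \<open>Differentiability on the unit interval and local stationarity\<close>

text \<open>
  Restricting the increment \<open>h\<close> to this set makes derivatives and limits at the endpoints of
  the unit interval one-sided.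
\<close>

abbreviation increments :: "real \<Rightarrow> real filter" where
  "increments u \<equiv> at 0 within {h. u + h \<in> {0..1}}"

text \<open>\<open>D l\<close> is the \<open>l\<close>-th derivative of \<open>D 0\<close> for \<open>l \<le> k\<close>.\<close>

definition Ck_derivs :: "nat \<Rightarrow> (nat \<Rightarrow> real \<Rightarrow> real) \<Rightarrow> bool" where
  "Ck_derivs k D \<longleftrightarrow>
     (\<forall>l<k. \<forall>u\<in>{0..1}. (D l has_real_derivative D (Suc l) u) (at u within {0..1})) \<and>
     continuous_on {0..1} (D k)"

definition Ck_weighted ::
  "nat \<Rightarrow> 'a measure \<Rightarrow> ('a \<Rightarrow> real) \<Rightarrow> (real \<Rightarrow> 'a set \<Rightarrow> real) \<Rightarrow> bool" where
  "Ck_weighted k N W m \<longleftrightarrow>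
     (\<exists>D :: nat \<Rightarrow> real \<Rightarrow> 'a set \<Rightarrow> real.
        (\<forall>u\<in>{0..1}. D 0 u = m u) \<and>
        (\<forall>l\<le>k. \<forall>u\<in>{0..1}. D l u \<in> weighted_measures N W) \<and>
        (\<forall>l<k. \<forall>u\<in>{0..1}.
           ((\<lambda>h. weighted_norm N W (\<lambda>A. (D l (u + h) A - D l u A) / h - D (Suc l) u A)) \<longlongrightarrow> 0)
             (increments u)) \<and>
        (\<forall>u\<in>{0..1}.
           ((\<lambda>h. weighted_norm N W (\<lambda>A. D k (u + h) A - D k u A)) \<longlongrightarrow> 0) (increments u)))"

definition locally_stationary ::
  "nat \<Rightarrow> ((nat \<Rightarrow> 'e::topological_space) \<Rightarrow> real) \<Rightarrow> (nat \<Rightarrow> 'w measure) \<Rightarrow> (nat \<Rightarrow> int \<Rightarrow> 'w \<Rightarrow> 'e)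
    \<Rightarrow> (real \<Rightarrow> nat \<Rightarrow> (nat \<Rightarrow> nat \<Rightarrow> 'e) measure) \<Rightarrow> bool" where
  "locally_stationary p V M Y \<pi>j \<longleftrightarrow>
     (\<forall>j\<ge>1. \<exists>C>0. \<forall>u\<in>{0..1}. \<forall>n\<ge>1. \<forall>t. 1 \<le> t \<longrightarrow> t \<le> int n - int j + 1 \<longrightarrow>
        weighted_norm (E_pow_pow p j) (sum_weight j V)
          (\<lambda>A. measure (block_path_law p (M n) (Y n) t j) A - measure (\<pi>j u j) A)
        \<le> ereal (C * (\<bar>u - real_of_int t / real n\<bar> + 1 / real n)))"

end

theory Submission
  imports Defs
begin

text \<open>
  The drift condition and the minorization, applied to \<open>p\<close> consecutive steps of the chain, give for
  each weight \<open>\<phi>^d\<close>, \<open>0 < d \<le> d_0\<close>, a contraction of an iterate of \<open>Q_u\<close>, uniformly in \<open>u\<close>. Hence the Poisson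
  operator \<open>Z_u g = \<Sum>_n (Q_u^n g - \<pi>_u g)\<close> is bounded uniformly in \<open>u\<close>, and invariance gives
  \<open>\<pi>_v g - \<pi>_u g = \<pi>_u (Q_v - Q_u) Z_v g\<close>. Since each derivative of \<open>Q_u\<close> maps functions bounded by
  \<open>\<phi>^d\<close> to functions bounded by \<open>\<phi>^(d + q)\<close>, this identity can be differentiated \<open>k\<close> times
  along the weights \<open>\<phi>^(d_1 + q s)\<close>, with the recursion
  \<open>\<pi>_u^(l) g = \<Sum>_{i < l} (l choose i) \<pi>_u^(i) Q_u^(l - i) Z_u g\<close>; the laws of paths follow by the
  Leibniz rule. Local stationarity compares \<open>Q_{1/n} \<dots> Q_{t/n}\<close> with powers of \<open>Q_{t/n}\<close>: the error of
  the factor \<open>i\<close> steps before time \<open>t\<close> is of order \<open>\<kappa>^i i / n\<close>, which is summable in \<open>i\<close>.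

  Signed measures with a finite weighted norm are handled through the functionals that they induce on
  functions bounded by the weight.
\<close>

section \<open>Functionals on weighted spaces of functions\<close>

text \<open>The limits in (SCp3) are taken for each point of the state space separately, so u
  \<mapsto> Q_u is not known to be continuous in operator norm. What is known is convergence at
  every point, together with a bound that is uniform in the point. A functional that obeys dominated
  convergence, applied from the left, turns this into convergence uniform over bounded sets of test
  functions. Hence the notions used throughout: functionals are linear and continuous under bounded
  pointwise convergence, families of functionals are differentiated along arbitrary bounded
  sequences of functions, and operators are differentiated pointwise. The regularity of u \<mapsto>
  Z_u is never studied. In the difference identities a function Z_v g is just another test function,
  bounded uniformly in the parameter. The shift structure is the other obstacle. One transition
  renews a single coordinate of the block and moves the rest deterministically, so for p > 1 neither
  the drift nor the minorization of R_u contracts Q_u in one step; two chains have to be compared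
  letter by letter over p steps.\<close>

definition wbound :: "'a measure \<Rightarrow> ('a \<Rightarrow> real) \<Rightarrow> real \<Rightarrow> ('a \<Rightarrow> real) \<Rightarrow> bool" where
  "wbound N w b g \<longleftrightarrow> g \<in> borel_measurable N \<and> (\<forall>x\<in>space N. \<bar>g x\<bar> \<le> b * w x)"

lemma wboundD:
  assumes "wbound N w b g"
  shows "g \<in> borel_measurable N" "x \<in> space N \<Longrightarrow> \<bar>g x\<bar> \<le> b * w x"
  using assms by (auto simp: wbound_def)

lemma wboundI:
  assumes "g \<in> borel_measurable N" "\<And>x. x \<in> space N \<Longrightarrow> \<bar>g x\<bar> \<le> b * w x"
  shows "wbound N w b g"
  using assms by (auto simp: wbound_def)

lemma wbound_add:
  assumes "wbound N w b g" "wbound N w c h"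
  shows "wbound N w (b + c) (\<lambda>x. g x + h x)"
proof (rule wboundI)
  show "(\<lambda>x. g x + h x) \<in> borel_measurable N"
    using assms by (auto simp: wbound_def)
  show "\<bar>g x + h x\<bar> \<le> (b + c) * w x" if "x \<in> space N" for x
    using wboundD(2)[OF assms(1) that] wboundD(2)[OF assms(2) that] by (simp add: algebra_simps)
qed

lemma wbound_scale:
  assumes "wbound N w b g"
  shows "wbound N w (\<bar>a\<bar> * b) (\<lambda>x. a * g x)"
proof (rule wboundI)
  show "(\<lambda>x. a * g x) \<in> borel_measurable N"
    using assms by (auto simp: wbound_def)
  show "\<bar>a * g x\<bar> \<le> \<bar>a\<bar> * b * w x" if "x \<in> space N" for x
    using mult_left_mono[OF wboundD(2)[OF assms that], of "\<bar>a\<bar>"] by (simp add: abs_mult mult.assoc)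
qed

lemma wbound_lincomb:
  assumes "wbound N w b g" "wbound N w c h"
  shows "wbound N w (\<bar>r\<bar> * b + \<bar>s\<bar> * c) (\<lambda>x. r * g x + s * h x)"
  by (intro wbound_add wbound_scale assms)

lemma wbound_diff:
  assumes "wbound N w b g" "wbound N w c h"
  shows "wbound N w (b + c) (\<lambda>x. g x - h x)"
  using wbound_lincomb[OF assms, of 1 "-1"] by simp

lemma wbound_mono:
  assumes "wbound N w b g" "b \<le> c" "\<And>x. x \<in> space N \<Longrightarrow> 0 \<le> w x"
  shows "wbound N w c g"
  using assms unfolding wbound_def by (meson mult_right_mono order_trans)

lemma wbound_mono_weight:
  assumes "wbound N w b g" "0 \<le> b" "\<And>x. x \<in> space N \<Longrightarrow> w x \<le> w' x"
  shows "wbound N w' b g"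
  using assms unfolding wbound_def by (meson mult_left_mono order_trans)

lemma wbound_const:
  assumes "\<And>x. x \<in> space N \<Longrightarrow> 1 \<le> w x"
  shows "wbound N w \<bar>c\<bar> (\<lambda>x. c)"
  using assms by (auto intro!: wboundI simp: mult_le_cancel_left1)

lemma wbound_indicator:
  assumes "\<And>x. x \<in> space N \<Longrightarrow> 1 \<le> w x" "A \<in> sets N"
  shows "wbound N w 1 (indicator A)"
  using assms by (intro wboundI) (auto simp: indicator_def dest: order_trans[OF zero_le_one])

text \<open>Linearity and dominated convergence, the two properties of integration against a signed
  measure that the arguments use. Both are required only on functions bounded by a multiple of
  \<open>w\<close>; elsewhere \<open>F\<close> may take default values, as an integral does.\<close>

definition cont_functional :: "'a measure \<Rightarrow> ('a \<Rightarrow> real) \<Rightarrow> (('a \<Rightarrow> real) \<Rightarrow> real) \<Rightarrow> bool" where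
  "cont_functional N w F \<longleftrightarrow>
     (\<forall>g h a b c c'. wbound N w c g \<longrightarrow> wbound N w c' h \<longrightarrow>
        F (\<lambda>x. a * g x + b * h x) = a * F g + b * F h) \<and>
     (\<forall>g G c. (\<forall>n. wbound N w c (g n)) \<longrightarrow> wbound N w c G \<longrightarrow>
        (\<forall>x\<in>space N. (\<lambda>n. g n x) \<longlonglongrightarrow> G x) \<longrightarrow> (\<lambda>n::nat. F (g n)) \<longlonglongrightarrow> F G)"

lemma cont_functional_lincomb:
  assumes "cont_functional N w F" "wbound N w c g" "wbound N w c' h"
  shows "F (\<lambda>x. a * g x + b * h x) = a * F g + b * F h"
  using assms unfolding cont_functional_def by blast

lemma cont_functional_tendsto:
  assumes "cont_functional N w F" "\<And>n. wbound N w c (g n)" "wbound N w c G"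
    "\<And>x. x \<in> space N \<Longrightarrow> (\<lambda>n. g n x) \<longlonglongrightarrow> G x"
  shows "(\<lambda>n::nat. F (g n)) \<longlonglongrightarrow> F G"
  using assms unfolding cont_functional_def by blast

lemma cont_functional_add:
  assumes "cont_functional N w F" "wbound N w c g" "wbound N w c' h"
  shows "F (\<lambda>x. g x + h x) = F g + F h"
  using cont_functional_lincomb[OF assms, of 1 1] by simp

lemma cont_functional_diff:
  assumes "cont_functional N w F" "wbound N w c g" "wbound N w c' h"
  shows "F (\<lambda>x. g x - h x) = F g - F h"
  using cont_functional_lincomb[OF assms, of 1 "-1"] by simp

lemma cont_functional_scale:
  assumes "cont_functional N w F" "wbound N w c g"
  shows "F (\<lambda>x. a * g x) = a * F g"
  using cont_functional_lincomb[OF assms(1,2,2), of a 0] by simp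

lemma cont_functional_zero:
  assumes "cont_functional N w F"
  shows "F (\<lambda>x. 0) = 0"
  using cont_functional_scale[OF assms, of 0 "\<lambda>x. 0" 0] by (simp add: wbound_def)

text \<open>Convergence is asked only on \<open>space N\<close>, so the constant sequence
  \<open>g\<close> converges to \<open>h\<close>: values off the space do not matter.\<close>

lemma cont_functional_cong:
  assumes "cont_functional N w F" "wbound N w c g" "\<And>x. x \<in> space N \<Longrightarrow> g x = h x"
  shows "F g = F h"
proof -
  have h: "wbound N w c h"
    using assms(2,3) by (auto simp: wbound_def cong: measurable_cong)
  have "(\<lambda>n::nat. F g) \<longlonglongrightarrow> F h"
    by (rule cont_functional_tendsto[OF assms(1) assms(2) h]) (simp add: assms(3))
  then show ?thesis by (simp add: LIMSEQ_const_iff)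
qed

text \<open>If \<open>F\<close> were unbounded on the unit ball, one could pick \<open>g n\<close>
  there with \<open>|F (g n)| > n + 1\<close>. Then \<open>g n / F (g n)\<close> is dominated and
  tends to 0 pointwise although \<open>F\<close> equals 1 on it, against dominated
  convergence.\<close>

lemma cont_functional_bounded:
  assumes F: "cont_functional N w F" and w: "\<And>x. x \<in> space N \<Longrightarrow> 0 \<le> w x"
  obtains K where "0 \<le> K" "\<And>g b. 0 \<le> b \<Longrightarrow> wbound N w b g \<Longrightarrow> \<bar>F g\<bar> \<le> K * b"
proof -
  have "\<exists>K\<ge>0. \<forall>g. wbound N w 1 g \<longrightarrow> \<bar>F g\<bar> \<le> K"
  proof (rule ccontr)
    assume "\<not> ?thesis"
    then have "\<forall>n::nat. \<exists>g. wbound N w 1 g \<and> \<bar>F g\<bar> > real (Suc n)"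
      by (metis not_le of_nat_0_le_iff)
    then obtain g where g: "\<And>n. wbound N w 1 (g n)" "\<And>n. \<bar>F (g n)\<bar> > real (Suc n)"
      by metis
    define h where "h n x = 1 / F (g n) * g n x" for n x
    have Fn: "\<bar>1 / F (g n)\<bar> \<le> 1 / real (Suc n)" for n
      using g(2)[of n] by (auto simp: field_simps)
    have h_le: "\<bar>h n x\<bar> \<le> w x / real (Suc n)" if "x \<in> space N" for n x
      using mult_mono[OF Fn[of n] wboundD(2)[OF g(1)[of n] that]]
      by (simp add: h_def abs_mult)
    have hb: "wbound N w 1 (h n)" for n
    proof (rule wboundI)
      show "h n \<in> borel_measurable N"
        using wboundD(1)[OF g(1)[of n]] by (simp add: h_def[abs_def])
      show "\<bar>h n x\<bar> \<le> 1 * w x" if "x \<in> space N" for x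
        using h_le[OF that, of n] w[OF that] divide_left_mono[of 1 "real (Suc n)" "w x"] by simp
    qed
    have "(\<lambda>n. F (h n)) \<longlonglongrightarrow> F (\<lambda>x. 0)"
    proof (rule cont_functional_tendsto[OF F hb])
      show "wbound N w 1 (\<lambda>x. 0)" using w by (auto simp: wbound_def)
      fix x assume x: "x \<in> space N"
      have "(\<lambda>n. w x / real (Suc n)) \<longlonglongrightarrow> 0"
        using LIMSEQ_Suc[OF lim_const_over_n[of "w x"]] by simp
      then show "(\<lambda>n. h n x) \<longlonglongrightarrow> 0"
        by (rule Lim_null_comparison[rotated]) (use h_le[OF x] in auto)
    qed
    moreover have "F (h n) = 1" for n
      using g(2)[of n] cont_functional_scale[OF F g(1)[of n], of "1 / F (g n)"]
      by (auto simp: h_def[abs_def])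
    ultimately show False
      using cont_functional_zero[OF F] by (simp add: LIMSEQ_const_iff)
  qed
  then obtain K where K: "K \<ge> 0" "\<And>g. wbound N w 1 g \<Longrightarrow> \<bar>F g\<bar> \<le> K" by blast
  show ?thesis
  proof (rule that[OF K(1)])
    fix g b assume b: "0 \<le> b" and g: "wbound N w b g"
    show "\<bar>F g\<bar> \<le> K * b"
    proof (cases "b = 0")
      case True
      then have "F g = F (\<lambda>x. 0)"
        using g by (intro cont_functional_cong[OF F g]) (auto simp: wbound_def)
      then show ?thesis using True cont_functional_zero[OF F] by simp
    next
      case False
      then have "wbound N w 1 (\<lambda>x. (1/b) * g x)"
        using wbound_scale[OF g, of "1/b"] b by simp
      from K(2)[OF this] have "\<bar>(1/b) * F g\<bar> \<le> K"
        using cont_functional_scale[OF F g, of "1/b"] by simp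
      then show ?thesis using b False by (simp add: field_simps abs_mult)
    qed
  qed
qed

lemma cont_functional_sum:
  assumes F: "cont_functional N w F" and "finite I" "\<And>i. i \<in> I \<Longrightarrow> wbound N w (c i) (g i)"
  shows "wbound N w (\<Sum>i\<in>I. c i) (\<lambda>x. \<Sum>i\<in>I. g i x) \<and> F (\<lambda>x. \<Sum>i\<in>I. g i x) = (\<Sum>i\<in>I. F (g i))"
  using assms(2,3)
proof (induction I rule: finite_induct)
  case empty
  then show ?case using cont_functional_zero[OF F] by (simp add: wbound_def)
next
  case (insert i I)
  then have 1: "wbound N w (sum c I) (\<lambda>x. \<Sum>i\<in>I. g i x)"
    "F (\<lambda>x. \<Sum>i\<in>I. g i x) = (\<Sum>i\<in>I. F (g i))" "wbound N w (c i) (g i)" by auto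
  show ?case
    using wbound_add[OF 1(3,1)] cont_functional_add[OF F 1(3,1)] insert(1,2) 1(2) by simp
qed

lemma cont_functional_eqI:
  assumes F: "cont_functional N w F" and G: "cont_functional N w G"
    and w: "\<And>x. x \<in> space N \<Longrightarrow> 1 \<le> w x"
    and eq: "\<And>A. A \<in> sets N \<Longrightarrow> F (indicator A) = G (indicator A)"
    and g: "wbound N w c g"
  shows "F g = G g"
proof -
  have w0: "0 \<le> w x" if "x \<in> space N" for x using w[OF that] by simp
  have simp: "F s = G s" if s: "simple_function N s" and sb: "wbound N w b s" for s :: "'a \<Rightarrow> real" and b
  proof -
    let ?A = "\<lambda>y. s -` {y} \<inter> space N"
    have fin: "finite (s ` space N)" and A: "?A y \<in> sets N" if "y \<in> s ` space N" for y
      using s that by (auto simp: simple_function_def)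
    have fin: "finite (s ` space N)" using s by (auto simp: simple_function_def)
    have rep: "s x = (\<Sum>y\<in>s ` space N. y * indicator (?A y) x)" if "x \<in> space N" for x
    proof -
      have "(\<Sum>y\<in>s ` space N. y * indicator (?A y) x) = (\<Sum>y\<in>s ` space N. if y = s x then y else 0)"
        using that by (intro sum.cong) (auto simp: indicator_def)
      also have "\<dots> = s x" using that fin by simp
      finally show ?thesis by simp
    qed
    have b: "wbound N w (\<bar>y\<bar> * 1) (\<lambda>x. y * indicator (?A y) x)" if "y \<in> s ` space N" for y
      by (intro wbound_scale wbound_indicator w A that)
    have "F s = F (\<lambda>x. \<Sum>y\<in>s ` space N. y * indicator (?A y) x)"
      by (intro cont_functional_cong[OF F sb]) (rule rep)
    also have "\<dots> = (\<Sum>y\<in>s ` space N. F (\<lambda>x. y * indicator (?A y) x))"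
      by (rule cont_functional_sum[OF F fin, THEN conjunct2]) (rule b)
    also have "\<dots> = (\<Sum>y\<in>s ` space N. G (\<lambda>x. y * indicator (?A y) x))"
    proof (intro sum.cong refl)
      fix y assume y: "y \<in> s ` space N"
      show "F (\<lambda>x. y * indicator (?A y) x) = G (\<lambda>x. y * indicator (?A y) x)"
        using eq[OF A[OF y]] cont_functional_scale[OF F wbound_indicator[OF w A[OF y]]]
          cont_functional_scale[OF G wbound_indicator[OF w A[OF y]]] by simp
    qed
    also have "\<dots> = G (\<lambda>x. \<Sum>y\<in>s ` space N. y * indicator (?A y) x)"
      by (rule cont_functional_sum[OF G fin, THEN conjunct2, symmetric]) (rule b)
    also have "\<dots> = G s"
      by (intro cont_functional_cong[OF G sb, symmetric]) (rule rep)
    finally show ?thesis .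
  qed
  obtain s where s: "\<And>i. simple_function N (s i)" "\<And>x. x \<in> space N \<Longrightarrow> (\<lambda>i. s i x) \<longlonglongrightarrow> g x"
    "\<And>i x. x \<in> space N \<Longrightarrow> dist (s i x) 0 \<le> 2 * dist (g x) 0"
    using borel_measurable_implies_sequence_metric[OF wboundD(1)[OF g], of 0] by blast
  \<comment> \<open>The simple approximations satisfy \<open>|s i| \<le> 2 * |g|\<close>, hence the
    factor 2.\<close>
  have sb: "wbound N w (2 * \<bar>c\<bar>) (s i)" for i
  proof (rule wboundI)
    show "s i \<in> borel_measurable N" by (rule borel_measurable_simple_function[OF s(1)])
    fix x assume x: "x \<in> space N"
    have "\<bar>s i x\<bar> \<le> 2 * \<bar>g x\<bar>" using s(3)[OF x] by (simp add: dist_real_def)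
    also have "\<bar>g x\<bar> \<le> \<bar>c\<bar> * w x"
      using wboundD(2)[OF g x] mult_right_mono[OF abs_ge_self[of c] w0[OF x]] by linarith
    finally show "\<bar>s i x\<bar> \<le> 2 * \<bar>c\<bar> * w x" by simp
  qed
  have gb: "wbound N w (2 * \<bar>c\<bar>) g"
    by (rule wbound_mono[OF g _ w0]) auto
  have "(\<lambda>i. F (s i)) \<longlonglongrightarrow> F g"
    by (rule cont_functional_tendsto[OF F sb gb s(2)])
  moreover have "(\<lambda>i. G (s i)) \<longlonglongrightarrow> G g"
    by (rule cont_functional_tendsto[OF G sb gb s(2)])
  moreover have "F (s i) = G (s i)" for i by (rule simp[OF s(1) sb])
  ultimately show ?thesis by (simp add: LIMSEQ_unique)
qed

lemma cont_functional_comb: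
  assumes "cont_functional N w F" "cont_functional N w G"
  shows "cont_functional N w (\<lambda>g. a * F g + b * G g)"
  unfolding cont_functional_def
proof (intro conjI allI impI)
  fix g h r s c c' assume "wbound N w c g" "wbound N w c' h"
  then show "a * F (\<lambda>x. r * g x + s * h x) + b * G (\<lambda>x. r * g x + s * h x) =
       r * (a * F g + b * G g) + s * (a * F h + b * G h)"
    using cont_functional_lincomb[OF assms(1), of c g c' h r s]
      cont_functional_lincomb[OF assms(2), of c g c' h r s] by (simp add: algebra_simps)
next
  fix g G' c assume *: "\<forall>n::nat. wbound N w c (g n)" "wbound N w c G'" "\<forall>x\<in>space N. (\<lambda>n. g n x) \<longlonglongrightarrow> G' x"
  show "(\<lambda>n. a * F (g n) + b * G (g n)) \<longlonglongrightarrow> a * F G' + b * G G'"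
    by (intro tendsto_intros cont_functional_tendsto[OF assms(1), of c] cont_functional_tendsto[OF assms(2), of c])
      (use * in auto)
qed

lemma cont_functional_integral:
  assumes w: "integrable \<mu> w" and sets: "sets \<mu> = sets N"
  shows "cont_functional N w (\<lambda>g. \<integral>x. g x \<partial>\<mu>)"
    and "wbound N w c g \<Longrightarrow> integrable \<mu> g"
proof -
  have [simp]: "space \<mu> = space N" by (rule sets_eq_imp_space_eq[OF sets])
  have [measurable_cong]: "sets \<mu> = sets N" by (rule sets)
  show int: "integrable \<mu> g" if "wbound N w c g" for c g
  proof (rule Bochner_Integration.integrable_bound)
    show "integrable \<mu> (\<lambda>x. c * w x)" using w by simp
    show "g \<in> borel_measurable \<mu>" using wboundD(1)[OF that] by measurable
    show "AE x in \<mu>. norm (g x) \<le> norm (c * w x)"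
      using wboundD(2)[OF that] by (auto intro!: AE_I2 intro: order_trans[OF _ abs_ge_self])
  qed
  show "cont_functional N w (\<lambda>g. \<integral>x. g x \<partial>\<mu>)"
    unfolding cont_functional_def
  proof (intro conjI allI impI)
    fix g h a b c c' assume "wbound N w c g" "wbound N w c' h"
    then show "(\<integral>x. a * g x + b * h x \<partial>\<mu>) = a * (\<integral>x. g x \<partial>\<mu>) + b * (\<integral>x. h x \<partial>\<mu>)"
      using int by simp
  next
    fix g G c assume *: "\<forall>n::nat. wbound N w c (g n)" "wbound N w c G" "\<forall>x\<in>space N. (\<lambda>n. g n x) \<longlonglongrightarrow> G x"
    show "(\<lambda>n. \<integral>x. g n x \<partial>\<mu>) \<longlonglongrightarrow> (\<integral>x. G x \<partial>\<mu>)"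
    proof (rule integral_dominated_convergence)
      show "integrable \<mu> (\<lambda>x. c * w x)" using w by simp
      show "G \<in> borel_measurable \<mu>" "\<And>i. g i \<in> borel_measurable \<mu>"
        using wboundD(1)[OF *(2)] wboundD(1)[OF *(1)[rule_format]] by measurable
      show "AE x in \<mu>. (\<lambda>i. g i x) \<longlonglongrightarrow> G x" using * by (auto intro!: AE_I2)
      show "AE x in \<mu>. norm (g i x) \<le> c * w x" for i
        using wboundD(2)[OF *(1)[rule_format]] by (auto intro!: AE_I2)
    qed
  qed
qed


section \<open>Signed measures as functionals\<close>

text \<open>The bound keeps the suprema that define the positive part finite. For a set function
  induced by a functional it comes from \<open>cont_functional_bounded\<close>.\<close>

locale bounded_signed_measure =
  fixes N :: "'a measure" and \<mu> :: "'a set \<Rightarrow> real" and B :: real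
  assumes signed: "signed_measure N \<mu>" and bounded: "\<bar>\<mu> A\<bar> \<le> B"
begin

lemma empty: "\<mu> {} = 0"
  using signed by (simp add: signed_measure_def)

lemma sums: "range A \<subseteq> sets N \<Longrightarrow> disjoint_family A \<Longrightarrow> (\<lambda>i::nat. \<mu> (A i)) sums \<mu> (\<Union>i. A i)"
  using signed by (simp add: signed_measure_def)

lemma additive:
  assumes "A \<in> sets N" "A' \<in> sets N" "A \<inter> A' = {}"
  shows "\<mu> (A \<union> A') = \<mu> A + \<mu> A'"
proof -
  have "(\<lambda>i. \<mu> (binaryset A A' i)) sums \<mu> (\<Union>i. binaryset A A' i)"
    using assms by (intro sums) (auto simp: range_binaryset_eq disjoint_family_on_def binaryset_def)
  moreover have "(\<lambda>i. \<mu> (binaryset A A' i)) sums (\<mu> A + \<mu> A')"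
    by (rule binaryset_sums[where f=\<mu>, OF empty])
  ultimately show ?thesis
    unfolding UN_binaryset_eq by (rule sums_unique2)
qed

lemma diff: "A \<in> sets N \<Longrightarrow> A' \<in> sets N \<Longrightarrow> A' \<subseteq> A \<Longrightarrow> \<mu> (A - A') = \<mu> A - \<mu> A'"
  using additive[of A' "A - A'"] by (auto simp: Un_absorb1)

text \<open>The positive variation as a real number; \<open>SUP_eq_upper\<close> identifies it with
  the extended supremum in \<open>jordan_pos\<close>.\<close>

definition upper :: "'a set \<Rightarrow> real" where
  "upper A = (SUP E\<in>{E \<in> sets N. E \<subseteq> A}. \<mu> E)"

lemma bdd: "bdd_above (\<mu> ` {E \<in> sets N. E \<subseteq> A})"
  by (rule bdd_aboveI2[of _ _ B]) (rule abs_le_D1[OF bounded])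

lemma upper_ge: "E \<in> sets N \<Longrightarrow> E \<subseteq> A \<Longrightarrow> \<mu> E \<le> upper A"
  unfolding upper_def by (rule cSUP_upper[OF _ bdd]) auto

lemma upper_le: "(\<And>E. E \<in> sets N \<Longrightarrow> E \<subseteq> A \<Longrightarrow> \<mu> E \<le> c) \<Longrightarrow> upper A \<le> c"
  unfolding upper_def by (rule cSUP_least) auto

lemma upper_nonneg: "0 \<le> upper A"
  using upper_ge[of "{}" A] empty by simp

lemma upper_approx:
  assumes "0 < e"
  obtains E where "E \<in> sets N" "E \<subseteq> A" "upper A - e < \<mu> E"
proof -
  have "\<exists>E\<in>{E \<in> sets N. E \<subseteq> A}. upper A - e < \<mu> E"
    using assms unfolding upper_def by (subst less_cSUP_iff[OF _ bdd, symmetric]) auto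
  then show ?thesis using that by blast
qed

lemma upper_mono: "A \<subseteq> A' \<Longrightarrow> upper A \<le> upper A'"
  by (rule upper_le) (auto intro: upper_ge)

lemma upper_superadditive:
  assumes "A \<inter> A' = {}"
  shows "upper A + upper A' \<le> upper (A \<union> A')"
proof -
  have "\<mu> E' \<le> upper (A \<union> A') - upper A" if E': "E' \<in> sets N" "E' \<subseteq> A'" for E'
  proof -
    have "\<mu> E \<le> upper (A \<union> A') - \<mu> E'" if E: "E \<in> sets N" "E \<subseteq> A" for E
    proof -
      have "E \<inter> E' = {}" "E \<union> E' \<subseteq> A \<union> A'" using E E' assms by blast+
      then show ?thesis using additive[of E E'] upper_ge[of "E \<union> E'" "A \<union> A'"] E E' by simp
    qed
    then have "upper A \<le> upper (A \<union> A') - \<mu> E'" by (rule upper_le)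
    then show ?thesis by simp
  qed
  then have "upper A' \<le> upper (A \<union> A') - upper A" by (rule upper_le)
  then show ?thesis by simp
qed

text \<open>\<open>ennreal\<close> cuts negative values to 0. The supremum does not change, since
  the empty set already contributes 0.\<close>

lemma SUP_eq_upper: "(SUP E\<in>{E \<in> sets N. E \<subseteq> A}. ennreal (\<mu> E)) = ennreal (upper A)" (is "?S = _")
proof (rule antisym)
  show "?S \<le> ennreal (upper A)"
    by (rule SUP_least) (auto intro: ennreal_leI upper_ge)
  then obtain x where x: "?S = ennreal x" "0 \<le> x"
    by (cases ?S) (auto simp: top_unique)
  have "\<mu> E \<le> x" if "E \<in> sets N" "E \<subseteq> A" for E
  proof -
    have "ennreal (\<mu> E) \<le> ?S" by (rule SUP_upper) (use that in auto)
    then show ?thesis using x ennreal_le_iff[OF x(2)] by simp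
  qed
  then show "ennreal (upper A) \<le> ?S"
    unfolding x(1) by (intro ennreal_leI upper_le)
qed

text \<open>One inequality is superadditivity over finitely many sets, followed by a limit. For the
  other, a test set below the union is cut into its intersections with the \<open>A i\<close>, and
  countable additivity of the signed measure sums the pieces.\<close>

lemma upper_suminf:
  assumes A: "range A \<subseteq> sets N" "disjoint_family A"
  shows "(\<Sum>i. ennreal (upper (A i))) = ennreal (upper (\<Union>i. A i))"
proof (rule antisym)
  have fin: "(\<Sum>i<n. upper (A i)) \<le> upper (\<Union>i<n. A i)" for n
  proof (induction n)
    case (Suc n)
    have "A i \<inter> A n = {}" if "i < n" for i
      using disjoint_family_onD[OF A(2), of i n] that by simp
    then have "(\<Union>i<n. A i) \<inter> A n = {}" by blast
    then show ?case
      using upper_superadditive[of "\<Union>i<n. A i" "A n"] Suc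
      by (simp add: lessThan_Suc Un_commute)
  qed (simp add: upper_nonneg)
  show "(\<Sum>i. ennreal (upper (A i))) \<le> ennreal (upper (\<Union>i. A i))"
  proof (rule suminf_le_const)
    show "summable (\<lambda>i. ennreal (upper (A i)))" by simp
    fix n
    have "(\<Sum>i<n. ennreal (upper (A i))) = ennreal (\<Sum>i<n. upper (A i))"
      by (simp add: sum_ennreal upper_nonneg)
    also have "\<dots> \<le> ennreal (upper (\<Union>i. A i))"
      by (intro ennreal_leI order_trans[OF fin] upper_mono) auto
    finally show "(\<Sum>i<n. ennreal (upper (A i))) \<le> ennreal (upper (\<Union>i. A i))" .
  qed
  have "ennreal (\<mu> E) \<le> (\<Sum>i. ennreal (upper (A i)))" if E: "E \<in> sets N" "E \<subseteq> (\<Union>i. A i)" for E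
  proof -
    have "(\<lambda>i. \<mu> (E \<inter> A i)) sums \<mu> (\<Union>i. E \<inter> A i)"
      using A E(1) by (intro sums) (auto simp: disjoint_family_on_def)
    also have "(\<Union>i. E \<inter> A i) = E" using E(2) by blast
    finally have s: "(\<lambda>i. \<mu> (E \<inter> A i)) sums \<mu> E" .
    have "(\<lambda>n. ennreal (\<Sum>i<n. \<mu> (E \<inter> A i))) \<longlonglongrightarrow> ennreal (\<mu> E)"
      using s unfolding sums_def by (rule tendsto_ennrealI)
    then show ?thesis
    proof (rule LIMSEQ_le_const2)
      have "ennreal (\<Sum>i<n. \<mu> (E \<inter> A i)) \<le> (\<Sum>i. ennreal (upper (A i)))" for n
      proof -
        have "ennreal (\<Sum>i<n. \<mu> (E \<inter> A i)) \<le> ennreal (\<Sum>i<n. upper (A i))"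
          using A E(1) by (intro ennreal_leI sum_mono upper_ge) auto
        also have "\<dots> = (\<Sum>i<n. ennreal (upper (A i)))"
          by (simp add: sum_ennreal upper_nonneg)
        also have "\<dots> \<le> (\<Sum>i. ennreal (upper (A i)))"
          by (rule sum_le_suminf) auto
        finally show ?thesis .
      qed
      then show "\<exists>N. \<forall>n\<ge>N. ennreal (\<Sum>i<n. \<mu> (E \<inter> A i)) \<le> (\<Sum>i. ennreal (upper (A i)))" by blast
    qed
  qed
  then show "ennreal (upper (\<Union>i. A i)) \<le> (\<Sum>i. ennreal (upper (A i)))"
    unfolding SUP_eq_upper[symmetric] by (intro SUP_least) auto
qed

lemma sets_jordan_pos: "sets (jordan_pos N \<mu>) = sets N"
  by (simp add: jordan_pos_def sets.space_closed)

lemma emeasure_jordan_pos: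
  assumes "A \<in> sets N"
  shows "emeasure (jordan_pos N \<mu>) A = ennreal (upper A)"
  unfolding SUP_eq_upper[symmetric]
proof (rule emeasure_measure_of[OF jordan_pos_def])
  show "sets N \<subseteq> Pow (space N)" by (rule sets.space_closed)
  show "A \<in> sets (jordan_pos N \<mu>)" using assms by (simp add: sets_jordan_pos)
  have "upper {} = 0" using upper_le[of "{}" 0] upper_nonneg[of "{}"] empty by force
  then show "positive (sets (jordan_pos N \<mu>)) (\<lambda>A. SUP E\<in>{E \<in> sets N. E \<subseteq> A}. ennreal (\<mu> E))"
    by (simp add: positive_def SUP_eq_upper)
  show "countably_additive (sets (jordan_pos N \<mu>)) (\<lambda>A. SUP E\<in>{E \<in> sets N. E \<subseteq> A}. ennreal (\<mu> E))"
    unfolding SUP_eq_upper by (auto simp: countably_additive_def sets_jordan_pos upper_suminf)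
qed

lemma measure_jordan_pos: "A \<in> sets N \<Longrightarrow> measure (jordan_pos N \<mu>) A = upper A"
  by (simp add: emeasure_jordan_pos measure_def upper_nonneg)

end

lemma bounded_signed_measure_uminus:
  assumes "bounded_signed_measure N \<mu> B"
  shows "bounded_signed_measure N (\<lambda>A. - \<mu> A) B"
proof -
  interpret bounded_signed_measure N \<mu> B by fact
  show ?thesis
    using signed bounded by unfold_locales (auto simp: signed_measure_def intro: sums_minus)
qed

text \<open>For \<open>E \<subseteq> A\<close>, the value on \<open>E\<close> is the value on
  \<open>A\<close> minus that on \<open>A - E\<close>; taking suprema bounds the positive part by
  \<open>\<mu> A\<close> plus the negative part. The reverse inequality is the same one for the
  opposite measure.\<close>

lemma jordan_decomposition:
  assumes "bounded_signed_measure N \<mu> B" "A \<in> sets N"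
  shows "measure (jordan_pos N \<mu>) A - measure (jordan_pos N (\<lambda>A. - \<mu> A)) A = \<mu> A"
proof -
  have le: "measure (jordan_pos N \<mu>) A \<le> \<mu> A + measure (jordan_pos N (\<lambda>A. - \<mu> A)) A"
    if "bounded_signed_measure N \<mu> B" for \<mu>
  proof -
    interpret P: bounded_signed_measure N \<mu> B by fact
    interpret Q: bounded_signed_measure N "\<lambda>A. - \<mu> A" B
      by (rule bounded_signed_measure_uminus[OF that])
    have "P.upper A \<le> \<mu> A + Q.upper A"
    proof (rule P.upper_le)
      fix E assume "E \<in> sets N" "E \<subseteq> A"
      then show "\<mu> E \<le> \<mu> A + Q.upper A"
        using Q.upper_ge[of "A - E" A] P.diff[of A E] assms(2) by auto
    qed
    then show ?thesis
      using assms(2) by (simp add: P.measure_jordan_pos Q.measure_jordan_pos)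
  qed
  show ?thesis
    using le[OF assms(1)] le[OF bounded_signed_measure_uminus[OF assms(1)]] by simp
qed

text \<open>Restores a measure from its integral. The value 0 off the \<sigma>-field follows the
  convention of \<open>signed_measure\<close>, so that \<open>functional_measure_integral\<close> is
  an equality of functions.\<close>

definition functional_measure :: "'a measure \<Rightarrow> (('a \<Rightarrow> real) \<Rightarrow> real) \<Rightarrow> 'a set \<Rightarrow> real" where
  "functional_measure N F A = (if A \<in> sets N then F (indicator A) else 0)"

context
  fixes N :: "'a measure" and w F
  assumes F: "cont_functional N w F" and w1: "\<And>x. x \<in> space N \<Longrightarrow> 1 \<le> w x"
    and w_meas: "w \<in> borel_measurable N"
begin

lemma weight_nonneg: "x \<in> space N \<Longrightarrow> 0 \<le> w x"
  using w1[of x] by simp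

lemma functional_measure_bounded: "\<exists>B. bounded_signed_measure N (functional_measure N F) B"
proof -
  obtain K where K: "0 \<le> K" "\<And>g b. 0 \<le> b \<Longrightarrow> wbound N w b g \<Longrightarrow> \<bar>F g\<bar> \<le> K * b"
    by (rule cont_functional_bounded[OF F]) (use weight_nonneg in auto)
  have "bounded_signed_measure N (functional_measure N F) K"
  proof
    show "\<bar>functional_measure N F A\<bar> \<le> K" for A
      using K(1) K(2)[OF _ wbound_indicator[OF w1], of A] by (auto simp: functional_measure_def)
    show "signed_measure N (functional_measure N F)"
      unfolding signed_measure_def
    proof (intro conjI allI impI)
      show "functional_measure N F A = 0" if "A \<notin> sets N" for A
        using that by (simp add: functional_measure_def)
      have "F (indicator {}) = F (\<lambda>x. 0)"
        by (rule arg_cong[of _ _ F]) auto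
      then show "functional_measure N F {} = 0"
        using cont_functional_zero[OF F] by (simp add: functional_measure_def)
      fix A :: "nat \<Rightarrow> 'a set" assume A: "range A \<subseteq> sets N" "disjoint_family A"
      have A': "A i \<in> sets N" for i using A(1) by auto
      have ind: "wbound N w 1 (indicator (A i))" for i
        by (rule wbound_indicator[OF w1 A'])
      have pt: "(\<lambda>i. indicator (A i) x) sums (indicator (\<Union>i. A i) x :: real)" for x
        using A(2) by (intro indicator_sums) (auto simp: disjoint_family_on_def)
      \<comment> \<open>Partial sums of the indicators increase to the indicator of the union and
        stay below 1, so dominated convergence gives countable additivity.\<close>
      have "(\<lambda>n. F (\<lambda>x. \<Sum>i<n. indicator (A i) x)) \<longlonglongrightarrow> F (indicator (\<Union>i. A i))"
      proof (rule cont_functional_tendsto[OF F])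
        show "wbound N w 1 (indicator (\<Union>i. A i))"
          by (rule wbound_indicator[OF w1]) (use A in auto)
        show "wbound N w 1 (\<lambda>x. \<Sum>i<n. indicator (A i) x)" for n
        proof (rule wboundI)
          show "(\<lambda>x. \<Sum>i<n. indicator (A i) x :: real) \<in> borel_measurable N"
            using A' by measurable
          fix x assume "x \<in> space N"
          have "(\<Sum>i<n. indicator (A i) x :: real) \<le> indicator (\<Union>i. A i) x"
            using sum_le_suminf[OF sums_summable[OF pt[of x]], of "{..<n}"] sums_unique[OF pt[of x]] by simp
          also have "\<dots> \<le> 1" by (simp add: indicator_def)
          finally show "\<bar>\<Sum>i<n. indicator (A i) x :: real\<bar> \<le> 1 * w x"
            using w1[OF \<open>x \<in> space N\<close>] by (simp add: sum_nonneg)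
        qed
        show "(\<lambda>n. \<Sum>i<n. indicator (A i) x) \<longlonglongrightarrow> (indicator (\<Union>i. A i) x :: real)" for x
          using pt[of x] by (simp add: sums_def)
      qed
      moreover have "F (\<lambda>x. \<Sum>i<n. indicator (A i) x) = (\<Sum>i<n. F (indicator (A i)))" for n
        by (rule cont_functional_sum[OF F finite_lessThan, THEN conjunct2]) (rule ind)
      ultimately show "(\<lambda>i. functional_measure N F (A i)) sums functional_measure N F (\<Union> (range A))"
        using A A' by (auto simp: sums_def functional_measure_def)
    qed
  qed
  then show ?thesis by blast
qed

lemma signed_measure_functional: "signed_measure N (functional_measure N F)"
proof -
  obtain B where "bounded_signed_measure N (functional_measure N F) B"
    using functional_measure_bounded by blast
  then show ?thesis by (rule bounded_signed_measure.signed)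
qed

text \<open>The integral of a simple function below the weight is approximated by the values of the
  functional on simple functions below the weight, so no Hahn decomposition is needed.\<close>

lemma integrable_jordan_pos: "integrable (jordan_pos N (functional_measure N F)) w"
proof -
  obtain B where "bounded_signed_measure N (functional_measure N F) B"
    using functional_measure_bounded by blast
  then interpret bounded_signed_measure N "functional_measure N F" B .
  let ?P = "jordan_pos N (functional_measure N F)"
  have sp: "space ?P = space N" by (rule sets_eq_imp_space_eq[OF sets_jordan_pos])
  obtain K where K: "0 \<le> K" "\<And>g b. 0 \<le> b \<Longrightarrow> wbound N w b g \<Longrightarrow> \<bar>F g\<bar> \<le> K * b"
    by (rule cont_functional_bounded[OF F]) (use weight_nonneg in auto)
  have "(\<integral>\<^sup>+x. ennreal (w x) \<partial>?P) \<le> ennreal K"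
    unfolding nn_integral_def
  proof (rule SUP_least, safe)
    fix s assume s: "simple_function ?P s" and le: "s \<le> (\<lambda>x. ennreal (w x))"
    define A where "A y = s -` {y} \<inter> space N" for y
    define Y where "Y = s ` space N"
    have Y: "finite Y" and A: "\<And>y. y \<in> Y \<Longrightarrow> A y \<in> sets N"
      using s by (auto simp: simple_function_def Y_def A_def sp sets_jordan_pos)
    have fin: "y < top" if y: "y \<in> Y" for y
    proof -
      obtain x where "y = s x" using y by (auto simp: Y_def)
      then have "y \<le> ennreal (w x)" using le by (simp add: le_fun_def)
      then show ?thesis by (rule le_less_trans) simp
    qed
    define c where "c = enn2real"
    have c: "ennreal (c y) = y" if "y \<in> Y" for y using fin[OF that] by (simp add: c_def)
    have c0: "0 \<le> c y" for y by (simp add: c_def)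
    \<comment> \<open>Choose in each level set \<open>A y\<close> a measurable set
      \<open>E y\<close> almost attaining the positive variation. The function \<open>?g\<close> has
      coefficient \<open>c y\<close> on \<open>E y\<close> and lies below \<open>w\<close>, since
      \<open>E y\<close> stays inside \<open>A y\<close>; hence \<open>F ?g \<le> K\<close>.\<close>
    have eps: "(\<Sum>y\<in>Y. c y * upper (A y)) \<le> K + e * (\<Sum>y\<in>Y. c y)" if "0 < e" for e
    proof -
      have "\<forall>y. \<exists>E. E \<in> sets N \<and> E \<subseteq> A y \<and> upper (A y) - e < functional_measure N F E"
        using upper_approx[OF that] by metis
      then obtain E where E: "\<And>y. E y \<in> sets N" "\<And>y. E y \<subseteq> A y"
        "\<And>y. upper (A y) - e < functional_measure N F (E y)" by metis
      let ?g = "\<lambda>x. \<Sum>y\<in>Y. c y * indicator (E y) x"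
      have ind: "wbound N w (\<bar>c y\<bar> * 1) (\<lambda>x. c y * indicator (E y) x)" for y
        by (intro wbound_scale wbound_indicator w1 E(1))
      have "wbound N w 1 ?g"
      proof (rule wboundI)
        show "?g \<in> borel_measurable N" using E(1) by measurable
        fix x assume x: "x \<in> space N"
        have "?g x \<le> (\<Sum>y\<in>Y. if y = s x then c y else 0)"
          using E(2) by (intro sum_mono) (auto simp: indicator_def A_def c0)
        also have "\<dots> = c (s x)" using x Y by (simp add: Y_def)
        also have "\<dots> \<le> w x"
        proof -
          have "ennreal (c (s x)) \<le> ennreal (w x)"
            using le c[of "s x"] x by (simp add: le_fun_def Y_def)
          then show ?thesis by (simp only: ennreal_le_iff[OF weight_nonneg[OF x]])
        qed
        finally show "\<bar>?g x\<bar> \<le> 1 * w x" by (simp add: sum_nonneg c0)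
      qed
      from K(2)[OF _ this] have "F ?g \<le> K" by simp
      also have "F ?g = (\<Sum>y\<in>Y. F (\<lambda>x. c y * indicator (E y) x))"
        by (rule cont_functional_sum[OF F Y, THEN conjunct2]) (rule ind)
      also have "\<dots> = (\<Sum>y\<in>Y. c y * functional_measure N F (E y))"
        using cont_functional_scale[OF F wbound_indicator[OF w1 E(1)]] E(1)
        by (simp add: functional_measure_def)
      finally have "(\<Sum>y\<in>Y. c y * functional_measure N F (E y)) \<le> K" .
      moreover have "(\<Sum>y\<in>Y. c y * (upper (A y) - e)) \<le> (\<Sum>y\<in>Y. c y * functional_measure N F (E y))"
        using E(3) by (intro sum_mono mult_left_mono c0) (simp add: less_imp_le)
      ultimately show ?thesis
        by (simp add: right_diff_distrib sum_subtractf sum_distrib_left mult.commute)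
    qed
    have "(\<Sum>y\<in>Y. c y * upper (A y)) \<le> K"
    proof (rule field_le_epsilon)
      fix e :: real assume "0 < e"
      \<comment> \<open>Dividing by \<open>S + 1\<close> below covers the case
        \<open>S = 0\<close>.\<close>
      define S where "S = (\<Sum>y\<in>Y. c y)"
      have S: "0 \<le> S" by (simp add: S_def sum_nonneg c0)
      have "e / (S + 1) * S \<le> e" using S \<open>0 < e\<close> by (simp add: field_simps)
      then show "(\<Sum>y\<in>Y. c y * upper (A y)) \<le> K + e"
        using eps[of "e / (S + 1)"] S \<open>0 < e\<close> by (simp add: S_def)
    qed
    then have "ennreal (\<Sum>y\<in>Y. c y * upper (A y)) \<le> ennreal K" by (rule ennreal_leI)
    moreover have "integral\<^sup>S ?P s = (\<Sum>y\<in>Y. ennreal (c y * upper (A y)))"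
      unfolding simple_integral_def sp Y_def[symmetric] A_def[symmetric]
      by (intro sum.cong refl) (simp add: emeasure_jordan_pos A c ennreal_mult c0 upper_nonneg)
    ultimately show "integral\<^sup>S ?P s \<le> ennreal K"
      by (simp add: sum_ennreal c0 upper_nonneg)
  qed
  then have "(\<integral>\<^sup>+x. ennreal (w x) \<partial>?P) < \<infinity>"
    by (rule le_less_trans) simp
  moreover have "w \<in> borel_measurable ?P"
    using w_meas by (simp cong: measurable_cong_sets add: sets_jordan_pos)
  ultimately show ?thesis
    by (intro integrableI_nonneg) (auto simp: sp weight_nonneg intro!: AE_I2)
qed

end

text \<open>The weight is integrable for both Jordan parts, so the signed integral is a continuous
  functional. By \<open>jordan_decomposition\<close> it agrees with \<open>F\<close> on indicators,
  which determine it.\<close>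

lemma signed_integral_functional:
  assumes F: "cont_functional N w F" and w1: "\<And>x. x \<in> space N \<Longrightarrow> 1 \<le> w x"
    and w_meas: "w \<in> borel_measurable N" and g: "wbound N w c g"
  shows "signed_integral N (functional_measure N F) g = F g"
proof -
  let ?\<mu> = "functional_measure N F"
  have F': "cont_functional N w (\<lambda>g. - F g)"
    using cont_functional_comb[OF F F, of "-1" 0] by simp
  have neg: "(\<lambda>A. - ?\<mu> A) = functional_measure N (\<lambda>g. - F g)"
    by (auto simp: functional_measure_def)
  obtain B where B: "bounded_signed_measure N ?\<mu> B"
    using functional_measure_bounded[OF F w1 w_meas] by blast
  interpret P: bounded_signed_measure N ?\<mu> B by fact
  interpret Q: bounded_signed_measure N "\<lambda>A. - ?\<mu> A" B
    by (rule bounded_signed_measure_uminus[OF B])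
  have iP: "integrable (jordan_pos N ?\<mu>) w" by (rule integrable_jordan_pos[OF F w1 w_meas])
  have iQ: "integrable (jordan_pos N (\<lambda>A. - ?\<mu> A)) w"
    unfolding neg by (rule integrable_jordan_pos[OF F' w1 w_meas])
  have "cont_functional N w (signed_integral N ?\<mu>)"
    using cont_functional_comb[OF cont_functional_integral(1)[OF iP P.sets_jordan_pos]
        cont_functional_integral(1)[OF iQ Q.sets_jordan_pos], of 1 "-1"]
    unfolding signed_integral_def[abs_def] by simp
  then show ?thesis
  proof (rule cont_functional_eqI[OF _ F w1 _ g])
    fix A assume A: "A \<in> sets N"
    have "A \<inter> space N = A" using sets.sets_into_space[OF A] by blast
    then show "signed_integral N ?\<mu> (indicator A) = F (indicator A)"
      using jordan_decomposition[OF B A] A sets_eq_imp_space_eq[OF P.sets_jordan_pos]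
        sets_eq_imp_space_eq[OF Q.sets_jordan_pos]
      by (simp add: signed_integral_def functional_measure_def)
  qed
qed

text \<open>\<open>W\<close> is the weight of the norm and \<open>w\<close> the one on which
  \<open>F\<close> acts; in use \<open>W\<close> is a sum of powers and \<open>w\<close> a power of
  a maximum. Upper bounds on \<open>F g\<close> suffice because the supremum is taken without
  absolute values.\<close>

lemma weighted_norm_le:
  assumes F: "cont_functional N w F" and w1: "\<And>x. x \<in> space N \<Longrightarrow> 1 \<le> w x"
    and w_meas: "w \<in> borel_measurable N"
    and W: "\<And>x. x \<in> space N \<Longrightarrow> W x \<le> c * w x"
    and le: "\<And>g. g \<in> borel_measurable N \<Longrightarrow> (\<And>x. x \<in> space N \<Longrightarrow> \<bar>g x\<bar> \<le> W x) \<Longrightarrow> wbound N w c g \<Longrightarrow> F g \<le> K"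
  shows "weighted_norm N W (functional_measure N F) \<le> ereal K"
  unfolding weighted_norm_def
proof (rule SUP_least)
  fix g assume g: "g \<in> {g \<in> borel_measurable N. \<forall>x\<in>space N. \<bar>g x\<bar> \<le> W x}"
  then have "wbound N w c g" using W by (fastforce simp: wbound_def)
  then show "ereal (signed_integral N (functional_measure N F) g) \<le> ereal K"
    using signed_integral_functional[OF F w1 w_meas] le[of g] g by simp
qed

lemma weighted_norm_nonneg:
  assumes W: "\<And>x. x \<in> space N \<Longrightarrow> 0 \<le> W x"
  shows "0 \<le> weighted_norm N W \<mu>"
  unfolding weighted_norm_def
  by (rule SUP_upper2[of "\<lambda>x. 0"]) (use W in \<open>auto simp: signed_integral_def\<close>)

lemma functional_measure_weighted:
  assumes F: "cont_functional N w F" and w1: "\<And>x. x \<in> space N \<Longrightarrow> 1 \<le> w x"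
    and w_meas: "w \<in> borel_measurable N"
    and W: "\<And>x. x \<in> space N \<Longrightarrow> W x \<le> c * w x" and "0 \<le> c"
  shows "functional_measure N F \<in> weighted_measures N W"
proof -
  obtain K where K: "0 \<le> K" "\<And>g b. 0 \<le> b \<Longrightarrow> wbound N w b g \<Longrightarrow> \<bar>F g\<bar> \<le> K * b"
    using cont_functional_bounded[OF F weight_nonneg[OF F w1 w_meas]] by blast
  have "weighted_norm N W (functional_measure N F) \<le> ereal (K * c)"
  proof (rule weighted_norm_le[OF F w1 w_meas W])
    show "F g \<le> K * c" if "wbound N w c g" for g
      using K(2)[OF \<open>0 \<le> c\<close> that] by simp
  qed
  then show ?thesis
    using signed_measure_functional[OF F w1 w_meas] by (auto simp: weighted_measures_def)
qed

lemma functional_measure_comb: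
  "functional_measure N (\<lambda>g. a * F g + b * G g) A = a * functional_measure N F A + b * functional_measure N G A"
  by (simp add: functional_measure_def)

lemma functional_measure_integral:
  assumes "sets \<mu> = sets N"
  shows "functional_measure N (\<lambda>g. \<integral>x. g x \<partial>\<mu>) = measure \<mu>"
proof
  fix A
  show "functional_measure N (\<lambda>g. \<integral>x. g x \<partial>\<mu>) A = measure \<mu> A"
  proof (cases "A \<in> sets N")
    case True
    then have "A \<inter> space \<mu> = A"
      using sets.sets_into_space[OF True] sets_eq_imp_space_eq[OF assms] by blast
    then show ?thesis using True by (simp add: functional_measure_def)
  next
    case False
    then show ?thesis using assms by (simp add: functional_measure_def measure_notin_sets)
  qed
qed

section \<open>Differentiable families of functionals and operators\<close>

text \<open>Continuity and differentiability are uniform over bounded sets of functions; this is encoded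
  by letting the function vary along the sequence of parameters.\<close>

definition cont_family :: "'a measure \<Rightarrow> ('a \<Rightarrow> real) \<Rightarrow> (real \<Rightarrow> ('a \<Rightarrow> real) \<Rightarrow> real) \<Rightarrow> bool" where
  "cont_family N w F \<longleftrightarrow>
     (\<forall>u\<in>{0..1}. cont_functional N w (F u)) \<and>
     (\<forall>u\<in>{0..1}. \<forall>v g c. 0 \<le> c \<longrightarrow> (\<forall>n::nat. v n \<in> {0..1}) \<longrightarrow> v \<longlonglongrightarrow> u \<longrightarrow>
        (\<forall>n. wbound N w c (g n)) \<longrightarrow> (\<lambda>n. F (v n) (g n) - F u (g n)) \<longlonglongrightarrow> 0)"

definition deriv_family ::
  "'a measure \<Rightarrow> ('a \<Rightarrow> real) \<Rightarrow> (real \<Rightarrow> ('a \<Rightarrow> real) \<Rightarrow> real) \<Rightarrow> (real \<Rightarrow> ('a \<Rightarrow> real) \<Rightarrow> real) \<Rightarrow> bool"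
where
  "deriv_family N w F F' \<longleftrightarrow>
     (\<forall>u\<in>{0..1}. \<forall>v g c. 0 \<le> c \<longrightarrow> (\<forall>n::nat. v n \<in> {0..1} - {u}) \<longrightarrow> v \<longlonglongrightarrow> u \<longrightarrow>
        (\<forall>n. wbound N w c (g n)) \<longrightarrow>
        (\<lambda>n. (F (v n) (g n) - F u (g n)) / (v n - u) - F' u (g n)) \<longlonglongrightarrow> 0)"

text \<open>Convergence is asked at each point \<open>x\<close>, and only the bound is uniform in
  \<open>x\<close>. This is what dominated convergence consumes in
  \<open>cont_family_comp\<close>.\<close>

definition op_cont ::
  "'b measure \<Rightarrow> ('b \<Rightarrow> real) \<Rightarrow> 'a measure \<Rightarrow> ('a \<Rightarrow> real) \<Rightarrow> (real \<Rightarrow> ('b \<Rightarrow> real) \<Rightarrow> 'a \<Rightarrow> real) \<Rightarrow> bool"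
where
  "op_cont N' w' N w T \<longleftrightarrow>
     (\<forall>x\<in>space N. cont_family N' w' (\<lambda>u g. T u g x)) \<and>
     (\<exists>K\<ge>0. \<forall>u\<in>{0..1}. \<forall>g b. 0 \<le> b \<longrightarrow> wbound N' w' b g \<longrightarrow> wbound N w (K * b) (T u g))"

text \<open>The Lipschitz bound dominates the difference quotients of \<open>T\<close>, whose limit
  is again taken at each point. In use the weight \<open>w\<close> is larger than the one in which
  \<open>T\<close> itself takes its values.\<close>

definition op_deriv ::
  "'b measure \<Rightarrow> ('b \<Rightarrow> real) \<Rightarrow> 'a measure \<Rightarrow> ('a \<Rightarrow> real) \<Rightarrow>
    (real \<Rightarrow> ('b \<Rightarrow> real) \<Rightarrow> 'a \<Rightarrow> real) \<Rightarrow> (real \<Rightarrow> ('b \<Rightarrow> real) \<Rightarrow> 'a \<Rightarrow> real) \<Rightarrow> bool"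
where
  "op_deriv N' w' N w T T' \<longleftrightarrow>
     (\<forall>x\<in>space N. deriv_family N' w' (\<lambda>u g. T u g x) (\<lambda>u g. T' u g x)) \<and>
     (\<exists>K\<ge>0. \<forall>u\<in>{0..1}. \<forall>v\<in>{0..1}. \<forall>g b. 0 \<le> b \<longrightarrow> wbound N' w' b g \<longrightarrow>
        wbound N w (K * b * \<bar>v - u\<bar>) (\<lambda>x. T v g x - T u g x))"

lemma cont_familyD:
  assumes "cont_family N w F" "u \<in> {0..1}"
  shows "cont_functional N w (F u)"
    and "0 \<le> c \<Longrightarrow> (\<And>n::nat. v n \<in> {0..1}) \<Longrightarrow> v \<longlonglongrightarrow> u \<Longrightarrow> (\<And>n. wbound N w c (g n)) \<Longrightarrow>
      (\<lambda>n. F (v n) (g n) - F u (g n)) \<longlonglongrightarrow> 0"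
  using assms unfolding cont_family_def by blast+

lemma deriv_familyD:
  assumes "deriv_family N w F F'" "u \<in> {0..1}" "0 \<le> c" "\<And>n::nat. v n \<in> {0..1} - {u}" "v \<longlonglongrightarrow> u"
    "\<And>n. wbound N w c (g n)"
  shows "(\<lambda>n. (F (v n) (g n) - F u (g n)) / (v n - u) - F' u (g n)) \<longlonglongrightarrow> 0"
  using assms unfolding deriv_family_def by blast

lemma op_contD:
  assumes "op_cont N' w' N w T"
  shows "x \<in> space N \<Longrightarrow> cont_family N' w' (\<lambda>u g. T u g x)"
    and "\<exists>K\<ge>0. \<forall>u\<in>{0..1}. \<forall>g b. 0 \<le> b \<longrightarrow> wbound N' w' b g \<longrightarrow> wbound N w (K * b) (T u g)"
  using assms unfolding op_cont_def by blast+

lemma op_derivD: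
  assumes "op_deriv N' w' N w T T'"
  shows "x \<in> space N \<Longrightarrow> deriv_family N' w' (\<lambda>u g. T u g x) (\<lambda>u g. T' u g x)"
    and "\<exists>K\<ge>0. \<forall>u\<in>{0..1}. \<forall>v\<in>{0..1}. \<forall>g b. 0 \<le> b \<longrightarrow> wbound N' w' b g \<longrightarrow>
        wbound N w (K * b * \<bar>v - u\<bar>) (\<lambda>x. T v g x - T u g x)"
  using assms unfolding op_deriv_def by blast+

lemma cont_functional_const_sum:
  assumes "finite I" "\<And>i. i \<in> I \<Longrightarrow> cont_functional N w (F i)"
  shows "cont_functional N w (\<lambda>g. \<Sum>i\<in>I. c i * F i g)"
  using assms
proof (induction I rule: finite_induct)
  case empty
  then show ?case by (simp add: cont_functional_def)
next
  case (insert i I)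
  then show ?case
    using cont_functional_comb[of N w "F i" "\<lambda>g. \<Sum>i\<in>I. c i * F i g" "c i" 1] by simp
qed

lemma cont_family_sum:
  assumes "finite I" "\<And>i. i \<in> I \<Longrightarrow> cont_family N w (F i)"
  shows "cont_family N w (\<lambda>u g. \<Sum>i\<in>I. c i * F i u g)"
  unfolding cont_family_def
proof (intro conjI ballI allI impI)
  show "cont_functional N w (\<lambda>g. \<Sum>i\<in>I. c i * F i u g)" if "u \<in> {0..1}" for u
    by (intro cont_functional_const_sum assms(1) cont_familyD(1)[OF assms(2) that])
  fix u v g C assume *: "u \<in> {0..1}" "0 \<le> C" "\<forall>n::nat. v n \<in> {0..1::real}" "v \<longlonglongrightarrow> u" "\<forall>n::nat. wbound N w C (g n)"
  have "(\<lambda>n. \<Sum>i\<in>I. c i * (F i (v n) (g n) - F i u (g n))) \<longlonglongrightarrow> (\<Sum>i\<in>I. c i * 0)"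
    by (intro tendsto_intros cont_familyD(2)[OF assms(2) *(1,2) _ *(4)]) (use * in auto)
  then show "(\<lambda>n. (\<Sum>i\<in>I. c i * F i (v n) (g n)) - (\<Sum>i\<in>I. c i * F i u (g n))) \<longlonglongrightarrow> 0"
    by (simp add: right_diff_distrib sum_subtractf)
qed

lemma deriv_family_sum:
  assumes "finite I" "\<And>i. i \<in> I \<Longrightarrow> deriv_family N w (F i) (F' i)"
  shows "deriv_family N w (\<lambda>u g. \<Sum>i\<in>I. c i * F i u g) (\<lambda>u g. \<Sum>i\<in>I. c i * F' i u g)"
  unfolding deriv_family_def
proof (intro ballI allI impI)
  fix u v g C assume *: "u \<in> {0..1}" "0 \<le> C" "\<forall>n::nat. v n \<in> {0..1::real} - {u}" "v \<longlonglongrightarrow> u" "\<forall>n::nat. wbound N w C (g n)"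
  have "(\<lambda>n. \<Sum>i\<in>I. c i * ((F i (v n) (g n) - F i u (g n)) / (v n - u) - F' i u (g n))) \<longlonglongrightarrow> (\<Sum>i\<in>I. c i * 0)"
    by (intro tendsto_intros deriv_familyD[OF assms(2) *(1,2) _ *(4)]) (use * in auto)
  then show "(\<lambda>n. ((\<Sum>i\<in>I. c i * F i (v n) (g n)) - (\<Sum>i\<in>I. c i * F i u (g n))) / (v n - u)
      - (\<Sum>i\<in>I. c i * F' i u (g n))) \<longlonglongrightarrow> 0"
    by (simp add: right_diff_distrib sum_subtractf diff_divide_distrib sum_divide_distrib)
qed

lemma cont_functional_comp:
  assumes F: "cont_functional N w F" and T: "\<And>x. x \<in> space N \<Longrightarrow> cont_functional N' w' (\<lambda>g. T g x)"
    and K: "\<And>g b. 0 \<le> b \<Longrightarrow> wbound N' w' b g \<Longrightarrow> wbound N w (K * b) (T g)"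
    and w': "\<And>x. x \<in> space N' \<Longrightarrow> 0 \<le> w' x"
  shows "cont_functional N' w' (\<lambda>g. F (T g))"
proof -
  have K': "wbound N w (K * \<bar>b\<bar>) (T g)" if "wbound N' w' b g" for g b
    by (intro K wbound_mono[OF that]) (auto intro: w')
  show ?thesis
    unfolding cont_functional_def
  proof (intro conjI allI impI)
    fix g h a b c c' assume *: "wbound N' w' c g" "wbound N' w' c' h"
    have "F (T (\<lambda>x. a * g x + b * h x)) = F (\<lambda>x. a * T g x + b * T h x)"
      by (rule cont_functional_cong[OF F K'[OF wbound_lincomb[OF *]]])
        (simp add: cont_functional_lincomb[OF T *])
    also have "\<dots> = a * F (T g) + b * F (T h)"
      by (rule cont_functional_lincomb[OF F K'[OF *(1)] K'[OF *(2)]])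
    finally show "F (T (\<lambda>x. a * g x + b * h x)) = a * F (T g) + b * F (T h)" .
  next
    fix g G c assume *: "\<forall>n::nat. wbound N' w' c (g n)" "wbound N' w' c G" "\<forall>x\<in>space N'. (\<lambda>n. g n x) \<longlonglongrightarrow> G x"
    show "(\<lambda>n. F (T (g n))) \<longlonglongrightarrow> F (T G)"
      by (rule cont_functional_tendsto[OF F K' K'[OF *(2)] cont_functional_tendsto[OF T _ *(2)]])
        (use * in auto)
  qed
qed

lemma cont_functional_tendsto_0:
  assumes "cont_functional N w F" "0 \<le> c" "\<And>n. wbound N w c (g n)" "\<And>x. x \<in> space N \<Longrightarrow> 0 \<le> w x"
    "\<And>x. x \<in> space N \<Longrightarrow> (\<lambda>n. g n x) \<longlonglongrightarrow> 0"
  shows "(\<lambda>n::nat. F (g n)) \<longlonglongrightarrow> 0"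
  using cont_functional_tendsto[OF assms(1,3) _ assms(5)] assms(2,4) cont_functional_zero[OF assms(1)]
  by (simp add: wbound_def)

text \<open>Split the increment into \<open>F v - F u\<close> applied to \<open>T v g\<close>, small
  because \<open>T v g\<close> stays in a bounded set, and \<open>F u\<close> applied to
  \<open>T v g - T u g\<close>, small by dominated convergence.\<close>

lemma cont_family_comp:
  assumes F: "cont_family N w F" and T: "op_cont N' w' N w T"
    and w: "\<And>x. x \<in> space N \<Longrightarrow> 0 \<le> w x" and w': "\<And>x. x \<in> space N' \<Longrightarrow> 0 \<le> w' x"
  shows "cont_family N' w' (\<lambda>u g. F u (T u g))"
proof -
  obtain K where K0: "0 \<le> K"
    and K: "\<And>u g b. u \<in> {0..1} \<Longrightarrow> 0 \<le> b \<Longrightarrow> wbound N' w' b g \<Longrightarrow> wbound N w (K * b) (T u g)"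
    using op_contD(2)[OF T] by blast
  show ?thesis
    unfolding cont_family_def
  proof (intro conjI ballI allI impI)
    show "cont_functional N' w' (\<lambda>g. F u (T u g))" if "u \<in> {0..1}" for u
      by (rule cont_functional_comp[OF cont_familyD(1)[OF F that] cont_familyD(1)[OF op_contD(1)[OF T] that] K w'])
        (use that in auto)
    fix u v g c assume *: "u \<in> {0..1}" "0 \<le> c" "\<forall>n::nat. v n \<in> {0..1::real}" "v \<longlonglongrightarrow> u" "\<forall>n::nat. wbound N' w' c (g n)"
    have Kv: "wbound N w (K * c) (T (v n) (g n))" and Ku: "wbound N w (K * c) (T u (g n))" for n
      using * by (auto intro: K)
    have "(\<lambda>n. F (v n) (T (v n) (g n)) - F u (T (v n) (g n))) \<longlonglongrightarrow> 0"
      by (rule cont_familyD(2)[OF F *(1) _ _ *(4) Kv]) (use * K0 in auto)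
    moreover have "(\<lambda>n. F u (\<lambda>x. T (v n) (g n) x - T u (g n) x)) \<longlonglongrightarrow> 0"
      by (rule cont_functional_tendsto_0[OF cont_familyD(1)[OF F *(1)] _ wbound_diff[OF Kv Ku] w
          cont_familyD(2)[OF op_contD(1)[OF T] *(1) *(2) _ *(4)]]) (use * K0 in auto)
    ultimately have "(\<lambda>n. (F (v n) (T (v n) (g n)) - F u (T (v n) (g n))) + F u (\<lambda>x. T (v n) (g n) x - T u (g n) x)) \<longlonglongrightarrow> 0 + 0"
      by (rule tendsto_add)
    then show "(\<lambda>n. F (v n) (T (v n) (g n)) - F u (T u (g n))) \<longlonglongrightarrow> 0"
      by (simp add: cont_functional_diff[OF cont_familyD(1)[OF F *(1)] Kv Ku])
  qed
qed

text \<open>Product rule in three terms: the error of the difference quotient of \<open>F\<close> at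
  \<open>T (v n) (g n)\<close>, then \<open>F' u\<close> applied to the increment of
  \<open>T\<close>, then \<open>F u\<close> applied to the error of the difference quotient of
  \<open>T\<close>. The derivative of \<open>T\<close> takes its values in the weight
  \<open>w2\<close>, so \<open>F\<close> has to act on both weights.\<close>

lemma deriv_family_comp:
  assumes F: "deriv_family N w F F'" and F': "cont_family N w F'"
    and Fw: "cont_family N w F" and Fw2: "cont_family N w2 F"
    and T: "op_cont N' w' N w T" and TT': "op_deriv N' w' N w2 T T'" and T': "op_cont N' w' N w2 T'"
    and w: "\<And>x. x \<in> space N \<Longrightarrow> 0 \<le> w x" and w2: "\<And>x. x \<in> space N \<Longrightarrow> 0 \<le> w2 x"
  shows "deriv_family N' w' (\<lambda>u g. F u (T u g)) (\<lambda>u g. F' u (T u g) + F u (T' u g))"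
proof -
  obtain K where K0: "0 \<le> K"
    and K: "\<And>u g b. u \<in> {0..1} \<Longrightarrow> 0 \<le> b \<Longrightarrow> wbound N' w' b g \<Longrightarrow> wbound N w (K * b) (T u g)"
    using op_contD(2)[OF T] by blast
  obtain K' where K'0: "0 \<le> K'"
    and K': "\<And>u g b. u \<in> {0..1} \<Longrightarrow> 0 \<le> b \<Longrightarrow> wbound N' w' b g \<Longrightarrow> wbound N w2 (K' * b) (T' u g)"
    using op_contD(2)[OF T'] by blast
  obtain L where L0: "0 \<le> L"
    and L: "\<And>u v g b. u \<in> {0..1} \<Longrightarrow> v \<in> {0..1} \<Longrightarrow> 0 \<le> b \<Longrightarrow> wbound N' w' b g \<Longrightarrow>
        wbound N w2 (L * b * \<bar>v - u\<bar>) (\<lambda>x. T v g x - T u g x)"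
    using op_derivD(2)[OF TT'] by blast
  show ?thesis
    unfolding deriv_family_def
  proof (intro ballI allI impI)
    fix u v g c assume *: "u \<in> {0..1}" "0 \<le> c" "\<forall>n::nat. v n \<in> {0..1::real} - {u}" "v \<longlonglongrightarrow> u" "\<forall>n::nat. wbound N' w' c (g n)"
    note Fu = cont_familyD(1)[OF Fw *(1)] and Fu2 = cont_familyD(1)[OF Fw2 *(1)]
      and Fu' = cont_familyD(1)[OF F' *(1)]
    have Kv: "wbound N w (K * c) (T (v n) (g n))" and Ku: "wbound N w (K * c) (T u (g n))"
      and Ku': "wbound N w2 (K' * c) (T' u (g n))" for n
      using * by (auto intro: K K')
    have Lv: "wbound N w2 (L * c) (\<lambda>x. 1 / (v n - u) * (T (v n) (g n) x - T u (g n) x))" for n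
    proof -
      have "wbound N w2 (\<bar>1 / (v n - u)\<bar> * (L * c * \<bar>v n - u\<bar>)) (\<lambda>x. 1 / (v n - u) * (T (v n) (g n) x - T u (g n) x))"
        by (intro wbound_scale L) (use * in auto)
      moreover have "v n - u \<noteq> 0" using * by auto
      ultimately show ?thesis by simp
    qed
    have 1: "(\<lambda>n. (F (v n) (T (v n) (g n)) - F u (T (v n) (g n))) / (v n - u) - F' u (T (v n) (g n))) \<longlonglongrightarrow> 0"
      by (rule deriv_familyD[OF F *(1) _ _ *(4) Kv]) (use * K0 in auto)
    have 2: "(\<lambda>n. F' u (\<lambda>x. T (v n) (g n) x - T u (g n) x)) \<longlonglongrightarrow> 0"
      by (rule cont_functional_tendsto_0[OF Fu' _ wbound_diff[OF Kv Ku] w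
          cont_familyD(2)[OF op_contD(1)[OF T] *(1) *(2) _ *(4)]]) (use * K0 in auto)
    have 3: "(\<lambda>n. F u (\<lambda>x. 1 / (v n - u) * (T (v n) (g n) x - T u (g n) x) - T' u (g n) x)) \<longlonglongrightarrow> 0"
    proof (rule cont_functional_tendsto_0[OF Fu2 _ wbound_diff[OF Lv Ku'] w2])
      fix x assume x: "x \<in> space N"
      show "(\<lambda>n. 1 / (v n - u) * (T (v n) (g n) x - T u (g n) x) - T' u (g n) x) \<longlonglongrightarrow> 0"
        using deriv_familyD[OF op_derivD(1)[OF TT' x] *(1) *(2) *(3)[rule_format] *(4) *(5)[rule_format]] by simp
    qed (use * K'0 L0 in auto)
    have eq: "F u (\<lambda>x. 1 / (v n - u) * (T (v n) (g n) x - T u (g n) x) - T' u (g n) x)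
        = (F u (T (v n) (g n)) - F u (T u (g n))) / (v n - u) - F u (T' u (g n))" for n
      unfolding cont_functional_diff[OF Fu2 Lv Ku'] cont_functional_scale[OF Fu wbound_diff[OF Kv Ku]]
        cont_functional_diff[OF Fu Kv Ku] by simp
    have "(\<lambda>n. ((F (v n) (T (v n) (g n)) - F u (T (v n) (g n))) / (v n - u) - F' u (T (v n) (g n)))
        + F' u (\<lambda>x. T (v n) (g n) x - T u (g n) x)
        + F u (\<lambda>x. 1 / (v n - u) * (T (v n) (g n) x - T u (g n) x) - T' u (g n) x)) \<longlonglongrightarrow> 0 + 0 + 0"
      by (intro tendsto_add 1 2 3)
    then show "(\<lambda>n. (F (v n) (T (v n) (g n)) - F u (T u (g n))) / (v n - u)
        - (F' u (T u (g n)) + F u (T' u (g n)))) \<longlonglongrightarrow> 0"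
      unfolding eq cont_functional_diff[OF Fu' Kv Ku] by (simp add: diff_divide_distrib algebra_simps)
  qed
qed

section \<open>The Leibniz rule on a scale of weights\<close>

text \<open>Each derivative costs one step on the scale of weights: the derivative of order
  \<open>l\<close> acts on weight \<open>s\<close> while \<open>l + s \<le> k\<close>, and can be
  differentiated once more while the inequality is strict.\<close>

definition smooth_family ::
  "nat \<Rightarrow> 'a measure \<Rightarrow> (nat \<Rightarrow> 'a \<Rightarrow> real) \<Rightarrow> (nat \<Rightarrow> real \<Rightarrow> ('a \<Rightarrow> real) \<Rightarrow> real) \<Rightarrow> bool" where
  "smooth_family k N w F \<longleftrightarrow>
     (\<forall>l s. l + s \<le> k \<longrightarrow> cont_family N (w s) (F l)) \<and>
     (\<forall>l s. l + s < k \<longrightarrow> deriv_family N (w s) (F l) (F (Suc l)))"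

text \<open>For the kernels, a derivative of order \<open>l\<close> multiplies the weight by the
  power \<open>q * l\<close> of the basic function; hence the shift of the index from
  \<open>s\<close> to \<open>l + s\<close>.\<close>

definition smooth_op ::
  "nat \<Rightarrow> 'b measure \<Rightarrow> (nat \<Rightarrow> 'b \<Rightarrow> real) \<Rightarrow> 'a measure \<Rightarrow> (nat \<Rightarrow> 'a \<Rightarrow> real) \<Rightarrow>
    (nat \<Rightarrow> real \<Rightarrow> ('b \<Rightarrow> real) \<Rightarrow> 'a \<Rightarrow> real) \<Rightarrow> bool" where
  "smooth_op k N' w' N w T \<longleftrightarrow>
     (\<forall>l s. l + s \<le> k \<longrightarrow> op_cont N' (w' s) N (w (l + s)) (T l)) \<and>
     (\<forall>l s. l + s < k \<longrightarrow> op_deriv N' (w' s) N (w (Suc (l + s))) (T l) (T (Suc l)))"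

definition leibniz ::
  "(nat \<Rightarrow> real \<Rightarrow> ('a \<Rightarrow> real) \<Rightarrow> real) \<Rightarrow> (nat \<Rightarrow> real \<Rightarrow> ('b \<Rightarrow> real) \<Rightarrow> 'a \<Rightarrow> real) \<Rightarrow>
    nat \<Rightarrow> real \<Rightarrow> ('b \<Rightarrow> real) \<Rightarrow> real" where
  "leibniz F T l u g = (\<Sum>i\<le>l. real (l choose i) * F i u (T (l - i) u g))"

text \<open>Pascal's rule, in the form in which the derivative of a Leibniz sum of order
  \<open>l\<close> becomes the sum of order \<open>Suc l\<close>.\<close>

lemma sum_choose_Suc:
  fixes a :: "nat \<Rightarrow> nat \<Rightarrow> real"
  shows "(\<Sum>i\<le>l. real (l choose i) * (a (Suc i) (l - i) + a i (Suc l - i)))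
    = (\<Sum>i\<le>Suc l. real (Suc l choose i) * a i (Suc l - i))"
proof -
  have "(\<Sum>i\<le>Suc l. real (Suc l choose i) * a i (Suc l - i))
      = a 0 (Suc l) + (\<Sum>i\<le>l. real (Suc l choose Suc i) * a (Suc i) (l - i))"
    by (subst sum.atMost_Suc_shift) (simp del: binomial_Suc_Suc)
  also have "\<dots> = a 0 (Suc l) + (\<Sum>i\<le>l. real (l choose Suc i) * a (Suc i) (l - i))
      + (\<Sum>i\<le>l. real (l choose i) * a (Suc i) (l - i))"
    by (simp add: sum.distrib algebra_simps)
  also have "a 0 (Suc l) + (\<Sum>i\<le>l. real (l choose Suc i) * a (Suc i) (l - i))
      = (\<Sum>i\<le>Suc l. real (l choose i) * a i (Suc l - i))"
    by (subst sum.atMost_Suc_shift) simp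
  also have "\<dots> = (\<Sum>i\<le>l. real (l choose i) * a i (Suc l - i))" by simp
  finally show ?thesis by (simp add: sum.distrib algebra_simps)
qed

text \<open>The indices fit: \<open>T (l - i)\<close> sends weight \<open>s\<close> to weight
  \<open>l - i + s\<close>, on which \<open>F i\<close> acts because
  \<open>i + (l - i + s) = l + s \<le> k\<close>.\<close>

lemma smooth_family_leibniz:
  assumes F: "smooth_family k N w F" and T: "smooth_op k N' w' N w T"
    and w: "\<And>s x. x \<in> space N \<Longrightarrow> 0 \<le> w s x" and w': "\<And>s x. x \<in> space N' \<Longrightarrow> 0 \<le> w' s x"
  shows "smooth_family k N' w' (leibniz F T)"
  unfolding smooth_family_def
proof (intro conjI allI impI)
  have F1: "cont_family N (w s) (F l)" if "l + s \<le> k" for l s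
    using F that by (simp add: smooth_family_def)
  have F2: "deriv_family N (w s) (F l) (F (Suc l))" if "l + s < k" for l s
    using F that by (simp add: smooth_family_def)
  have T1: "op_cont N' (w' s) N (w (l + s)) (T l)" if "l + s \<le> k" for l s
    using T that by (simp add: smooth_op_def)
  have T2: "op_deriv N' (w' s) N (w (Suc (l + s))) (T l) (T (Suc l))" if "l + s < k" for l s
    using T that by (simp add: smooth_op_def)
  fix l s
  show "cont_family N' (w' s) (leibniz F T l)" if "l + s \<le> k"
    unfolding leibniz_def[abs_def]
    using that by (intro cont_family_sum cont_family_comp[OF F1 T1] w w') auto
  show "deriv_family N' (w' s) (leibniz F T l) (leibniz F T (Suc l))" if "l + s < k"
  proof -
    have "deriv_family N' (w' s) (\<lambda>u g. F i u (T (l - i) u g))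
        (\<lambda>u g. F (Suc i) u (T (l - i) u g) + F i u (T (Suc l - i) u g))" if "i \<le> l" for i
    proof -
      have *: "Suc l - i = Suc (l - i)" using that by simp
      show ?thesis
        unfolding * using that \<open>l + s < k\<close> T1[of "Suc (l - i)" s]
        by (intro deriv_family_comp[OF F2 F1 F1 F1 T1 T2] w) auto
    qed
    then have "deriv_family N' (w' s) (\<lambda>u g. \<Sum>i\<le>l. real (l choose i) * F i u (T (l - i) u g))
        (\<lambda>u g. \<Sum>i\<le>l. real (l choose i) * (F (Suc i) u (T (l - i) u g) + F i u (T (Suc l - i) u g)))"
      by (intro deriv_family_sum) auto
    then show ?thesis
      unfolding sum_choose_Suc[of l "\<lambda>i j. F i _ (T j _ _)"]
      by (unfold leibniz_def[abs_def])
  qed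
qed

section \<open>Derivatives of an invariant functional\<close>

text \<open>\<open>Z u\<close> inverts the identity minus \<open>T 0 u\<close> up to constants, from
  both sides: \<open>Z_T\<close> yields \<open>D_generator\<close> and \<open>T_Z\<close> yields
  \<open>D_difference\<close>. As to the dependence of \<open>Z u\<close> on \<open>u\<close>, a
  uniform bound is all that is asked.\<close>

locale invariant_family =
  fixes k :: nat and N :: "'a measure" and w :: "nat \<Rightarrow> 'a \<Rightarrow> real"
    and T :: "nat \<Rightarrow> real \<Rightarrow> ('a \<Rightarrow> real) \<Rightarrow> 'a \<Rightarrow> real"
    and P :: "real \<Rightarrow> ('a \<Rightarrow> real) \<Rightarrow> real" and Z :: "real \<Rightarrow> ('a \<Rightarrow> real) \<Rightarrow> 'a \<Rightarrow> real"
  assumes T: "smooth_op k N w N w T"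
    and w_ge_1: "\<And>s x. x \<in> space N \<Longrightarrow> 1 \<le> w s x"
    and T_deriv_one: "\<And>l u x. 1 \<le> l \<Longrightarrow> l \<le> k \<Longrightarrow> u \<in> {0..1} \<Longrightarrow> x \<in> space N \<Longrightarrow> T l u (\<lambda>_. 1) x = 0"
    and P: "\<And>s u. s \<le> k \<Longrightarrow> u \<in> {0..1} \<Longrightarrow> cont_functional N (w s) (P u)"
    and P_one: "\<And>u. u \<in> {0..1} \<Longrightarrow> P u (\<lambda>_. 1) = 1"
    and P_T: "\<And>s u g b. s \<le> k \<Longrightarrow> u \<in> {0..1} \<Longrightarrow> wbound N (w s) b g \<Longrightarrow> P u (T 0 u g) = P u g"
    and Z: "\<And>s u x. s \<le> k \<Longrightarrow> u \<in> {0..1} \<Longrightarrow> x \<in> space N \<Longrightarrow> cont_functional N (w s) (\<lambda>g. Z u g x)"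
    and Z_bound: "\<And>s. s \<le> k \<Longrightarrow> \<exists>K\<ge>0. \<forall>u\<in>{0..1}. \<forall>g b. 0 \<le> b \<longrightarrow> wbound N (w s) b g \<longrightarrow> wbound N (w s) (K * b) (Z u g)"
    and Z_one: "\<And>u x. u \<in> {0..1} \<Longrightarrow> x \<in> space N \<Longrightarrow> Z u (\<lambda>_. 1) x = 0"
    and T_Z: "\<And>s u g b x. s \<le> k \<Longrightarrow> u \<in> {0..1} \<Longrightarrow> wbound N (w s) b g \<Longrightarrow> x \<in> space N \<Longrightarrow>
        Z u g x - T 0 u (Z u g) x = g x - P u g"
    and Z_T: "\<And>s u g b x. s \<le> k \<Longrightarrow> u \<in> {0..1} \<Longrightarrow> wbound N (w s) b g \<Longrightarrow> x \<in> space N \<Longrightarrow>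
        Z u g x - Z u (T 0 u g) x = g x - P u g"
begin

lemma w_nonneg: "x \<in> space N \<Longrightarrow> 0 \<le> w s x"
  using w_ge_1[of x s] by simp

lemma op_cont_T: "l + s \<le> k \<Longrightarrow> op_cont N (w s) N (w (l + s)) (T l)"
  using T by (simp add: smooth_op_def)

lemma op_deriv_T: "l + s < k \<Longrightarrow> op_deriv N (w s) N (w (Suc (l + s))) (T l) (T (Suc l))"
  using T by (simp add: smooth_op_def)

lemma cont_T: "l + s \<le> k \<Longrightarrow> u \<in> {0..1} \<Longrightarrow> x \<in> space N \<Longrightarrow> cont_functional N (w s) (\<lambda>g. T l u g x)"
  by (rule cont_familyD(1)[OF op_contD(1)[OF op_cont_T]])

lemma wbound_T:
  assumes "l + s \<le> k"
  obtains K where "0 \<le> K" "\<And>u g b. u \<in> {0..1} \<Longrightarrow> 0 \<le> b \<Longrightarrow> wbound N (w s) b g \<Longrightarrow> wbound N (w (l + s)) (K * b) (T l u g)"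
  using op_contD(2)[OF op_cont_T[OF assms]] by blast

lemma wbound_Z:
  assumes "s \<le> k"
  obtains K where "0 \<le> K" "\<And>u g b. u \<in> {0..1} \<Longrightarrow> 0 \<le> b \<Longrightarrow> wbound N (w s) b g \<Longrightarrow> wbound N (w s) (K * b) (Z u g)"
  using Z_bound[OF assms] by blast

text \<open>Formal origin: differentiating \<open>P u (g - T 0 u g) = 0\<close> gives, at order
  \<open>l\<close>, \<open>D l u (g - T 0 u g) = A l u g\<close>. Replacing \<open>g\<close> by
  \<open>Z u g\<close> turns the left side into \<open>D l u\<close> of \<open>g\<close> minus a
  constant, and \<open>D l u\<close> kills constants for \<open>l \<ge> 1\<close>.\<close>

fun D :: "nat \<Rightarrow> real \<Rightarrow> ('a \<Rightarrow> real) \<Rightarrow> real" where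
  "D 0 u g = P u g"
| "D (Suc l) u g = (\<Sum>i<Suc l. real (Suc l choose i) * D i u (T (Suc l - i) u (Z u g)))"

definition A :: "nat \<Rightarrow> real \<Rightarrow> ('a \<Rightarrow> real) \<Rightarrow> real" where
  "A l u g = (\<Sum>i<l. real (l choose i) * D i u (T (l - i) u g))"

lemma D_eq: "D l u g = A l u (Z u g) + (if l = 0 then P u g else 0)"
  by (cases l) (simp_all add: A_def)

lemma cont_functional_T_comp:
  assumes "cont_functional N (w (l + s)) F" "l + s \<le> k" "u \<in> {0..1}"
  shows "cont_functional N (w s) (\<lambda>g. F (T l u g))"
proof -
  obtain K where K: "0 \<le> K" "\<And>u g b. u \<in> {0..1} \<Longrightarrow> 0 \<le> b \<Longrightarrow> wbound N (w s) b g \<Longrightarrow> wbound N (w (l + s)) (K * b) (T l u g)"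
    using wbound_T[OF assms(2)] by blast
  show ?thesis
    by (rule cont_functional_comp[OF assms(1) cont_T[OF assms(2,3)] K(2)[OF assms(3)] w_nonneg])
qed

lemma cont_functional_D:
  "l + s \<le> k \<Longrightarrow> u \<in> {0..1} \<Longrightarrow> cont_functional N (w s) (D l u)"
proof (induction l arbitrary: s rule: less_induct)
  case (less l)
  show ?case
  proof (cases "l = 0")
    case True
    then show ?thesis using P[of s u] less.prems by (simp add: fun_eq_iff[of "D 0 u"])
  next
    case False
    have "cont_functional N (w s) (A l u)"
      unfolding A_def[abs_def]
      by (intro cont_functional_const_sum cont_functional_T_comp less.IH) (use less.prems in auto)
    moreover obtain K where K: "0 \<le> K" "\<And>u g b. u \<in> {0..1} \<Longrightarrow> 0 \<le> b \<Longrightarrow> wbound N (w s) b g \<Longrightarrow> wbound N (w s) (K * b) (Z u g)"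
      using wbound_Z[of s] less.prems by auto
    ultimately have "cont_functional N (w s) (\<lambda>g. A l u (Z u g))"
      using less.prems by (intro cont_functional_comp[OF _ Z K(2) w_nonneg]) auto
    then show ?thesis using False by (simp add: D_eq[abs_def])
  qed
qed

lemma cont_functional_A:
  "l + s \<le> k \<Longrightarrow> u \<in> {0..1} \<Longrightarrow> cont_functional N (w s) (A l u)"
  unfolding A_def[abs_def]
  by (intro cont_functional_const_sum cont_functional_T_comp cont_functional_D) auto

lemma wbound_one: "wbound N (w s) 1 (\<lambda>_. 1)"
  using wbound_const[of N "w s" 1] w_ge_1 by simp

lemma A_one:
  assumes "l \<le> k" "u \<in> {0..1}"
  shows "A l u (\<lambda>_. 1) = 0"
proof -
  have "D i u (T (l - i) u (\<lambda>_. 1)) = 0" if "i < l" for i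
  proof -
    obtain K where K: "0 \<le> K" "\<And>u g b. u \<in> {0..1} \<Longrightarrow> 0 \<le> b \<Longrightarrow> wbound N (w 0) b g \<Longrightarrow> wbound N (w (l - i + 0)) (K * b) (T (l - i) u g)"
    proof -
      have "l - i + 0 \<le> k" using assms by simp
      from wbound_T[OF this] that show ?thesis by blast
    qed
    have c: "cont_functional N (w (l - i + 0)) (D i u)"
      by (rule cont_functional_D) (use assms that in auto)
    have "D i u (T (l - i) u (\<lambda>_. 1)) = D i u (\<lambda>_. 0)"
      by (rule cont_functional_cong[OF c K(2)[OF assms(2) _ wbound_one]])
        (use T_deriv_one[of "l - i" u] assms that in auto)
    then show ?thesis using cont_functional_zero[OF c] by simp
  qed
  then show ?thesis by (simp add: A_def)
qed

lemma D_one: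
  assumes "l \<le> k" "u \<in> {0..1}"
  shows "D l u (\<lambda>_. 1) = (if l = 0 then 1 else 0)"
proof -
  obtain K where K: "0 \<le> K" "\<And>u g b. u \<in> {0..1} \<Longrightarrow> 0 \<le> b \<Longrightarrow> wbound N (w 0) b g \<Longrightarrow> wbound N (w 0) (K * b) (Z u g)"
    using wbound_Z[of 0] by auto
  have c: "cont_functional N (w 0) (A l u)"
    by (rule cont_functional_A) (use assms in auto)
  have "A l u (Z u (\<lambda>_. 1)) = A l u (\<lambda>_. 0)"
    by (rule cont_functional_cong[OF c K(2)[OF assms(2) _ wbound_one]]) (use Z_one assms in auto)
  then show ?thesis using cont_functional_zero[OF c] P_one assms by (simp add: D_eq)
qed

text \<open>\<open>Z u\<close> maps \<open>g - T 0 u g\<close> to \<open>g - P u g\<close>, and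
  \<open>A l u\<close> kills constants; at order 0 both sides vanish by invariance.\<close>

lemma D_generator:
  assumes "l + s \<le> k" "u \<in> {0..1}" "0 \<le> b" "wbound N (w s) b g"
  shows "D l u (\<lambda>x. g x - T 0 u g x) = A l u g"
proof -
  obtain K where K: "0 \<le> K" "\<And>u g b. u \<in> {0..1} \<Longrightarrow> 0 \<le> b \<Longrightarrow> wbound N (w s) b g \<Longrightarrow> wbound N (w s) (K * b) (T 0 u g)"
    using wbound_T[of 0 s] assms(1) by auto
  obtain L where L: "0 \<le> L" "\<And>u g b. u \<in> {0..1} \<Longrightarrow> 0 \<le> b \<Longrightarrow> wbound N (w s) b g \<Longrightarrow> wbound N (w s) (L * b) (Z u g)"
    using wbound_Z[of s] assms(1) by auto
  have Tg: "wbound N (w s) (K * b) (T 0 u g)" by (rule K(2)[OF assms(2-4)])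
  have h: "wbound N (w s) (b + K * b) (\<lambda>x. g x - T 0 u g x)"
    by (rule wbound_diff[OF assms(4) Tg])
  have sk: "s \<le> k" using assms(1) by simp
  have Ph: "P u (\<lambda>x. g x - T 0 u g x) = 0"
    using cont_functional_diff[OF P[OF sk assms(2)] assms(4) Tg] P_T[OF sk assms(2,4)] by simp
  have cA: "cont_functional N (w s) (A l u)" by (rule cont_functional_A) (use assms in auto)
  have "A l u (Z u (\<lambda>x. g x - T 0 u g x)) = A l u (\<lambda>x. 1 * g x + (- P u g) * 1)"
  proof (rule cont_functional_cong[OF cA L(2)[OF assms(2) _ h]])
    show "0 \<le> b + K * b" using K(1) assms(3) by simp
    fix x assume x: "x \<in> space N"
    show "Z u (\<lambda>x. g x - T 0 u g x) x = 1 * g x + (- P u g) * 1"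
      using cont_functional_diff[OF Z[OF sk assms(2) x] assms(4) Tg] Z_T[OF sk assms(2,4) x] by simp
  qed
  also have "\<dots> = A l u g"
    unfolding cont_functional_lincomb[OF cA assms(4) wbound_one]
    using A_one[of l u] assms by simp
  finally show ?thesis using Ph by (simp add: D_eq)
qed

text \<open>Insert the Poisson equation at \<open>v\<close>,
  \<open>g = Z v g - T 0 v (Z v g) + P v g\<close>, into \<open>D l u g\<close>, exchange
  \<open>T 0 v\<close> for \<open>T 0 u\<close>, and use \<open>D_generator\<close> at
  \<open>u\<close>. At order 0 this is the perturbation identity for the invariant
  functional.\<close>

lemma D_difference:
  assumes "l + s \<le> k" "u \<in> {0..1}" "v \<in> {0..1}" "0 \<le> b" "wbound N (w s) b g"
  shows "D l v g - D l u g
    = A l v (Z v g) - A l u (Z v g) + D l u (\<lambda>x. T 0 v (Z v g) x - T 0 u (Z v g) x)"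
proof -
  obtain K where K: "0 \<le> K" "\<And>u g b. u \<in> {0..1} \<Longrightarrow> 0 \<le> b \<Longrightarrow> wbound N (w s) b g \<Longrightarrow> wbound N (w s) (K * b) (T 0 u g)"
    using wbound_T[of 0 s] assms(1) by auto
  obtain L where L: "0 \<le> L" "\<And>u g b. u \<in> {0..1} \<Longrightarrow> 0 \<le> b \<Longrightarrow> wbound N (w s) b g \<Longrightarrow> wbound N (w s) (L * b) (Z u g)"
    using wbound_Z[of s] assms(1) by auto
  let ?h = "Z v g"
  have sk: "s \<le> k" using assms(1) by simp
  have h: "wbound N (w s) (L * b) ?h" by (rule L(2)[OF assms(3-5)])
  have Lb: "0 \<le> L * b" using L(1) assms(4) by simp
  have Tv: "wbound N (w s) (K * (L * b)) (T 0 v ?h)" and Tu: "wbound N (w s) (K * (L * b)) (T 0 u ?h)"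
    using assms(2,3) Lb h by (auto intro: K(2))
  have cD: "cont_functional N (w s) (D l u)" by (rule cont_functional_D) (use assms in auto)
  have e1: "wbound N (w s) (L * b + K * (L * b)) (\<lambda>x. ?h x - T 0 v ?h x)" by (rule wbound_diff[OF h Tv])
  have e2: "wbound N (w s) (L * b + K * (L * b)) (\<lambda>x. ?h x - T 0 u ?h x)" by (rule wbound_diff[OF h Tu])
  have e3: "wbound N (w s) (K * (L * b) + K * (L * b)) (\<lambda>x. T 0 v ?h x - T 0 u ?h x)" by (rule wbound_diff[OF Tv Tu])
  have "D l u g = D l u (\<lambda>x. 1 * (?h x - T 0 v ?h x) + P v g * 1)"
    by (rule cont_functional_cong[OF cD assms(5)]) (simp add: T_Z[OF sk assms(3,5)])
  also have "\<dots> = D l u (\<lambda>x. ?h x - T 0 v ?h x) + P v g * D l u (\<lambda>_. 1)"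
    using cont_functional_lincomb[OF cD e1 wbound_one, of 1 "P v g"] by simp
  also have "D l u (\<lambda>x. ?h x - T 0 v ?h x) = D l u (\<lambda>x. ?h x - T 0 u ?h x) - D l u (\<lambda>x. T 0 v ?h x - T 0 u ?h x)"
    using cont_functional_diff[OF cD e2 e3] by simp
  also have "D l u (\<lambda>x. ?h x - T 0 u ?h x) = A l u ?h"
    by (rule D_generator[OF assms(1,2) Lb h])
  finally show ?thesis
    using D_one[of l u] assms(1,2) D_eq[of l v g] by (auto simp: A_def)
qed

text \<open>In \<open>D_difference\<close> the functions \<open>Z (v n) (g n)\<close> form just
  another bounded sequence, so the continuity of \<open>A l\<close> along bounded sequences applies
  although \<open>Z\<close> moves with the parameter.\<close>

lemma cont_family_D:
  "l + s \<le> k \<Longrightarrow> cont_family N (w s) (D l)"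
proof (induction l arbitrary: s rule: less_induct)
  case (less l)
  have cA: "cont_family N (w s) (A l)"
    unfolding A_def[abs_def]
    by (intro cont_family_sum cont_family_comp[OF less.IH op_cont_T] w_nonneg) (use less.prems in auto)
  obtain K where K: "0 \<le> K" "\<And>u g b. u \<in> {0..1} \<Longrightarrow> 0 \<le> b \<Longrightarrow> wbound N (w s) b g \<Longrightarrow> wbound N (w s) (K * b) (T 0 u g)"
    using wbound_T[of 0 s] less.prems by auto
  obtain L where L: "0 \<le> L" "\<And>u g b. u \<in> {0..1} \<Longrightarrow> 0 \<le> b \<Longrightarrow> wbound N (w s) b g \<Longrightarrow> wbound N (w s) (L * b) (Z u g)"
    using wbound_Z[of s] less.prems by auto
  show ?case
    unfolding cont_family_def
  proof (intro conjI ballI allI impI)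
    show "cont_functional N (w s) (D l u)" if "u \<in> {0..1}" for u
      by (rule cont_functional_D[OF less.prems that])
    fix u v g c assume *: "u \<in> {0..1}" "0 \<le> c" "\<forall>n::nat. v n \<in> {0..1::real}" "v \<longlonglongrightarrow> u" "\<forall>n::nat. wbound N (w s) c (g n)"
    have h: "wbound N (w s) (L * c) (Z (v n) (g n))" for n
      by (rule L(2)) (use * in auto)
    have Lc: "0 \<le> L * c" using L(1) *(2) by simp
    have "wbound N (w s) (K * (L * c)) (T 0 (v n) (Z (v n) (g n)))"
      "wbound N (w s) (K * (L * c)) (T 0 u (Z (v n) (g n)))" for n
      using * by (auto intro!: K(2) Lc h)
    note d = wbound_diff[OF this]
    have "(\<lambda>n. A l (v n) (Z (v n) (g n)) - A l u (Z (v n) (g n))) \<longlonglongrightarrow> 0"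
      by (rule cont_familyD(2)[OF cA *(1) Lc _ *(4) h]) (use * in auto)
    moreover have "(\<lambda>n. D l u (\<lambda>x. T 0 (v n) (Z (v n) (g n)) x - T 0 u (Z (v n) (g n)) x)) \<longlonglongrightarrow> 0"
    proof (rule cont_functional_tendsto_0[OF cont_functional_D[OF less.prems *(1)] _ d w_nonneg])
      fix x assume "x \<in> space N"
      then show "(\<lambda>n. T 0 (v n) (Z (v n) (g n)) x - T 0 u (Z (v n) (g n)) x) \<longlonglongrightarrow> 0"
        using * less.prems by (intro cont_familyD(2)[OF op_contD(1)[OF op_cont_T[of 0 s]] _ Lc _ _ h]) auto
    qed (use K(1) Lc in auto)
    ultimately have "(\<lambda>n. A l (v n) (Z (v n) (g n)) - A l u (Z (v n) (g n))
        + D l u (\<lambda>x. T 0 (v n) (Z (v n) (g n)) x - T 0 u (Z (v n) (g n)) x)) \<longlonglongrightarrow> 0 + 0"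
      by (rule tendsto_add)
    then show "(\<lambda>n. D l (v n) (g n) - D l u (g n)) \<longlonglongrightarrow> 0"
      using D_difference[OF less.prems *(1) *(3)[rule_format] *(2) *(5)[rule_format]] by simp
  qed
qed

text \<open>\<open>D_difference\<close> is used with the two parameters exchanged: the Poisson
  operator then stays at \<open>u\<close>, and the moving functional \<open>D l (v n)\<close> is
  controlled by \<open>cont_family_D\<close> on the weight of index \<open>1 + s\<close>, where the
  difference quotients of \<open>T 0\<close> live.\<close>

lemma deriv_family_D:
  "l + s < k \<Longrightarrow> deriv_family N (w s) (D l) (D (Suc l))"
proof (induction l arbitrary: s rule: less_induct)
  case (less l)
  let ?A' = "\<lambda>u g. \<Sum>i<l. real (l choose i) * (D (Suc i) u (T (l - i) u g) + D i u (T (Suc l - i) u g))"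
  have dA: "deriv_family N (w s) (A l) ?A'"
    unfolding A_def[abs_def]
  proof (rule deriv_family_sum)
    fix i assume "i \<in> {..<l}"
    then have i: "i < l" and *: "Suc l - i = Suc (l - i)" by auto
    show "deriv_family N (w s) (\<lambda>u g. D i u (T (l - i) u g)) (\<lambda>u g. D (Suc i) u (T (l - i) u g) + D i u (T (Suc l - i) u g))"
      unfolding * using i less.prems op_cont_T[of "Suc (l - i)" s]
      by (intro deriv_family_comp[OF less.IH cont_family_D cont_family_D cont_family_D op_cont_T op_deriv_T] w_nonneg) auto
  qed simp
  \<comment> \<open>In \<open>sum_choose_Suc\<close> the term \<open>D (Suc l) u (T 0 u g)\<close>
    occurs on both sides and cancels; of the summand \<open>i = l\<close> there remains
    \<open>D l u (T 1 u g)\<close>.\<close>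
  have A': "?A' u g + D l u (T 1 u g) = A (Suc l) u g" for u g
    using sum_choose_Suc[of l "\<lambda>i j. D i u (T j u g)"]
    by (simp add: A_def lessThan_Suc_atMost[symmetric] del: D.simps)
  obtain K where K: "0 \<le> K" "\<And>u g b. u \<in> {0..1} \<Longrightarrow> 0 \<le> b \<Longrightarrow> wbound N (w s) b g \<Longrightarrow> wbound N (w (1 + s)) (K * b) (T 1 u g)"
    using wbound_T[of 1 s] less.prems by auto
  obtain K0 where K0: "0 \<le> K0" "\<And>u g b. u \<in> {0..1} \<Longrightarrow> 0 \<le> b \<Longrightarrow> wbound N (w s) b g \<Longrightarrow> wbound N (w s) (K0 * b) (T 0 u g)"
    using wbound_T[of 0 s] less.prems by auto
  obtain L where L: "0 \<le> L" "\<And>u g b. u \<in> {0..1} \<Longrightarrow> 0 \<le> b \<Longrightarrow> wbound N (w s) b g \<Longrightarrow> wbound N (w s) (L * b) (Z u g)"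
    using wbound_Z[of s] less.prems by auto
  obtain H where H: "0 \<le> H" "\<And>u v g b. u \<in> {0..1} \<Longrightarrow> v \<in> {0..1} \<Longrightarrow> 0 \<le> b \<Longrightarrow> wbound N (w s) b g \<Longrightarrow>
      wbound N (w (1 + s)) (H * b * \<bar>v - u\<bar>) (\<lambda>x. T 0 v g x - T 0 u g x)"
    using op_derivD(2)[OF op_deriv_T[of 0 s]] less.prems by auto
  show ?case
    unfolding deriv_family_def
  proof (intro ballI allI impI)
    fix u v g c assume *: "u \<in> {0..1}" "0 \<le> c" "\<forall>n::nat. v n \<in> {0..1::real} - {u}" "v \<longlonglongrightarrow> u" "\<forall>n::nat. wbound N (w s) c (g n)"
    have vn: "v n \<in> {0..1}" "v n - u \<noteq> 0" for n using *(3) by auto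
    define h where "h n = Z u (g n)" for n
    have h: "wbound N (w s) (L * c) (h n)" for n
      unfolding h_def by (rule L(2)) (use * in auto)
    have Lc: "0 \<le> L * c" using L(1) *(2) by simp
    define q where "q n = (\<lambda>x. 1 / (v n - u) * (T 0 (v n) (h n) x - T 0 u (h n) x))" for n
    have q: "wbound N (w (1 + s)) (H * (L * c)) (q n)" for n
    proof -
      have "wbound N (w (1 + s)) (\<bar>1 / (v n - u)\<bar> * (H * (L * c) * \<bar>v n - u\<bar>)) (q n)"
        unfolding q_def by (intro wbound_scale H(2) vn *(1) Lc h)
      then show ?thesis using vn(2)[of n] by simp
    qed
    have T1: "wbound N (w (1 + s)) (K * (L * c)) (T 1 u (h n))" for n
      by (intro K(2) *(1) Lc h)
    have ls: "l + (1 + s) \<le> k" "l + s \<le> k" using less.prems by auto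
    note cD = cont_functional_D[OF ls(1) *(1)]
    have 1: "(\<lambda>n. (A l (v n) (h n) - A l u (h n)) / (v n - u) - ?A' u (h n)) \<longlonglongrightarrow> 0"
      by (rule deriv_familyD[OF dA *(1) Lc _ *(4) h]) (use * in auto)
    have 2: "(\<lambda>n. D l (v n) (q n) - D l u (q n)) \<longlonglongrightarrow> 0"
      by (rule cont_familyD(2)[OF cont_family_D[OF ls(1)] *(1) _ vn(1) *(4) q]) (use H(1) Lc in simp)
    have 3: "(\<lambda>n. D l u (\<lambda>x. q n x - T 1 u (h n) x)) \<longlonglongrightarrow> 0"
    proof (rule cont_functional_tendsto_0[OF cD _ wbound_diff[OF q T1] w_nonneg])
      fix x assume x: "x \<in> space N"
      have "(\<lambda>n. (T 0 (v n) (h n) x - T 0 u (h n) x) / (v n - u) - T (Suc 0) u (h n) x) \<longlonglongrightarrow> 0"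
        by (rule deriv_familyD[OF op_derivD(1)[OF op_deriv_T[of 0 s] x] *(1) Lc _ *(4) h]) (use * less.prems in auto)
      then show "(\<lambda>n. q n x - T 1 u (h n) x) \<longlonglongrightarrow> 0" by (simp add: q_def)
    qed (use H(1) K(1) Lc in simp)
    have eq: "(D l (v n) (g n) - D l u (g n)) / (v n - u) - D (Suc l) u (g n) =
       ((A l (v n) (h n) - A l u (h n)) / (v n - u) - ?A' u (h n)) + (D l (v n) (q n) - D l u (q n))
         + D l u (\<lambda>x. q n x - T 1 u (h n) x)" for n
    proof -
      have cDv: "cont_functional N (w s) (D l (v n))"
        by (rule cont_functional_D[OF ls(2) vn(1)])
      have t: "wbound N (w s) (K0 * (L * c)) (T 0 (v n) (h n))" "wbound N (w s) (K0 * (L * c)) (T 0 u (h n))"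
        by (intro K0(2) vn *(1) Lc h)+
      have d: "D l (v n) (g n) - D l u (g n) = A l (v n) (h n) - A l u (h n) - D l (v n) (\<lambda>x. T 0 u (h n) x - T 0 (v n) (h n) x)"
        using D_difference[OF ls(2) vn(1)[of n] *(1) *(2) *(5)[rule_format, of n]] by (simp add: h_def)
      have "(\<lambda>x. T 0 u (h n) x - T 0 (v n) (h n) x) = (\<lambda>x. (-1) * (T 0 (v n) (h n) x - T 0 u (h n) x))" by auto
      then have "D l (v n) (\<lambda>x. T 0 u (h n) x - T 0 (v n) (h n) x) = - D l (v n) (\<lambda>x. T 0 (v n) (h n) x - T 0 u (h n) x)"
        using cont_functional_scale[OF cDv wbound_diff[OF t], of "-1"] by simp
      moreover have "D l (v n) (q n) = D l (v n) (\<lambda>x. T 0 (v n) (h n) x - T 0 u (h n) x) / (v n - u)"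
        unfolding q_def using cont_functional_scale[OF cDv wbound_diff[OF t], of "1 / (v n - u)"] by simp
      ultimately have "(D l (v n) (g n) - D l u (g n)) / (v n - u) = (A l (v n) (h n) - A l u (h n)) / (v n - u) + D l (v n) (q n)"
        by (simp add: d add_divide_distrib)
      moreover have "D (Suc l) u (g n) = ?A' u (h n) + D l u (T 1 u (h n))"
        unfolding A' h_def using D_eq[of "Suc l" u "g n"] by simp
      ultimately show ?thesis
        using cont_functional_diff[OF cD q T1] by simp
    qed
    show "(\<lambda>n. (D l (v n) (g n) - D l u (g n)) / (v n - u) - D (Suc l) u (g n)) \<longlonglongrightarrow> 0"
      unfolding eq using tendsto_add[OF tendsto_add[OF 1 2] 3] by simp
  qed
qed

lemma smooth_family_D: "smooth_family k N w D"
  by (simp add: smooth_family_def cont_family_D deriv_family_D del: D.simps)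

end

section \<open>Differentiation of densities in mean\<close>

text \<open>On each cell the mean value theorem produces a value of \<open>G'\<close> within
  \<open>e / 2\<close> of the one at the left end. This supplies the finite sums to which Fatou's
  lemma is applied below.\<close>

lemma riemann_sum_deriv:
  fixes G G' :: "real \<Rightarrow> real"
  assumes d: "\<And>t. t \<in> {0..1} \<Longrightarrow> (G has_real_derivative G' t) (at t within {0..1})"
    and c: "continuous_on {0..1} G'"
  shows "(\<lambda>n. \<Sum>i<n. G' (real i / real n) / real n) \<longlonglongrightarrow> G 1 - G 0"
proof (rule LIMSEQ_I)
  fix e :: real assume e: "0 < e"
  have "uniformly_continuous_on {0..1} G'"
    by (rule compact_uniformly_continuous[OF c]) simp
  then obtain r where r: "r > 0"
    "\<And>x y. x \<in> {0..1} \<Longrightarrow> y \<in> {0..1} \<Longrightarrow> dist x y < r \<Longrightarrow> dist (G' x) (G' y) < e / 2"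
    using e unfolding uniformly_continuous_on_def by (metis half_gt_zero dist_commute)
  obtain n0 :: nat where n0: "1 / r < real n0" using reals_Archimedean2 by blast
  show "\<exists>n0. \<forall>n\<ge>n0. norm ((\<Sum>i<n. G' (real i / real n) / real n) - (G 1 - G 0)) < e"
  proof (intro exI allI impI)
    fix n :: nat assume n: "max n0 1 \<le> n"
    have n_pos: "0 < real n" using n by simp
    have "1 / r < real n" using n0 n by linarith
    then have n1: "1 / real n < r" using r(1) n_pos by (simp add: field_simps)
    have step: "\<bar>G (real (Suc i) / real n) - G (real i / real n) - G' (real i / real n) / real n\<bar> \<le> e / 2 / real n"
      if i: "i < n" for i
    proof -
      let ?a = "real i / real n" and ?b = "real (Suc i) / real n"
      have ab: "?a < ?b" "0 \<le> ?a" "?b \<le> 1" "?b - ?a = 1 / real n"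
        using i n_pos by (auto simp: field_simps)
      have "\<exists>x\<in>{?a<..<?b}. G ?b - G ?a = (\<lambda>h. G' x * h) (?b - ?a)"
      proof (rule mvt_simple[OF ab(1)])
        fix x assume "?a \<le> x" "x \<le> ?b"
        then have "(G has_real_derivative G' x) (at x within {?a..?b})"
          using ab order_trans[OF ab(2)] by (intro DERIV_subset[OF d]) auto
        then show "(G has_derivative (\<lambda>h. G' x * h)) (at x within {?a..?b})"
          by (simp add: has_field_derivative_def)
      qed
      then obtain x where x: "x \<in> {?a<..<?b}" "G ?b - G ?a = G' x / real n"
        using ab by auto
      have "dist (G' x) (G' ?a) < e / 2"
        using x(1) ab order_trans[OF ab(2), of x] n1 by (intro r(2)) (auto simp: dist_real_def)
      then have "\<bar>G' x - G' ?a\<bar> / real n \<le> e / 2 / real n"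
        using n_pos by (intro divide_right_mono) (auto simp: dist_real_def)
      then show ?thesis
        unfolding x(2) using n_pos by (simp flip: diff_divide_distrib)
    qed
    have "(\<Sum>i<n. G (real (Suc i) / real n) - G (real i / real n)) = G 1 - G 0"
      using sum_lessThan_telescope[of "\<lambda>i. G (real i / real n)" n] n_pos by simp
    then have "\<bar>(\<Sum>i<n. G' (real i / real n) / real n) - (G 1 - G 0)\<bar>
        = \<bar>\<Sum>i<n. G (real (Suc i) / real n) - G (real i / real n) - G' (real i / real n) / real n\<bar>"
      by (simp add: sum_subtractf abs_minus_commute)
    also have "\<dots> \<le> (\<Sum>i<n. e / 2 / real n)"
      by (rule order_trans[OF sum_abs]) (rule sum_mono, use step in auto)
    also have "\<dots> = e / 2" using n_pos by simp
    finally show "norm ((\<Sum>i<n. G' (real i / real n) / real n) - (G 1 - G 0)) < e"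
      using e by simp
  qed
qed

text \<open>Fatou's lemma for Riemann sums replaces Fubini's theorem
  because the reference measure need not be \<open>\<sigma>\<close>-finite.\<close>

lemma nn_integral_mean_value:
  fixes F F' :: "real \<Rightarrow> 'a \<Rightarrow> real"
  assumes u: "u \<in> {0..1}" and v: "v \<in> {0..1}"
    and d: "\<And>y t. y \<in> space \<gamma> \<Longrightarrow> t \<in> {0..1} \<Longrightarrow> ((\<lambda>t. F t y) has_real_derivative F' t y) (at t within {0..1})"
    and cont: "\<And>y. y \<in> space \<gamma> \<Longrightarrow> continuous_on {0..1} (\<lambda>t. F' t y)"
    and meas: "\<And>t. t \<in> {0..1} \<Longrightarrow> F' t \<in> borel_measurable \<gamma>"
    and c[measurable]: "c \<in> borel_measurable \<gamma>" and \<omega>[measurable]: "\<omega> \<in> borel_measurable \<gamma>"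
    and \<omega>0: "\<And>y. y \<in> space \<gamma> \<Longrightarrow> 0 \<le> \<omega> y"
    and B: "\<And>t. t \<in> {0..1} \<Longrightarrow> \<bar>t - u\<bar> \<le> \<bar>v - u\<bar> \<Longrightarrow> (\<integral>\<^sup>+y. ennreal (\<omega> y * \<bar>F' t y - c y\<bar>) \<partial>\<gamma>) \<le> B"
  shows "(\<integral>\<^sup>+y. ennreal (\<omega> y * \<bar>F v y - F u y - (v - u) * c y\<bar>) \<partial>\<gamma>) \<le> ennreal \<bar>v - u\<bar> * B"
proof -
  define t where "t n i = u + real i / real n * (v - u)" for n i :: nat
  have t_in: "t n i \<in> {0..1} \<and> \<bar>t n i - u\<bar> \<le> \<bar>v - u\<bar>" if "i < n" for n i
  proof -
    have f: "0 \<le> real i / real n" "real i / real n \<le> 1" using that by auto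
    have "t n i = (1 - real i / real n) * u + real i / real n * v"
      by (simp add: t_def left_diff_distrib right_diff_distrib)
    moreover have "(1 - real i / real n) * u + real i / real n * v \<le> (1 - real i / real n) * 1 + real i / real n * 1"
      using f u v by (intro add_mono mult_left_mono) auto
    moreover have "0 \<le> (1 - real i / real n) * u + real i / real n * v"
      using f u v by (intro add_nonneg_nonneg mult_nonneg_nonneg) auto
    moreover have "\<bar>t n i - u\<bar> \<le> \<bar>v - u\<bar>"
      using mult_right_mono[OF f(2) abs_ge_zero[of "v - u"]] f(1) by (simp add: t_def abs_mult)
    ultimately show ?thesis by simp
  qed
  \<comment> \<open>Riemann sum for the integral of \<open>F' - c\<close> along the segment from
    \<open>u\<close> to \<open>v\<close>. With \<open>c = 0\<close> the lemma is a mean value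
    inequality; with \<open>c\<close> the derivative at \<open>u\<close> it gives differentiability
    in mean.\<close>
  define S where "S n y = (\<Sum>i<n. (v - u) / real n * (F' (t n i) y - c y))" for n y
  have Sm[measurable]: "S n \<in> borel_measurable \<gamma>" for n
    unfolding S_def using meas t_in by (intro borel_measurable_sum borel_measurable_times borel_measurable_diff) auto
  have lim: "(\<lambda>n. S n y) \<longlonglongrightarrow> F v y - F u y - (v - u) * c y" if y: "y \<in> space \<gamma>" for y
  proof -
    let ?G = "\<lambda>s. F (u + s * (v - u)) y" and ?G' = "\<lambda>s. F' (u + s * (v - u)) y * (v - u)"
    have seg: "u + s * (v - u) \<in> {0..1}" if "s \<in> {0..1}" for s
    proof -
      have "u + s * (v - u) = (1 - s) * u + s * v" by (simp add: algebra_simps)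
      moreover have "(1 - s) * u + s * v \<le> (1 - s) * 1 + s * 1" "0 \<le> (1 - s) * u + s * v"
        using that u v by (intro add_mono mult_left_mono add_nonneg_nonneg mult_nonneg_nonneg; simp)+
      ultimately show ?thesis by simp
    qed
    have "(\<lambda>n. \<Sum>i<n. ?G' (real i / real n) / real n) \<longlonglongrightarrow> ?G 1 - ?G 0"
    proof (rule riemann_sum_deriv)
      show "(?G has_real_derivative ?G' s) (at s within {0..1})" if "s \<in> {0..1}" for s
      proof -
        have "((\<lambda>t. F t y) \<circ> (\<lambda>s. u + s * (v - u)) has_real_derivative F' (u + s * (v - u)) y * (v - u)) (at s within {0..1})"
        proof (rule DERIV_image_chain)
          show "((\<lambda>t. F t y) has_real_derivative F' (u + s * (v - u)) y) (at (u + s * (v - u)) within (\<lambda>s. u + s * (v - u)) ` {0..1})"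
            by (rule DERIV_subset[OF d[OF y seg[OF that]]]) (use seg in auto)
          show "((\<lambda>s. u + s * (v - u)) has_real_derivative v - u) (at s within {0..1})"
            by (auto intro!: derivative_eq_intros)
        qed
        then show ?thesis by (simp add: o_def)
      qed
      show "continuous_on {0..1} ?G'"
        by (intro continuous_intros continuous_on_compose2[OF cont[OF y]]) (use seg in auto)
    qed
    then have "(\<lambda>n. (\<Sum>i<n. ?G' (real i / real n) / real n) - (v - u) * c y) \<longlonglongrightarrow> F v y - F u y - (v - u) * c y"
      by (intro tendsto_diff tendsto_const) simp
    moreover have "eventually (\<lambda>n. (\<Sum>i<n. ?G' (real i / real n) / real n) - (v - u) * c y = S n y) sequentially"
      using eventually_gt_at_top[of 0]
    proof eventually_elim
      case (elim n)
      have "S n y = (\<Sum>i<n. ?G' (real i / real n) / real n - (v - u) * c y / real n)"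
        unfolding S_def t_def by (intro sum.cong refl) (simp add: field_simps)
      also have "\<dots> = (\<Sum>i<n. ?G' (real i / real n) / real n) - (v - u) * c y"
        using elim by (simp add: sum_subtractf)
      finally show ?case by simp
    qed
    ultimately show ?thesis by (rule Lim_transform_eventually)
  qed
  have bound: "(\<integral>\<^sup>+y. ennreal (\<omega> y * \<bar>S n y\<bar>) \<partial>\<gamma>) \<le> ennreal \<bar>v - u\<bar> * B" for n
  proof (cases "n = 0")
    case True
    then show ?thesis by (simp add: S_def)
  next
    case False
    have "(\<integral>\<^sup>+y. ennreal (\<omega> y * \<bar>S n y\<bar>) \<partial>\<gamma>)
        \<le> (\<integral>\<^sup>+y. (\<Sum>i<n. ennreal (\<bar>v - u\<bar> / real n) * ennreal (\<omega> y * \<bar>F' (t n i) y - c y\<bar>)) \<partial>\<gamma>)"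
    proof (rule nn_integral_mono)
      fix y assume y: "y \<in> space \<gamma>"
      have "\<omega> y * \<bar>S n y\<bar> \<le> \<omega> y * (\<Sum>i<n. \<bar>(v - u) / real n * (F' (t n i) y - c y)\<bar>)"
        unfolding S_def by (intro mult_left_mono sum_abs \<omega>0 y)
      also have "\<dots> = (\<Sum>i<n. \<bar>v - u\<bar> / real n * (\<omega> y * \<bar>F' (t n i) y - c y\<bar>))"
        by (simp add: sum_distrib_left abs_mult mult_ac)
      finally show "ennreal (\<omega> y * \<bar>S n y\<bar>)
          \<le> (\<Sum>i<n. ennreal (\<bar>v - u\<bar> / real n) * ennreal (\<omega> y * \<bar>F' (t n i) y - c y\<bar>))"
        using \<omega>0[OF y] by (simp add: ennreal_mult[symmetric] sum_ennreal ennreal_leI)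
    qed
    also have "\<dots> = (\<Sum>i<n. ennreal (\<bar>v - u\<bar> / real n) * (\<integral>\<^sup>+y. ennreal (\<omega> y * \<bar>F' (t n i) y - c y\<bar>) \<partial>\<gamma>))"
    proof -
      have [measurable]: "F' (t n i) \<in> borel_measurable \<gamma>" if "i < n" for i using meas t_in that by blast
      show ?thesis by (subst nn_integral_sum) (auto simp: nn_integral_cmult)
    qed
    also have "\<dots> \<le> (\<Sum>i<n. ennreal (\<bar>v - u\<bar> / real n) * B)"
      using t_in by (intro sum_mono mult_left_mono B) auto
    also have "\<dots> = ennreal \<bar>v - u\<bar> * B"
      using False by (simp add: ennreal_of_nat_eq_real_of_nat mult.assoc[symmetric] ennreal_mult[symmetric])
    finally show ?thesis .
  qed
  have "(\<integral>\<^sup>+y. ennreal (\<omega> y * \<bar>F v y - F u y - (v - u) * c y\<bar>) \<partial>\<gamma>)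
      = (\<integral>\<^sup>+y. liminf (\<lambda>n. ennreal (\<omega> y * \<bar>S n y\<bar>)) \<partial>\<gamma>)"
  proof (rule nn_integral_cong)
    fix y assume y: "y \<in> space \<gamma>"
    have "(\<lambda>n. ennreal (\<omega> y * \<bar>S n y\<bar>)) \<longlonglongrightarrow> ennreal (\<omega> y * \<bar>F v y - F u y - (v - u) * c y\<bar>)"
      by (intro tendsto_ennrealI tendsto_intros lim y)
    then show "ennreal (\<omega> y * \<bar>F v y - F u y - (v - u) * c y\<bar>) = liminf (\<lambda>n. ennreal (\<omega> y * \<bar>S n y\<bar>))"
      by (simp add: lim_imp_Liminf)
  qed
  also have "\<dots> \<le> liminf (\<lambda>n. \<integral>\<^sup>+y. ennreal (\<omega> y * \<bar>S n y\<bar>) \<partial>\<gamma>)"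
    by (rule nn_integral_liminf) measurable
  also have "\<dots> \<le> liminf (\<lambda>n. ennreal \<bar>v - u\<bar> * B)"
    by (intro Liminf_mono always_eventually allI bound)
  also have "\<dots> = ennreal \<bar>v - u\<bar> * B" by (simp add: Liminf_const)
  finally show ?thesis .
qed

text \<open>Jensen's inequality for a concave power when only an upper bound \<open>a\<close> of the
  mean is known: integrate the tangent at \<open>a\<close>, which Young's inequality places above
  the power.\<close>

lemma powr_jensen:
  fixes h :: "'a \<Rightarrow> real"
  assumes "prob_space \<mu>" and h[measurable]: "h \<in> borel_measurable \<mu>" and h0: "\<And>y. 0 < h y"
    and a: "0 < a" and \<theta>: "0 \<le> \<theta>" "\<theta> \<le> 1" and le: "(\<integral>\<^sup>+y. ennreal (h y) \<partial>\<mu>) \<le> ennreal a"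
  shows "(\<integral>\<^sup>+y. ennreal (h y powr \<theta>) \<partial>\<mu>) \<le> ennreal (a powr \<theta>)"
proof -
  interpret prob_space \<mu> by fact
  have ap: "0 < a powr (\<theta> - 1)" using a by simp
  have "(\<integral>\<^sup>+y. ennreal (h y powr \<theta>) \<partial>\<mu>)
      \<le> (\<integral>\<^sup>+y. ennreal (\<theta> * a powr (\<theta> - 1)) * ennreal (h y) + ennreal ((1 - \<theta>) * a powr \<theta>) \<partial>\<mu>)"
  proof (rule nn_integral_mono)
    fix y
    have "h y powr \<theta> * a powr (1 - \<theta>) \<le> \<theta> * h y + (1 - \<theta>) * a"
      using \<theta> a h0[of y] by (intro Youngs_inequality_0) auto
    then have "h y powr \<theta> * a powr (1 - \<theta>) * a powr (\<theta> - 1) \<le> (\<theta> * h y + (1 - \<theta>) * a) * a powr (\<theta> - 1)"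
      using ap by (intro mult_right_mono) auto
    moreover have "a powr (1 - \<theta>) * a powr (\<theta> - 1) = 1" "a * a powr (\<theta> - 1) = a powr \<theta>"
      using a by (simp_all add: powr_add[symmetric] powr_mult_base)
    ultimately have "h y powr \<theta> \<le> \<theta> * a powr (\<theta> - 1) * h y + (1 - \<theta>) * a powr \<theta>"
      by (simp add: algebra_simps)
    then show "ennreal (h y powr \<theta>) \<le> ennreal (\<theta> * a powr (\<theta> - 1)) * ennreal (h y) + ennreal ((1 - \<theta>) * a powr \<theta>)"
      using \<theta> h0[of y] ap by (simp add: ennreal_mult[symmetric] ennreal_plus[symmetric] ennreal_leI del: ennreal_plus)
  qed
  also have "\<dots> = ennreal (\<theta> * a powr (\<theta> - 1)) * (\<integral>\<^sup>+y. ennreal (h y) \<partial>\<mu>) + ennreal ((1 - \<theta>) * a powr \<theta>)"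
    by (simp add: nn_integral_add nn_integral_cmult emeasure_space_1)
  also have "\<dots> \<le> ennreal (\<theta> * a powr (\<theta> - 1)) * ennreal a + ennreal ((1 - \<theta>) * a powr \<theta>)"
    by (intro add_mono mult_left_mono le) auto
  also have "\<dots> = ennreal (\<theta> * (a powr (\<theta> - 1) * a) + (1 - \<theta>) * a powr \<theta>)"
    using \<theta> a by (simp add: ennreal_mult[symmetric] ennreal_plus[symmetric] mult.assoc del: ennreal_plus)
  also have "a powr (\<theta> - 1) * a = a powr \<theta>"
    using a by (simp add: powr_mult_base mult.commute)
  finally show ?thesis by (simp add: algebra_simps)
qed

section \<open>The kernels and their derivatives\<close>

locale kernel_model =
  fixes p k :: nat
    and \<gamma> :: "'e::topological_space measure"
    and f :: "real \<Rightarrow> (nat \<Rightarrow> 'e) \<Rightarrow> 'e \<Rightarrow> real"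
    and df :: "nat \<Rightarrow> real \<Rightarrow> (nat \<Rightarrow> 'e) \<Rightarrow> 'e \<Rightarrow> real"
    and \<phi> :: "'e \<Rightarrow> real"
    and \<alpha> :: "nat \<Rightarrow> real \<Rightarrow> real"
    and \<alpha>\<^sub>0 d\<^sub>0 d\<^sub>1 q C :: real
  assumes p: "p \<ge> 1"
    and \<gamma>: "sets \<gamma> = sets borel"
    and f_measurable: "(\<lambda>(u, x, y). f u x y) \<in>
        borel_measurable (restrict_space borel {0..1} \<Otimes>\<^sub>M (E_pow p \<Otimes>\<^sub>M borel))"
    and f_nonneg: "\<And>u x y. u \<in> {0..1} \<Longrightarrow> x \<in> space (E_pow p) \<Longrightarrow> f u x y \<ge> 0"
    and R_prob_kernel: "\<And>u. u \<in> {0..1} \<Longrightarrow> R_kernel \<gamma> f u \<in> E_pow p \<rightarrow>\<^sub>M prob_algebra borel"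
    and \<phi>_measurable[measurable]: "\<phi> \<in> borel_measurable borel"
    and \<phi>_ge_1: "\<And>y. \<phi> y \<ge> 1"
    and SCp1_constants: "d\<^sub>0 \<ge> 1" "\<alpha>\<^sub>0 > 0"
        "\<And>i u. i \<in> {1..p} \<Longrightarrow> u \<in> {0..1} \<Longrightarrow> \<alpha> i u > 0"
        "(SUP u\<in>{0..1}. ereal (\<Sum>i=1..p. \<alpha> i u)) < 1"
    and SCp1_drift: "\<And>u x. u \<in> {0..1} \<Longrightarrow> x \<in> space (E_pow p) \<Longrightarrow>
        (\<integral>\<^sup>+y. ennreal (\<phi> y powr d\<^sub>0) \<partial>R_kernel \<gamma> f u x)
          \<le> ennreal ((\<Sum>i=1..p. \<alpha> i u * \<phi> (x i) powr d\<^sub>0) + \<alpha>\<^sub>0)"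
    and SCp1_small: "\<And>r. r > 0 \<Longrightarrow> \<exists>\<eta>>0. \<exists>\<nu>. prob_space \<nu> \<and> sets \<nu> = sets borel \<and>
        (\<forall>u\<in>{0..1}. \<forall>A\<in>sets borel. \<forall>x\<in>space (E_pow p).
           (MAX i\<in>{1..p}. \<phi> (x i) powr d\<^sub>0) \<le> r \<longrightarrow> measure (R_kernel \<gamma> f u x) A \<ge> \<eta> * measure \<nu> A)"
    and SCp2: "k \<ge> 1"
        "\<And>u x y. u \<in> {0..1} \<Longrightarrow> x \<in> space (E_pow p) \<Longrightarrow> df 0 u x y = f u x y"
        "\<And>x y. x \<in> space (E_pow p) \<Longrightarrow> Ck_derivs k (\<lambda>l u. df l u x y)"
    and SCp3_constants: "d\<^sub>1 > 0" "q \<ge> 0" "C > 0" "d\<^sub>1 + real k * q \<le> d\<^sub>0"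
    and SCp3_bound: "\<And>l d u x. 1 \<le> l \<Longrightarrow> l \<le> k \<Longrightarrow> 0 \<le> d \<Longrightarrow> d \<le> d\<^sub>1 + real (k - l) * q \<Longrightarrow>
        u \<in> {0..1} \<Longrightarrow> x \<in> space (E_pow p) \<Longrightarrow>
        (\<integral>\<^sup>+y. ennreal (\<phi> y powr d * \<bar>df l u x y\<bar>) \<partial>\<gamma>)
          \<le> ennreal (C * (\<Sum>i=1..p. \<phi> (x i) powr (d + q * real l)))"
    and SCp3_continuity: "\<And>s u x. s \<le> k \<Longrightarrow> u \<in> {0..1} \<Longrightarrow> x \<in> space (E_pow p) \<Longrightarrow>
        ((\<lambda>h. \<integral>\<^sup>+y. ennreal (\<phi> y powr (d\<^sub>1 + q * real s) *
                 \<bar>df (k - s) (u + h) x y - df (k - s) u x y\<bar>) \<partial>\<gamma>) \<longlongrightarrow> 0) (increments u)"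
begin

abbreviation "R \<equiv> R_kernel \<gamma> f"

text \<open>Exponents of the scale of weights: one derivative costs \<open>q\<close>, and
  \<open>ex k \<le> d\<^sub>0\<close> keeps the whole scale within reach of the drift
  condition.\<close>

definition ex :: "nat \<Rightarrow> real" where "ex s = d\<^sub>1 + q * real s"

lemma ex_pos: "0 < ex s"
  using SCp3_constants by (simp add: ex_def add_pos_nonneg)

lemma ex_mono: "s \<le> s' \<Longrightarrow> ex s \<le> ex s'"
  using SCp3_constants by (simp add: ex_def mult_left_mono)

lemma ex_le: "s \<le> k \<Longrightarrow> ex s \<le> d\<^sub>0"
  using ex_mono[of s k] SCp3_constants by (simp add: ex_def mult.commute)

lemma ex_add: "ex (l + s) = ex s + q * real l"
  by (simp add: ex_def algebra_simps)

lemma \<phi>_pos: "0 < \<phi> y"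
  using \<phi>_ge_1[of y] by simp

lemma measurable_\<gamma>: "g \<in> borel_measurable \<gamma> \<longleftrightarrow> g \<in> borel_measurable borel"
  using \<gamma> by (simp cong: measurable_cong_sets)

lemma space_\<gamma>: "space \<gamma> = UNIV"
  using sets_eq_imp_space_eq[OF \<gamma>] by simp

lemma R_prob: "u \<in> {0..1} \<Longrightarrow> x \<in> space (E_pow p) \<Longrightarrow> prob_space (R u x)"
  and sets_R: "sets (R u x) = sets borel"
  using measurable_space[OF R_prob_kernel] \<gamma> by (auto simp: space_prob_algebra R_kernel_def)

lemma f_meas: "u \<in> {0..1} \<Longrightarrow> x \<in> space (E_pow p) \<Longrightarrow> f u x \<in> borel_measurable borel"
proof -
  assume u: "u \<in> {0..1}" and x: "x \<in> space (E_pow p)"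
  have "(\<lambda>y. (u, x, y)) \<in> borel \<rightarrow>\<^sub>M restrict_space borel {0..1} \<Otimes>\<^sub>M (E_pow p \<Otimes>\<^sub>M borel)"
    using u x by (intro measurable_Pair measurable_const measurable_ident) (auto simp: space_restrict_space)
  from measurable_compose[OF this f_measurable] show ?thesis by simp
qed

lemma df_deriv:
  assumes "l < k" "u \<in> {0..1}" "x \<in> space (E_pow p)"
  shows "((\<lambda>u. df l u x y) has_real_derivative df (Suc l) u x y) (at u within {0..1})"
  using SCp2(3)[OF assms(3), of y] assms(1,2) by (simp add: Ck_derivs_def)

lemma df_cont:
  assumes "l \<le> k" "x \<in> space (E_pow p)"
  shows "continuous_on {0..1} (\<lambda>u. df l u x y)"
proof (cases "l = k")
  case True
  then show ?thesis using SCp2(3)[OF assms(2), of y] by (simp add: Ck_derivs_def)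
next
  case False
  then have "l < k" using assms by simp
  then show ?thesis
    unfolding continuous_on_eq_continuous_within
    by (intro ballI DERIV_continuous[OF df_deriv] assms)
qed

text \<open>Tends to \<open>u\<close> inside the unit interval without reaching it: to the right
  from the left half and to the left from the right half, with steps at most 1/2. It turns
  derivatives into limits of sequences, for measurability.\<close>

definition approach :: "real \<Rightarrow> nat \<Rightarrow> real" where
  "approach u n = (if u \<le> 1 / 2 then u + 1 / real (n + 2) else u - 1 / real (n + 2))"

lemma approach_in: "u \<in> {0..1} \<Longrightarrow> approach u n \<in> {0..1} - {u}"
proof -
  assume "u \<in> {0..1}"
  moreover define r where "r = 1 / real (n + 2)"
  moreover have "r \<le> 1 / 2" "0 < r"
    by (auto simp: r_def intro!: divide_left_mono)
  ultimately show ?thesis unfolding approach_def r_def[symmetric] by auto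
qed

lemma approach_tendsto: "approach u \<longlonglongrightarrow> u"
proof -
  have "(\<lambda>n. 1 / real (n + 2)) \<longlonglongrightarrow> 0"
    using LIMSEQ_ignore_initial_segment[OF lim_1_over_n, of 2] by simp
  from tendsto_add[OF tendsto_const this, of u] tendsto_diff[OF tendsto_const this, of u]
  show ?thesis by (cases "u \<le> 1 / 2") (simp_all add: approach_def[abs_def])
qed

lemma deriv_approach:
  assumes "(F has_real_derivative F') (at u within {0..1})" "u \<in> {0..1}"
  shows "(\<lambda>n. (F (approach u n) - F u) / (approach u n - u)) \<longlonglongrightarrow> F'"
proof -
  have "((\<lambda>t. (F t - F u) / (t - u)) \<longlongrightarrow> F') (at u within {0..1})"
    using assms(1) by (simp add: has_field_derivative_iff)
  moreover have "filterlim (approach u) (at u within {0..1}) sequentially"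
    using approach_in[OF assms(2)] approach_tendsto
    by (auto simp: filterlim_at intro!: always_eventually)
  ultimately show ?thesis by (rule filterlim_compose)
qed

text \<open>Measurability is assumed for \<open>f\<close> only; each further derivative is a
  pointwise limit of difference quotients.\<close>

lemma df_meas:
  assumes "l \<le> k" "u \<in> {0..1}" "x \<in> space (E_pow p)"
  shows "df l u x \<in> borel_measurable borel"
  using assms(1,2)
proof (induction l arbitrary: u)
  case 0
  then have "df 0 u x = f u x" using SCp2(2) assms(3) by auto
  then show ?case using f_meas 0 assms(3) by simp
next
  case (Suc l)
  show ?case
  proof (rule borel_measurable_LIMSEQ_real)
    show "(\<lambda>y. (df l (approach u n) x y - df l u x y) / (approach u n - u)) \<in> borel_measurable borel" for n
      using Suc approach_in[OF Suc.prems(2), of n] by (intro borel_measurable_divide borel_measurable_diff) auto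
    show "(\<lambda>n. (df l (approach u n) x y - df l u x y) / (approach u n - u)) \<longlonglongrightarrow> df (Suc l) u x y" for y
      using Suc.prems assms(3) by (intro deriv_approach[OF df_deriv]) auto
  qed
qed

lemma nn_integral_R:
  assumes "u \<in> {0..1}" "x \<in> space (E_pow p)" "\<And>y. 0 \<le> g y" "g \<in> borel_measurable borel"
  shows "(\<integral>\<^sup>+y. ennreal (g y) \<partial>R u x) = (\<integral>\<^sup>+y. ennreal (g y * \<bar>df 0 u x y\<bar>) \<partial>\<gamma>)"
proof -
  have [measurable]: "f u x \<in> borel_measurable \<gamma>" "g \<in> borel_measurable \<gamma>"
    using f_meas assms by (auto simp: measurable_\<gamma>)
  show ?thesis
    unfolding R_kernel_def using f_nonneg[OF assms(1,2)] SCp2(2)[OF assms(1,2)] assms(3)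
    by (subst nn_integral_density) (auto simp: ennreal_mult[symmetric] mult.commute)
qed

lemma integral_R:
  assumes "u \<in> {0..1}" "x \<in> space (E_pow p)" "g \<in> borel_measurable borel"
  shows "(\<integral>y. g y \<partial>R u x) = (\<integral>y. g y * df 0 u x y \<partial>\<gamma>)"
proof -
  have [measurable]: "f u x \<in> borel_measurable \<gamma>" "g \<in> borel_measurable \<gamma>"
    using f_meas assms by (auto simp: measurable_\<gamma>)
  show ?thesis
    unfolding R_kernel_def using f_nonneg[OF assms(1,2)] SCp2(2)[OF assms(1,2)]
    by (subst integral_density) (auto simp: mult.commute)
qed

text \<open>A real number separating all sums of the \<open>\<alpha> i u\<close> from 1, extracted
  from the strict bound on their extended supremum.\<close>

definition \<rho> :: real where
  "\<rho> = (SOME r. 0 < r \<and> r < 1 \<and> (\<forall>u\<in>{0..1}. (\<Sum>i=1..p. \<alpha> i u) \<le> r))"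

lemma \<rho>: "0 < \<rho>" "\<rho> < 1" "u \<in> {0..1} \<Longrightarrow> (\<Sum>i=1..p. \<alpha> i u) \<le> \<rho>"
proof -
  obtain r where r: "(SUP u\<in>{0..1}. ereal (\<Sum>i=1..p. \<alpha> i u)) < ereal r" "ereal r < 1"
    using ereal_dense2[OF SCp1_constants(4)] by blast
  have le: "(\<Sum>i=1..p. \<alpha> i u) \<le> r" if "u \<in> {0..1}" for u
  proof -
    have "ereal (\<Sum>i=1..p. \<alpha> i u) \<le> (SUP u\<in>{0..1}. ereal (\<Sum>i=1..p. \<alpha> i u))"
      by (rule SUP_upper[OF that])
    then have "ereal (\<Sum>i=1..p. \<alpha> i u) < ereal r" by (rule le_less_trans[OF _ r(1)])
    then show ?thesis by simp
  qed
  have "0 < (\<Sum>i=1..p. \<alpha> i 0)"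
    using SCp1_constants(3)[of _ 0] p by (intro sum_pos) auto
  then have "0 < r" using le[of 0] by simp
  moreover have "r < 1" using r(2) by (simp add: one_ereal_def)
  ultimately have "\<exists>r. 0 < r \<and> r < 1 \<and> (\<forall>u\<in>{0..1}. (\<Sum>i=1..p. \<alpha> i u) \<le> r)"
    using le by blast
  then have "0 < \<rho> \<and> \<rho> < 1 \<and> (\<forall>u\<in>{0..1}. (\<Sum>i=1..p. \<alpha> i u) \<le> \<rho>)"
    unfolding \<rho>_def by (rule someI_ex)
  then show "0 < \<rho>" "\<rho> < 1" "u \<in> {0..1} \<Longrightarrow> (\<Sum>i=1..p. \<alpha> i u) \<le> \<rho>" by auto
qed

lemma drift_max:
  assumes u: "u \<in> {0..1}" and x: "x \<in> space (E_pow p)" and M: "\<And>i. i \<in> {1..p} \<Longrightarrow> h i \<le> M" and "0 \<le> M"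
  shows "(\<Sum>i=1..p. \<alpha> i u * h i) + \<alpha>\<^sub>0 \<le> \<rho> * M + \<alpha>\<^sub>0"
proof -
  have "(\<Sum>i=1..p. \<alpha> i u * h i) \<le> (\<Sum>i=1..p. \<alpha> i u * M)"
    using SCp1_constants(3)[OF _ u] M by (intro sum_mono mult_left_mono) (auto simp: less_imp_le)
  also have "\<dots> = (\<Sum>i=1..p. \<alpha> i u) * M" by (simp add: sum_distrib_right)
  also have "\<dots> \<le> \<rho> * M" by (intro mult_right_mono \<rho>(3) u \<open>0 \<le> M\<close>)
  finally show ?thesis by simp
qed

text \<open>At exponent \<open>d\<^sub>0\<close> this is the drift condition, with its constant
  absorbed by \<open>1 \<le> M\<close>; Jensen's inequality with
  \<open>\<theta> = d / d\<^sub>0\<close> passes to smaller exponents.\<close>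

lemma nn_integral_R_powr:
  assumes u: "u \<in> {0..1}" and x: "x \<in> space (E_pow p)" and M: "\<And>i. i \<in> {1..p} \<Longrightarrow> \<phi> (x i) \<le> M"
    and d: "0 \<le> d" "d \<le> d\<^sub>0"
  shows "(\<integral>\<^sup>+y. ennreal (\<phi> y powr d) \<partial>R u x) \<le> ennreal ((1 + \<alpha>\<^sub>0) * M powr d)"
proof -
  have d0: "0 < d\<^sub>0" using SCp1_constants(1) by simp
  have M1: "1 \<le> M" using M[of 1] p \<phi>_ge_1[of "x 1"] by simp
  define \<theta> where "\<theta> = d / d\<^sub>0"
  have \<theta>: "0 \<le> \<theta>" "\<theta> \<le> 1" using d d0 by (auto simp: \<theta>_def)
  interpret prob_space "R u x" by (rule R_prob[OF u x])
  have "(\<integral>\<^sup>+y. ennreal (\<phi> y powr d\<^sub>0) \<partial>R u x) \<le> ennreal ((\<Sum>i=1..p. \<alpha> i u * \<phi> (x i) powr d\<^sub>0) + \<alpha>\<^sub>0)"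
    by (rule SCp1_drift[OF u x])
  also have "\<dots> \<le> ennreal ((1 + \<alpha>\<^sub>0) * M powr d\<^sub>0)"
  proof (rule ennreal_leI)
    have "(\<Sum>i=1..p. \<alpha> i u * \<phi> (x i) powr d\<^sub>0) + \<alpha>\<^sub>0 \<le> \<rho> * M powr d\<^sub>0 + \<alpha>\<^sub>0"
      using M d0 \<phi>_ge_1 by (intro drift_max[OF u x] powr_mono2) (auto intro: order_trans[OF zero_le_one])
    also have "\<dots> \<le> 1 * M powr d\<^sub>0 + \<alpha>\<^sub>0 * M powr d\<^sub>0"
      using \<rho>(2) SCp1_constants(2) ge_one_powr_ge_zero[OF M1, of "d\<^sub>0"] d0
      by (intro add_mono mult_right_mono) (auto simp: mult_le_cancel_left1)
    finally show "(\<Sum>i=1..p. \<alpha> i u * \<phi> (x i) powr d\<^sub>0) + \<alpha>\<^sub>0 \<le> (1 + \<alpha>\<^sub>0) * M powr d\<^sub>0"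
      by (simp add: algebra_simps)
  qed
  finally have le: "(\<integral>\<^sup>+y. ennreal (\<phi> y powr d\<^sub>0) \<partial>R u x) \<le> ennreal ((1 + \<alpha>\<^sub>0) * M powr d\<^sub>0)" .
  have "(\<integral>\<^sup>+y. ennreal ((\<phi> y powr d\<^sub>0) powr \<theta>) \<partial>R u x) \<le> ennreal (((1 + \<alpha>\<^sub>0) * M powr d\<^sub>0) powr \<theta>)"
    using M1 SCp1_constants(2) \<phi>_pos[THEN order.strict_implies_not_eq]
    by (intro powr_jensen[OF R_prob[OF u x] _ _ _ \<theta> le])
      (auto simp: sets_R cong: measurable_cong_sets)
  also have "((1 + \<alpha>\<^sub>0) * M powr d\<^sub>0) powr \<theta> = (1 + \<alpha>\<^sub>0) powr \<theta> * M powr d"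
    using SCp1_constants(2) d0 by (simp add: powr_mult powr_powr \<theta>_def)
  also have "ennreal \<dots> \<le> ennreal ((1 + \<alpha>\<^sub>0) * M powr d)"
    using powr_mono[OF \<theta>(2), of "1 + \<alpha>\<^sub>0"] SCp1_constants(2) by (intro ennreal_leI mult_right_mono) auto
  finally show ?thesis using d0 by (simp add: powr_powr \<theta>_def)
qed

lemma nn_integral_df:
  assumes l: "1 \<le> l" "l \<le> k" and u: "u \<in> {0..1}" and x: "x \<in> space (E_pow p)"
    and M: "\<And>i. i \<in> {1..p} \<Longrightarrow> \<phi> (x i) \<le> M" and d: "0 \<le> d" "d \<le> ex (k - l)"
  shows "(\<integral>\<^sup>+y. ennreal (\<phi> y powr d * \<bar>df l u x y\<bar>) \<partial>\<gamma>) \<le> ennreal (C * real p * M powr (d + q * real l))"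
proof -
  have "(\<integral>\<^sup>+y. ennreal (\<phi> y powr d * \<bar>df l u x y\<bar>) \<partial>\<gamma>) \<le> ennreal (C * (\<Sum>i=1..p. \<phi> (x i) powr (d + q * real l)))"
    using d by (intro SCp3_bound l u x) (auto simp: ex_def mult.commute)
  also have "\<dots> \<le> ennreal (C * (\<Sum>i=1..p. M powr (d + q * real l)))"
    using M \<phi>_pos SCp3_constants d
    by (intro ennreal_leI mult_left_mono sum_mono powr_mono2) (auto simp: less_imp_le)
  finally show ?thesis by (simp add: mult.assoc)
qed

text \<open>(SCp3) pairs the derivative of order \<open>k - s\<close> with the exponent of index
  \<open>s\<close>; here \<open>s = k - l\<close>. Smaller exponents follow from
  \<open>1 \<le> \<phi> y\<close>.\<close>

lemma df_L1_continuous: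
  assumes l: "l \<le> k" and u: "u \<in> {0..1}" and x: "x \<in> space (E_pow p)" and e: "0 < e"
  obtains \<delta> where "0 < \<delta>" "\<And>t d. t \<in> {0..1} \<Longrightarrow> \<bar>t - u\<bar> < \<delta> \<Longrightarrow> d \<le> ex (k - l) \<Longrightarrow>
    (\<integral>\<^sup>+y. ennreal (\<phi> y powr d * \<bar>df l t x y - df l u x y\<bar>) \<partial>\<gamma>) \<le> ennreal e"
proof -
  have kl: "k - (k - l) = l" using l by simp
  have "((\<lambda>h. \<integral>\<^sup>+y. ennreal (\<phi> y powr (ex (k - l)) * \<bar>df l (u + h) x y - df l u x y\<bar>) \<partial>\<gamma>) \<longlongrightarrow> 0) (increments u)"
    using SCp3_continuity[of "k - l" u x] u x unfolding kl ex_def by simp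
  then have "eventually (\<lambda>h. (\<integral>\<^sup>+y. ennreal (\<phi> y powr (ex (k - l)) * \<bar>df l (u + h) x y - df l u x y\<bar>) \<partial>\<gamma>) < ennreal e) (increments u)"
    using e by (auto simp: order_tendsto_iff)
  then obtain \<delta> where \<delta>: "0 < \<delta>" "\<And>h. u + h \<in> {0..1} \<Longrightarrow> h \<noteq> 0 \<Longrightarrow> \<bar>h\<bar> < \<delta> \<Longrightarrow>
      (\<integral>\<^sup>+y. ennreal (\<phi> y powr (ex (k - l)) * \<bar>df l (u + h) x y - df l u x y\<bar>) \<partial>\<gamma>) < ennreal e"
    unfolding eventually_at by (auto simp: dist_real_def)
  show ?thesis
  proof (rule that[OF \<delta>(1)])
    fix t d assume t: "t \<in> {0..1}" "\<bar>t - u\<bar> < \<delta>" and d: "d \<le> ex (k - l)"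
    show "(\<integral>\<^sup>+y. ennreal (\<phi> y powr d * \<bar>df l t x y - df l u x y\<bar>) \<partial>\<gamma>) \<le> ennreal e"
    proof (cases "t = u")
      case False
      have "(\<integral>\<^sup>+y. ennreal (\<phi> y powr d * \<bar>df l t x y - df l u x y\<bar>) \<partial>\<gamma>)
          \<le> (\<integral>\<^sup>+y. ennreal (\<phi> y powr (ex (k - l)) * \<bar>df l t x y - df l u x y\<bar>) \<partial>\<gamma>)"
        by (intro nn_integral_mono ennreal_leI mult_right_mono powr_mono d \<phi>_ge_1) auto
      also have "\<dots> \<le> ennreal e"
        using \<delta>(2)[of "t - u"] t False by simp
      finally show ?thesis .
    qed simp
  qed
qed

lemma df_L1_lipschitz:
  assumes l: "l < k" and u: "u \<in> {0..1}" and v: "v \<in> {0..1}" and x: "x \<in> space (E_pow p)"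
    and M: "\<And>i. i \<in> {1..p} \<Longrightarrow> \<phi> (x i) \<le> M" and d: "0 \<le> d" "d \<le> ex (k - Suc l)"
  shows "(\<integral>\<^sup>+y. ennreal (\<phi> y powr d * \<bar>df l v x y - df l u x y\<bar>) \<partial>\<gamma>)
    \<le> ennreal (\<bar>v - u\<bar> * (C * real p * M powr (d + q * real (Suc l))))"
proof -
  \<comment> \<open>Mean value inequality, with centring function 0.\<close>
  have "(\<integral>\<^sup>+y. ennreal (\<phi> y powr d * \<bar>df l v x y - df l u x y - (v - u) * 0\<bar>) \<partial>\<gamma>)
      \<le> ennreal \<bar>v - u\<bar> * ennreal (C * real p * M powr (d + q * real (Suc l)))"
  proof (rule nn_integral_mean_value[OF u v])
    show "((\<lambda>t. df l t x y) has_real_derivative df (Suc l) t x y) (at t within {0..1})" if "t \<in> {0..1}" for t y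
      by (rule df_deriv[OF l that x])
    show "continuous_on {0..1} (\<lambda>t. df (Suc l) t x y)" for y
      by (rule df_cont) (use l x in auto)
    show "df (Suc l) t x \<in> borel_measurable \<gamma>" if "t \<in> {0..1}" for t
      unfolding measurable_\<gamma> by (rule df_meas) (use l x that in auto)
    show "(\<integral>\<^sup>+y. ennreal (\<phi> y powr d * \<bar>df (Suc l) t x y - 0\<bar>) \<partial>\<gamma>) \<le> ennreal (C * real p * M powr (d + q * real (Suc l)))"
      if "t \<in> {0..1}" for t
      using nn_integral_df[of "Suc l" t x M d] l d M x that by simp
  qed (auto simp: measurable_\<gamma>)
  then show ?thesis using SCp3_constants by (simp add: ennreal_mult)
qed

lemma df_L1_differentiable:
  assumes l: "l < k" and u: "u \<in> {0..1}" and x: "x \<in> space (E_pow p)" and e: "0 < e"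
  obtains \<delta> where "0 < \<delta>" "\<And>v d. v \<in> {0..1} \<Longrightarrow> \<bar>v - u\<bar> < \<delta> \<Longrightarrow> d \<le> ex (k - Suc l) \<Longrightarrow>
    (\<integral>\<^sup>+y. ennreal (\<phi> y powr d * \<bar>df l v x y - df l u x y - (v - u) * df (Suc l) u x y\<bar>) \<partial>\<gamma>) \<le> ennreal (\<bar>v - u\<bar> * e)"
proof -
  have l': "Suc l \<le> k" using l by simp
  obtain \<delta> where \<delta>: "0 < \<delta>" "\<And>t d. t \<in> {0..1} \<Longrightarrow> \<bar>t - u\<bar> < \<delta> \<Longrightarrow> d \<le> ex (k - Suc l) \<Longrightarrow>
    (\<integral>\<^sup>+y. ennreal (\<phi> y powr d * \<bar>df (Suc l) t x y - df (Suc l) u x y\<bar>) \<partial>\<gamma>) \<le> ennreal e"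
    using df_L1_continuous[OF l' u x e] by blast
  show ?thesis
  proof (rule that[OF \<delta>(1)])
    fix v d assume v: "v \<in> {0..1}" "\<bar>v - u\<bar> < \<delta>" and d: "d \<le> ex (k - Suc l)"
    \<comment> \<open>Centring at the derivative at \<open>u\<close> leaves only its oscillation
      near \<open>u\<close>, which is at most \<open>e\<close> in weighted mean.\<close>
    have "(\<integral>\<^sup>+y. ennreal (\<phi> y powr d * \<bar>df l v x y - df l u x y - (v - u) * df (Suc l) u x y\<bar>) \<partial>\<gamma>)
        \<le> ennreal \<bar>v - u\<bar> * ennreal e"
    proof (rule nn_integral_mean_value[OF u v(1)])
      show "((\<lambda>t. df l t x y) has_real_derivative df (Suc l) t x y) (at t within {0..1})" if "t \<in> {0..1}" for t y
        by (rule df_deriv[OF l that x])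
      show "continuous_on {0..1} (\<lambda>t. df (Suc l) t x y)" for y
        by (rule df_cont) (use l x in auto)
      show m: "df (Suc l) t x \<in> borel_measurable \<gamma>" if "t \<in> {0..1}" for t
        unfolding measurable_\<gamma> by (rule df_meas) (use l x that in auto)
      show "df (Suc l) u x \<in> borel_measurable \<gamma>" by (rule m[OF u])
      show "(\<integral>\<^sup>+y. ennreal (\<phi> y powr d * \<bar>df (Suc l) t x y - df (Suc l) u x y\<bar>) \<partial>\<gamma>) \<le> ennreal e"
        if "t \<in> {0..1}" "\<bar>t - u\<bar> \<le> \<bar>v - u\<bar>" for t
        using \<delta>(2)[OF that(1) _ d] that(2) v(2) by simp
    qed (auto simp: measurable_\<gamma>)
    then show "(\<integral>\<^sup>+y. ennreal (\<phi> y powr d * \<bar>df l v x y - df l u x y - (v - u) * df (Suc l) u x y\<bar>) \<partial>\<gamma>) \<le> ennreal (\<bar>v - u\<bar> * e)"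
      using e by (simp add: ennreal_mult)
  qed
qed

end

lemma mult_divide_less:
  fixes K e :: real
  assumes "0 \<le> K" "0 < e"
  shows "K * (e / (2 * (K + 1))) < e"
proof -
  have "K * e < 2 * (K + 1) * e" using assms by simp
  then show ?thesis using assms by (simp add: divide_less_eq mult.commute)
qed

section \<open>One-step operators and their derivatives\<close>

context kernel_model
begin

text \<open>One step of a chain: from the state \<open>z\<close>, a new letter \<open>y\<close> is drawn according to the block
  \<open>\<tau> z\<close>, and the state becomes \<open>\<psi> z y\<close>. The weights are powers of a maximum of values of \<open>\<phi>\<close>,
  so that they multiply exactly.\<close>

definition step_system ::
  "'a measure \<Rightarrow> ('a \<Rightarrow> real) \<Rightarrow> 'b measure \<Rightarrow> ('b \<Rightarrow> real) \<Rightarrow> ('a \<Rightarrow> nat \<Rightarrow> 'e) \<Rightarrow> ('a \<Rightarrow> 'e \<Rightarrow> 'b) \<Rightarrow> bool"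
where
  "step_system N m N' m' \<tau> \<psi> \<longleftrightarrow>
     \<tau> \<in> N \<rightarrow>\<^sub>M E_pow p \<and> (\<lambda>(z, y). \<psi> z y) \<in> N \<Otimes>\<^sub>M borel \<rightarrow>\<^sub>M N' \<and>
     m \<in> borel_measurable N \<and> m' \<in> borel_measurable N' \<and>
     (\<forall>x\<in>space N'. 1 \<le> m' x) \<and>
     (\<forall>z\<in>space N. \<forall>i\<in>{1..p}. \<phi> (\<tau> z i) \<le> m z) \<and>
     (\<forall>z\<in>space N. \<forall>y. m' (\<psi> z y) \<le> max (m z) (\<phi> y))"

text \<open>Derivative of order \<open>l\<close>, in the parameter, of the one-step transition
  operator. Order 0 is integration against \<open>R u (\<tau> z)\<close>, see
  \<open>step_0_eq\<close>.\<close>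

definition step_op ::
  "('a \<Rightarrow> nat \<Rightarrow> 'e) \<Rightarrow> ('a \<Rightarrow> 'e \<Rightarrow> 'b) \<Rightarrow> nat \<Rightarrow> real \<Rightarrow> ('b \<Rightarrow> real) \<Rightarrow> 'a \<Rightarrow> real" where
  "step_op \<tau> \<psi> l u g z = (\<integral>y. g (\<psi> z y) * df l u (\<tau> z) y \<partial>\<gamma>)"

text \<open>Covers both kinds of mass: \<open>1 + \<alpha>\<^sub>0\<close> for the kernel itself
  (\<open>nn_integral_R_powr\<close>) and \<open>C * real p\<close> for its derivatives
  (\<open>nn_integral_df\<close>).\<close>

definition mass_bound :: real where "mass_bound = 1 + \<alpha>\<^sub>0 + C * real p"

lemma mass_bound_pos: "0 < mass_bound"
  using SCp1_constants(2) SCp3_constants(3) p by (simp add: mass_bound_def add_pos_nonneg)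

lemma nn_integral_phi_powr_mono:
  "0 \<le> d \<Longrightarrow> (\<integral>\<^sup>+y. ennreal \<bar>h y\<bar> \<partial>\<gamma>) \<le> (\<integral>\<^sup>+y. ennreal (\<phi> y powr d * \<bar>h y\<bar>) \<partial>\<gamma>)"
  using \<phi>_ge_1 by (intro nn_integral_mono ennreal_leI) (auto simp: mult_le_cancel_right1 ge_one_powr_ge_zero)

lemma ex_le_diff: "l + s \<le> k \<Longrightarrow> ex s \<le> ex (k - l)"
  by (rule ex_mono) simp

context
  fixes N :: "'a measure" and m N' and m' :: "'b \<Rightarrow> real" and \<tau> \<psi>
  assumes sys: "step_system N m N' m' \<tau> \<psi>"
begin

abbreviation "T \<equiv> step_op \<tau> \<psi>"

lemma tau_measurable[measurable]: "\<tau> \<in> N \<rightarrow>\<^sub>M E_pow p"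
  and psi_measurable[measurable]: "(\<lambda>(z, y). \<psi> z y) \<in> N \<Otimes>\<^sub>M borel \<rightarrow>\<^sub>M N'"
  and m_measurable[measurable]: "m \<in> borel_measurable N"
  and m'_measurable: "m' \<in> borel_measurable N'"
  and m'_ge_1: "x \<in> space N' \<Longrightarrow> 1 \<le> m' x"
  and phi_tau_le: "z \<in> space N \<Longrightarrow> i \<in> {1..p} \<Longrightarrow> \<phi> (\<tau> z i) \<le> m z"
  and m'_psi_le: "z \<in> space N \<Longrightarrow> m' (\<psi> z y) \<le> max (m z) (\<phi> y)"
  using sys by (auto simp: step_system_def)

lemma m_ge_1: "z \<in> space N \<Longrightarrow> 1 \<le> m z"
  using phi_tau_le[of z 1] p \<phi>_ge_1[of "\<tau> z 1"] by simp

lemma tau_space: "z \<in> space N \<Longrightarrow> \<tau> z \<in> space (E_pow p)"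
  using measurable_space[OF tau_measurable] .

lemma psi_measurable_snd: "z \<in> space N \<Longrightarrow> \<psi> z \<in> borel \<rightarrow>\<^sub>M N'"
  using measurable_compose[OF measurable_Pair1' psi_measurable] by simp

lemma psi_space: "z \<in> space N \<Longrightarrow> \<psi> z y \<in> space N'"
  using measurable_space[OF psi_measurable_snd] by simp

lemma step_integrand_bound:
  assumes z: "z \<in> space N" and g: "wbound N' (\<lambda>x. m' x powr d) b g" and b: "0 \<le> b" and d: "0 \<le> d"
  shows "\<bar>g (\<psi> z y)\<bar> \<le> b * (m z powr d + \<phi> y powr d)"
proof -
  have "m' (\<psi> z y) powr d \<le> max (m z) (\<phi> y) powr d"
    using m'_psi_le[OF z] m'_ge_1[OF psi_space[OF z]] d
    by (intro powr_mono2) (auto intro: order_trans[OF zero_le_one])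
  also have "\<dots> \<le> m z powr d + \<phi> y powr d" by (simp add: max_def)
  finally show ?thesis
    using wboundD(2)[OF g psi_space[OF z]] mult_left_mono[OF _ b] by (meson order_trans)
qed

text \<open>\<open>h\<close> stands for a derivative of the density or for a difference of such. The
  plain mass \<open>a0\<close> and the weighted mass \<open>a1\<close> are kept apart because
  \<open>m z powr d * a0\<close> and \<open>a1\<close> turn out to carry the same power of
  \<open>m z\<close>, so that the exact power survives.\<close>

lemma step_integral_bound:
  assumes z: "z \<in> space N" and g: "wbound N' (\<lambda>x. m' x powr d) b g" and b: "0 \<le> b" and d: "0 \<le> d"
    and h: "h \<in> borel_measurable borel"
    and a0: "(\<integral>\<^sup>+y. ennreal \<bar>h y\<bar> \<partial>\<gamma>) \<le> ennreal a0" "0 \<le> a0"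
    and a1: "(\<integral>\<^sup>+y. ennreal (\<phi> y powr d * \<bar>h y\<bar>) \<partial>\<gamma>) \<le> ennreal a1" "0 \<le> a1"
  shows "integrable \<gamma> (\<lambda>y. g (\<psi> z y) * h y)"
    and "\<bar>\<integral>y. g (\<psi> z y) * h y \<partial>\<gamma>\<bar> \<le> b * (m z powr d * a0 + a1)"
    and "integrable \<gamma> (\<lambda>y. b * (m z powr d + \<phi> y powr d) * \<bar>h y\<bar>)"
proof -
  have [measurable]: "h \<in> borel_measurable \<gamma>" "\<phi> \<in> borel_measurable \<gamma>"
    using h by (auto simp: measurable_\<gamma>)
  have "(\<lambda>y. g (\<psi> z y)) \<in> borel_measurable borel"
    by (rule measurable_compose[OF psi_measurable_snd[OF z] wboundD(1)[OF g]])
  then have [measurable]: "(\<lambda>y. g (\<psi> z y)) \<in> borel_measurable \<gamma>" by (simp add: measurable_\<gamma>)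
  have "(\<integral>\<^sup>+y. ennreal (b * (m z powr d + \<phi> y powr d) * \<bar>h y\<bar>) \<partial>\<gamma>)
      = (\<integral>\<^sup>+y. ennreal (b * m z powr d) * ennreal \<bar>h y\<bar> + ennreal b * ennreal (\<phi> y powr d * \<bar>h y\<bar>) \<partial>\<gamma>)"
    using b by (intro nn_integral_cong)
      (simp add: ennreal_mult[symmetric] ennreal_plus[symmetric] algebra_simps del: ennreal_plus)
  also have "\<dots> = ennreal (b * m z powr d) * (\<integral>\<^sup>+y. ennreal \<bar>h y\<bar> \<partial>\<gamma>) + ennreal b * (\<integral>\<^sup>+y. ennreal (\<phi> y powr d * \<bar>h y\<bar>) \<partial>\<gamma>)"
    by (simp add: nn_integral_add nn_integral_cmult)
  also have "\<dots> \<le> ennreal (b * m z powr d) * ennreal a0 + ennreal b * ennreal a1"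
    by (intro add_mono mult_left_mono a0 a1) auto
  also have "\<dots> = ennreal (b * (m z powr d * a0 + a1))"
    using b a0(2) a1(2) by (simp add: ennreal_mult[symmetric] ennreal_plus[symmetric] algebra_simps del: ennreal_plus)
  finally have le: "(\<integral>\<^sup>+y. ennreal (b * (m z powr d + \<phi> y powr d) * \<bar>h y\<bar>) \<partial>\<gamma>) \<le> ennreal (b * (m z powr d * a0 + a1))" .
  have pw: "\<bar>g (\<psi> z y) * h y\<bar> \<le> b * (m z powr d + \<phi> y powr d) * \<bar>h y\<bar>" for y
    using step_integrand_bound[OF z g b d, of y] by (simp add: abs_mult mult_right_mono)
  have nn: "0 \<le> b * (m z powr d + \<phi> y powr d) * \<bar>h y\<bar>" for y using b by simp
  show i: "integrable \<gamma> (\<lambda>y. b * (m z powr d + \<phi> y powr d) * \<bar>h y\<bar>)"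
    by (rule integrableI_nonneg) (use nn le in \<open>auto intro: le_less_trans\<close>)
  show "integrable \<gamma> (\<lambda>y. g (\<psi> z y) * h y)"
    by (rule Bochner_Integration.integrable_bound[OF i]) (use pw nn in auto)
  have "\<bar>\<integral>y. g (\<psi> z y) * h y \<partial>\<gamma>\<bar> \<le> (\<integral>y. b * (m z powr d + \<phi> y powr d) * \<bar>h y\<bar> \<partial>\<gamma>)"
    by (rule order_trans[OF integral_abs_bound integral_mono[OF _ i pw]])
      (use \<open>integrable \<gamma> (\<lambda>y. g (\<psi> z y) * h y)\<close> in simp)
  also have "\<dots> \<le> b * (m z powr d * a0 + a1)"
    using le b a0(2) a1(2) nn by (subst integral_eq_nn_integral) (auto intro!: enn2real_leI)
  finally show "\<bar>\<integral>y. g (\<psi> z y) * h y \<partial>\<gamma>\<bar> \<le> b * (m z powr d * a0 + a1)" .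
qed

text \<open>At order 0 every exponent up to \<open>d\<^sub>0\<close> is allowed, beyond the scale
  \<open>ex\<close>; the drift argument works at \<open>d\<^sub>0\<close> itself.\<close>

lemma mass_0:
  assumes z: "z \<in> space N" and u: "u \<in> {0..1}" and d: "0 \<le> d" "d \<le> d\<^sub>0"
  shows "(\<integral>\<^sup>+y. ennreal (\<phi> y powr d * \<bar>df 0 u (\<tau> z) y\<bar>) \<partial>\<gamma>) \<le> ennreal (mass_bound * m z powr d)"
proof -
  have "(\<integral>\<^sup>+y. ennreal (\<phi> y powr d * \<bar>df 0 u (\<tau> z) y\<bar>) \<partial>\<gamma>) \<le> ennreal ((1 + \<alpha>\<^sub>0) * m z powr d)"
    by (subst nn_integral_R[OF u tau_space[OF z], symmetric])
      (auto intro!: nn_integral_R_powr[OF u tau_space[OF z] phi_tau_le[OF z] d])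
  also have "\<dots> \<le> ennreal (mass_bound * m z powr d)"
    using SCp3_constants(3) by (intro ennreal_leI mult_right_mono) (auto simp: mass_bound_def)
  finally show ?thesis .
qed

lemma mass:
  assumes z: "z \<in> space N" and u: "u \<in> {0..1}" and l: "l \<le> k" and d: "0 \<le> d" "d \<le> ex (k - l)"
  shows "(\<integral>\<^sup>+y. ennreal (\<phi> y powr d * \<bar>df l u (\<tau> z) y\<bar>) \<partial>\<gamma>) \<le> ennreal (mass_bound * m z powr (d + q * real l))"
proof (cases "l = 0")
  case True
  then show ?thesis using mass_0[OF z u d(1)] d(2) ex_le[of k] by simp
next
  case False
  have "(\<integral>\<^sup>+y. ennreal (\<phi> y powr d * \<bar>df l u (\<tau> z) y\<bar>) \<partial>\<gamma>) \<le> ennreal (C * real p * m z powr (d + q * real l))"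
    using False by (intro nn_integral_df l u tau_space z phi_tau_le d) auto
  also have "\<dots> \<le> ennreal (mass_bound * m z powr (d + q * real l))"
    using SCp1_constants(2) by (intro ennreal_leI mult_right_mono) (auto simp: mass_bound_def)
  finally show ?thesis .
qed

text \<open>A single mass \<open>a\<close> serves for both; the exact power of \<open>m z\<close> is
  lost, which is harmless for limits at a fixed \<open>z\<close>.\<close>

lemma step_integral_bound':
  assumes z: "z \<in> space N" and g: "wbound N' (\<lambda>x. m' x powr d) b g" and b: "0 \<le> b" and d: "0 \<le> d"
    and h: "h \<in> borel_measurable borel"
    and a: "(\<integral>\<^sup>+y. ennreal (\<phi> y powr d * \<bar>h y\<bar>) \<partial>\<gamma>) \<le> ennreal a" "0 \<le> a"
  shows "integrable \<gamma> (\<lambda>y. g (\<psi> z y) * h y)"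
    and "\<bar>\<integral>y. g (\<psi> z y) * h y \<partial>\<gamma>\<bar> \<le> b * (m z powr d + 1) * a"
  using step_integral_bound(1,2)[OF z g b d h order_trans[OF nn_integral_phi_powr_mono[OF d] a(1)] a(2) a]
  by (simp_all add: algebra_simps)

lemma df_tau_meas: "z \<in> space N \<Longrightarrow> u \<in> {0..1} \<Longrightarrow> l \<le> k \<Longrightarrow> df l u (\<tau> z) \<in> borel_measurable borel"
  by (rule df_meas[OF _ _ tau_space])

lemma step_integrable:
  assumes z: "z \<in> space N" and u: "u \<in> {0..1}" and l: "l \<le> k" and d: "0 \<le> d" "d \<le> ex (k - l)"
    and g: "wbound N' (\<lambda>x. m' x powr d) b g" and b: "0 \<le> b"
  shows "integrable \<gamma> (\<lambda>y. g (\<psi> z y) * df l u (\<tau> z) y)"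
  by (rule step_integral_bound'(1)[OF z g b d(1) df_tau_meas[OF z u l] mass[OF z u l d]])
    (use mass_bound_pos in simp)

lemma step_cont_functional_aux:
  assumes z: "z \<in> space N" and u: "u \<in> {0..1}" and l: "l \<le> k" and d: "0 \<le> d"
    and a: "(\<integral>\<^sup>+y. ennreal (\<phi> y powr d * \<bar>df l u (\<tau> z) y\<bar>) \<partial>\<gamma>) \<le> ennreal a" "0 \<le> a"
  shows "cont_functional N' (\<lambda>x. m' x powr d) (\<lambda>g. T l u g z)"
  unfolding cont_functional_def step_op_def
proof (intro conjI allI impI)
  note h = df_tau_meas[OF z u l]
  have b: "wbound N' (\<lambda>x. m' x powr d) \<bar>c\<bar> g" if "wbound N' (\<lambda>x. m' x powr d) c g" for g c
    by (rule wbound_mono[OF that]) auto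
  note i = step_integral_bound'(1)[OF z b abs_ge_zero d h a]
  fix g g' r s c c' assume *: "wbound N' (\<lambda>x. m' x powr d) c g" "wbound N' (\<lambda>x. m' x powr d) c' g'"
  show "(\<integral>y. (r * g (\<psi> z y) + s * g' (\<psi> z y)) * df l u (\<tau> z) y \<partial>\<gamma>) =
      r * (\<integral>y. g (\<psi> z y) * df l u (\<tau> z) y \<partial>\<gamma>) + s * (\<integral>y. g' (\<psi> z y) * df l u (\<tau> z) y \<partial>\<gamma>)"
    using i[OF *(1)] i[OF *(2)] by (simp add: distrib_right mult.assoc)
next
  note h = df_tau_meas[OF z u l]
  fix g G c assume *: "\<forall>n::nat. wbound N' (\<lambda>x. m' x powr d) c (g n)" "wbound N' (\<lambda>x. m' x powr d) c G"
    "\<forall>x\<in>space N'. (\<lambda>n. g n x) \<longlonglongrightarrow> G x"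
  have b: "wbound N' (\<lambda>x. m' x powr d) \<bar>c\<bar> g" if "wbound N' (\<lambda>x. m' x powr d) c g" for g
    by (rule wbound_mono[OF that]) auto
  have meas: "(\<lambda>y. g (\<psi> z y) * df l u (\<tau> z) y) \<in> borel_measurable \<gamma>" if "wbound N' (\<lambda>x. m' x powr d) c g" for g
    using measurable_compose[OF psi_measurable_snd[OF z] wboundD(1)[OF that]] h
    by (auto simp: measurable_\<gamma>)
  show "(\<lambda>n. \<integral>y. g n (\<psi> z y) * df l u (\<tau> z) y \<partial>\<gamma>) \<longlonglongrightarrow> (\<integral>y. G (\<psi> z y) * df l u (\<tau> z) y \<partial>\<gamma>)"
  proof (rule integral_dominated_convergence)
    show "integrable \<gamma> (\<lambda>y. \<bar>c\<bar> * (m z powr d + \<phi> y powr d) * \<bar>df l u (\<tau> z) y\<bar>)"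
      by (rule step_integral_bound(3)[OF z b[OF *(2)] abs_ge_zero d h order_trans[OF nn_integral_phi_powr_mono[OF d] a(1)] a(2) a])
    show "(\<lambda>y. G (\<psi> z y) * df l u (\<tau> z) y) \<in> borel_measurable \<gamma>"
      "(\<lambda>y. g n (\<psi> z y) * df l u (\<tau> z) y) \<in> borel_measurable \<gamma>" for n
      using meas * by auto
    show "AE y in \<gamma>. (\<lambda>n. g n (\<psi> z y) * df l u (\<tau> z) y) \<longlonglongrightarrow> G (\<psi> z y) * df l u (\<tau> z) y"
      using * psi_space[OF z] by (intro AE_I2 tendsto_mult_right) auto
    show "AE y in \<gamma>. norm (g n (\<psi> z y) * df l u (\<tau> z) y) \<le> \<bar>c\<bar> * (m z powr d + \<phi> y powr d) * \<bar>df l u (\<tau> z) y\<bar>" for n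
      using step_integrand_bound[OF z b[OF *(1)[rule_format, of n]] abs_ge_zero d]
      by (intro AE_I2) (simp add: abs_mult mult_right_mono)
  qed
qed

lemma step_cont_functional:
  assumes "z \<in> space N" "u \<in> {0..1}" "l \<le> k" "0 \<le> d" "d \<le> ex (k - l)"
  shows "cont_functional N' (\<lambda>x. m' x powr d) (\<lambda>g. T l u g z)"
  by (rule step_cont_functional_aux[OF assms(1-4) mass[OF assms]]) (use mass_bound_pos in simp)

lemma step_0_cont_functional:
  assumes "z \<in> space N" "u \<in> {0..1}" "0 \<le> d" "d \<le> d\<^sub>0"
  shows "cont_functional N' (\<lambda>x. m' x powr d) (\<lambda>g. T 0 u g z)"
  by (rule step_cont_functional_aux[OF assms(1-2) _ assms(3) mass_0[OF assms]]) (use mass_bound_pos in simp_all)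

lemma step_0_eq:
  assumes z: "z \<in> space N" and u: "u \<in> {0..1}" and g: "g \<in> borel_measurable N'"
  shows "T 0 u g z = (\<integral>y. g (\<psi> z y) \<partial>R u (\<tau> z))"
  unfolding step_op_def using measurable_compose[OF psi_measurable_snd[OF z] g]
  by (subst integral_R[OF u tau_space[OF z]]) auto

text \<open>Since \<gamma> may fail to be \<sigma>-finite, measurability in \<open>z\<close> is
  taken from the kernel property of \<open>R u\<close>, by integrating against the image of
  \<open>R u (\<tau> z)\<close> under \<open>Pair z\<close>.\<close>

lemma step_0_measurable:
  assumes u: "u \<in> {0..1}" and g[measurable]: "g \<in> borel_measurable N'"
  shows "T 0 u g \<in> borel_measurable N"
proof -
  have [measurable]: "(\<lambda>z. R u (\<tau> z)) \<in> N \<rightarrow>\<^sub>M subprob_algebra borel"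
    using measurable_prob_algebraD[OF R_prob_kernel[OF u]] by measurable
  have "(\<lambda>z. distr (R u (\<tau> z)) (N \<Otimes>\<^sub>M borel) (Pair z)) \<in> N \<rightarrow>\<^sub>M subprob_algebra (N \<Otimes>\<^sub>M borel)"
    by (rule measurable_distr2[where M = borel]) simp_all
  moreover have "(\<lambda>(z, y). g (\<psi> z y)) \<in> borel_measurable (N \<Otimes>\<^sub>M borel)"
    using measurable_compose[OF psi_measurable g] by (simp add: case_prod_beta')
  ultimately have "(\<lambda>z. \<integral>zy. (\<lambda>(z, y). g (\<psi> z y)) zy \<partial>distr (R u (\<tau> z)) (N \<Otimes>\<^sub>M borel) (Pair z)) \<in> borel_measurable N"
    by (rule measurable_compose[OF _ integral_measurable_subprob_algebra])
  moreover have "T 0 u g z = (\<integral>zy. (\<lambda>(z, y). g (\<psi> z y)) zy \<partial>distr (R u (\<tau> z)) (N \<Otimes>\<^sub>M borel) (Pair z))"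
    if z: "z \<in> space N" for z
    using z \<open>(\<lambda>(z, y). g (\<psi> z y)) \<in> borel_measurable (N \<Otimes>\<^sub>M borel)\<close>
    by (subst integral_distr) (auto simp: step_0_eq[OF z u g] sets_R cong: measurable_cong_sets)
  ultimately show ?thesis by (simp cong: measurable_cong)
qed

text \<open>The two masses of \<open>step_integral_bound\<close> contribute equally, hence the
  factor 2; the mean value inequality costs one derivative, hence the exponent
  \<open>q * real (Suc l)\<close>.\<close>

lemma step_diff_bound:
  assumes z: "z \<in> space N" and u: "u \<in> {0..1}" and v: "v \<in> {0..1}" and l: "l < k"
    and d: "0 \<le> d" "d \<le> ex (k - Suc l)" and g: "wbound N' (\<lambda>x. m' x powr d) b g" and b: "0 \<le> b"
  shows "\<bar>T l v g z - T l u g z\<bar> \<le> 2 * mass_bound * b * \<bar>v - u\<bar> * m z powr (d + q * real (Suc l))"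
proof -
  have d': "d \<le> ex (k - l)" by (rule order_trans[OF d(2) ex_mono]) (rule diff_le_mono2, simp)
  have m0: "0 \<le> m z" using m_ge_1[OF z] by simp
  define a where "a d = \<bar>v - u\<bar> * (C * real p * m z powr (d + q * real (Suc l)))" for d
  have a0: "0 \<le> a d" for d using SCp3_constants(3) by (simp add: a_def)
  have A: "(\<integral>\<^sup>+y. ennreal (\<phi> y powr d' * \<bar>df l v (\<tau> z) y - df l u (\<tau> z) y\<bar>) \<partial>\<gamma>) \<le> ennreal (a d')"
    if "0 \<le> d'" "d' \<le> d" for d'
    unfolding a_def using that d by (intro df_L1_lipschitz[OF l u v tau_space[OF z] phi_tau_le[OF z]]) auto
  have A0: "(\<integral>\<^sup>+y. ennreal \<bar>df l v (\<tau> z) y - df l u (\<tau> z) y\<bar> \<partial>\<gamma>) \<le> ennreal (a 0)"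
    using A[of 0] d \<phi>_pos[THEN order.strict_implies_not_eq] by simp
  have meas: "(\<lambda>y. df l v (\<tau> z) y - df l u (\<tau> z) y) \<in> borel_measurable borel"
    using df_tau_meas[OF z] u v l by auto
  have "T l v g z - T l u g z = (\<integral>y. g (\<psi> z y) * (df l v (\<tau> z) y - df l u (\<tau> z) y) \<partial>\<gamma>)"
    unfolding step_op_def using l d
    by (subst Bochner_Integration.integral_diff[symmetric])
      (auto intro!: step_integrable[OF z _ _ _ d' g b] u v simp: right_diff_distrib)
  also have "\<bar>\<dots>\<bar> \<le> b * (m z powr d * a 0 + a d)"
    by (rule step_integral_bound(2)[OF z g b d(1) meas A0 a0 A a0]) (use d in auto)
  also have "m z powr d * a 0 + a d = 2 * (C * real p) * \<bar>v - u\<bar> * m z powr (d + q * real (Suc l))"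
    by (simp add: a_def powr_add)
  also have "b * \<dots> \<le> b * (2 * mass_bound * \<bar>v - u\<bar> * m z powr (d + q * real (Suc l)))"
    using SCp1_constants(2) by (intro mult_left_mono mult_right_mono b) (auto simp: mass_bound_def)
  finally show ?thesis by (simp add: mult_ac)
qed

lemma step_bound_aux:
  assumes z: "z \<in> space N" and u: "u \<in> {0..1}" and l: "l \<le> k" and d: "0 \<le> d"
    and g: "wbound N' (\<lambda>x. m' x powr d) b g" and b: "0 \<le> b"
    and A: "\<And>d'. 0 \<le> d' \<Longrightarrow> d' \<le> d \<Longrightarrow>
      (\<integral>\<^sup>+y. ennreal (\<phi> y powr d' * \<bar>df l u (\<tau> z) y\<bar>) \<partial>\<gamma>) \<le> ennreal (mass_bound * m z powr (d' + q * real l))"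
  shows "\<bar>T l u g z\<bar> \<le> 2 * mass_bound * b * m z powr (d + q * real l)"
proof -
  have A0: "(\<integral>\<^sup>+y. ennreal \<bar>df l u (\<tau> z) y\<bar> \<partial>\<gamma>) \<le> ennreal (mass_bound * m z powr (q * real l))"
    using A[of 0] d \<phi>_pos[THEN order.strict_implies_not_eq] by simp
  have "\<bar>T l u g z\<bar> \<le> b * (m z powr d * (mass_bound * m z powr (q * real l)) + mass_bound * m z powr (d + q * real l))"
    unfolding step_op_def
    by (rule step_integral_bound(2)[OF z g b d df_tau_meas[OF z u l] A0 _ A]) (use mass_bound_pos d in auto)
  then show ?thesis by (simp add: powr_add algebra_simps)
qed

lemma step_bound:
  assumes "z \<in> space N" "u \<in> {0..1}" "l \<le> k" "0 \<le> d" "d \<le> ex (k - l)"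
    "wbound N' (\<lambda>x. m' x powr d) b g" "0 \<le> b"
  shows "\<bar>T l u g z\<bar> \<le> 2 * mass_bound * b * m z powr (d + q * real l)"
  by (rule step_bound_aux[OF assms(1-4,6,7) mass]) (use assms in auto)

lemma step_0_bound:
  assumes "z \<in> space N" "u \<in> {0..1}" "0 \<le> d" "d \<le> d\<^sub>0"
    "wbound N' (\<lambda>x. m' x powr d) b g" "0 \<le> b"
  shows "\<bar>T 0 u g z\<bar> \<le> 2 * mass_bound * b * m z powr d"
proof -
  have "\<bar>T 0 u g z\<bar> \<le> 2 * mass_bound * b * m z powr (d + q * real 0)"
  proof (rule step_bound_aux[OF assms(1,2) _ assms(3,5,6)])
    fix d' assume "0 \<le> d'" "d' \<le> d"
    then show "(\<integral>\<^sup>+y. ennreal (\<phi> y powr d' * \<bar>df 0 u (\<tau> z) y\<bar>) \<partial>\<gamma>) \<le> ennreal (mass_bound * m z powr (d' + q * real 0))"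
      using mass_0[OF assms(1,2), of d'] assms(4) by simp
  qed simp
  then show ?thesis by simp
qed

lemma step_0_wbound:
  assumes "u \<in> {0..1}" "0 \<le> d" "d \<le> d\<^sub>0" "0 \<le> b" "wbound N' (\<lambda>x. m' x powr d) b g"
  shows "wbound N (\<lambda>x. m x powr d) (2 * mass_bound * b) (T 0 u g)"
  using step_0_bound[OF _ assms(1-3,5,4)] step_0_measurable[OF assms(1) wboundD(1)[OF assms(5)]]
  by (intro wboundI)

lemma step_cont_family:
  assumes z: "z \<in> space N" and l: "l \<le> k" and d: "0 \<le> d" "d \<le> ex (k - l)"
  shows "cont_family N' (\<lambda>x. m' x powr d) (\<lambda>u g. T l u g z)"
  unfolding cont_family_def
proof (intro conjI ballI allI impI)
  show "cont_functional N' (\<lambda>x. m' x powr d) (\<lambda>g. T l u g z)" if "u \<in> {0..1}" for u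
    by (rule step_cont_functional[OF z that l d])
  fix u v g c assume *: "u \<in> {0..1}" "0 \<le> c" "\<forall>n::nat. v n \<in> {0..1::real}" "v \<longlonglongrightarrow> u"
    "\<forall>n::nat. wbound N' (\<lambda>x. m' x powr d) c (g n)"
  let ?K = "c * (m z powr d + 1)"
  have K: "0 \<le> ?K" using *(2) by simp
  show "(\<lambda>n. T l (v n) (g n) z - T l u (g n) z) \<longlonglongrightarrow> 0"
  proof (rule LIMSEQ_I)
    fix e :: real assume e: "0 < e"
    define e' where "e' = e / (2 * (?K + 1))"
    have e': "0 < e'" using e K by (simp add: e'_def)
    obtain \<delta> where \<delta>: "0 < \<delta>" "\<And>t d. t \<in> {0..1} \<Longrightarrow> \<bar>t - u\<bar> < \<delta> \<Longrightarrow> d \<le> ex (k - l) \<Longrightarrow>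
        (\<integral>\<^sup>+y. ennreal (\<phi> y powr d * \<bar>df l t (\<tau> z) y - df l u (\<tau> z) y\<bar>) \<partial>\<gamma>) \<le> ennreal e'"
      using df_L1_continuous[OF l *(1) tau_space[OF z] e'] by blast
    obtain n0 where n0: "\<And>n. n \<ge> n0 \<Longrightarrow> \<bar>v n - u\<bar> < \<delta>"
      using LIMSEQ_D[OF *(4) \<delta>(1)] by auto
    show "\<exists>n0. \<forall>n\<ge>n0. norm (T l (v n) (g n) z - T l u (g n) z - 0) < e"
    proof (intro exI allI impI)
      fix n assume n: "n \<ge> n0"
      have g: "wbound N' (\<lambda>x. m' x powr d) c (g n)" and v: "v n \<in> {0..1}" using * by auto
      have meas: "(\<lambda>y. df l (v n) (\<tau> z) y - df l u (\<tau> z) y) \<in> borel_measurable borel"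
        using df_tau_meas[OF z _ l] *(1) v by auto
      have "T l (v n) (g n) z - T l u (g n) z = (\<integral>y. g n (\<psi> z y) * (df l (v n) (\<tau> z) y - df l u (\<tau> z) y) \<partial>\<gamma>)"
        unfolding step_op_def
        by (subst Bochner_Integration.integral_diff[symmetric])
          (auto intro!: step_integrable[OF z _ l d g *(2)] *(1) v simp: right_diff_distrib)
      also have "\<bar>\<dots>\<bar> \<le> ?K * e'"
        by (rule step_integral_bound'(2)[OF z g *(2) d(1) meas \<delta>(2)[OF v n0[OF n] d(2)]]) (use e' in simp)
      also have "\<dots> < e" unfolding e'_def by (rule mult_divide_less[OF K e])
      finally show "norm (T l (v n) (g n) z - T l u (g n) z - 0) < e" by simp
    qed
  qed
qed

lemma step_deriv_family:
  assumes z: "z \<in> space N" and l: "l < k" and d: "0 \<le> d" "d \<le> ex (k - Suc l)"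
  shows "deriv_family N' (\<lambda>x. m' x powr d) (\<lambda>u g. T l u g z) (\<lambda>u g. T (Suc l) u g z)"
  unfolding deriv_family_def
proof (intro ballI allI impI)
  fix u v g c assume *: "u \<in> {0..1}" "0 \<le> c" "\<forall>n::nat. v n \<in> {0..1::real} - {u}" "v \<longlonglongrightarrow> u"
    "\<forall>n::nat. wbound N' (\<lambda>x. m' x powr d) c (g n)"
  let ?K = "c * (m z powr d + 1)"
  have K: "0 \<le> ?K" using *(2) by simp
  have d': "d \<le> ex (k - l)" by (rule order_trans[OF d(2) ex_mono]) (rule diff_le_mono2, simp)
  show "(\<lambda>n. (T l (v n) (g n) z - T l u (g n) z) / (v n - u) - T (Suc l) u (g n) z) \<longlonglongrightarrow> 0"
  proof (rule LIMSEQ_I)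
    fix e :: real assume e: "0 < e"
    define e' where "e' = e / (2 * (?K + 1))"
    have e': "0 < e'" using e K by (simp add: e'_def)
    obtain \<delta> where \<delta>: "0 < \<delta>" "\<And>v d. v \<in> {0..1} \<Longrightarrow> \<bar>v - u\<bar> < \<delta> \<Longrightarrow> d \<le> ex (k - Suc l) \<Longrightarrow>
        (\<integral>\<^sup>+y. ennreal (\<phi> y powr d * \<bar>df l v (\<tau> z) y - df l u (\<tau> z) y - (v - u) * df (Suc l) u (\<tau> z) y\<bar>) \<partial>\<gamma>)
          \<le> ennreal (\<bar>v - u\<bar> * e')"
      using df_L1_differentiable[OF l *(1) tau_space[OF z] e'] by blast
    obtain n0 where n0: "\<And>n. n \<ge> n0 \<Longrightarrow> \<bar>v n - u\<bar> < \<delta>"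
      using LIMSEQ_D[OF *(4) \<delta>(1)] by auto
    show "\<exists>n0. \<forall>n\<ge>n0. norm ((T l (v n) (g n) z - T l u (g n) z) / (v n - u) - T (Suc l) u (g n) z - 0) < e"
    proof (intro exI allI impI)
      fix n assume n: "n \<ge> n0"
      have g: "wbound N' (\<lambda>x. m' x powr d) c (g n)" and v: "v n \<in> {0..1}" "v n - u \<noteq> 0" using * by auto
      let ?h = "\<lambda>y. df l (v n) (\<tau> z) y - df l u (\<tau> z) y - (v n - u) * df (Suc l) u (\<tau> z) y"
      have meas: "?h \<in> borel_measurable borel"
        using df_tau_meas[OF z] l *(1) v by auto
      have i: "integrable \<gamma> (\<lambda>y. g n (\<psi> z y) * df l t (\<tau> z) y)" if "t \<in> {0..1}" for t
        using l by (intro step_integrable[OF z that _ d(1) d' g *(2)]) simp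
      have i': "integrable \<gamma> (\<lambda>y. g n (\<psi> z y) * df (Suc l) u (\<tau> z) y)"
        using l by (intro step_integrable[OF z *(1) _ d g *(2)]) simp
      have "(\<integral>y. g n (\<psi> z y) * ?h y \<partial>\<gamma>) = (\<integral>y. g n (\<psi> z y) * df l (v n) (\<tau> z) y - g n (\<psi> z y) * df l u (\<tau> z) y
          - (v n - u) * (g n (\<psi> z y) * df (Suc l) u (\<tau> z) y) \<partial>\<gamma>)"
        by (simp add: algebra_simps)
      also have "\<dots> = T l (v n) (g n) z - T l u (g n) z - (v n - u) * T (Suc l) u (g n) z"
        unfolding step_op_def using i[OF *(1)] i[OF v(1)] i' by simp
      finally have eq: "T l (v n) (g n) z - T l u (g n) z - (v n - u) * T (Suc l) u (g n) z = (\<integral>y. g n (\<psi> z y) * ?h y \<partial>\<gamma>)" ..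
      have "\<bar>T l (v n) (g n) z - T l u (g n) z - (v n - u) * T (Suc l) u (g n) z\<bar> \<le> ?K * (\<bar>v n - u\<bar> * e')"
        unfolding eq
        by (rule step_integral_bound'(2)[OF z g *(2) d(1) meas \<delta>(2)[OF v(1) n0[OF n] d(2)]]) (use e' in simp)
      then have "\<bar>T l (v n) (g n) z - T l u (g n) z - (v n - u) * T (Suc l) u (g n) z\<bar> / \<bar>v n - u\<bar> \<le> ?K * e'"
        using v(2) by (simp add: divide_le_eq mult_ac)
      moreover have "(T l (v n) (g n) z - T l u (g n) z) / (v n - u) - T (Suc l) u (g n) z
          = (T l (v n) (g n) z - T l u (g n) z - (v n - u) * T (Suc l) u (g n) z) / (v n - u)"
        using v(2) by (simp add: diff_divide_distrib)
      moreover have "?K * e' < e" unfolding e'_def by (rule mult_divide_less[OF K e])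
      ultimately show "norm ((T l (v n) (g n) z - T l u (g n) z) / (v n - u) - T (Suc l) u (g n) z - 0) < e"
        by simp
    qed
  qed
qed

text \<open>Starting from the kernel case, each order is a limit of difference quotients along
  \<open>approach\<close>.\<close>

lemma step_measurable:
  assumes "l \<le> k" "u \<in> {0..1}" "0 \<le> d" "d \<le> ex (k - l)" "wbound N' (\<lambda>x. m' x powr d) b g" "0 \<le> b"
  shows "T l u g \<in> borel_measurable N"
  using assms
proof (induction l arbitrary: u)
  case 0
  then show ?case by (intro step_0_measurable) (auto dest: wboundD)
next
  case (Suc l)
  have d': "d \<le> ex (k - l)" by (rule order_trans[OF Suc.prems(4) ex_mono]) (rule diff_le_mono2, simp)
  show ?case
  proof (rule borel_measurable_LIMSEQ_real)
    show "(\<lambda>z. (T l (approach u n) g z - T l u g z) / (approach u n - u)) \<in> borel_measurable N" for n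
      using approach_in[OF Suc.prems(2), of n] Suc.prems d'
      by (intro borel_measurable_divide borel_measurable_diff Suc.IH) auto
    fix z assume z: "z \<in> space N"
    have "(\<lambda>n. (T l (approach u n) g z - T l u g z) / (approach u n - u) - T (Suc l) u g z) \<longlonglongrightarrow> 0"
      using Suc.prems
      by (intro deriv_familyD[OF step_deriv_family[OF z _ Suc.prems(3,4)] _ _ approach_in approach_tendsto]) auto
    then show "(\<lambda>n. (T l (approach u n) g z - T l u g z) / (approach u n - u)) \<longlonglongrightarrow> T (Suc l) u g z"
      by (simp add: LIM_zero_iff)
  qed
qed

text \<open>Places every one-step system in the abstract scale: order \<open>l\<close> multiplies
  the weight by \<open>m x powr (q * l)\<close>, which is the passage from \<open>ex s\<close> to
  \<open>ex (l + s)\<close>.\<close>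

lemma smooth_op_step:
  "smooth_op k N' (\<lambda>s x. m' x powr ex s) N (\<lambda>s x. m x powr ex s) T"
  unfolding smooth_op_def
proof (intro conjI allI impI)
  have e0: "0 \<le> ex s" for s using ex_pos[of s] by simp
  fix l s
  show "op_cont N' (\<lambda>x. m' x powr ex s) N (\<lambda>x. m x powr ex (l + s)) (T l)" if ls: "l + s \<le> k"
    unfolding op_cont_def
  proof (intro conjI ballI)
    have l: "l \<le> k" using ls by simp
    show "cont_family N' (\<lambda>x. m' x powr ex s) (\<lambda>u g. T l u g z)" if "z \<in> space N" for z
      by (rule step_cont_family[OF that l e0 ex_le_diff[OF ls]])
    show "\<exists>K\<ge>0. \<forall>u\<in>{0..1}. \<forall>g b. 0 \<le> b \<longrightarrow> wbound N' (\<lambda>x. m' x powr ex s) b g \<longrightarrow>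
        wbound N (\<lambda>x. m x powr ex (l + s)) (K * b) (T l u g)"
      using step_bound[OF _ _ l e0 ex_le_diff[OF ls]] step_measurable[OF l _ e0 ex_le_diff[OF ls]] mass_bound_pos
      by (intro exI[of _ "2 * mass_bound"] conjI ballI allI impI wboundI) (auto simp: ex_add)
  qed
  show "op_deriv N' (\<lambda>x. m' x powr ex s) N (\<lambda>x. m x powr ex (Suc (l + s))) (T l) (T (Suc l))" if ls: "l + s < k"
    unfolding op_deriv_def
  proof (intro conjI ballI)
    have l: "l < k" "l \<le> k" "l + s \<le> k" using ls by auto
    have ls': "ex s \<le> ex (k - Suc l)" using ls by (intro ex_mono) simp
    have ex: "ex (Suc (l + s)) = ex s + q * real (Suc l)" using ex_add[of "Suc l" s] by simp
    show "deriv_family N' (\<lambda>x. m' x powr ex s) (\<lambda>u g. T l u g z) (\<lambda>u g. T (Suc l) u g z)" if "z \<in> space N" for z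
      by (rule step_deriv_family[OF that l(1) e0 ls'])
    show "\<exists>K\<ge>0. \<forall>u\<in>{0..1}. \<forall>v\<in>{0..1}. \<forall>g b. 0 \<le> b \<longrightarrow> wbound N' (\<lambda>x. m' x powr ex s) b g \<longrightarrow>
        wbound N (\<lambda>x. m x powr ex (Suc (l + s))) (K * b * \<bar>v - u\<bar>) (\<lambda>x. T l v g x - T l u g x)"
      unfolding ex
      using step_diff_bound[OF _ _ _ l(1) e0 ls'] step_measurable[OF l(2) _ e0 ex_le_diff[OF l(3)]] mass_bound_pos
      by (intro exI[of _ "2 * mass_bound"] conjI ballI allI impI wboundI borel_measurable_diff) auto
  qed
qed

lemma wbound_one': "0 \<le> d \<Longrightarrow> wbound N' (\<lambda>x. m' x powr d) 1 (\<lambda>_. 1)"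
  using m'_ge_1 by (auto simp: wbound_def ge_one_powr_ge_zero)

lemma step_0_one:
  assumes "z \<in> space N" "u \<in> {0..1}"
  shows "T 0 u (\<lambda>_. c) z = c"
proof -
  interpret prob_space "R u (\<tau> z)" by (rule R_prob[OF assms(2) tau_space[OF assms(1)]])
  show ?thesis by (simp add: step_0_eq[OF assms] prob_space)
qed

text \<open>The total mass is 1 for every parameter, so its successive derivatives vanish.\<close>

lemma step_deriv_one:
  assumes z: "z \<in> space N"
  shows "1 \<le> l \<Longrightarrow> l \<le> k \<Longrightarrow> u \<in> {0..1} \<Longrightarrow> T l u (\<lambda>_. 1) z = 0"
proof (induction l arbitrary: u)
  case (Suc l)
  have const: "T l v (\<lambda>_. 1) z = T l u (\<lambda>_. 1) z" if "v \<in> {0..1}" for v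
    using Suc step_0_one[OF z, of _ 1] that by (cases "l = 0") auto
  have e0: "0 \<le> ex 0" "ex 0 \<le> ex (k - Suc l)" using ex_pos[of 0] ex_mono[of 0 "k - Suc l"] by auto
  have "(\<lambda>n. (T l (approach u n) (\<lambda>_. 1) z - T l u (\<lambda>_. 1) z) / (approach u n - u) - T (Suc l) u (\<lambda>_. 1) z) \<longlonglongrightarrow> 0"
    using Suc.prems wbound_one'[OF e0(1)]
    by (intro deriv_familyD[OF step_deriv_family[OF z _ e0] _ _ approach_in approach_tendsto]) auto
  moreover have "T l (approach u n) (\<lambda>_. 1) z = T l u (\<lambda>_. 1) z" for n
    using approach_in[OF Suc.prems(3), of n] by (intro const) auto
  ultimately show ?case by (simp add: LIMSEQ_const_iff)
qed simp

end

end

(* Keeps the simplifier from rewriting {1..p} to {Suc 0..p}. *)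
declare One_nat_def [simp del]

text \<open>The tangent of the concave power at \<open>a\<close> is affine in \<open>h\<close>, so a
  positive operator that fixes constants can be applied to it.\<close>

lemma powr_tangent:
  fixes h a \<theta> :: real
  assumes "0 < h" "0 < a" "0 \<le> \<theta>" "\<theta> \<le> 1"
  shows "h powr \<theta> \<le> \<theta> * a powr (\<theta> - 1) * h + (1 - \<theta>) * a powr \<theta>"
proof -
  have "h powr \<theta> * a powr (1 - \<theta>) \<le> \<theta> * h + (1 - \<theta>) * a"
    using assms by (intro Youngs_inequality_0) auto
  then have "h powr \<theta> * a powr (1 - \<theta>) * a powr (\<theta> - 1) \<le> (\<theta> * h + (1 - \<theta>) * a) * a powr (\<theta> - 1)"
    by (intro mult_right_mono) auto
  also have "h powr \<theta> * a powr (1 - \<theta>) * a powr (\<theta> - 1) = h powr \<theta>"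
    using assms by (simp add: mult.assoc powr_add[symmetric])
  also have "(\<theta> * h + (1 - \<theta>) * a) * a powr (\<theta> - 1) = \<theta> * a powr (\<theta> - 1) * h + (1 - \<theta>) * (a * a powr (\<theta> - 1))"
    by (simp add: algebra_simps)
  also have "a * a powr (\<theta> - 1) = a powr \<theta>"
    using assms by (simp add: powr_mult_base)
  finally show ?thesis .
qed

lemma powr_add_le:
  fixes x y \<theta> :: real
  assumes "0 \<le> x" "0 \<le> y" "0 \<le> \<theta>" "\<theta> \<le> 1"
  shows "(x + y) powr \<theta> \<le> 2 * (x powr \<theta> + y powr \<theta>)"
proof -
  have "(x + y) powr \<theta> \<le> (2 * max x y) powr \<theta>"
    using assms by (intro powr_mono2) auto
  also have "\<dots> = 2 powr \<theta> * max x y powr \<theta>" using assms by (simp add: powr_mult)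
  also have "\<dots> \<le> 2 * max x y powr \<theta>"
    using powr_mono[OF assms(4), of "2 :: real"] by (intro mult_right_mono) auto
  also have "max x y powr \<theta> \<le> x powr \<theta> + y powr \<theta>" by (simp add: max_def)
  finally show ?thesis by simp
qed

context kernel_model
begin

section \<open>Geometric ergodicity\<close>

definition shift :: "(nat \<Rightarrow> 'e) \<Rightarrow> 'e \<Rightarrow> nat \<Rightarrow> 'e" where
  "shift x y = (\<lambda>i\<in>{1..p}. if i = p then y else x (i + 1))"

definition mx :: "(nat \<Rightarrow> 'e) \<Rightarrow> real" where
  "mx x = Max ((\<lambda>i. \<phi> (x i)) ` {1..p})"

lemma phi_le_mx: "i \<in> {1..p} \<Longrightarrow> \<phi> (x i) \<le> mx x"
  unfolding mx_def by (rule Max_ge) auto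

lemma mx_le: "(\<And>i. i \<in> {1..p} \<Longrightarrow> \<phi> (x i) \<le> c) \<Longrightarrow> mx x \<le> c"
  unfolding mx_def using p by (subst Max_le_iff) auto

lemma mx_attained: "\<exists>i\<in>{1..p}. mx x = \<phi> (x i)"
proof -
  have "mx x \<in> (\<lambda>i. \<phi> (x i)) ` {1..p}"
    unfolding mx_def using p by (intro Max_in) auto
  then show ?thesis by auto
qed

lemma mx_ge_1: "1 \<le> mx x"
  using mx_attained[of x] \<phi>_ge_1 by auto

lemma mx_measurable[measurable]: "mx \<in> borel_measurable (E_pow p)"
  unfolding mx_def[abs_def]
  by (intro borel_measurable_Max finite_atLeastAtMost measurable_compose[OF _ \<phi>_measurable]
      measurable_component_singleton)

lemma shift_measurable: "(\<lambda>(x, y). shift x y) \<in> E_pow p \<Otimes>\<^sub>M borel \<rightarrow>\<^sub>M E_pow p"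
proof -
  have "(\<lambda>z. if i = p then snd z else fst z (i + 1)) \<in> E_pow p \<Otimes>\<^sub>M borel \<rightarrow>\<^sub>M borel"
    if i: "i \<in> {1..p}" for i
  proof (cases "i = p")
    case False
    then have "i + 1 \<in> {1..p}" using i by auto
    then have "(\<lambda>x. x (i + 1)) \<in> E_pow p \<rightarrow>\<^sub>M borel"
      by (rule measurable_component_singleton)
    from measurable_compose[OF measurable_fst this] show ?thesis using False by simp
  qed (simp add: measurable_snd)
  then have "(\<lambda>z. \<lambda>i\<in>{1..p}. if i = p then snd z else fst z (i + 1)) \<in> E_pow p \<Otimes>\<^sub>M borel \<rightarrow>\<^sub>M E_pow p"
    by (rule measurable_restrict)
  then show ?thesis by (simp add: shift_def case_prod_beta')
qed

lemma mx_shift_le: "mx (shift x y) \<le> max (mx x) (\<phi> y)"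
proof (rule mx_le)
  fix i assume "i \<in> {1..p}"
  then show "\<phi> (shift x y i) \<le> max (mx x) (\<phi> y)"
    using phi_le_mx[of "i + 1" x] by (auto simp: shift_def)
qed

lemma shift_system: "step_system (E_pow p) mx (E_pow p) mx (\<lambda>x. x) shift"
  unfolding step_system_def
  by (intro conjI ballI allI measurable_ident_sets[OF refl] shift_measurable mx_measurable mx_ge_1 phi_le_mx mx_shift_le)

abbreviation Qop :: "real \<Rightarrow> ((nat \<Rightarrow> 'e) \<Rightarrow> real) \<Rightarrow> (nat \<Rightarrow> 'e) \<Rightarrow> real" where
  "Qop u \<equiv> step_op (\<lambda>x. x) shift 0 u"

abbreviation V :: "real \<Rightarrow> (nat \<Rightarrow> 'e) \<Rightarrow> real" where
  "V d \<equiv> (\<lambda>x. mx x powr d)"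

abbreviation E :: "(nat \<Rightarrow> 'e) measure" where "E \<equiv> E_pow p"

lemma V_ge_1: "0 \<le> d \<Longrightarrow> 1 \<le> V d x"
  by (simp add: ge_one_powr_ge_zero mx_ge_1)

lemma V_nonneg: "0 \<le> V d x" by simp

lemma mx_pos: "0 < mx x"
  using mx_ge_1[of x] by simp

lemma V_measurable: "V d \<in> borel_measurable E"
  by (rule measurable_compose[OF mx_measurable]) measurable

lemma shift_space: "x \<in> space E \<Longrightarrow> shift x y \<in> space E"
  by (rule psi_space[OF shift_system])

definition coord :: "nat \<Rightarrow> (nat \<Rightarrow> 'e) \<Rightarrow> real" where "coord i x = \<phi> (x i) powr d\<^sub>0"

lemma d0_nonneg: "0 \<le> d\<^sub>0" "d\<^sub>0 \<le> d\<^sub>0" "0 < d\<^sub>0"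
  using SCp1_constants(1) by auto

lemma coord_measurable: "i \<in> {1..p} \<Longrightarrow> coord i \<in> borel_measurable E"
  unfolding coord_def[abs_def]
  by (rule measurable_compose[OF measurable_component_singleton, where g = "\<lambda>y. \<phi> y powr d\<^sub>0"]) auto

lemma coord_le: "i \<in> {1..p} \<Longrightarrow> coord i x \<le> V d\<^sub>0 x"
  unfolding coord_def using phi_le_mx d0_nonneg(1) \<phi>_pos by (intro powr_mono2) (auto simp: less_imp_le)

lemma coord_wbound: "i \<in> {1..p} \<Longrightarrow> wbound E (V d\<^sub>0) 1 (coord i)"
  using coord_le[of i] coord_measurable[of i] by (intro wboundI) (auto simp: coord_def)

text \<open>Fixed point of the affine map \<open>c \<mapsto> \<rho> * c + \<alpha>\<^sub>0\<close>,
  the level to which the drift condition pulls the moments.\<close>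

definition \<kappa>\<^sub>0 :: real where "\<kappa>\<^sub>0 = \<alpha>\<^sub>0 / (1 - \<rho>)"

lemma \<kappa>\<^sub>0: "0 < \<kappa>\<^sub>0" "\<rho> * \<kappa>\<^sub>0 + \<alpha>\<^sub>0 = \<kappa>\<^sub>0"
  using \<rho>(1,2) SCp1_constants(2) by (auto simp: \<kappa>\<^sub>0_def field_simps)

lemma V_le_sum: "V d x \<le> (\<Sum>i=1..p. \<phi> (x i) powr d)"
proof -
  obtain i where "i \<in> {1..p}" "mx x = \<phi> (x i)" using mx_attained by blast
  then show ?thesis using member_le_sum[of i "{1..p}" "\<lambda>i. \<phi> (x i) powr d"] by simp
qed

context
  fixes u :: real assumes u: "u \<in> {0..1}"
begin

lemma Qop_eq: "x \<in> space E \<Longrightarrow> g \<in> borel_measurable E \<Longrightarrow> Qop u g x = (\<integral>y. g (shift x y) \<partial>R u x)"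
  by (rule step_0_eq[OF shift_system _ u])

lemma Qop_pow_wbound:
  assumes d: "0 \<le> d" "d \<le> d\<^sub>0" and g: "wbound E (V d) b g" "0 \<le> b"
  shows "wbound E (V d) ((2 * mass_bound) ^ n * b) ((Qop u ^^ n) g)"
proof (induction n)
  case (Suc n)
  have "0 \<le> (2 * mass_bound) ^ n * b" using g(2) mass_bound_pos by simp
  from step_0_wbound[OF shift_system u d this Suc] show ?case by (simp add: mult_ac)
qed (use g in simp)

lemma Qop_pow_cont:
  assumes d: "0 \<le> d" "d \<le> d\<^sub>0" and x: "x \<in> space E"
  shows "cont_functional E (V d) (\<lambda>g. (Qop u ^^ n) g x)"
proof (induction n)
  case 0
  then show ?case unfolding cont_functional_def using x by simp
next
  case (Suc n)
  have "cont_functional E (V d) (\<lambda>g. (Qop u ^^ n) (Qop u g) x)"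
    by (rule cont_functional_comp[OF Suc step_0_cont_functional[OF shift_system _ u d]
          step_0_wbound[OF shift_system u d] V_nonneg])
  then show ?case by (simp only: funpow_Suc_right o_apply)
qed

lemma Qop_pow_const: "x \<in> space E \<Longrightarrow> (Qop u ^^ n) (\<lambda>_. c) x = c"
proof (induction n arbitrary: x)
  case (Suc n)
  have w: "wbound E (V 0) \<bar>c\<bar> (\<lambda>_. c)" by (rule wbound_const) (rule V_ge_1, simp)
  have d0: "0 \<le> d\<^sub>0" using SCp1_constants(1) by simp
  have "Qop u ((Qop u ^^ n) (\<lambda>_. c)) x = Qop u (\<lambda>_. c) x"
    by (rule cont_functional_cong[OF step_0_cont_functional[OF shift_system Suc.prems u _ d0] Qop_pow_wbound[OF _ d0 w]])
      (use Suc.IH in auto)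
  then show ?case by (simp add: step_0_one[OF shift_system Suc.prems u])
qed simp

lemma Qop_nonneg:
  assumes "x \<in> space E" "g \<in> borel_measurable E" "\<And>x. x \<in> space E \<Longrightarrow> 0 \<le> g x"
  shows "0 \<le> Qop u g x"
  unfolding Qop_eq[OF assms(1,2)] using assms(3)[OF shift_space[OF assms(1)]] by simp

lemma Qop_pow_nonneg:
  assumes d: "0 \<le> d" "d \<le> d\<^sub>0" and g: "wbound E (V d) b g" "0 \<le> b" and nn: "\<And>x. x \<in> space E \<Longrightarrow> 0 \<le> g x"
  shows "x \<in> space E \<Longrightarrow> 0 \<le> (Qop u ^^ n) g x"
proof (induction n arbitrary: x)
  case (Suc n)
  show ?case
    using Qop_nonneg[OF Suc.prems wboundD(1)[OF Qop_pow_wbound[OF d g]]] Suc.IH by simp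
qed (simp add: nn)

lemma Qop_pow_mono:
  assumes d: "0 \<le> d" "d \<le> d\<^sub>0" and g: "wbound E (V d) b g" "0 \<le> b" and h: "wbound E (V d) c h" "0 \<le> c"
    and le: "\<And>x. x \<in> space E \<Longrightarrow> g x \<le> h x" and x: "x \<in> space E"
  shows "(Qop u ^^ n) g x \<le> (Qop u ^^ n) h x"
proof -
  have "0 \<le> (Qop u ^^ n) (\<lambda>x. h x - g x) x"
    by (rule Qop_pow_nonneg[OF d wbound_diff[OF h(1) g(1)]]) (use g(2) h(2) le x in auto)
  then show ?thesis
    using cont_functional_diff[OF Qop_pow_cont[OF d x] h(1) g(1), of n] by simp
qed

lemma Qop_coord_less:
  assumes "i \<in> {1..p}" "i < p" "x \<in> space E"
  shows "Qop u (coord i) x = coord (Suc i) x"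
proof -
  interpret prob_space "R u x" by (rule R_prob[OF u assms(3)])
  show ?thesis
    unfolding Qop_eq[OF assms(3) coord_measurable[OF assms(1)]]
    using assms by (simp add: coord_def shift_def prob_space Suc_eq_plus1)
qed

lemma Qop_coord_p:
  assumes x: "x \<in> space E"
  shows "Qop u (coord p) x \<le> (\<Sum>i=1..p. \<alpha> i u * coord i x) + \<alpha>\<^sub>0"
proof -
  have pp: "p \<in> {1..p}" using p by simp
  have nn: "0 \<le> (\<Sum>i=1..p. \<alpha> i u * coord i x) + \<alpha>\<^sub>0"
    using SCp1_constants(2) SCp1_constants(3)[OF _ u]
    by (intro add_nonneg_nonneg sum_nonneg mult_nonneg_nonneg) (auto simp: coord_def less_imp_le)
  have "Qop u (coord p) x = (\<integral>y. \<phi> y powr d\<^sub>0 \<partial>R u x)"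
    unfolding Qop_eq[OF x coord_measurable[OF pp]] using p by (simp add: coord_def shift_def)
  also have "\<dots> \<le> (\<Sum>i=1..p. \<alpha> i u * coord i x) + \<alpha>\<^sub>0"
    using SCp1_drift[OF u x] nn
    by (subst integral_eq_nn_integral) (auto intro!: enn2real_leI simp: coord_def sets_R cong: measurable_cong_sets)
  finally show ?thesis .
qed

text \<open>The drift inequality bounds the newest letter by all letters of the preceding block; the
  monotone operator \<open>Qop u ^^ n\<close> is applied to it.\<close>

lemma Qop_pow_coord_Suc:
  assumes M: "\<And>i. i \<in> {1..p} \<Longrightarrow> (Qop u ^^ n) (coord i) x \<le> M" and "0 \<le> M" and x: "x \<in> space E"
  shows "(Qop u ^^ Suc n) (coord p) x \<le> \<rho> * M + \<alpha>\<^sub>0"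
proof -
  have pp: "p \<in> {1..p}" using p by simp
  note c = Qop_pow_cont[OF d0_nonneg(1,2) x, of n]
  have w: "wbound E (V d\<^sub>0) (\<bar>\<alpha> i u\<bar> * 1) (\<lambda>x. \<alpha> i u * coord i x)" if "i \<in> {1..p}" for i
    by (intro wbound_scale coord_wbound that)
  have s: "wbound E (V d\<^sub>0) (\<Sum>i=1..p. \<bar>\<alpha> i u\<bar> * 1) (\<lambda>x. \<Sum>i=1..p. \<alpha> i u * coord i x)
      \<and> (Qop u ^^ n) (\<lambda>x. \<Sum>i=1..p. \<alpha> i u * coord i x) x = (\<Sum>i=1..p. (Qop u ^^ n) (\<lambda>x. \<alpha> i u * coord i x) x)"
    by (rule cont_functional_sum[OF c]) (use w in auto)
  have k: "wbound E (V d\<^sub>0) \<bar>\<alpha>\<^sub>0\<bar> (\<lambda>_. \<alpha>\<^sub>0)" by (rule wbound_const) (rule V_ge_1[OF d0_nonneg(1)])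
  have "(Qop u ^^ Suc n) (coord p) x = (Qop u ^^ n) (Qop u (coord p)) x" by (simp only: funpow_Suc_right o_apply)
  also have "\<dots> \<le> (Qop u ^^ n) (\<lambda>x. (\<Sum>i=1..p. \<alpha> i u * coord i x) + \<alpha>\<^sub>0) x"
    by (rule Qop_pow_mono[OF d0_nonneg(1,2) step_0_wbound[OF shift_system u d0_nonneg(1,2) zero_le_one coord_wbound[OF pp]] _ wbound_add[OF s[THEN conjunct1] k]])
      (use mass_bound_pos x Qop_coord_p in \<open>auto intro!: sum_nonneg add_nonneg_nonneg\<close>)
  also have "\<dots> = (\<Sum>i=1..p. \<alpha> i u * (Qop u ^^ n) (coord i) x) + \<alpha>\<^sub>0"
    using cont_functional_add[OF c s[THEN conjunct1] k] s cont_functional_scale[OF c coord_wbound] Qop_pow_const[OF x]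
    by simp
  also have "\<dots> \<le> \<rho> * M + \<alpha>\<^sub>0"
    by (rule drift_max[OF u x M \<open>0 \<le> M\<close>])
  finally show ?thesis .
qed

text \<open>Older coordinates are earlier values of the last one, so every round of \<open>p\<close>
  steps replaces the whole block and gains one factor \<open>\<rho>\<close>, while the additive
  level stays at the fixed point \<open>\<kappa>\<^sub>0\<close>.\<close>

lemma Qop_pow_coord:
  assumes x: "x \<in> space E"
  shows "n \<ge> j * p \<Longrightarrow> i \<in> {1..p} \<Longrightarrow> (Qop u ^^ n) (coord i) x \<le> \<rho> ^ j * V d\<^sub>0 x + \<kappa>\<^sub>0"
proof (induction j arbitrary: n i)
  case 0
  have "i \<in> {1..p} \<Longrightarrow> (Qop u ^^ n) (coord i) x \<le> V d\<^sub>0 x + \<kappa>\<^sub>0" for i n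
  proof (induction n arbitrary: i)
    case 0
    then show ?case using coord_le[of i x] \<kappa>\<^sub>0(1) by simp
  next
    case (Suc n)
    show ?case
    proof (cases "i = p")
      case True
      have "(Qop u ^^ Suc n) (coord p) x \<le> \<rho> * (V d\<^sub>0 x + \<kappa>\<^sub>0) + \<alpha>\<^sub>0"
        using \<kappa>\<^sub>0(1) by (intro Qop_pow_coord_Suc Suc.IH x) auto
      also have "\<dots> = \<rho> * V d\<^sub>0 x + \<kappa>\<^sub>0" using \<kappa>\<^sub>0(2) by (simp add: algebra_simps)
      also have "\<dots> \<le> V d\<^sub>0 x + \<kappa>\<^sub>0" using \<rho>(1,2) by (simp add: mult_left_le_one_le)
      finally show ?thesis using True by simp
    next
      case False
      then have i: "i < p" "Suc i \<in> {1..p}" using Suc.prems by auto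
      have "(Qop u ^^ Suc n) (coord i) x = (Qop u ^^ n) (Qop u (coord i)) x" by (simp only: funpow_Suc_right o_apply)
      also have "\<dots> = (Qop u ^^ n) (coord (Suc i)) x"
        by (rule cont_functional_cong[OF Qop_pow_cont[OF d0_nonneg(1,2) x] step_0_wbound[OF shift_system u d0_nonneg(1,2) zero_le_one coord_wbound]])
          (use Suc.prems i Qop_coord_less in auto)
      finally show ?thesis using Suc.IH[OF i(2)] by simp
    qed
  qed
  then show ?case using 0 by simp
next
  case (Suc j)
  have step: "(Qop u ^^ n) (coord p) x \<le> \<rho> ^ Suc j * V d\<^sub>0 x + \<kappa>\<^sub>0" if n: "j * p < n" for n
  proof -
    obtain n' where n': "n = Suc n'" "j * p \<le> n'" using n by (cases n) auto
    have "(Qop u ^^ n) (coord p) x \<le> \<rho> * (\<rho> ^ j * V d\<^sub>0 x + \<kappa>\<^sub>0) + \<alpha>\<^sub>0"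
      unfolding n'(1) using \<kappa>\<^sub>0(1) \<rho>(1) n'(2) by (intro Qop_pow_coord_Suc Suc.IH x) auto
    then show ?thesis using \<kappa>\<^sub>0(2) by (simp add: algebra_simps)
  qed
  have *: "i \<in> {1..p} \<Longrightarrow> i + r = p \<Longrightarrow> (Qop u ^^ (n + r)) (coord i) x = (Qop u ^^ n) (coord p) x" for i r n
  proof (induction r arbitrary: i)
    case (Suc r)
    have "(Qop u ^^ (n + Suc r)) (coord i) x = (Qop u ^^ (n + r)) (Qop u (coord i)) x"
      by (simp only: add_Suc_right funpow_Suc_right o_apply)
    also have "\<dots> = (Qop u ^^ (n + r)) (coord (Suc i)) x"
      by (rule cont_functional_cong[OF Qop_pow_cont[OF d0_nonneg(1,2) x] step_0_wbound[OF shift_system u d0_nonneg(1,2) zero_le_one coord_wbound]])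
        (use Suc.prems Qop_coord_less in auto)
    also have "\<dots> = (Qop u ^^ n) (coord p) x" by (rule Suc.IH) (use Suc.prems in auto)
    finally show ?case .
  qed simp
  have i: "i \<le> p" "1 \<le> i" using Suc.prems(2) by auto
  \<comment> \<open>Tracing coordinate \<open>i\<close> back to the last one uses at most
    \<open>p - 1\<close> steps, so more than \<open>j * p\<close> remain, as the strict inequality
    in \<open>step\<close> requires.\<close>
  have "(p - i) + Suc (j * p) \<le> n" using Suc.prems i by simp
  then have n: "n = (n - (p - i)) + (p - i)" "j * p < n - (p - i)" by auto
  have "(Qop u ^^ n) (coord i) x = (Qop u ^^ (n - (p - i))) (coord p) x"
    by (subst n(1)) (rule *[OF Suc.prems(2)], use i in simp)
  then show ?case using step[OF n(2)] by simp
qed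

text \<open>From exponent \<open>d\<^sub>0\<close> to \<open>d\<close>: the tangent is taken at the
  bound \<open>a\<close> of \<open>Qop_pow_coord\<close>, so its image is at most
  \<open>a powr \<theta>\<close>. The factor \<open>p\<close> comes from replacing the maximum by a
  sum, the factor 2 from \<open>powr_add_le\<close>.\<close>

lemma Qop_pow_V:
  assumes d: "0 < d" "d \<le> d\<^sub>0" and x: "x \<in> space E" and n: "n \<ge> j * p"
  shows "(Qop u ^^ n) (V d) x \<le> 2 * real p * ((\<rho> powr (d / d\<^sub>0)) ^ j * V d x + \<kappa>\<^sub>0 powr (d / d\<^sub>0))"
proof -
  define \<theta> where "\<theta> = d / d\<^sub>0"
  have \<theta>: "0 \<le> \<theta>" "\<theta> \<le> 1" using d by (auto simp: \<theta>_def)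
  have d': "0 \<le> d" using d by simp
  define a where "a = \<rho> ^ j * V d\<^sub>0 x + \<kappa>\<^sub>0"
  have a: "0 < a" unfolding a_def using \<rho>(1) \<kappa>\<^sub>0(1) by (intro add_nonneg_pos) auto
  have phi: "wbound E (V d) 1 (\<lambda>x. \<phi> (x i) powr d)" if "i \<in> {1..p}" for i
  proof (rule wboundI)
    show "(\<lambda>x. \<phi> (x i) powr d) \<in> borel_measurable E"
      by (rule measurable_compose[OF measurable_component_singleton[OF that], where g = "\<lambda>y. \<phi> y powr d"]) auto
    show "\<bar>\<phi> (y i) powr d\<bar> \<le> 1 * V d y" for y
      using phi_le_mx[OF that, of y] d' \<phi>_pos by (auto intro!: powr_mono2 simp: less_imp_le)
  qed
  note c = Qop_pow_cont[OF d' d(2) x, of n] and c0 = Qop_pow_cont[OF d0_nonneg(1,2) x, of n]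
  have each: "(Qop u ^^ n) (\<lambda>x. \<phi> (x i) powr d) x \<le> a powr \<theta>" if i: "i \<in> {1..p}" for i
  proof -
    let ?r = "\<theta> * a powr (\<theta> - 1)" and ?s = "(1 - \<theta>) * a powr \<theta>"
    have w: "wbound E (V d\<^sub>0) 1 (\<lambda>x. \<phi> (x i) powr d)"
      using wbound_mono_weight[OF phi[OF i], of "V d\<^sub>0"] d(2) mx_ge_1 by (simp add: powr_mono)
    have k: "wbound E (V d\<^sub>0) 1 (\<lambda>_. 1)" using wbound_const[of E "V d\<^sub>0" 1] V_ge_1[OF d0_nonneg(1)] by simp
    have "(Qop u ^^ n) (\<lambda>x. \<phi> (x i) powr d) x \<le> (Qop u ^^ n) (\<lambda>x. ?r * coord i x + ?s * 1) x"
    proof (rule Qop_pow_mono[OF d0_nonneg(1,2) w _ wbound_lincomb[OF coord_wbound[OF i] k] _ _ x])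
      fix y
      have "(\<phi> (y i) powr d\<^sub>0) powr \<theta> \<le> ?r * (\<phi> (y i) powr d\<^sub>0) + ?s"
        using a \<theta> \<phi>_pos[THEN order.strict_implies_not_eq] by (intro powr_tangent) auto
      then show "\<phi> (y i) powr d \<le> ?r * coord i y + ?s * 1"
        using d0_nonneg(3) by (simp add: coord_def powr_powr \<theta>_def)
    qed auto
    also have "\<dots> = ?r * (Qop u ^^ n) (coord i) x + ?s"
      using cont_functional_lincomb[OF c0 coord_wbound[OF i] k] Qop_pow_const[OF x] by simp
    also have "\<dots> \<le> ?r * a + ?s"
      using Qop_pow_coord[OF x n i] \<theta> by (intro add_right_mono mult_left_mono) (auto simp: a_def)
    also have "\<dots> = a powr \<theta>"
    proof -
      have "a powr (\<theta> - 1) * a = a powr \<theta>" using a by (simp add: powr_mult_base mult.commute)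
      then show ?thesis by (simp add: algebra_simps)
    qed
    finally show ?thesis .
  qed
  have s: "wbound E (V d) (\<Sum>i=1..p. 1) (\<lambda>x. \<Sum>i=1..p. \<phi> (x i) powr d)
      \<and> (Qop u ^^ n) (\<lambda>x. \<Sum>i=1..p. \<phi> (x i) powr d) x = (\<Sum>i=1..p. (Qop u ^^ n) (\<lambda>x. \<phi> (x i) powr d) x)"
    by (rule cont_functional_sum[OF c]) (use phi in auto)
  have Vw: "wbound E (V d) 1 (V d)" by (intro wboundI) auto
  have "(Qop u ^^ n) (V d) x \<le> (Qop u ^^ n) (\<lambda>x. \<Sum>i=1..p. \<phi> (x i) powr d) x"
    by (rule Qop_pow_mono[OF d' d(2) Vw _ s[THEN conjunct1] _ V_le_sum x]) auto
  also have "\<dots> \<le> (\<Sum>i=1..p. a powr \<theta>)"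
    unfolding s[THEN conjunct2] by (rule sum_mono) (rule each)
  also have "\<dots> = real p * a powr \<theta>" by simp
  also have "\<dots> \<le> real p * (2 * ((\<rho> ^ j * V d\<^sub>0 x) powr \<theta> + \<kappa>\<^sub>0 powr \<theta>))"
    unfolding a_def using \<rho>(1) \<kappa>\<^sub>0(1) \<theta> by (intro mult_left_mono powr_add_le) auto
  also have "(\<rho> ^ j * V d\<^sub>0 x) powr \<theta> = (\<rho> powr \<theta>) ^ j * V d x"
    using \<rho>(1) d0_nonneg(3) mx_pos[of x]
    by (simp add: powr_mult powr_powr \<theta>_def powr_realpow[symmetric] mult.commute)
  finally show ?thesis by (simp add: \<theta>_def mult_ac)
qed

end

text \<open>Enough rounds of \<open>p\<close> steps bring the factor
  \<open>2 * real p * r ^ j\<close> below one half. The bound \<open>p \<le> t\<close> leaves room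
  for the overlap of the blocks in \<open>contraction\<close>.\<close>

lemma drift:
  assumes d: "0 < d" "d \<le> d\<^sub>0"
  obtains t K where "p \<le> t" "0 < K"
    "\<And>u x. u \<in> {0..1} \<Longrightarrow> x \<in> space E \<Longrightarrow> (Qop u ^^ t) (V d) x \<le> V d x / 2 + K"
proof -
  define r where "r = \<rho> powr (d / d\<^sub>0)"
  have d0: "0 < d\<^sub>0" using SCp1_constants(1) by simp
  have r: "0 \<le> r" "r < 1"
    using \<rho>(1,2) d d0 powr_less_mono2[of "d / d\<^sub>0" \<rho> 1] by (auto simp: r_def)
  have "(\<lambda>j. 2 * real p * r ^ j) \<longlonglongrightarrow> 2 * real p * 0"
    using r by (intro tendsto_intros LIMSEQ_realpow_zero) auto
  then have "eventually (\<lambda>j. 2 * real p * r ^ j < 1 / 2) sequentially"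
    by (rule order_tendstoD) simp
  with eventually_ge_at_top[of 1] have "eventually (\<lambda>j. 1 \<le> j \<and> 2 * real p * r ^ j < 1 / 2) sequentially"
    by eventually_elim simp
  then obtain j where j: "1 \<le> j" "2 * real p * r ^ j < 1 / 2"
    by (auto simp: eventually_sequentially)
  show ?thesis
  proof (rule that[of "j * p" "2 * real p * \<kappa>\<^sub>0 powr (d / d\<^sub>0)"])
    show "p \<le> j * p" using j(1) by simp
    show "0 < 2 * real p * \<kappa>\<^sub>0 powr (d / d\<^sub>0)" using p \<kappa>\<^sub>0(1) by simp
    fix u x assume u: "u \<in> {0..1::real}" and x: "x \<in> space E"
    have "(Qop u ^^ (j * p)) (V d) x \<le> 2 * real p * (r ^ j * V d x + \<kappa>\<^sub>0 powr (d / d\<^sub>0))"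
      unfolding r_def by (rule Qop_pow_V[OF u d x]) simp
    also have "\<dots> = (2 * real p * r ^ j) * V d x + 2 * real p * \<kappa>\<^sub>0 powr (d / d\<^sub>0)"
      by (simp add: algebra_simps)
    also have "(2 * real p * r ^ j) * V d x \<le> 1 / 2 * V d x"
      using j(2) by (intro mult_right_mono) auto
    finally show "(Qop u ^^ (j * p)) (V d) x \<le> V d x / 2 + 2 * real p * \<kappa>\<^sub>0 powr (d / d\<^sub>0)" by simp
  qed
qed

end

section \<open>Overlap of two chains and contraction\<close>

context kernel_model
begin

lemma step_integrable_R:
  assumes sys: "step_system N m N' m' \<tau> \<psi>" and z: "z \<in> space N" and u: "u \<in> {0..1}"
    and d: "0 \<le> d" "d \<le> d\<^sub>0" and b: "0 \<le> b" and g: "wbound N' (\<lambda>x. m' x powr d) b g"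
  shows "integrable (R u (\<tau> z)) (\<lambda>y. g (\<psi> z y))"
proof -
  have x: "\<tau> z \<in> space (E_pow p)" by (rule tau_space[OF sys z])
  have [measurable]: "f u (\<tau> z) \<in> borel_measurable \<gamma>" "(\<lambda>y. g (\<psi> z y)) \<in> borel_measurable \<gamma>"
    using f_meas[OF u x] measurable_compose[OF psi_measurable_snd[OF sys z] wboundD(1)[OF g]]
    by (simp_all add: measurable_\<gamma>)
  have "integrable \<gamma> (\<lambda>y. g (\<psi> z y) * df 0 u (\<tau> z) y)"
    by (rule step_integral_bound'(1)[OF sys z g b d(1) df_tau_meas[OF sys z u] mass_0[OF sys z u d]])
      (use mass_bound_pos in simp_all)
  then show ?thesis
    unfolding R_kernel_def using f_nonneg[OF u x] SCp2(2)[OF u x]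
    by (subst integrable_density) (auto simp: mult.commute)
qed

lemma Qop_markov:
  assumes u: "u \<in> {0..1}" and x: "x \<in> space E" and d: "0 \<le> d" "d \<le> d\<^sub>0"
    and b: "0 \<le> b" and g: "wbound E (V d) b g" and nn: "\<And>x. x \<in> space E \<Longrightarrow> 0 \<le> g x"
    and B: "B \<in> sets borel" "\<And>y. y \<in> B \<Longrightarrow> c \<le> g (shift x y)"
  shows "c * measure (R u x) B \<le> Qop u g x"
proof -
  interpret prob_space "R u x" by (rule R_prob[OF u x])
  have [measurable]: "B \<in> sets (R u x)" using B(1) by (simp add: sets_R)
  have "c * measure (R u x) B = (\<integral>y. c * indicator B y \<partial>R u x)" by simp
  also have "\<dots> \<le> (\<integral>y. g (shift x y) \<partial>R u x)"
  proof (rule integral_mono)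
    show "integrable (R u x) (\<lambda>y. c * indicator B y)"
      by (intro integrable_mult_right integrable_real_indicator) (auto simp: less_top[symmetric])
    show "integrable (R u x) (\<lambda>y. g (shift x y))"
      by (rule step_integrable_R[OF shift_system x u d b g])
    show "c * indicator B y \<le> g (shift x y)" for y
      using B(2)[of y] nn[OF shift_space[OF x, of y]] by (auto simp: indicator_def)
  qed
  also have "\<dots> = Qop u g x"
    by (rule Qop_eq[OF u x wboundD(1)[OF g], symmetric])
  finally show ?thesis .
qed

text \<open>Two copies of the chain are driven by the same letters; after \<open>i\<close> such steps their blocks
  agree in the last \<open>i\<close> coordinates.\<close>

lemma overlap:
  assumes d: "0 \<le> d" "d \<le> d\<^sub>0"
  shows "i \<le> p \<Longrightarrow> 0 < r \<Longrightarrow> \<exists>\<eta>>0. \<forall>u\<in>{0..1}. \<forall>x\<in>space E. \<forall>x'\<in>space E.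
    (\<forall>j\<in>{1..p}. i < j \<longrightarrow> x j = x' j) \<longrightarrow> (\<forall>j\<in>{1..p}. coord j x \<le> r \<and> coord j x' \<le> r) \<longrightarrow>
    (\<forall>h h' b s. 0 \<le> b \<longrightarrow> 0 \<le> s \<longrightarrow> wbound E (V d) b h \<longrightarrow> wbound E (V d) b h' \<longrightarrow>
       (\<forall>x\<in>space E. 0 \<le> h x \<and> 0 \<le> h' x \<and> 2 * s \<le> h x + h' x) \<longrightarrow>
       2 * \<eta> * s \<le> (Qop u ^^ i) h x + (Qop u ^^ i) h' x')"
proof (induction i arbitrary: r)
  case 0
  \<comment> \<open>With no step to go the two blocks agree in all coordinates and are extensional,
    hence equal; the claim is then the hypothesis on \<open>h\<close> and \<open>h'\<close>.\<close>
  have "x = x'" if "x \<in> space E" "x' \<in> space E" "\<forall>j\<in>{1..p}. 0 < j \<longrightarrow> x j = x' j" for x x' :: "nat \<Rightarrow> 'e"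
  proof (rule extensionalityI[of _ "{1..p}"])
    show "x \<in> extensional {1..p}" "x' \<in> extensional {1..p}"
      using that by (auto simp: space_PiM PiE_def)
    show "x j = x' j" if "j \<in> {1..p}" for j using that \<open>\<forall>j\<in>{1..p}. 0 < j \<longrightarrow> x j = x' j\<close> by auto
  qed
  then show ?case by (intro exI[of _ 1]) force
next
  case (Suc i)
  obtain \<eta> \<nu> where \<eta>: "0 < \<eta>" and \<nu>: "prob_space \<nu>" "sets \<nu> = sets borel"
    and minor: "\<And>u A x. u \<in> {0..1} \<Longrightarrow> A \<in> sets borel \<Longrightarrow> x \<in> space E \<Longrightarrow>
           (MAX i\<in>{1..p}. \<phi> (x i) powr d\<^sub>0) \<le> r \<Longrightarrow> \<eta> * measure \<nu> A \<le> measure (R u x) A"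
    using SCp1_small[OF Suc.prems(2)] by blast
  interpret \<nu>: prob_space \<nu> by fact
  \<comment> \<open>Letters with bounded \<open>\<phi>\<close>: some \<open>A n\<close> carries more
    than half of \<open>\<nu>\<close>, and \<open>r \<le> real n\<close> keeps the letters already
    present within the same level. So the shifted blocks meet the induction hypothesis with
    \<open>real n\<close> in place of \<open>r\<close>.\<close>
  define A where "A n = {y. \<phi> y powr d\<^sub>0 \<le> real n}" for n
  have A: "A n \<in> sets \<nu>" for n
    unfolding A_def \<nu>(2) by measurable
  have "(\<lambda>n. measure \<nu> (A n)) \<longlonglongrightarrow> measure \<nu> (\<Union>n. A n)"
    by (rule \<nu>.finite_Lim_measure_incseq) (use A in \<open>auto simp: incseq_def A_def\<close>)
  also have "(\<Union>n. A n) = space \<nu>"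
    using sets_eq_imp_space_eq[OF \<nu>(2)] real_arch_simple by (auto simp: A_def)
  finally have "(\<lambda>n. measure \<nu> (A n)) \<longlonglongrightarrow> 1" by (simp add: \<nu>.prob_space)
  then have "eventually (\<lambda>n. 1 / 2 < measure \<nu> (A n)) sequentially"
    by (rule order_tendstoD) simp
  moreover
  obtain n0 :: nat where "r \<le> real n0" using real_arch_simple by blast
  have "eventually (\<lambda>n. r \<le> real n) sequentially"
    using eventually_ge_at_top[of n0] by eventually_elim (use \<open>r \<le> real n0\<close> in simp)
  ultimately have "eventually (\<lambda>n. 1 / 2 < measure \<nu> (A n) \<and> r \<le> real n) sequentially"
    by eventually_elim simp
  then obtain n where n: "1 / 2 < measure \<nu> (A n)" "r \<le> real n"
    by (auto simp: eventually_sequentially)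
  have "0 < real n" using Suc.prems(2) n(2) by simp
  from Suc.IH[OF _ this] Suc.prems(1) obtain \<eta>' where \<eta>': "0 < \<eta>'"
    and IH: "\<And>u x x' h h' b s. u \<in> {0..1} \<Longrightarrow> x \<in> space E \<Longrightarrow> x' \<in> space E \<Longrightarrow>
      (\<forall>j\<in>{1..p}. i < j \<longrightarrow> x j = x' j) \<Longrightarrow> (\<forall>j\<in>{1..p}. coord j x \<le> real n \<and> coord j x' \<le> real n) \<Longrightarrow>
      0 \<le> b \<Longrightarrow> 0 \<le> s \<Longrightarrow> wbound E (V d) b h \<Longrightarrow> wbound E (V d) b h' \<Longrightarrow>
      (\<forall>x\<in>space E. 0 \<le> h x \<and> 0 \<le> h' x \<and> 2 * s \<le> h x + h' x) \<Longrightarrow>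
       2 * \<eta>' * s \<le> (Qop u ^^ i) h x + (Qop u ^^ i) h' x'"
    by force
  show ?case
  \<comment> \<open>One factor 1/2 is the mass of \<open>A n\<close>; the other is lost because each
    letter is only known to help one of the two chains.\<close>
  proof (intro exI[of _ "\<eta> * \<eta>' / 4"] conjI ballI allI impI)
    show "0 < \<eta> * \<eta>' / 4" using \<eta> \<eta>' by simp
    fix u x x' h h' b s
    assume u: "u \<in> {0..1::real}" and x: "x \<in> space E" and x': "x' \<in> space E"
      and agree: "\<forall>j\<in>{1..p}. Suc i < j \<longrightarrow> x j = x' j"
      and le: "\<forall>j\<in>{1..p}. coord j x \<le> r \<and> coord j x' \<le> r"
      and b: "0 \<le> b" and s: "0 \<le> s" and h: "wbound E (V d) b h" and h': "wbound E (V d) b h'"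
      and nn: "\<forall>x\<in>space E. 0 \<le> h x \<and> 0 \<le> h' x \<and> 2 * s \<le> h x + h' x"
    define H where "H = (Qop u ^^ i) h"
    define H' where "H' = (Qop u ^^ i) h'"
    let ?b = "(2 * mass_bound) ^ i * b"
    have b': "0 \<le> ?b" using b mass_bound_pos by simp
    have Hw: "wbound E (V d) ?b H" "wbound E (V d) ?b H'"
      unfolding H_def H'_def by (rule Qop_pow_wbound[OF u d _ b], fact)+
    have Hnn: "0 \<le> H x" "0 \<le> H' x" if "x \<in> space E" for x
      unfolding H_def H'_def
      by (rule Qop_pow_nonneg[OF u d h b _ that], use nn in blast, rule Qop_pow_nonneg[OF u d h' b _ that], use nn in blast)
    have sum: "2 * \<eta>' * s \<le> H (shift x y) + H' (shift x' y)" if y: "y \<in> A n" for y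
      unfolding H_def H'_def
    proof (rule IH[OF u shift_space[OF x] shift_space[OF x'] _ _ b s h h' nn])
      show "\<forall>j\<in>{1..p}. i < j \<longrightarrow> shift x y j = shift x' y j"
        using agree by (auto simp: shift_def)
      show "\<forall>j\<in>{1..p}. coord j (shift x y) \<le> real n \<and> coord j (shift x' y) \<le> real n"
      proof
        fix j assume j: "j \<in> {1..p}"
        show "coord j (shift x y) \<le> real n \<and> coord j (shift x' y) \<le> real n"
        proof (cases "j = p")
          case True
          then show ?thesis using y j by (simp add: coord_def shift_def A_def)
        next
          case False
          then have "j + 1 \<in> {1..p}" using j by auto
          then have "coord (j + 1) x \<le> r" "coord (j + 1) x' \<le> r" using le by auto
          then show ?thesis using False j n(2) by (auto simp: coord_def shift_def)
        qed
      qed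
    qed
    \<comment> \<open>For a letter in \<open>A n\<close> the two values add up to at least
      \<open>2 * \<eta>' * s\<close>, so one of them reaches half of this: \<open>B\<close> and
      \<open>B'\<close> cover \<open>A n\<close>. By the minorization each chain draws from its set
      with probability at least \<open>\<eta>\<close> times the mass under
      \<open>\<nu>\<close>.\<close>
    define B where "B = {y \<in> A n. \<eta>' * s \<le> H (shift x y)}"
    define B' where "B' = {y \<in> A n. \<eta>' * s \<le> H' (shift x' y)}"
    have [measurable]: "(\<lambda>y. H (shift x y)) \<in> borel_measurable borel" "(\<lambda>y. H' (shift x' y)) \<in> borel_measurable borel"
      "A n \<in> sets borel"
      using measurable_compose[OF psi_measurable_snd[OF shift_system x] wboundD(1)[OF Hw(1)]]
        measurable_compose[OF psi_measurable_snd[OF shift_system x'] wboundD(1)[OF Hw(2)]] A \<nu>(2) by auto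
    have B: "B \<in> sets borel" "B' \<in> sets borel"
      unfolding B_def B'_def by measurable
    have "A n \<subseteq> B \<union> B'"
      using sum unfolding B_def B'_def by fastforce
    then have "measure \<nu> (A n) \<le> measure \<nu> (B \<union> B')"
      using B \<nu>(2) by (intro \<nu>.finite_measure_mono) auto
    also have "\<dots> \<le> measure \<nu> B + measure \<nu> B'"
      using B \<nu>(2) by (intro measure_Un_le) auto
    finally have half: "1 / 2 \<le> measure \<nu> B + measure \<nu> B'" using n(1) by simp
    have max: "(MAX i\<in>{1..p}. \<phi> (x i) powr d\<^sub>0) \<le> r" "(MAX i\<in>{1..p}. \<phi> (x' i) powr d\<^sub>0) \<le> r"
      using le p by (auto simp: coord_def)
    have "\<eta>' * s * (\<eta> * measure \<nu> B) \<le> \<eta>' * s * measure (R u x) B"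
      using minor[OF u B(1) x max(1)] \<eta>' s by (intro mult_left_mono) auto
    also have "\<dots> \<le> Qop u H x"
      by (rule Qop_markov[OF u x d b' Hw(1) Hnn(1) B(1)]) (auto simp: B_def)
    finally have 1: "\<eta>' * s * (\<eta> * measure \<nu> B) \<le> Qop u H x" .
    have "\<eta>' * s * (\<eta> * measure \<nu> B') \<le> \<eta>' * s * measure (R u x') B'"
      using minor[OF u B(2) x' max(2)] \<eta>' s by (intro mult_left_mono) auto
    also have "\<dots> \<le> Qop u H' x'"
      by (rule Qop_markov[OF u x' d b' Hw(2) Hnn(2) B(2)]) (auto simp: B'_def)
    finally have 2: "\<eta>' * s * (\<eta> * measure \<nu> B') \<le> Qop u H' x'" .
    have "\<eta>' * s * \<eta> * (1 / 2) \<le> \<eta>' * s * \<eta> * (measure \<nu> B + measure \<nu> B')"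
      using half \<eta> \<eta>' s by (intro mult_left_mono) auto
    with 1 2 have "2 * (\<eta> * \<eta>' / 4) * s \<le> Qop u H x + Qop u H' x'"
      by (simp add: algebra_simps)
    then show "2 * (\<eta> * \<eta>' / 4) * s \<le> (Qop u ^^ Suc i) h x + (Qop u ^^ Suc i) h' x'"
      by (simp add: H_def H'_def)
  qed
qed

text \<open>The contraction argument of Hairer and Mattingly, for functions instead of measures.\<close>

lemma contraction:
  assumes d: "0 < d" "d \<le> d\<^sub>0"
  obtains t \<beta> \<kappa> where "p \<le> t" "0 < \<beta>" "0 < \<kappa>" "\<kappa> < 1"
    "\<And>u g a b x y. u \<in> {0..1} \<Longrightarrow> 0 \<le> b \<Longrightarrow> wbound E (V d) b g \<Longrightarrow> 0 \<le> a \<Longrightarrow>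
      (\<And>x y. x \<in> space E \<Longrightarrow> y \<in> space E \<Longrightarrow> \<bar>g x - g y\<bar> \<le> a * (2 + \<beta> * (V d x + V d y))) \<Longrightarrow>
      x \<in> space E \<Longrightarrow> y \<in> space E \<Longrightarrow>
      \<bar>(Qop u ^^ t) g x - (Qop u ^^ t) g y\<bar> \<le> \<kappa> * a * (2 + \<beta> * (V d x + V d y))"
proof -
  have d': "0 \<le> d" using d by simp
  obtain t K where t: "p \<le> t" "0 < K"
    "\<And>u x. u \<in> {0..1} \<Longrightarrow> x \<in> space E \<Longrightarrow> (Qop u ^^ t) (V d) x \<le> V d x / 2 + K"
    using drift[OF d] by blast
  \<comment> \<open>The set where the weight of exponent \<open>d\<close> is at most
    \<open>8 * K\<close>, written in terms of \<open>coord\<close>, which has exponent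
    \<open>d\<^sub>0\<close>.\<close>
  have "0 < (8 * K) powr (d\<^sub>0 / d)" using t(2) by simp
  from overlap[OF d' d(2) order_refl this] obtain \<eta>\<^sub>0 where \<eta>\<^sub>0: "0 < \<eta>\<^sub>0"
    and ov: "\<And>u x x' h h' b s. u \<in> {0..1} \<Longrightarrow> x \<in> space E \<Longrightarrow> x' \<in> space E \<Longrightarrow>
      (\<forall>j\<in>{1..p}. coord j x \<le> (8 * K) powr (d\<^sub>0 / d) \<and> coord j x' \<le> (8 * K) powr (d\<^sub>0 / d)) \<Longrightarrow>
      0 \<le> b \<Longrightarrow> 0 \<le> s \<Longrightarrow> wbound E (V d) b h \<Longrightarrow> wbound E (V d) b h' \<Longrightarrow>
      (\<forall>x\<in>space E. 0 \<le> h x \<and> 0 \<le> h' x \<and> 2 * s \<le> h x + h' x) \<Longrightarrow>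
       2 * \<eta>\<^sub>0 * s \<le> (Qop u ^^ p) h x + (Qop u ^^ p) h' x'"
    by force
  define \<eta> where "\<eta> = min \<eta>\<^sub>0 1"
  have \<eta>: "0 < \<eta>" "\<eta> \<le> 1" "\<eta> \<le> \<eta>\<^sub>0" using \<eta>\<^sub>0 by (auto simp: \<eta>_def)
  \<comment> \<open>\<open>\<beta> * K = \<eta> / 2\<close> makes the drift constants of the two
    points cost exactly \<open>\<eta>\<close>, half of the gain \<open>2 * \<eta>\<close> from the
    overlap.\<close>
  define \<beta> where "\<beta> = \<eta> / (2 * K)"
  have \<beta>: "0 < \<beta>" "\<beta> * K = \<eta> / 2" using \<eta>(1) t(2) by (auto simp: \<beta>_def)
  \<comment> \<open>The rate fits the threshold \<open>8 * K\<close>: beyond it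
    \<open>\<beta> * S \<ge> 4 * \<eta>\<close>, and \<open>\<eta> / 3 + \<eta> \<le> (1 / 2 -
    \<eta> / 6) * (4 * \<eta>)\<close> holds because \<open>\<eta> \<le> 1\<close>.\<close>
  define \<kappa> where "\<kappa> = 1 - \<eta> / 6"
  have one: "wbound E (V d) 1 (\<lambda>_. 1)" using wbound_const[of E "V d" 1] V_ge_1[OF d'] by simp
  have Vw: "wbound E (V d) 1 (V d)" using V_measurable by (intro wboundI) auto
  have half: "(Qop u ^^ t) g x - (Qop u ^^ t) g y \<le> \<kappa> * a * (2 + \<beta> * (V d x + V d y))"
    if u: "u \<in> {0..1}" and b: "0 \<le> b" and g: "wbound E (V d) b g" and a: "0 \<le> a"
      and lip: "\<And>x y. x \<in> space E \<Longrightarrow> y \<in> space E \<Longrightarrow> \<bar>g x - g y\<bar> \<le> a * (2 + \<beta> * (V d x + V d y))"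
      and x: "x \<in> space E" and y: "y \<in> space E" for u g a b x y
  proof -
    \<comment> \<open>A function that is Lipschitz for the distance
      \<open>2 + \<beta> * (V d x + V d y)\<close> is, after subtraction of a constant, bounded by a
      multiple of \<open>1 + \<beta> * V d x\<close>. This is that constant.\<close>
    define c where "c = (SUP x\<in>space E. g x - a * (1 + \<beta> * V d x))"
    have le: "g x - a * (1 + \<beta> * V d x) \<le> g y + a * (1 + \<beta> * V d y)" if "x \<in> space E" "y \<in> space E" for x y
      using lip[OF that] by (simp add: algebra_simps)
    have "g z - a * (1 + \<beta> * V d z) \<le> c" if "z \<in> space E" for z
      unfolding c_def by (rule cSUP_upper[OF that bdd_aboveI2[OF le[OF _ x]]])
    moreover have "c \<le> g z + a * (1 + \<beta> * V d z)" if "z \<in> space E" for z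
      unfolding c_def by (rule cSUP_least) (use x le[OF _ that] in auto)
    ultimately have c: "g z - c \<le> a * (1 + \<beta> * V d z)" "c - g z \<le> a * (1 + \<beta> * V d z)" if "z \<in> space E" for z
      using that by (simp_all add: algebra_simps)
    \<comment> \<open>\<open>?U\<close> is the bound just found for \<open>|g - c|\<close> and
      \<open>?G\<close> is \<open>g - c\<close>, so \<open>?U - ?G\<close> and
      \<open>?U + ?G\<close> are nonnegative. By \<open>eq\<close> below, a lower bound for the
      first at \<open>x\<close> plus the second at \<open>y\<close> is an upper bound for the
      increment of \<open>g\<close> after \<open>t\<close> steps.\<close>
    let ?U = "\<lambda>z. a * 1 + a * \<beta> * V d z" and ?G = "\<lambda>z. 1 * g z + (- c) * 1"
    have U: "wbound E (V d) (\<bar>a\<bar> * 1 + \<bar>a * \<beta>\<bar> * 1) ?U" by (rule wbound_lincomb[OF one Vw])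
    have G: "wbound E (V d) (\<bar>1\<bar> * b + \<bar>- c\<bar> * 1) ?G" by (rule wbound_lincomb[OF g one])
    define b' where "b' = (\<bar>a\<bar> * 1 + \<bar>a * \<beta>\<bar> * 1) + (\<bar>1\<bar> * b + \<bar>- c\<bar> * 1)"
    have b': "0 \<le> b'" using b by (simp add: b'_def)
    have h: "wbound E (V d) b' (\<lambda>z. ?U z - ?G z)" "wbound E (V d) b' (\<lambda>z. ?U z + ?G z)"
      unfolding b'_def by (intro wbound_diff wbound_add U G)+
    have hnn: "0 \<le> ?U z - ?G z" "0 \<le> ?U z + ?G z" "2 * a \<le> (?U z - ?G z) + (?U z + ?G z)" if "z \<in> space E" for z
      using c[OF that] a \<beta>(1) by (auto simp: algebra_simps)
    note cont = Qop_pow_cont[OF u d' d(2)]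
    have PU: "(Qop u ^^ n) ?U z = a + a * \<beta> * (Qop u ^^ n) (V d) z" if "z \<in> space E" for z n
      using cont_functional_lincomb[OF cont[OF that] one Vw] Qop_pow_const[OF u that] by simp
    have PG: "(Qop u ^^ n) ?G z = (Qop u ^^ n) g z - c" if "z \<in> space E" for z n
      using cont_functional_lincomb[OF cont[OF that] g one, of n 1 "- c"] Qop_pow_const[OF u that] by simp
    have eq: "(Qop u ^^ t) (\<lambda>z. ?U z - ?G z) x + (Qop u ^^ t) (\<lambda>z. ?U z + ?G z) y
      = 2 * a + a * \<beta> * ((Qop u ^^ t) (V d) x + (Qop u ^^ t) (V d) y) - ((Qop u ^^ t) g x - (Qop u ^^ t) g y)"
      unfolding cont_functional_diff[OF cont[OF x] U G] cont_functional_add[OF cont[OF y] U G]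
        PU[OF x] PU[OF y] PG[OF x] PG[OF y]
      by (simp add: algebra_simps)
    define S where "S = V d x + V d y"
    have S: "0 \<le> S" by (simp add: S_def)
    have "a * \<beta> * ((Qop u ^^ t) (V d) x + (Qop u ^^ t) (V d) y) \<le> a * \<beta> * (S / 2 + 2 * K)"
    proof (rule mult_left_mono)
      show "(Qop u ^^ t) (V d) x + (Qop u ^^ t) (V d) y \<le> S / 2 + 2 * K"
        using add_mono[OF t(3)[OF u x] t(3)[OF u y]] unfolding S_def
        by (simp only: add_divide_distrib)
    qed (use a \<beta>(1) in simp)
    also have "\<dots> = a * (\<beta> * S / 2 + \<eta>)"
      using \<beta>(2) by (simp add: algebra_simps)
    finally have up: "(Qop u ^^ t) g x - (Qop u ^^ t) g y
        \<le> a * (2 + \<beta> * S / 2 + \<eta>) - ((Qop u ^^ t) (\<lambda>z. ?U z - ?G z) x + (Qop u ^^ t) (\<lambda>z. ?U z + ?G z) y)"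
      unfolding eq by (simp add: algebra_simps)
    have "(Qop u ^^ t) g x - (Qop u ^^ t) g y \<le> a * (\<kappa> * (2 + \<beta> * S))"
    \<comment> \<open>Far out the drift alone contracts and the two nonnegative terms are dropped;
      otherwise both points lie in the small set and the overlap bounds these terms below by
      \<open>2 * \<eta> * a\<close>.\<close>
    proof (cases "8 * K \<le> S")
      case True
      have "0 \<le> (Qop u ^^ t) (\<lambda>z. ?U z - ?G z) x" "0 \<le> (Qop u ^^ t) (\<lambda>z. ?U z + ?G z) y"
        by (rule Qop_pow_nonneg[OF u d' d(2) h(1) b' hnn(1) x], assumption,
            rule Qop_pow_nonneg[OF u d' d(2) h(2) b' hnn(2) y])
      with up have "(Qop u ^^ t) g x - (Qop u ^^ t) g y \<le> a * (2 + \<beta> * S / 2 + \<eta>)" by linarith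
      also have "\<dots> \<le> a * (\<kappa> * (2 + \<beta> * S))"
      proof (rule mult_left_mono[OF _ a])
        have "\<beta> * (8 * K) = 8 * (\<beta> * K)" by simp
        then have "\<beta> * (8 * K) = 4 * \<eta>" using \<beta>(2) by simp
        then have "4 * \<eta> \<le> \<beta> * S" using mult_left_mono[OF True less_imp_le[OF \<beta>(1)]] by (simp only:)
        moreover have "\<eta> / 3 + \<eta> \<le> (1 / 2 - \<eta> / 6) * (4 * \<eta>)"
        proof -
          have "\<eta> * \<eta> \<le> \<eta>" using mult_right_mono[OF \<eta>(2), of \<eta>] \<eta>(1) by simp
          moreover have "(1 / 2 - \<eta> / 6) * (4 * \<eta>) = 2 * \<eta> - 2 / 3 * (\<eta> * \<eta>)"
            by (simp add: algebra_simps)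
          ultimately show ?thesis by linarith
        qed
        moreover have "(1 / 2 - \<eta> / 6) * (4 * \<eta>) \<le> (1 / 2 - \<eta> / 6) * (\<beta> * S)"
          using calculation(1) \<eta>(2) by (intro mult_left_mono) auto
        ultimately show "2 + \<beta> * S / 2 + \<eta> \<le> \<kappa> * (2 + \<beta> * S)"
          by (simp add: \<kappa>_def algebra_simps)
      qed
      finally show ?thesis .
    next
      case False
      have small: "coord j z \<le> (8 * K) powr (d\<^sub>0 / d)" if "z = x \<or> z = y" "j \<in> {1..p}" for z j
      proof -
        have "V d z \<le> S" using that(1) by (auto simp: S_def)
        then have "V d z \<le> 8 * K" using False by simp
        have "coord j z \<le> V d\<^sub>0 z" by (rule coord_le[OF that(2)])
        also have "\<dots> = (V d z) powr (d\<^sub>0 / d)" using d by (simp add: powr_powr)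
        also have "\<dots> \<le> (8 * K) powr (d\<^sub>0 / d)"
          using \<open>V d z \<le> 8 * K\<close> d by (intro powr_mono2) auto
        finally show ?thesis .
      qed
      \<comment> \<open>The chains first make the \<open>p\<close> steps of the overlap; the other
        \<open>t - p\<close> steps are put into the test functions, whose sum stays at least
        \<open>2 * a\<close>.\<close>
      have split: "(Qop u ^^ t) k z = (Qop u ^^ p) ((Qop u ^^ (t - p)) k) z" for k z
        using funpow_add[of p "t - p" "Qop u"] t(1) by simp
      let ?b = "(2 * mass_bound) ^ (t - p) * b'"
      have bb: "0 \<le> ?b" using b' mass_bound_pos by simp
      have "2 * \<eta>\<^sub>0 * a \<le> (Qop u ^^ t) (\<lambda>z. ?U z - ?G z) x + (Qop u ^^ t) (\<lambda>z. ?U z + ?G z) y"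
        unfolding split
      proof (rule ov[OF u x y _ bb a Qop_pow_wbound[OF u d' d(2) h(1) b'] Qop_pow_wbound[OF u d' d(2) h(2) b']])
        show "\<forall>j\<in>{1..p}. coord j x \<le> (8 * K) powr (d\<^sub>0 / d) \<and> coord j y \<le> (8 * K) powr (d\<^sub>0 / d)"
          using small by blast
        show "\<forall>z\<in>space E. 0 \<le> (Qop u ^^ (t - p)) (\<lambda>z. ?U z - ?G z) z \<and> 0 \<le> (Qop u ^^ (t - p)) (\<lambda>z. ?U z + ?G z) z \<and>
           2 * a \<le> (Qop u ^^ (t - p)) (\<lambda>z. ?U z - ?G z) z + (Qop u ^^ (t - p)) (\<lambda>z. ?U z + ?G z) z"
        proof (intro ballI conjI)
          fix z assume z: "z \<in> space E"
          show "0 \<le> (Qop u ^^ (t - p)) (\<lambda>z. ?U z - ?G z) z"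
            by (rule Qop_pow_nonneg[OF u d' d(2) h(1) b' hnn(1) z])
          show "0 \<le> (Qop u ^^ (t - p)) (\<lambda>z. ?U z + ?G z) z"
            by (rule Qop_pow_nonneg[OF u d' d(2) h(2) b' hnn(2) z])
          have nn: "0 \<le> (Qop u ^^ (t - p)) (V d) z"
            by (rule Qop_pow_nonneg[OF u d' d(2) Vw _ _ z]) auto
          have "(Qop u ^^ (t - p)) (\<lambda>z. ?U z - ?G z) z + (Qop u ^^ (t - p)) (\<lambda>z. ?U z + ?G z) z
              = 2 * a + 2 * (a * \<beta> * (Qop u ^^ (t - p)) (V d) z)"
            unfolding cont_functional_diff[OF cont[OF z] U G] cont_functional_add[OF cont[OF z] U G] PU[OF z] by simp
          moreover have "0 \<le> a * \<beta> * (Qop u ^^ (t - p)) (V d) z"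
            using nn a \<beta>(1) by simp
          ultimately show "2 * a \<le> (Qop u ^^ (t - p)) (\<lambda>z. ?U z - ?G z) z + (Qop u ^^ (t - p)) (\<lambda>z. ?U z + ?G z) z"
            by linarith
        qed
      qed
      moreover have "2 * \<eta> * a \<le> 2 * \<eta>\<^sub>0 * a" using \<eta>(3) a by (intro mult_right_mono) auto
      ultimately have "(Qop u ^^ t) g x - (Qop u ^^ t) g y \<le> a * (2 + \<beta> * S / 2 + \<eta>) - 2 * \<eta> * a"
        using up by linarith
      also have "\<dots> = a * (2 + \<beta> * S / 2 - \<eta>)" by (simp add: algebra_simps)
      also have "\<dots> \<le> a * (\<kappa> * (2 + \<beta> * S))"
      proof (rule mult_left_mono[OF _ a])
        have "0 \<le> (1 / 2 - \<eta> / 6) * (\<beta> * S)"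
          using \<eta>(2) \<beta>(1) S by (intro mult_nonneg_nonneg) auto
        then show "2 + \<beta> * S / 2 - \<eta> \<le> \<kappa> * (2 + \<beta> * S)"
          using \<eta>(1) by (simp add: \<kappa>_def algebra_simps)
      qed
      finally show ?thesis .
    qed
    then show ?thesis by (simp add: S_def mult_ac)
  qed
  show ?thesis
  proof (rule that[OF t(1) \<beta>(1)])
    show "0 < \<kappa>" "\<kappa> < 1" using \<eta> by (auto simp: \<kappa>_def)
    fix u g a b x y
    assume *: "u \<in> {0..1::real}" "0 \<le> b" "wbound E (V d) b g" "0 \<le> a"
      "\<And>x y. x \<in> space E \<Longrightarrow> y \<in> space E \<Longrightarrow> \<bar>g x - g y\<bar> \<le> a * (2 + \<beta> * (V d x + V d y))"
      "x \<in> space E" "y \<in> space E"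
    show "\<bar>(Qop u ^^ t) g x - (Qop u ^^ t) g y\<bar> \<le> \<kappa> * a * (2 + \<beta> * (V d x + V d y))"
      using half[OF *] half[OF *(1-5) *(7,6)] by (simp add: abs_le_iff add.commute)
  qed
qed

lemma mass_bound_ge_1: "1 \<le> mass_bound"
  using SCp1_constants(2) SCp3_constants(3) by (simp add: mass_bound_def)

text \<open>Iterate the contraction over rounds of \<open>t\<close> steps; the fewer than
  \<open>t\<close> remaining steps are applied to the function beforehand, at the cost of the factor
  \<open>K\<close>.\<close>

lemma geometric_forgetting:
  assumes d: "0 < d" "d \<le> d\<^sub>0"
  obtains L \<kappa> where "0 \<le> L" "0 < \<kappa>" "\<kappa> < 1"
    "\<And>u g b n x y. u \<in> {0..1} \<Longrightarrow> 0 \<le> b \<Longrightarrow> wbound E (V d) b g \<Longrightarrow> x \<in> space E \<Longrightarrow> y \<in> space E \<Longrightarrow>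
      \<bar>(Qop u ^^ n) g x - (Qop u ^^ n) g y\<bar> \<le> L * b * \<kappa> ^ n * (V d x + V d y)"
proof -
  have d': "0 \<le> d" using d by simp
  obtain t \<beta> k where t: "p \<le> t" and \<beta>: "0 < \<beta>" and k: "0 < k" "k < 1"
    and contr: "\<And>u g a b x y. u \<in> {0..1} \<Longrightarrow> 0 \<le> b \<Longrightarrow> wbound E (V d) b g \<Longrightarrow> 0 \<le> a \<Longrightarrow>
      (\<And>x y. x \<in> space E \<Longrightarrow> y \<in> space E \<Longrightarrow> \<bar>g x - g y\<bar> \<le> a * (2 + \<beta> * (V d x + V d y))) \<Longrightarrow>
      x \<in> space E \<Longrightarrow> y \<in> space E \<Longrightarrow>
      \<bar>(Qop u ^^ t) g x - (Qop u ^^ t) g y\<bar> \<le> k * a * (2 + \<beta> * (V d x + V d y))"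
    using contraction[OF d] by blast
  have t0: "0 < t" using t p by simp
  define K where "K = (2 * mass_bound) ^ t"
  have K: "0 \<le> K" using mass_bound_pos by (simp add: K_def)
  define \<kappa> where "\<kappa> = k powr (1 / real t)"
  have \<kappa>: "0 < \<kappa>" "\<kappa> < 1"
    using k t0 powr_less_mono2[of "1 / real t" k 1] by (auto simp: \<kappa>_def)
  \<comment> \<open>\<open>K / \<beta>\<close> is the initial Lipschitz constant for
    \<open>b = 1\<close>, the factor \<open>1 + \<beta>\<close> converts
    \<open>2 + \<beta> * (V d x + V d y)\<close> into a multiple of \<open>V d x + V d y\<close>,
    and the division by \<open>k\<close> pays for rounding \<open>n / t\<close> down.\<close>
  define L where "L = K / \<beta> * (1 + \<beta>) / k"
  have L: "0 \<le> L" using K \<beta> k by (simp add: L_def)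
  have iter: "\<bar>(Qop u ^^ (t * j)) g x - (Qop u ^^ (t * j)) g y\<bar> \<le> k ^ j * a * (2 + \<beta> * (V d x + V d y))"
    if u: "u \<in> {0..1}" and b: "0 \<le> b" and g: "wbound E (V d) b g" and a: "0 \<le> a"
      and lip: "\<And>x y. x \<in> space E \<Longrightarrow> y \<in> space E \<Longrightarrow> \<bar>g x - g y\<bar> \<le> a * (2 + \<beta> * (V d x + V d y))"
      and x: "x \<in> space E" and y: "y \<in> space E" for u g a b x y j
    using x y
  proof (induction j arbitrary: x y)
    case (Suc j)
    have w: "0 \<le> (2 * mass_bound) ^ (t * j) * b" using b mass_bound_pos by simp
    have ka: "0 \<le> k ^ j * a" using k a by simp
    have "\<bar>(Qop u ^^ t) ((Qop u ^^ (t * j)) g) x - (Qop u ^^ t) ((Qop u ^^ (t * j)) g) y\<bar>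
        \<le> k * (k ^ j * a) * (2 + \<beta> * (V d x + V d y))"
      by (rule contr[OF u w Qop_pow_wbound[OF u d' d(2) g b] ka Suc.IH Suc.prems])
    moreover have "t * Suc j = t + t * j" by simp
    ultimately show ?case by (simp only: funpow_add o_apply) (simp add: mult_ac)
  qed (use lip in simp)
  show ?thesis
  proof (rule that[OF L \<kappa>])
    fix u g b n x y
    assume u: "u \<in> {0..1::real}" and b: "0 \<le> b" and g: "wbound E (V d) b g" and x: "x \<in> space E" and y: "y \<in> space E"
    define r where "r = n mod t"
    define j where "j = n div t"
    have n: "n = t * j + r" "r < t" using t0 by (auto simp: r_def j_def)
    have r: "(2 * mass_bound) ^ r * b \<le> K * b"
      unfolding K_def using n(2) mass_bound_ge_1 b by (intro mult_right_mono power_increasing) auto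
    have rb: "0 \<le> (2 * mass_bound) ^ r * b" using b mass_bound_pos by simp
    have gr: "wbound E (V d) (K * b) ((Qop u ^^ r) g)"
      by (rule wbound_mono[OF Qop_pow_wbound[OF u d' d(2) g b] r]) auto
    have a: "0 \<le> K * b / \<beta>" and Kb: "0 \<le> K * b" using K b \<beta> by auto
    have "\<bar>(Qop u ^^ (t * j)) ((Qop u ^^ r) g) x - (Qop u ^^ (t * j)) ((Qop u ^^ r) g) y\<bar>
        \<le> k ^ j * (K * b / \<beta>) * (2 + \<beta> * (V d x + V d y))"
    proof (rule iter[OF u Kb gr a _ x y])
      fix x y assume "x \<in> space E" "y \<in> space E"
      then have "\<bar>(Qop u ^^ r) g x - (Qop u ^^ r) g y\<bar> \<le> K * b * (V d x + V d y)"
        using wboundD(2)[OF gr, of x] wboundD(2)[OF gr, of y] by (simp add: algebra_simps)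
      also have "\<dots> \<le> K * b / \<beta> * (2 + \<beta> * (V d x + V d y))"
        using \<beta> K b by (simp add: distrib_left)
      finally show "\<bar>(Qop u ^^ r) g x - (Qop u ^^ r) g y\<bar> \<le> K * b / \<beta> * (2 + \<beta> * (V d x + V d y))" .
    qed
    also have "\<dots> \<le> k ^ j * (K * b / \<beta>) * ((1 + \<beta>) * (V d x + V d y))"
      using V_ge_1[OF d', of x] V_ge_1[OF d', of y] k K b \<beta> by (intro mult_left_mono) (auto simp: algebra_simps)
    also have "k ^ j * (K * b / \<beta>) * ((1 + \<beta>) * (V d x + V d y)) = L * b * (k * k ^ j) * (V d x + V d y)"
    proof -
      have "K / \<beta> * (1 + \<beta>) = L * k" using k by (simp add: L_def)
      then have "k ^ j * b * (K / \<beta> * (1 + \<beta>)) * (V d x + V d y) = k ^ j * b * (L * k) * (V d x + V d y)" by simp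
      then show ?thesis by (simp add: mult_ac)
    qed
    also have "\<dots> \<le> L * b * \<kappa> ^ n * (V d x + V d y)"
    proof (intro mult_right_mono mult_left_mono)
      have "k * k ^ j = k powr (real (Suc j))" using k by (simp add: powr_realpow del: of_nat_Suc)
      also have "\<dots> \<le> k powr (real n / real t)"
      proof (rule powr_mono')
        have "real n \<le> real t * real (Suc j)" using n by (simp add: algebra_simps flip: of_nat_mult of_nat_add)
        then show "real n / real t \<le> real (Suc j)" using t0 by (simp add: divide_le_eq mult.commute)
      qed (use k in auto)
      also have "\<dots> = \<kappa> ^ n" using k \<kappa>(1) by (simp add: \<kappa>_def powr_powr flip: powr_realpow)
      finally show "k * k ^ j \<le> \<kappa> ^ n" .
    qed (use L b in auto)
    finally show "\<bar>(Qop u ^^ n) g x - (Qop u ^^ n) g y\<bar> \<le> L * b * \<kappa> ^ n * (V d x + V d y)"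
      unfolding n(1) by (simp add: funpow_add)
  qed
qed

end

context
  fixes \<kappa> :: real assumes \<kappa>: "0 < \<kappa>" "\<kappa> < 1"
begin

lemma summable_cmult_power: "summable (\<lambda>n. c * \<kappa> ^ n)"
  using \<kappa> by (intro summable_mult summable_geometric) auto

lemma suminf_cmult_power: "(\<Sum>n. c * \<kappa> ^ n) = c / (1 - \<kappa>)"
  using \<kappa> by (subst suminf_mult[OF summable_geometric]) (auto simp: suminf_geometric)

lemma sum_cmult_power_le: "0 \<le> c \<Longrightarrow> (\<Sum>n<N. c * \<kappa> ^ n) \<le> c / (1 - \<kappa>)"
  using sum_le_suminf[OF summable_cmult_power, of "{..<N}" c] \<kappa> by (simp add: suminf_cmult_power)

end

section \<open>Laws after one step\<close>

context kernel_model
begin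

text \<open>The law of the new state as an image measure, the form to which the bind operation
  applies; integration against it is \<open>step_op\<close> at order 0.\<close>

definition step_kernel :: "'b measure \<Rightarrow> ('a \<Rightarrow> nat \<Rightarrow> 'e) \<Rightarrow> ('a \<Rightarrow> 'e \<Rightarrow> 'b) \<Rightarrow> real \<Rightarrow> 'a \<Rightarrow> 'b measure" where
  "step_kernel N' \<tau> \<psi> u z = distr (R u (\<tau> z)) N' (\<psi> z)"

context
  fixes N :: "'a measure" and m N' and m' :: "'b \<Rightarrow> real" and \<tau> \<psi>
  assumes sys: "step_system N m N' m' \<tau> \<psi>"
begin

lemma step_kernel_measurable:
  assumes u: "u \<in> {0..1}"
  shows "step_kernel N' \<tau> \<psi> u \<in> N \<rightarrow>\<^sub>M prob_algebra N'"
  unfolding step_kernel_def[abs_def]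
  by (rule measurable_distr_prob_space2[OF measurable_compose[OF tau_measurable[OF sys] R_prob_kernel[OF u]] psi_measurable[OF sys]])

lemma psi_measurable_R: "z \<in> space N \<Longrightarrow> \<psi> z \<in> R u x \<rightarrow>\<^sub>M N'"
  using psi_measurable_snd[OF sys, of z] by (simp add: sets_R cong: measurable_cong_sets)

lemma step_kernel_indicator:
  assumes u: "u \<in> {0..1}" and z: "z \<in> space N" and A: "A \<in> sets N'"
  shows "step_op \<tau> \<psi> 0 u (indicator A) z = measure (step_kernel N' \<tau> \<psi> u z) A"
proof -
  interpret prob_space "R u (\<tau> z)" by (rule R_prob[OF u tau_space[OF sys z]])
  have "step_op \<tau> \<psi> 0 u (indicator A) z = (\<integral>y. indicator A (\<psi> z y) \<partial>R u (\<tau> z))"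
    by (rule step_0_eq[OF sys z u]) (use A in simp)
  also have "\<dots> = (\<integral>w. indicator A w \<partial>distr (R u (\<tau> z)) N' (\<psi> z))"
    by (rule integral_distr[symmetric, OF psi_measurable_R[OF z]]) (use A in simp)
  also have "\<dots> = measure (distr (R u (\<tau> z)) N' (\<psi> z)) (A \<inter> space (distr (R u (\<tau> z)) N' (\<psi> z)))"
    by simp
  also have "A \<inter> space (distr (R u (\<tau> z)) N' (\<psi> z)) = A"
    using sets.sets_into_space[OF A] by auto
  finally show ?thesis by (simp add: step_kernel_def)
qed

context
  fixes u :: real and \<mu> assumes u: "u \<in> {0..1}" and \<mu>: "prob_space \<mu>" "sets \<mu> = sets N"
begin

lemma step_kernel_measurable_mu: "step_kernel N' \<tau> \<psi> u \<in> \<mu> \<rightarrow>\<^sub>M subprob_algebra N'"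
  using measurable_prob_algebraD[OF step_kernel_measurable[OF u]] \<mu>(2) by (simp cong: measurable_cong_sets)

lemma mu_in_prob_algebra: "\<mu> \<in> space (prob_algebra N)"
  using \<mu> by (simp add: space_prob_algebra)

lemma prob_space_step_bind: "prob_space (\<mu> \<bind> step_kernel N' \<tau> \<psi> u)"
  by (rule prob_space_bind'[OF mu_in_prob_algebra step_kernel_measurable[OF u]])

lemma sets_step_bind: "sets (\<mu> \<bind> step_kernel N' \<tau> \<psi> u) = sets N'"
  by (rule sets_bind'[OF mu_in_prob_algebra step_kernel_measurable[OF u]])

lemma space_mu: "space \<mu> = space N"
  by (rule sets_eq_imp_space_eq[OF \<mu>(2)])

lemma measure_step_bind:
  assumes "A \<in> sets N'"
  shows "measure (\<mu> \<bind> step_kernel N' \<tau> \<psi> u) A = (\<integral>z. step_op \<tau> \<psi> 0 u (indicator A) z \<partial>\<mu>)"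
proof -
  interpret prob_space \<mu> by (rule \<mu>(1))
  have "measure (\<mu> \<bind> step_kernel N' \<tau> \<psi> u) A = (\<integral>z. measure (step_kernel N' \<tau> \<psi> u z) A \<partial>\<mu>)"
    by (rule measure_bind[OF step_kernel_measurable_mu assms])
  also have "\<dots> = (\<integral>z. step_op \<tau> \<psi> 0 u (indicator A) z \<partial>\<mu>)"
    by (rule Bochner_Integration.integral_cong[OF refl]) (simp add: space_mu step_kernel_indicator[OF u _ assms])
  finally show ?thesis .
qed

lemma integrable_step_bind:
  assumes d: "0 \<le> d" "d \<le> d\<^sub>0" and i: "integrable \<mu> (\<lambda>x. m x powr d)"
  shows "integrable (\<mu> \<bind> step_kernel N' \<tau> \<psi> u) (\<lambda>x. m' x powr d)"
proof (rule integrableI_nonneg)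
  have m'[measurable]: "(\<lambda>x. m' x powr d) \<in> borel_measurable N'"
    using m'_measurable[OF sys] by measurable
  then have m'e: "(\<lambda>x. ennreal (m' x powr d)) \<in> borel_measurable N'" by measurable
  show "(\<lambda>x. m' x powr d) \<in> borel_measurable (\<mu> \<bind> step_kernel N' \<tau> \<psi> u)"
    using m' sets_step_bind by (simp cong: measurable_cong_sets)
  have "(\<integral>\<^sup>+x. ennreal (m' x powr d) \<partial>(\<mu> \<bind> step_kernel N' \<tau> \<psi> u))
      = (\<integral>\<^sup>+z. \<integral>\<^sup>+x. ennreal (m' x powr d) \<partial>step_kernel N' \<tau> \<psi> u z \<partial>\<mu>)"
    by (rule nn_integral_bind[OF m'e step_kernel_measurable_mu])
  \<comment> \<open>In \<open>2 + \<alpha>\<^sub>0\<close> the summand 1 accounts for the old weight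
    \<open>m z\<close>, and \<open>1 + \<alpha>\<^sub>0\<close> for the moment of the new
    letter.\<close>
  also have "\<dots> \<le> (\<integral>\<^sup>+z. ennreal (2 + \<alpha>\<^sub>0) * ennreal (m z powr d) \<partial>\<mu>)"
  proof (rule nn_integral_mono)
    fix z assume "z \<in> space \<mu>"
    then have z: "z \<in> space N" by (simp add: space_mu)
    interpret prob_space "R u (\<tau> z)" by (rule R_prob[OF u tau_space[OF sys z]])
    have [measurable]: "\<phi> \<in> borel_measurable (R u (\<tau> z))"
      by (simp add: sets_R cong: measurable_cong_sets)
    have "(\<integral>\<^sup>+x. ennreal (m' x powr d) \<partial>step_kernel N' \<tau> \<psi> u z) = (\<integral>\<^sup>+y. ennreal (m' (\<psi> z y) powr d) \<partial>R u (\<tau> z))"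
      unfolding step_kernel_def by (rule nn_integral_distr[OF psi_measurable_R[OF z]]) (simp add: m'e)
    also have "\<dots> \<le> (\<integral>\<^sup>+y. ennreal (m z powr d) + ennreal (\<phi> y powr d) \<partial>R u (\<tau> z))"
    proof (rule nn_integral_mono)
      fix y
      have w: "wbound N' (\<lambda>x. m' x powr d) 1 (\<lambda>x. m' x powr d)" using m' by (intro wboundI) auto
      show "ennreal (m' (\<psi> z y) powr d) \<le> ennreal (m z powr d) + ennreal (\<phi> y powr d)"
        using step_integrand_bound[OF sys z w _ d(1), of y]
        by (simp add: ennreal_plus[symmetric] ennreal_leI del: ennreal_plus)
    qed
    also have "\<dots> = ennreal (m z powr d) + (\<integral>\<^sup>+y. ennreal (\<phi> y powr d) \<partial>R u (\<tau> z))"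
      by (simp add: nn_integral_add emeasure_space_1)
    also have "\<dots> \<le> ennreal (m z powr d) + ennreal ((1 + \<alpha>\<^sub>0) * m z powr d)"
      by (intro add_left_mono nn_integral_R_powr u tau_space[OF sys z] phi_tau_le[OF sys z] d)
    also have "\<dots> = ennreal (2 + \<alpha>\<^sub>0) * ennreal (m z powr d)"
      using SCp1_constants(2)
      by (simp add: ennreal_plus[symmetric] ennreal_mult[symmetric] algebra_simps del: ennreal_plus)
    finally show "(\<integral>\<^sup>+x. ennreal (m' x powr d) \<partial>step_kernel N' \<tau> \<psi> u z) \<le> ennreal (2 + \<alpha>\<^sub>0) * ennreal (m z powr d)" .
  qed
  also have "\<dots> = ennreal (2 + \<alpha>\<^sub>0) * (\<integral>\<^sup>+z. ennreal (m z powr d) \<partial>\<mu>)"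
    by (rule nn_integral_cmult) (use i in auto)
  also have "\<dots> < \<infinity>"
    using i by (auto simp: integrable_iff_bounded ennreal_mult_less_top)
  finally show "(\<integral>\<^sup>+x. ennreal (m' x powr d) \<partial>(\<mu> \<bind> step_kernel N' \<tau> \<psi> u)) < \<infinity>" .
qed auto

text \<open>Both sides are continuous functionals, so the identity for indicators,
  \<open>measure_step_bind\<close>, extends to all functions within the weight.\<close>

lemma integral_step_bind:
  assumes d: "0 \<le> d" "d \<le> d\<^sub>0" and i: "integrable \<mu> (\<lambda>x. m x powr d)"
    and g: "wbound N' (\<lambda>x. m' x powr d) b g"
  shows "(\<integral>x. g x \<partial>(\<mu> \<bind> step_kernel N' \<tau> \<psi> u)) = (\<integral>z. step_op \<tau> \<psi> 0 u g z \<partial>\<mu>)"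
proof (rule cont_functional_eqI[OF _ _ _ _ g])
  show "cont_functional N' (\<lambda>x. m' x powr d) (\<lambda>g. \<integral>x. g x \<partial>(\<mu> \<bind> step_kernel N' \<tau> \<psi> u))"
    by (rule cont_functional_integral(1)[OF integrable_step_bind[OF d i] sets_step_bind])
  show "cont_functional N' (\<lambda>x. m' x powr d) (\<lambda>g. \<integral>z. step_op \<tau> \<psi> 0 u g z \<partial>\<mu>)"
    by (rule cont_functional_comp[OF cont_functional_integral(1)[OF i \<mu>(2)] step_0_cont_functional[OF sys _ u d]
        step_0_wbound[OF sys u d]]) auto
  show "1 \<le> m' x powr d" if "x \<in> space N'" for x
    using m'_ge_1[OF sys that] d(1) by (simp add: ge_one_powr_ge_zero)
  fix A assume A: "A \<in> sets N'"
  have "A \<inter> space (\<mu> \<bind> step_kernel N' \<tau> \<psi> u) = A"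
    using sets.sets_into_space[OF A] sets_eq_imp_space_eq[OF sets_step_bind] by auto
  then show "(\<integral>x. indicator A x \<partial>(\<mu> \<bind> step_kernel N' \<tau> \<psi> u)) = (\<integral>z. step_op \<tau> \<psi> 0 u (indicator A) z \<partial>\<mu>)"
    using measure_step_bind[OF A] by simp
qed

end

end

text \<open>Compare on rectangles: the point masses of the first \<open>p - 1\<close> coordinates
  contribute indicators, and the preimage of a rectangle under \<open>shift x\<close> is either its
  last side or empty.\<close>

lemma Q_kernel_eq:
  assumes u: "u \<in> {0..1}" and x: "x \<in> space E"
  shows "Q_kernel p R u x = step_kernel E (\<lambda>x. x) shift u x"
  unfolding Q_kernel_def step_kernel_def
proof (rule product_sigma_finite.PiM_eqI[symmetric])
  interpret R: prob_space "R u x" by (rule R_prob[OF u x])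
  let ?M = "\<lambda>i. if i = p then R u x else return borel (x (i + 1))"
  have "prob_space (?M i)" for i
    using R.prob_space_axioms by (simp add: prob_space_return)
  then show "product_sigma_finite ?M"
    by (intro product_sigma_finite.intro) (rule prob_space_imp_sigma_finite)
  have s: "sets (?M i) = sets borel" for i by (simp add: sets_R)
  show "sets (distr (R u x) E (shift x)) = sets (PiM {1..p} ?M)"
    unfolding sets_distr by (rule sets_PiM_cong[OF refl]) (rule s[symmetric])
  fix A assume "\<And>i. i \<in> {1..p} \<Longrightarrow> A i \<in> sets (?M i)"
  then have A: "A i \<in> sets borel" if "i \<in> {1..p}" for i using s that by blast
  have Ap: "A p \<in> sets borel" using A[of p] p by simp
  have PA: "PiE {1..p} A \<in> sets E" by (rule sets_PiM_I_finite) (use A in auto)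
  have "emeasure (distr (R u x) E (shift x)) (PiE {1..p} A) = emeasure (R u x) (shift x -` PiE {1..p} A \<inter> space (R u x))"
    by (rule emeasure_distr[OF psi_measurable_R[OF shift_system x] PA])
  also have "shift x -` PiE {1..p} A \<inter> space (R u x) = (if \<forall>i\<in>{1..p} - {p}. x (i + 1) \<in> A i then A p else {})"
    using p sets_eq_imp_space_eq[OF sets_R[of u x]] by (auto simp: shift_def PiE_iff split: if_splits)
  also have "emeasure (R u x) \<dots> = emeasure (R u x) (A p) * (\<Prod>i\<in>{1..p} - {p}. indicator (A i) (x (i + 1)))"
  proof (cases "\<forall>i\<in>{1..p} - {p}. x (i + 1) \<in> A i")
    case True
    then show ?thesis by simp
  next
    case False
    then obtain i where i: "i \<in> {1..p} - {p}" "x (i + 1) \<notin> A i" by blast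
    have "(\<Prod>i\<in>{1..p} - {p}. indicator (A i) (x (i + 1)) :: ennreal) = 0"
      by (intro prod_zero bexI[OF _ i(1)]) (use i(2) in auto)
    then show ?thesis using False by simp
  qed
  also have "\<dots> = emeasure (?M p) (A p) * (\<Prod>i\<in>{1..p} - {p}. emeasure (?M i) (A i))"
    using A by (intro arg_cong2[of _ _ _ _ "(*)"] prod.cong) auto
  also have "\<dots> = (\<Prod>i\<in>{1..p}. emeasure (?M i) (A i))"
    using p by (subst prod.remove[of "{1..p}" p]) auto
  finally show "emeasure (distr (R u x) E (shift x)) (PiE {1..p} A) = (\<Prod>i\<in>{1..p}. emeasure (?M i) (A i))" .
qed simp

end

section \<open>The stationary laws\<close>

text \<open>The equivalence expresses existence and uniqueness of the invariant law at once;
  uniqueness later identifies the law of the block at time 0.\<close>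

locale stationary_model = kernel_model +
  fixes \<pi> :: "real \<Rightarrow> (nat \<Rightarrow> 'a) measure"
  assumes \<pi>: "\<And>u \<mu>. u \<in> {0..1} \<Longrightarrow> invariant_prob (E_pow p) (Q_kernel p (R_kernel \<gamma> f) u) \<mu> \<longleftrightarrow> \<mu> = \<pi> u"
begin

lemma bind_Q_kernel:
  assumes "u \<in> {0..1}" "sets \<mu> = sets E"
  shows "\<mu> \<bind> Q_kernel p R u = \<mu> \<bind> step_kernel E (\<lambda>x. x) shift u"
  by (rule bind_cong[OF refl]) (simp add: Q_kernel_eq[OF assms(1)] sets_eq_imp_space_eq[OF assms(2)])

context
  fixes u assumes u: "u \<in> {0..1::real}"
begin

lemma pi_prob: "prob_space (\<pi> u)" and pi_sets: "sets (\<pi> u) = sets E"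
  and pi_bind: "\<pi> u \<bind> step_kernel E (\<lambda>x. x) shift u = \<pi> u"
proof -
  have *: "invariant_prob E (Q_kernel p R u) (\<pi> u)" using \<pi>[OF u] by simp
  then show "prob_space (\<pi> u)" and s: "sets (\<pi> u) = sets E" by (auto simp: invariant_prob_def)
  show "\<pi> u \<bind> step_kernel E (\<lambda>x. x) shift u = \<pi> u"
    using * bind_Q_kernel[OF u s] by (simp add: invariant_prob_def)
qed

lemma pi_unique:
  assumes "prob_space \<mu>" "sets \<mu> = sets E" "\<mu> \<bind> step_kernel E (\<lambda>x. x) shift u = \<mu>"
  shows "\<mu> = \<pi> u"
  using \<pi>[OF u, of \<mu>] assms bind_Q_kernel[OF u assms(2)] by (simp add: invariant_prob_def)

lemma pi_space: "space (\<pi> u) = space E"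
  by (rule sets_eq_imp_space_eq[OF pi_sets])

lemma pi_invariant:
  assumes d: "0 \<le> d" "d \<le> d\<^sub>0" and i: "integrable (\<pi> u) (V d)" and g: "wbound E (V d) b g"
  shows "(\<integral>x. Qop u g x \<partial>\<pi> u) = (\<integral>x. g x \<partial>\<pi> u)"
  using integral_step_bind[OF shift_system u pi_prob pi_sets d i g] by (simp add: pi_bind)

lemma pi_invariant_pow:
  assumes d: "0 \<le> d" "d \<le> d\<^sub>0" and i: "integrable (\<pi> u) (V d)" and g: "wbound E (V d) b g" and b: "0 \<le> b"
  shows "(\<integral>x. (Qop u ^^ n) g x \<partial>\<pi> u) = (\<integral>x. g x \<partial>\<pi> u)"
proof (induction n)
  case (Suc n)
  then show ?case using pi_invariant[OF d i Qop_pow_wbound[OF u d g b], of n] by simp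
qed simp

text \<open>No moment of the invariant law is known beforehand, so invariance is applied to a
  bounded truncation. After many steps the drift bounds it by the smaller of \<open>M\<close> and a
  quantity tending to \<open>2 * real p * \<kappa>\<^sub>0\<close>; dominated convergence
  concludes.\<close>

lemma pi_truncated_moment:
  assumes M: "0 \<le> M"
  shows "(\<integral>x. min (V d\<^sub>0 x) M \<partial>\<pi> u) \<le> 2 * real p * \<kappa>\<^sub>0"
proof -
  interpret prob_space "\<pi> u" by (rule pi_prob)
  have d0: "0 < d\<^sub>0" "0 \<le> d\<^sub>0" using SCp1_constants(1) by auto
  let ?h = "\<lambda>x. min (V d\<^sub>0 x) M"
  have hm: "?h \<in> borel_measurable E" using V_measurable by measurable
  \<comment> \<open>With exponent 0 the weight is 1, so the invariance lemma applies to bounded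
    functions.\<close>
  have V0: "V 0 x = 1" for x using mx_pos[of x] by simp
  have h0: "wbound E (V 0) M ?h"
    by (rule wboundI[OF hm]) (use M V0 in \<open>simp add: min_def\<close>)
  have hV: "wbound E (V d\<^sub>0) 1 ?h"
    by (rule wboundI[OF hm]) (use M in \<open>simp add: min_def\<close>)
  have Vw: "wbound E (V d\<^sub>0) 1 (V d\<^sub>0)" using V_measurable by (intro wboundI) auto
  have i0: "integrable (\<pi> u) (V 0)" unfolding V0 by simp
  define B where "B j x = min M (2 * real p * (\<rho> ^ j * V d\<^sub>0 x + \<kappa>\<^sub>0))" for j x
  have Bm: "B j \<in> borel_measurable (\<pi> u)" for j
    unfolding B_def using V_measurable[of "d\<^sub>0"] pi_sets by (simp cong: measurable_cong_sets)
  have le: "(Qop u ^^ (j * p)) ?h x \<le> B j x" if x: "x \<in> space E" for j x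
  proof -
    have "(Qop u ^^ (j * p)) ?h x \<le> (Qop u ^^ (j * p)) (V d\<^sub>0) x"
      by (rule Qop_pow_mono[OF u d0(2) order_refl hV _ Vw _ _ x]) auto
    also have "\<dots> \<le> 2 * real p * ((\<rho> powr (d\<^sub>0 / d\<^sub>0)) ^ j * V d\<^sub>0 x + \<kappa>\<^sub>0 powr (d\<^sub>0 / d\<^sub>0))"
      by (rule Qop_pow_V[OF u d0(1) order_refl x]) simp
    also have "\<dots> = 2 * real p * (\<rho> ^ j * V d\<^sub>0 x + \<kappa>\<^sub>0)"
      using d0(1) \<rho>(1) \<kappa>\<^sub>0(1) by simp
    finally have 1: "(Qop u ^^ (j * p)) ?h x \<le> 2 * real p * (\<rho> ^ j * V d\<^sub>0 x + \<kappa>\<^sub>0)" .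
    have k: "wbound E (V 0) M (\<lambda>_. M)" using wbound_const[of E "V 0" M] M V0 by simp
    have "(Qop u ^^ (j * p)) ?h x \<le> (Qop u ^^ (j * p)) (\<lambda>_. M) x"
      by (rule Qop_pow_mono[OF u order_refl d0(2) h0 M k M _ x]) simp
    then show ?thesis using 1 Qop_pow_const[OF u x, of "j * p" M] by (simp add: B_def)
  qed
  have B0: "0 \<le> B j x" "B j x \<le> M" for j x
    using M \<rho>(1) \<kappa>\<^sub>0(1) by (auto simp: B_def)
  have Bi: "integrable (\<pi> u) (B j)" for j
    by (rule integrable_const_bound[of _ M]) (use B0 Bm in auto)
  have "(\<integral>x. ?h x \<partial>\<pi> u) \<le> (\<integral>x. B j x \<partial>\<pi> u)" for j
  proof -
    have "(\<integral>x. ?h x \<partial>\<pi> u) = (\<integral>x. (Qop u ^^ (j * p)) ?h x \<partial>\<pi> u)"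
      by (rule pi_invariant_pow[OF _ d0(2) i0 h0 M, symmetric]) simp
    also have "\<dots> \<le> (\<integral>x. B j x \<partial>\<pi> u)"
    proof (rule integral_mono[OF _ Bi])
      show "integrable (\<pi> u) ((Qop u ^^ (j * p)) ?h)"
        by (rule cont_functional_integral(2)[OF i0 pi_sets Qop_pow_wbound[OF u _ d0(2) h0 M]]) simp
      show "(Qop u ^^ (j * p)) ?h x \<le> B j x" if "x \<in> space (\<pi> u)" for x
        using le that pi_space by simp
    qed
    finally show ?thesis .
  qed
  moreover have "(\<lambda>j. \<integral>x. B j x \<partial>\<pi> u) \<longlonglongrightarrow> (\<integral>x. min M (2 * real p * \<kappa>\<^sub>0) \<partial>\<pi> u)"
  proof (rule integral_dominated_convergence[where w = "\<lambda>_. M"])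
    show "AE x in \<pi> u. (\<lambda>j. B j x) \<longlonglongrightarrow> min M (2 * real p * \<kappa>\<^sub>0)"
    proof (rule AE_I2)
      fix x
      have "(\<lambda>j. B j x) \<longlonglongrightarrow> min M (2 * real p * (0 * V d\<^sub>0 x + \<kappa>\<^sub>0))"
        unfolding B_def using \<rho>(1,2) by (intro tendsto_intros LIMSEQ_realpow_zero) auto
      then show "(\<lambda>j. B j x) \<longlonglongrightarrow> min M (2 * real p * \<kappa>\<^sub>0)" by simp
    qed
  qed (use B0 Bm in auto)
  ultimately have "(\<integral>x. ?h x \<partial>\<pi> u) \<le> (\<integral>x. min M (2 * real p * \<kappa>\<^sub>0) \<partial>\<pi> u)"
    by (intro LIMSEQ_le_const) auto
  also have "\<dots> = min M (2 * real p * \<kappa>\<^sub>0)" by (simp add: prob_space)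
  finally show ?thesis by simp
qed

lemma pi_moment: "(\<integral>\<^sup>+x. ennreal (V d\<^sub>0 x) \<partial>\<pi> u) \<le> ennreal (2 * real p * \<kappa>\<^sub>0)"
proof -
  interpret prob_space "\<pi> u" by (rule pi_prob)
  have Vm[measurable]: "V d\<^sub>0 \<in> borel_measurable (\<pi> u)"
    using V_measurable[of "d\<^sub>0"] pi_sets by (simp cong: measurable_cong_sets)
  have "(\<integral>\<^sup>+x. ennreal (V d\<^sub>0 x) \<partial>\<pi> u) = (\<integral>\<^sup>+x. (SUP n. ennreal (min (V d\<^sub>0 x) (real n))) \<partial>\<pi> u)"
  proof (rule nn_integral_cong)
    fix x
    obtain n :: nat where n: "V d\<^sub>0 x \<le> real n" using real_arch_simple by blast
    show "ennreal (V d\<^sub>0 x) = (SUP n. ennreal (min (V d\<^sub>0 x) (real n)))"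
    proof (rule antisym)
      show "ennreal (V d\<^sub>0 x) \<le> (SUP n. ennreal (min (V d\<^sub>0 x) (real n)))"
        by (rule SUP_upper2[of n]) (use n in simp_all)
      show "(SUP n. ennreal (min (V d\<^sub>0 x) (real n))) \<le> ennreal (V d\<^sub>0 x)"
        by (rule SUP_least) (simp add: ennreal_leI)
    qed
  qed
  also have "\<dots> = (SUP n. \<integral>\<^sup>+x. ennreal (min (V d\<^sub>0 x) (real n)) \<partial>\<pi> u)"
    by (rule nn_integral_monotone_convergence_SUP)
      (auto simp: incseq_def le_fun_def intro!: ennreal_leI min.mono)
  also have "\<dots> \<le> ennreal (2 * real p * \<kappa>\<^sub>0)"
  proof (rule SUP_least)
    fix n :: nat
    have "integrable (\<pi> u) (\<lambda>x. min (V d\<^sub>0 x) (real n))"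
      by (rule integrable_const_bound[of _ "real n"]) auto
    then have "(\<integral>\<^sup>+x. ennreal (min (V d\<^sub>0 x) (real n)) \<partial>\<pi> u) = ennreal (\<integral>x. min (V d\<^sub>0 x) (real n) \<partial>\<pi> u)"
      by (intro nn_integral_eq_integral) auto
    also have "\<dots> \<le> ennreal (2 * real p * \<kappa>\<^sub>0)"
      by (intro ennreal_leI pi_truncated_moment) simp
    finally show "(\<integral>\<^sup>+x. ennreal (min (V d\<^sub>0 x) (real n)) \<partial>\<pi> u) \<le> ennreal (2 * real p * \<kappa>\<^sub>0)" .
  qed
  finally show ?thesis .
qed

lemma pi_integrable_V0: "integrable (\<pi> u) (V d\<^sub>0)"
proof (rule integrableI_nonneg)
  show "V d\<^sub>0 \<in> borel_measurable (\<pi> u)"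
    using V_measurable[of "d\<^sub>0"] pi_sets by (simp cong: measurable_cong_sets)
  show "(\<integral>\<^sup>+x. ennreal (V d\<^sub>0 x) \<partial>\<pi> u) < \<infinity>"
    by (rule le_less_trans[OF pi_moment]) simp
qed auto

lemma V_mono: "d \<le> d' \<Longrightarrow> V d x \<le> V d' x"
  by (rule powr_mono) (auto simp: mx_ge_1)

lemma pi_integrable:
  assumes d: "d \<le> d\<^sub>0"
  shows "integrable (\<pi> u) (V d)"
proof -
  have "wbound E (V d\<^sub>0) 1 (V d)"
    by (rule wboundI[OF V_measurable]) (simp add: V_mono[OF d])
  then show ?thesis by (rule cont_functional_integral(2)[OF pi_integrable_V0 pi_sets])
qed

lemma pi_V_le:
  assumes d: "d \<le> d\<^sub>0"
  shows "(\<integral>x. V d x \<partial>\<pi> u) \<le> 2 * real p * \<kappa>\<^sub>0"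
proof -
  have "(\<integral>x. V d x \<partial>\<pi> u) \<le> (\<integral>x. V d\<^sub>0 x \<partial>\<pi> u)"
    by (rule integral_mono[OF pi_integrable[OF d] pi_integrable_V0 V_mono[OF d]])
  also have "ennreal \<dots> \<le> ennreal (2 * real p * \<kappa>\<^sub>0)"
    using pi_moment nn_integral_eq_integral[OF pi_integrable_V0] by simp
  then have "(\<integral>x. V d\<^sub>0 x \<partial>\<pi> u) \<le> 2 * real p * \<kappa>\<^sub>0"
    using \<kappa>\<^sub>0(1) by (simp add: ennreal_le_iff)
  finally show ?thesis .
qed

end

section \<open>Geometric ergodicity and the Poisson operator\<close>

text \<open>Integrate \<open>geometric_forgetting\<close> in \<open>y\<close> against the invariant
  law; the moment that this produces is absorbed by \<open>1 \<le> V d x\<close>.\<close>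

lemma geometric_ergodicity:
  assumes d: "0 < d" "d \<le> d\<^sub>0"
  obtains L \<kappa> where "0 \<le> L" "0 < \<kappa>" "\<kappa> < 1"
    "\<And>u g b n x. u \<in> {0..1} \<Longrightarrow> 0 \<le> b \<Longrightarrow> wbound E (V d) b g \<Longrightarrow> x \<in> space E \<Longrightarrow>
      \<bar>(Qop u ^^ n) g x - (\<integral>y. g y \<partial>\<pi> u)\<bar> \<le> L * b * \<kappa> ^ n * V d x"
proof -
  have d': "0 \<le> d" using d by simp
  obtain L \<kappa> where L: "0 \<le> L" and \<kappa>: "0 < \<kappa>" "\<kappa> < 1"
    and forget: "\<And>u g b n x y. u \<in> {0..1} \<Longrightarrow> 0 \<le> b \<Longrightarrow> wbound E (V d) b g \<Longrightarrow> x \<in> space E \<Longrightarrow> y \<in> space E \<Longrightarrow>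
      \<bar>(Qop u ^^ n) g x - (Qop u ^^ n) g y\<bar> \<le> L * b * \<kappa> ^ n * (V d x + V d y)"
    using geometric_forgetting[OF d] by blast
  let ?c = "2 * real p * \<kappa>\<^sub>0"
  have c: "0 \<le> ?c" using \<kappa>\<^sub>0(1) by simp
  show ?thesis
  proof (rule that[OF _ \<kappa>, of "L * (1 + ?c)"])
    show "0 \<le> L * (1 + ?c)" using L c by simp
    fix u g b n x
    assume u: "u \<in> {0..1::real}" and b: "0 \<le> b" and g: "wbound E (V d) b g" and x: "x \<in> space E"
    interpret prob_space "\<pi> u" by (rule pi_prob[OF u])
    note i = pi_integrable[OF u d(2)]
    have ig: "integrable (\<pi> u) ((Qop u ^^ n) g)"
      by (rule cont_functional_integral(2)[OF i pi_sets[OF u] Qop_pow_wbound[OF u d' d(2) g b]])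
    have eq: "(Qop u ^^ n) g x - (\<integral>y. g y \<partial>\<pi> u) = (\<integral>y. (Qop u ^^ n) g x - (Qop u ^^ n) g y \<partial>\<pi> u)"
      using pi_invariant_pow[OF u d' d(2) i g b, of n] ig by (simp add: prob_space)
    have "\<bar>(Qop u ^^ n) g x - (\<integral>y. g y \<partial>\<pi> u)\<bar> \<le> (\<integral>y. \<bar>(Qop u ^^ n) g x - (Qop u ^^ n) g y\<bar> \<partial>\<pi> u)"
      unfolding eq by (rule integral_abs_bound)
    also have "\<dots> \<le> (\<integral>y. L * b * \<kappa> ^ n * (V d x + V d y) \<partial>\<pi> u)"
    proof (rule integral_mono)
      show "integrable (\<pi> u) (\<lambda>y. \<bar>(Qop u ^^ n) g x - (Qop u ^^ n) g y\<bar>)"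
        by (rule integrable_abs[OF Bochner_Integration.integrable_diff[OF integrable_const ig]])
      show "integrable (\<pi> u) (\<lambda>y. L * b * \<kappa> ^ n * (V d x + V d y))"
        by (rule integrable_mult_right[OF Bochner_Integration.integrable_add[OF integrable_const i]])
      show "\<bar>(Qop u ^^ n) g x - (Qop u ^^ n) g y\<bar> \<le> L * b * \<kappa> ^ n * (V d x + V d y)" if "y \<in> space (\<pi> u)" for y
        by (rule forget[OF u b g x]) (use that pi_space[OF u] in simp)
    qed
    also have "\<dots> = L * b * \<kappa> ^ n * (V d x + (\<integral>y. V d y \<partial>\<pi> u))"
      using i by (simp add: prob_space)
    also have "\<dots> \<le> L * b * \<kappa> ^ n * (V d x + ?c * V d x)"
    proof (rule mult_left_mono)
      have "?c * 1 \<le> ?c * V d x" by (rule mult_left_mono[OF V_ge_1[OF d'] c])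
      then show "V d x + (\<integral>y. V d y \<partial>\<pi> u) \<le> V d x + ?c * V d x"
        using pi_V_le[OF u d(2)] by simp
    qed (use L b \<kappa> in simp)
    finally show "\<bar>(Qop u ^^ n) g x - (\<integral>y. g y \<partial>\<pi> u)\<bar> \<le> L * (1 + ?c) * b * \<kappa> ^ n * V d x"
      by (simp add: algebra_simps)
  qed
qed

definition Z :: "real \<Rightarrow> ((nat \<Rightarrow> 'a) \<Rightarrow> real) \<Rightarrow> (nat \<Rightarrow> 'a) \<Rightarrow> real" where
  "Z u g x = (\<Sum>n. (Qop u ^^ n) g x - (\<integral>y. g y \<partial>\<pi> u))"

context
  fixes d assumes d: "0 < d" "d \<le> d\<^sub>0"
begin

lemma Z_geometric:
  "\<exists>L \<kappa>. 0 \<le> L \<and> 0 < \<kappa> \<and> \<kappa> < 1 \<and> (\<forall>u\<in>{0..1}. \<forall>g b. wbound E (V d) b g \<longrightarrow> (\<forall>x\<in>space E. \<forall>n.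
      \<bar>(Qop u ^^ n) g x - (\<integral>y. g y \<partial>\<pi> u)\<bar> \<le> L * \<bar>b\<bar> * V d x * \<kappa> ^ n))"
proof -
  obtain L \<kappa> where L: "0 \<le> L" and \<kappa>: "0 < \<kappa>" "\<kappa> < 1"
    and erg: "\<And>u g b n x. u \<in> {0..1} \<Longrightarrow> 0 \<le> b \<Longrightarrow> wbound E (V d) b g \<Longrightarrow> x \<in> space E \<Longrightarrow>
      \<bar>(Qop u ^^ n) g x - (\<integral>y. g y \<partial>\<pi> u)\<bar> \<le> L * b * \<kappa> ^ n * V d x"
    using geometric_ergodicity[OF d] by blast
  have "\<bar>(Qop u ^^ n) g x - (\<integral>y. g y \<partial>\<pi> u)\<bar> \<le> L * \<bar>b\<bar> * V d x * \<kappa> ^ n"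
    if "u \<in> {0..1}" "wbound E (V d) b g" "x \<in> space E" for u g b n x
    using erg[OF that(1) abs_ge_zero wbound_mono[OF that(2)] that(3), of b n] by (simp add: mult_ac)
  then show ?thesis using L \<kappa> by blast
qed

lemma Z_summable:
  assumes "u \<in> {0..1}" "wbound E (V d) b g" "x \<in> space E"
  shows "summable (\<lambda>n. (Qop u ^^ n) g x - (\<integral>y. g y \<partial>\<pi> u))"
proof -
  obtain L \<kappa> where \<kappa>: "0 < \<kappa>" "\<kappa> < 1"
    and le: "\<And>n. \<bar>(Qop u ^^ n) g x - (\<integral>y. g y \<partial>\<pi> u)\<bar> \<le> L * \<bar>b\<bar> * V d x * \<kappa> ^ n"
    using Z_geometric assms by blast
  have "summable (\<lambda>n. L * \<bar>b\<bar> * V d x * \<kappa> ^ n)" by (rule summable_cmult_power[OF \<kappa>])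
  then show ?thesis
    by (rule summable_comparison_test'[where N = 0]) (use le in simp)
qed

lemma Z_wbound: "\<exists>K\<ge>0. \<forall>u\<in>{0..1}. \<forall>g b. 0 \<le> b \<longrightarrow> wbound E (V d) b g \<longrightarrow> wbound E (V d) (K * b) (Z u g)"
proof -
  have d': "0 \<le> d" using d by simp
  obtain L \<kappa> where L: "0 \<le> L" and \<kappa>: "0 < \<kappa>" "\<kappa> < 1"
    and geo: "\<And>u g b n x. u \<in> {0..1} \<Longrightarrow> wbound E (V d) b g \<Longrightarrow> x \<in> space E \<Longrightarrow>
      \<bar>(Qop u ^^ n) g x - (\<integral>y. g y \<partial>\<pi> u)\<bar> \<le> L * \<bar>b\<bar> * V d x * \<kappa> ^ n"
    using Z_geometric by blast
  note s = summable_cmult_power[OF \<kappa>] and s_eq = suminf_cmult_power[OF \<kappa>] and s_le = sum_cmult_power_le[OF \<kappa>]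
  show ?thesis
  proof (intro exI[of _ "L / (1 - \<kappa>)"] conjI ballI allI impI wboundI)
    show "0 \<le> L / (1 - \<kappa>)" using L \<kappa> by simp
    fix u g b assume u: "u \<in> {0..1::real}" and b: "0 \<le> b" and g: "wbound E (V d) b g"
    have [measurable]: "(Qop u ^^ n) g \<in> borel_measurable E" for n
      by (rule wboundD(1)[OF Qop_pow_wbound[OF u d' d(2) g b]])
    show "Z u g \<in> borel_measurable E" unfolding Z_def[abs_def] by measurable
    fix x assume x: "x \<in> space E"
    have "\<bar>Z u g x\<bar> \<le> (\<Sum>n. L * \<bar>b\<bar> * V d x * \<kappa> ^ n)"
      unfolding Z_def by (subst real_norm_def[symmetric], rule norm_suminf_le[OF _ s]) (simp add: geo[OF u g x])
    then show "\<bar>Z u g x\<bar> \<le> L / (1 - \<kappa>) * b * V d x" using s_eq b by simp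
  qed
qed

lemma Z_cont_functional:
  assumes u: "u \<in> {0..1}" and x: "x \<in> space E"
  shows "cont_functional E (V d) (\<lambda>g. Z u g x)"
  unfolding cont_functional_def
proof (intro conjI allI impI)
  have d': "0 \<le> d" using d by simp
  note Q = Qop_pow_cont[OF u d' d(2) x]
    and P = cont_functional_integral(1)[OF pi_integrable[OF u d(2)] pi_sets[OF u]]
  fix g h a b c c' assume *: "wbound E (V d) c g" "wbound E (V d) c' h"
  have "(\<lambda>n. (Qop u ^^ n) (\<lambda>x. a * g x + b * h x) x - (\<integral>y. a * g y + b * h y \<partial>\<pi> u))
     = (\<lambda>n. a * ((Qop u ^^ n) g x - (\<integral>y. g y \<partial>\<pi> u)) + b * ((Qop u ^^ n) h x - (\<integral>y. h y \<partial>\<pi> u)))"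
    unfolding cont_functional_lincomb[OF Q *] cont_functional_lincomb[OF P *]
    by (simp add: algebra_simps)
  moreover have "(\<lambda>n. a * ((Qop u ^^ n) g x - (\<integral>y. g y \<partial>\<pi> u)) + b * ((Qop u ^^ n) h x - (\<integral>y. h y \<partial>\<pi> u)))
      sums (a * Z u g x + b * Z u h x)"
    unfolding Z_def
    by (intro sums_add sums_mult summable_sums Z_summable[OF u *(1) x] Z_summable[OF u *(2) x])
  ultimately show "Z u (\<lambda>x. a * g x + b * h x) x = a * Z u g x + b * Z u h x"
    unfolding Z_def[of u "\<lambda>x. a * g x + b * h x"] by (simp add: sums_unique[symmetric])
next
  have d': "0 \<le> d" using d by simp
  note Q = Qop_pow_cont[OF u d' d(2) x]
    and P = cont_functional_integral(1)[OF pi_integrable[OF u d(2)] pi_sets[OF u]]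
  obtain L \<kappa> where L: "0 \<le> L" and \<kappa>: "0 < \<kappa>" "\<kappa> < 1"
    and geo: "\<And>u g b n x. u \<in> {0..1} \<Longrightarrow> wbound E (V d) b g \<Longrightarrow> x \<in> space E \<Longrightarrow>
      \<bar>(Qop u ^^ n) g x - (\<integral>y. g y \<partial>\<pi> u)\<bar> \<le> L * \<bar>b\<bar> * V d x * \<kappa> ^ n"
    using Z_geometric by blast
  note s = summable_cmult_power[OF \<kappa>] and s_eq = suminf_cmult_power[OF \<kappa>] and s_le = sum_cmult_power_le[OF \<kappa>]
  fix g G c assume *: "\<forall>n::nat. wbound E (V d) c (g n)" "wbound E (V d) c G" "\<forall>x\<in>space E. (\<lambda>n. g n x) \<longlonglongrightarrow> G x"
  have gn: "wbound E (V d) c (g n)" "y \<in> space E \<Longrightarrow> (\<lambda>n. g n y) \<longlonglongrightarrow> G y" for n y using * by auto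
  show "(\<lambda>n. Z u (g n) x) \<longlonglongrightarrow> Z u G x"
    unfolding Z_def
  \<comment> \<open>Dominated convergence for series: the geometric majorant does not depend on
    \<open>n\<close>.\<close>
  proof (rule tannerys_theorem[THEN conjunct2, THEN conjunct2])
    show "(\<lambda>n. (Qop u ^^ j) (g n) x - (\<integral>y. g n y \<partial>\<pi> u)) \<longlonglongrightarrow> (Qop u ^^ j) G x - (\<integral>y. G y \<partial>\<pi> u)" for j
      by (intro tendsto_diff cont_functional_tendsto[OF Q gn(1) *(2) gn(2)] cont_functional_tendsto[OF P gn(1) *(2) gn(2)])
    show "summable (\<lambda>n. L * \<bar>c\<bar> * V d x * \<kappa> ^ n)" by (rule s)
    show "eventually (\<lambda>(j, n). norm ((Qop u ^^ j) (g n) x - (\<integral>y. g n y \<partial>\<pi> u)) \<le> L * \<bar>c\<bar> * V d x * \<kappa> ^ j) (at_top \<times>\<^sub>F sequentially)"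
      using geo[OF u gn(1) x] by (auto intro!: always_eventually)
  qed simp
qed

text \<open>Applying \<open>Z u\<close> to \<open>Qop u g\<close> removes the first term of the
  series; the centring constant is unchanged by invariance.\<close>

lemma Z_Qop:
  assumes u: "u \<in> {0..1}" and g: "wbound E (V d) b g" and x: "x \<in> space E"
  shows "Z u g x - Z u (Qop u g) x = g x - (\<integral>y. g y \<partial>\<pi> u)"
proof -
  have d': "0 \<le> d" using d by simp
  have "Z u (Qop u g) x = (\<Sum>n. (Qop u ^^ Suc n) g x - (\<integral>y. g y \<partial>\<pi> u))"
    unfolding Z_def pi_invariant[OF u d' d(2) pi_integrable[OF u d(2)] g]
    by (simp only: funpow_Suc_right o_apply)
  also have "\<dots> = Z u g x - (g x - (\<integral>y. g y \<partial>\<pi> u))"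
    unfolding Z_def by (subst suminf_split_head[OF Z_summable[OF u g x]]) simp
  finally show ?thesis by simp
qed

text \<open>Here \<open>Qop u\<close> has to pass through the infinite sum: the partial sums have a
  common geometric majorant, and the functional at \<open>x\<close> is continuous under dominated
  convergence.\<close>

lemma Qop_Z:
  assumes u: "u \<in> {0..1}" and g: "wbound E (V d) b g" and x: "x \<in> space E"
  shows "Z u g x - Qop u (Z u g) x = g x - (\<integral>y. g y \<partial>\<pi> u)"
proof -
  have d': "0 \<le> d" using d by simp
  have gb: "wbound E (V d) \<bar>b\<bar> g" by (rule wbound_mono[OF g]) auto
  obtain L \<kappa> where L: "0 \<le> L" and \<kappa>: "0 < \<kappa>" "\<kappa> < 1"
    and geo: "\<And>u g b n x. u \<in> {0..1} \<Longrightarrow> wbound E (V d) b g \<Longrightarrow> x \<in> space E \<Longrightarrow>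
      \<bar>(Qop u ^^ n) g x - (\<integral>y. g y \<partial>\<pi> u)\<bar> \<le> L * \<bar>b\<bar> * V d x * \<kappa> ^ n"
    using Z_geometric by blast
  note s = summable_cmult_power[OF \<kappa>] and s_eq = suminf_cmult_power[OF \<kappa>] and s_le = sum_cmult_power_le[OF \<kappa>]
  let ?c = "\<integral>y. g y \<partial>\<pi> u"
  define S where "S n = (\<lambda>x. \<Sum>j<n. (Qop u ^^ j) g x - ?c)" for n
  have t: "wbound E (V d) ((2 * mass_bound) ^ j * \<bar>b\<bar> + \<bar>?c\<bar>) (\<lambda>x. (Qop u ^^ j) g x - ?c)" for j
    by (intro wbound_diff Qop_pow_wbound[OF u d' d(2) gb] wbound_const V_ge_1 d') simp
  have Sb: "wbound E (V d) (L / (1 - \<kappa>) * \<bar>b\<bar>) (S n)" for n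
  proof (rule wboundI)
    show "S n \<in> borel_measurable E"
      unfolding S_def by (intro borel_measurable_sum wboundD(1)[OF t])
    fix y assume y: "y \<in> space E"
    have "\<bar>S n y\<bar> \<le> (\<Sum>j<n. L * \<bar>b\<bar> * V d y * \<kappa> ^ j)"
      unfolding S_def by (rule order_trans[OF sum_abs sum_mono]) (rule geo[OF u g y])
    then show "\<bar>S n y\<bar> \<le> L / (1 - \<kappa>) * \<bar>b\<bar> * V d y" using s_le[of "L * \<bar>b\<bar> * V d y" n] L by simp
  qed
  have Zb: "wbound E (V d) (L / (1 - \<kappa>) * \<bar>b\<bar>) (Z u g)"
  proof (rule wboundI)
    obtain K where "\<And>u g b. u \<in> {0..1} \<Longrightarrow> 0 \<le> b \<Longrightarrow> wbound E (V d) b g \<Longrightarrow> wbound E (V d) (K * b) (Z u g)"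
      using Z_wbound by blast
    from this[OF u abs_ge_zero gb] show "Z u g \<in> borel_measurable E" by (rule wboundD(1))
    fix y assume y: "y \<in> space E"
    have "\<bar>Z u g y\<bar> \<le> (\<Sum>n. L * \<bar>b\<bar> * V d y * \<kappa> ^ n)"
      unfolding Z_def by (subst real_norm_def[symmetric], rule norm_suminf_le[OF _ s]) (simp add: geo[OF u g y])
    then show "\<bar>Z u g y\<bar> \<le> L / (1 - \<kappa>) * \<bar>b\<bar> * V d y" using s_eq by simp
  qed
  note cQ = step_0_cont_functional[OF shift_system x u d' d(2)]
  have "(\<lambda>n. Qop u (S n) x) \<longlonglongrightarrow> Qop u (Z u g) x"
  proof (rule cont_functional_tendsto[OF cQ Sb Zb])
    fix y assume y: "y \<in> space E"
    show "(\<lambda>n. S n y) \<longlonglongrightarrow> Z u g y"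
      unfolding S_def Z_def using summable_LIMSEQ[OF Z_summable[OF u g y]] .
  qed
  moreover have "Qop u (S n) x = (\<Sum>j<n. (Qop u ^^ Suc j) g x - ?c)" for n
  proof -
    have "Qop u (S n) x = (\<Sum>j<n. Qop u (\<lambda>x. (Qop u ^^ j) g x - ?c) x)"
      unfolding S_def
      by (rule cont_functional_sum[where g = "\<lambda>j x. (Qop u ^^ j) g x - ?c" and I = "{..<n}",
            OF cQ finite_lessThan t, THEN conjunct2])
    also have "\<dots> = (\<Sum>j<n. (Qop u ^^ Suc j) g x - ?c)"
    proof (rule sum.cong[OF refl])
      fix j
      have c: "wbound E (V d) \<bar>?c\<bar> (\<lambda>_. ?c)" by (intro wbound_const V_ge_1 d')
      show "Qop u (\<lambda>x. (Qop u ^^ j) g x - ?c) x = (Qop u ^^ Suc j) g x - ?c"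
        using cont_functional_diff[OF cQ Qop_pow_wbound[OF u d' d(2) gb abs_ge_zero] c] step_0_one[OF shift_system x u] by simp
    qed
    finally show ?thesis .
  qed
  moreover have "(\<lambda>n. \<Sum>j<n. (Qop u ^^ Suc j) g x - ?c) \<longlonglongrightarrow> (\<Sum>j. (Qop u ^^ Suc j) g x - ?c)"
    using summable_LIMSEQ[OF summable_Suc_iff[THEN iffD2, OF Z_summable[OF u g x]]] .
  ultimately have "Qop u (Z u g) x = (\<Sum>j. (Qop u ^^ Suc j) g x - ?c)"
    by (simp add: LIMSEQ_unique)
  also have "\<dots> = Z u g x - (g x - ?c)"
    unfolding Z_def by (subst suminf_split_head[OF Z_summable[OF u g x]]) simp
  finally show ?thesis by simp
qed

end

lemma ex_nonneg: "0 \<le> ex s"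
  using ex_pos[of s] by simp

text \<open>Connects the kernels with the abstract differentiation argument: the exponents
  \<open>ex s\<close> with \<open>s \<le> k\<close> are positive and at most
  \<open>d\<^sub>0\<close>, the range in which the estimates on \<open>Z\<close> hold.\<close>

sublocale inv: invariant_family k E "\<lambda>s. V (ex s)" "step_op (\<lambda>x. x) shift" "\<lambda>u g. \<integral>x. g x \<partial>\<pi> u" Z
proof (rule invariant_family.intro, goal_cases)
  case 1
  show ?case by (rule smooth_op_step[OF shift_system])
next
  case (2 s x)
  show ?case by (rule V_ge_1[OF ex_nonneg])
next
  case (3 l u x)
  then show ?case by (intro step_deriv_one[OF shift_system])
next
  case (4 s u)
  then show ?case by (intro cont_functional_integral(1) pi_integrable pi_sets ex_le)
next
  case (5 u)
  then show ?case using prob_space.prob_space[OF pi_prob] by simp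
next
  case (6 s u g b)
  show ?case
    by (rule pi_invariant[OF 6(2) ex_nonneg ex_le[OF 6(1)] pi_integrable[OF 6(2) ex_le[OF 6(1)]] 6(3)])
next
  case (7 s u x)
  then show ?case by (intro Z_cont_functional[OF ex_pos ex_le])
next
  case (8 s)
  then show ?case by (rule Z_wbound[OF ex_pos ex_le])
next
  case (9 u x)
  then show ?case
    unfolding Z_def using prob_space.prob_space[OF pi_prob] by (simp add: Qop_pow_const)
next
  case (10 s u g b x)
  show ?case by (rule Qop_Z[OF ex_pos ex_le[OF 10(1)] 10(2,3,4)])
next
  case (11 s u g b x)
  show ?case by (rule Z_Qop[OF ex_pos ex_le[OF 11(1)] 11(2,3,4)])
qed

end

section \<open>Laws of paths\<close>

lemma cont_functional_pullback:
  assumes F: "cont_functional N w F" and \<iota>: "\<iota> \<in> N \<rightarrow>\<^sub>M N'" and w: "\<And>x. x \<in> space N \<Longrightarrow> w' (\<iota> x) = w x"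
  shows "cont_functional N' w' (\<lambda>g. F (\<lambda>x. g (\<iota> x)))"
    and "wbound N' w' c g \<Longrightarrow> wbound N w c (\<lambda>x. g (\<iota> x))"
proof -
  show b: "wbound N w c (\<lambda>x. g (\<iota> x))" if "wbound N' w' c g" for c g
  proof (rule wboundI)
    show "(\<lambda>x. g (\<iota> x)) \<in> borel_measurable N"
      by (rule measurable_compose[OF \<iota> wboundD(1)[OF that]])
    show "\<bar>g (\<iota> x)\<bar> \<le> c * w x" if "x \<in> space N" for x
      using wboundD(2)[OF \<open>wbound N' w' c g\<close> measurable_space[OF \<iota> that]] w[OF that] by simp
  qed
  show "cont_functional N' w' (\<lambda>g. F (\<lambda>x. g (\<iota> x)))"
    unfolding cont_functional_def
  proof (intro conjI allI impI)
    fix g h r s c c' assume "wbound N' w' c g" "wbound N' w' c' h"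
    then show "F (\<lambda>x. r * g (\<iota> x) + s * h (\<iota> x)) = r * F (\<lambda>x. g (\<iota> x)) + s * F (\<lambda>x. h (\<iota> x))"
      by (intro cont_functional_lincomb[OF F] b)
  next
    fix g G c assume *: "\<forall>n::nat. wbound N' w' c (g n)" "wbound N' w' c G" "\<forall>x\<in>space N'. (\<lambda>n. g n x) \<longlonglongrightarrow> G x"
    show "(\<lambda>n. F (\<lambda>x. g n (\<iota> x))) \<longlonglongrightarrow> F (\<lambda>x. G (\<iota> x))"
      by (rule cont_functional_tendsto[OF F b b]) (use * measurable_space[OF \<iota>] in auto)
  qed
qed

text \<open>Used with the embedding \<open>single\<close>, which regards one block as a path of
  length 1.\<close>

lemma smooth_family_pullback:
  assumes F: "smooth_family k N w F" and \<iota>: "\<iota> \<in> N \<rightarrow>\<^sub>M N'" and w: "\<And>s x. x \<in> space N \<Longrightarrow> w' s (\<iota> x) = w s x"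
  shows "smooth_family k N' w' (\<lambda>l u g. F l u (\<lambda>x. g (\<iota> x)))"
  unfolding smooth_family_def
proof (intro conjI allI impI)
  fix l s
  note pb = cont_functional_pullback[where w = "w s" and w' = "w' s", OF _ \<iota> w]
  show "cont_family N' (w' s) (\<lambda>u g. F l u (\<lambda>x. g (\<iota> x)))" if "l + s \<le> k"
  proof -
    have c: "cont_family N (w s) (F l)" using F that by (simp add: smooth_family_def)
    show ?thesis
      unfolding cont_family_def
    proof (intro conjI ballI allI impI)
      fix u :: real assume u: "u \<in> {0..1}"
      show "cont_functional N' (w' s) (\<lambda>g. F l u (\<lambda>x. g (\<iota> x)))"
        by (rule pb(1)[OF cont_familyD(1)[OF c u]])
      fix v g b assume *: "0 \<le> b" "\<forall>n::nat. v n \<in> {0..1}" "v \<longlonglongrightarrow> u" "\<forall>n::nat. wbound N' (w' s) b (g n)"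
      show "(\<lambda>n. F l (v n) (\<lambda>x. g n (\<iota> x)) - F l u (\<lambda>x. g n (\<iota> x))) \<longlonglongrightarrow> 0"
        by (rule cont_familyD(2)[OF c u *(1) _ *(3) pb(2)[OF cont_familyD(1)[OF c u]]]) (use * in auto)
    qed
  qed
  show "deriv_family N' (w' s) (\<lambda>u g. F l u (\<lambda>x. g (\<iota> x))) (\<lambda>u g. F (Suc l) u (\<lambda>x. g (\<iota> x)))" if ls: "l + s < k"
  proof -
    have c: "cont_family N (w s) (F l)" and d: "deriv_family N (w s) (F l) (F (Suc l))"
      using F ls by (auto simp: smooth_family_def)
    show ?thesis
      unfolding deriv_family_def
    proof (intro ballI allI impI)
      fix u v g b assume *: "u \<in> {0..1::real}" "0 \<le> b" "\<forall>n::nat. v n \<in> {0..1} - {u}" "v \<longlonglongrightarrow> u" "\<forall>n::nat. wbound N' (w' s) b (g n)"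
      show "(\<lambda>n. (F l (v n) (\<lambda>x. g n (\<iota> x)) - F l u (\<lambda>x. g n (\<iota> x))) / (v n - u) - F (Suc l) u (\<lambda>x. g n (\<iota> x))) \<longlonglongrightarrow> 0"
        by (rule deriv_familyD[OF d *(1,2) _ *(4) pb(2)[OF cont_familyD(1)[OF c *(1)]]]) (use * in auto)
    qed
  qed
qed

section \<open>From functionals to limits in weighted norm\<close>

text \<open>If the norm did not tend to 0, there would be increments \<open>h n\<close> tending to 0
  and functions \<open>g n\<close> with \<open>G (h n) (g n)\<close> above a fixed \<open>e\<close>;
  the hypothesis on varying sequences excludes this. Here the sequential encoding yields convergence
  in norm.\<close>

lemma tendsto_weighted_norm:
  assumes G: "\<And>h. h \<noteq> 0 \<Longrightarrow> u + h \<in> {0..1} \<Longrightarrow> cont_functional N w (G h)"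
    and w1: "\<And>x. x \<in> space N \<Longrightarrow> 1 \<le> w x" and w_meas: "w \<in> borel_measurable N"
    and W: "\<And>x. x \<in> space N \<Longrightarrow> W x \<le> c * w x" "\<And>x. x \<in> space N \<Longrightarrow> 0 \<le> W x"
    and lim: "\<And>h g. (\<And>n::nat. h n \<noteq> 0) \<Longrightarrow> (\<And>n. u + h n \<in> {0..1}) \<Longrightarrow> h \<longlonglongrightarrow> 0 \<Longrightarrow>
      (\<And>n. wbound N w c (g n)) \<Longrightarrow> (\<lambda>n. G (h n) (g n)) \<longlonglongrightarrow> 0"
  shows "((\<lambda>h. weighted_norm N W (functional_measure N (G h))) \<longlongrightarrow> 0) (increments u)"
proof -
  have ev: "eventually (\<lambda>h. weighted_norm N W (functional_measure N (G h)) \<le> ereal e) (increments u)" if e: "0 < e" for e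
  proof (rule ccontr)
    assume "\<not> ?thesis"
    then have "\<forall>n::nat. \<exists>h. h \<noteq> 0 \<and> u + h \<in> {0..1} \<and> \<bar>h\<bar> < 1 / real (Suc n) \<and>
        \<not> weighted_norm N W (functional_measure N (G h)) \<le> ereal e"
      unfolding eventually_at by (auto simp: dist_real_def) (metis divide_pos_pos of_nat_0_less_iff zero_less_Suc zero_less_one of_nat_Suc)
    then obtain h where h: "\<And>n. h n \<noteq> 0" "\<And>n. u + h n \<in> {0..1}" "\<And>n::nat. \<bar>h n\<bar> < 1 / real (Suc n)"
      "\<And>n. \<not> weighted_norm N W (functional_measure N (G (h n))) \<le> ereal e"
      by metis
    have "\<exists>g. wbound N w c g \<and> e < G (h n) g" for n
    proof (rule ccontr)
      assume "\<nexists>g. wbound N w c g \<and> e < G (h n) g"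
      then have "weighted_norm N W (functional_measure N (G (h n))) \<le> ereal e"
        by (intro weighted_norm_le[OF G[OF h(1,2)] w1 w_meas W(1)]) (auto simp: not_less)
      then show False using h(4) by blast
    qed
    then obtain g where g: "\<And>n. wbound N w c (g n)" "\<And>n. e < G (h n) (g n)" by metis
    have "(\<lambda>n. 1 / real (Suc n)) \<longlonglongrightarrow> 0"
      using LIMSEQ_Suc[OF lim_1_over_n] by simp
    then have "h \<longlonglongrightarrow> 0"
      by (rule Lim_null_comparison[rotated]) (use h(3) in \<open>auto intro!: always_eventually less_imp_le\<close>)
    from lim[OF h(1,2) this g(1)] have "eventually (\<lambda>n. G (h n) (g n) < e) sequentially"
      using e by (rule order_tendstoD(2))
    then show False using g(2) by (auto simp: eventually_sequentially dest: less_asym)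
  qed
  show ?thesis
  proof (rule order_tendstoI)
    fix a :: ereal assume "a < 0"
    then show "eventually (\<lambda>h. a < weighted_norm N W (functional_measure N (G h))) (increments u)"
      by (intro always_eventually allI) (rule less_le_trans[OF _ weighted_norm_nonneg[OF W(2)]])
  next
    fix a :: ereal assume a: "0 < a"
    obtain e where e: "0 < e" "ereal e < a"
      using ereal_dense2[OF a] by (auto simp: zero_ereal_def)
    from ev[OF e(1)] show "eventually (\<lambda>h. weighted_norm N W (functional_measure N (G h)) < a) (increments u)"
      by eventually_elim (use e(2) in \<open>auto intro: le_less_trans\<close>)
  qed
qed

text \<open>Only the weight of index 0 enters, the one on which derivatives of all orders up to
  \<open>k\<close> act.\<close>

lemma smooth_family_Ck_weighted:
  assumes F: "smooth_family k N w F" and w1: "\<And>x. x \<in> space N \<Longrightarrow> 1 \<le> w 0 x" and w_meas: "w 0 \<in> borel_measurable N"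
    and W: "\<And>x. x \<in> space N \<Longrightarrow> W x \<le> c * w 0 x" "\<And>x. x \<in> space N \<Longrightarrow> 0 \<le> W x" and c: "0 \<le> c"
    and m: "\<And>u. u \<in> {0..1} \<Longrightarrow> m u = functional_measure N (F 0 u)"
  shows "Ck_weighted k N W m"
  unfolding Ck_weighted_def
proof (intro exI[of _ "\<lambda>l u. functional_measure N (F l u)"] conjI ballI allI impI)
  have cf: "cont_family N (w 0) (F l)" if "l \<le> k" for l
    using F that by (simp add: smooth_family_def)
  have df: "deriv_family N (w 0) (F l) (F (Suc l))" if "l < k" for l
    using F that by (simp add: smooth_family_def)
  note cont = cont_familyD(1)[OF cf]
  fix u :: real assume u: "u \<in> {0..1}"
  show "functional_measure N (F 0 u) = m u" using m[OF u] by simp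
  show "functional_measure N (F l u) \<in> weighted_measures N W" if "l \<le> k" for l
    by (rule functional_measure_weighted[OF cont[OF that u] w1 w_meas W(1) c])
  show "((\<lambda>h. weighted_norm N W (\<lambda>A. (functional_measure N (F l (u + h)) A - functional_measure N (F l u) A) / h
      - functional_measure N (F (Suc l) u) A)) \<longlongrightarrow> 0) (increments u)" if l: "l < k" for l
  proof -
    have l': "l \<le> k" "Suc l \<le> k" using l by auto
    let ?G = "\<lambda>h g. 1 * (1 / h * F l (u + h) g + (- 1 / h) * F l u g) + (- 1) * F (Suc l) u g"
    have eq: "(\<lambda>A. (functional_measure N (F l (u + h)) A - functional_measure N (F l u) A) / h
      - functional_measure N (F (Suc l) u) A) = functional_measure N (?G h)" for h
      by (auto simp: functional_measure_def diff_divide_distrib)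
    show ?thesis
      unfolding eq
    proof (rule tendsto_weighted_norm[OF _ w1 w_meas W])
      show "cont_functional N (w 0) (?G h)" if "u + h \<in> {0..1}" for h
        by (intro cont_functional_comb cont l' u that)
      fix h g assume *: "\<And>n::nat. h n \<noteq> 0" "\<And>n. u + h n \<in> {0..1}" "h \<longlonglongrightarrow> 0" "\<And>n::nat. wbound N (w 0) c (g n)"
      have "(\<lambda>n. u + h n) \<longlonglongrightarrow> u" using tendsto_add[OF tendsto_const *(3), of u] by simp
      then have "(\<lambda>n. (F l (u + h n) (g n) - F l u (g n)) / (u + h n - u) - F (Suc l) u (g n)) \<longlonglongrightarrow> 0"
        by (intro deriv_familyD[OF df[OF l] u c _ _ *(4)]) (use * in auto)
      then show "(\<lambda>n. ?G (h n) (g n)) \<longlonglongrightarrow> 0"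
        by (simp add: diff_divide_distrib)
    qed
  qed
  show "((\<lambda>h. weighted_norm N W (\<lambda>A. functional_measure N (F k (u + h)) A - functional_measure N (F k u) A)) \<longlongrightarrow> 0) (increments u)"
  proof -
    let ?G = "\<lambda>h g. 1 * F k (u + h) g + (- 1) * F k u g"
    have eq: "(\<lambda>A. functional_measure N (F k (u + h)) A - functional_measure N (F k u) A) = functional_measure N (?G h)" for h
      by (auto simp: functional_measure_def)
    show ?thesis
      unfolding eq
    proof (rule tendsto_weighted_norm[OF _ w1 w_meas W])
      show "cont_functional N (w 0) (?G h)" if "u + h \<in> {0..1}" for h
        by (intro cont_functional_comb cont order_refl u that)
      fix h g assume *: "\<And>n::nat. h n \<noteq> 0" "\<And>n. u + h n \<in> {0..1}" "h \<longlonglongrightarrow> 0" "\<And>n::nat. wbound N (w 0) c (g n)"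
      have "(\<lambda>n. u + h n) \<longlonglongrightarrow> u" using tendsto_add[OF tendsto_const *(3), of u] by simp
      then have "(\<lambda>n. F k (u + h n) (g n) - F k u (g n)) \<longlonglongrightarrow> 0"
        by (intro cont_familyD(2)[OF cf u c _ _ *(4)]) (use * in auto)
      then show "(\<lambda>n. ?G (h n) (g n)) \<longlonglongrightarrow> 0" by simp
    qed
  qed
qed

section \<open>Paths of blocks as states\<close>

context kernel_model
begin

abbreviation EE :: "nat \<Rightarrow> (nat \<Rightarrow> nat \<Rightarrow> 'e) measure" where "EE j \<equiv> E_pow_pow p j"

definition mxs :: "nat \<Rightarrow> (nat \<Rightarrow> nat \<Rightarrow> 'e) \<Rightarrow> real" where
  "mxs j z = Max ((\<lambda>i. mx (z i)) ` {1..j})"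

definition path_step :: "nat \<Rightarrow> (nat \<Rightarrow> nat \<Rightarrow> 'e) \<Rightarrow> 'e \<Rightarrow> nat \<Rightarrow> nat \<Rightarrow> 'e" where
  "path_step j z y = z(Suc j := shift (z j) y)"

definition single :: "(nat \<Rightarrow> 'e) \<Rightarrow> nat \<Rightarrow> nat \<Rightarrow> 'e" where
  "single x = (\<lambda>_. undefined)(1 := x)"

lemma mx_le_mxs: "i \<in> {1..j} \<Longrightarrow> mx (z i) \<le> mxs j z"
  unfolding mxs_def by (rule Max_ge) auto

lemma mxs_le: "1 \<le> j \<Longrightarrow> (\<And>i. i \<in> {1..j} \<Longrightarrow> mx (z i) \<le> c) \<Longrightarrow> mxs j z \<le> c"
  unfolding mxs_def by (subst Max_le_iff) auto

lemma mxs_ge_1: "1 \<le> j \<Longrightarrow> 1 \<le> mxs j z"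
  using mx_le_mxs[of 1 j z] mx_ge_1[of "z 1"] by simp

lemma mxs_measurable: "mxs j \<in> borel_measurable (EE j)"
  unfolding mxs_def[abs_def]
  by (intro borel_measurable_Max finite_atLeastAtMost measurable_compose[OF _ mx_measurable]
      measurable_component_singleton)

lemma mxs_single: "mxs 1 (single x) = mx x"
  by (simp add: mxs_def single_def)

lemma single_measurable: "single \<in> E \<rightarrow>\<^sub>M EE 1"
proof -
  have "(\<lambda>_. \<lambda>_. undefined) \<in> E \<rightarrow>\<^sub>M PiM {} (\<lambda>_. E)" by simp
  from measurable_fun_upd[OF _ this measurable_ident, of "{1}" "1 :: nat"]
  show ?thesis by (simp add: single_def[abs_def])
qed

lemma component_measurable: "1 \<le> j \<Longrightarrow> (\<lambda>z. z j) \<in> EE j \<rightarrow>\<^sub>M E"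
  by (rule measurable_component_singleton) simp

text \<open>Appending a block to a path is again a one-letter step, driven by the last block
  \<open>z j\<close>. So the estimates for one-step operators apply to paths of any length.\<close>

lemma path_step_system:
  assumes j: "1 \<le> j"
  shows "step_system (EE j) (mxs j) (EE (Suc j)) (mxs (Suc j)) (\<lambda>z. z j) (path_step j)"
  unfolding step_system_def
proof (intro conjI ballI allI)
  show c: "(\<lambda>z. z j) \<in> EE j \<rightarrow>\<^sub>M E" by (rule component_measurable[OF j])
  have "(\<lambda>q. (fst q)(Suc j := shift (fst q j) (snd q))) \<in> EE j \<Otimes>\<^sub>M borel \<rightarrow>\<^sub>M EE (Suc j)"
  proof (rule measurable_fun_upd)
    show "{1..Suc j} = {1..j} \<union> {Suc j}" by auto
    show "fst \<in> EE j \<Otimes>\<^sub>M borel \<rightarrow>\<^sub>M EE j" by (rule measurable_fst)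
    have "(\<lambda>q. (fst q j, snd q)) \<in> EE j \<Otimes>\<^sub>M borel \<rightarrow>\<^sub>M E \<Otimes>\<^sub>M borel"
      by (rule measurable_Pair[OF measurable_compose[OF measurable_fst c] measurable_snd])
    from measurable_compose[OF this shift_measurable]
    show "(\<lambda>q. shift (fst q j) (snd q)) \<in> EE j \<Otimes>\<^sub>M borel \<rightarrow>\<^sub>M E" by simp
  qed
  then show "(\<lambda>(z, y). path_step j z y) \<in> EE j \<Otimes>\<^sub>M borel \<rightarrow>\<^sub>M EE (Suc j)"
    by (simp add: path_step_def case_prod_beta')
  show "mxs j \<in> borel_measurable (EE j)" "mxs (Suc j) \<in> borel_measurable (EE (Suc j))"
    by (rule mxs_measurable)+
  show "1 \<le> mxs (Suc j) z" for z by (rule mxs_ge_1) simp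
  show "\<phi> (z j i) \<le> mxs j z" if "i \<in> {1..p}" for z i
    using phi_le_mx[OF that, of "z j"] mx_le_mxs[of j j z] j by simp
  show "mxs (Suc j) (path_step j z y) \<le> max (mxs j z) (\<phi> y)" for z y
  proof (rule mxs_le)
    fix i assume i: "i \<in> {1..Suc j}"
    show "mx (path_step j z y i) \<le> max (mxs j z) (\<phi> y)"
    proof (cases "i = Suc j")
      case True
      then show ?thesis
        using mx_shift_le[of "z j" y] mx_le_mxs[of j j z] j by (auto simp: path_step_def)
    next
      case False
      then show ?thesis using i mx_le_mxs[of i j z] by (auto simp: path_step_def)
    qed
  qed simp
qed

lemma path_law_1:
  assumes "prob_space \<mu>" "sets \<mu> = sets E"
  shows "path_law E \<mu> K 1 = distr \<mu> (EE 1) single"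
proof -
  let ?f = "\<lambda>z. distr \<mu> (EE 1) (\<lambda>y. z(1 := y))"
  have "(\<lambda>q. (fst q)(1 := snd q)) \<in> PiM {} (\<lambda>_. E) \<Otimes>\<^sub>M E \<rightarrow>\<^sub>M EE 1"
    by (rule measurable_fun_upd[OF _ measurable_fst measurable_snd]) simp
  then have m: "(\<lambda>(z, y). z(1 := y)) \<in> PiM {} (\<lambda>_. E) \<Otimes>\<^sub>M E \<rightarrow>\<^sub>M EE 1"
    by (simp add: case_prod_beta')
  have "\<mu> \<in> space (prob_algebra E)" using assms by (simp add: space_prob_algebra)
  then have "(\<lambda>_. \<mu>) \<in> PiM {} (\<lambda>_. E) \<rightarrow>\<^sub>M prob_algebra E" by simp
  from measurable_distr_prob_space2[OF this m]
  have "?f \<in> PiM {} (\<lambda>_. E) \<rightarrow>\<^sub>M subprob_algebra (EE 1)"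
    by (rule measurable_prob_algebraD)
  from bind_return[OF this, of "\<lambda>_. undefined"]
  have "return (PiM {} (\<lambda>_. E)) (\<lambda>_. undefined) \<bind> ?f = distr \<mu> (EE 1) single"
    by (simp add: space_PiM single_def[abs_def])
  then show ?thesis by (simp add: One_nat_def)
qed

lemma path_law_Suc:
  assumes u: "u \<in> {0..1}" and j: "1 \<le> j" and s: "sets (path_law E \<mu> (Q_kernel p R u) j) = sets (EE j)"
  shows "path_law E \<mu> (Q_kernel p R u) (Suc j)
    = path_law E \<mu> (Q_kernel p R u) j \<bind> step_kernel (EE (Suc j)) (\<lambda>z. z j) (path_step j) u"
  unfolding path_law.simps
proof (rule bind_cong[OF refl])
  fix z assume "z \<in> space (path_law E \<mu> (Q_kernel p R u) j)"
  then have z: "z \<in> space (EE j)" using sets_eq_imp_space_eq[OF s] by simp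
  have x: "z j \<in> space E" using measurable_space[OF component_measurable[OF j] z] .
  have m1: "shift (z j) \<in> R u (z j) \<rightarrow>\<^sub>M E" by (rule psi_measurable_R[OF shift_system x])
  have ins: "{1..Suc j} = {1..j} \<union> {Suc j}" by auto
  have m2: "(\<lambda>y. z(Suc j := y)) \<in> E \<rightarrow>\<^sub>M EE (Suc j)"
    using measurable_fun_upd[OF ins measurable_const[OF z] measurable_ident_sets[OF refl]] .
  have "distr (Q_kernel p R u (z j)) (EE (Suc j)) (\<lambda>y. z(Suc j := y)) = step_kernel (EE (Suc j)) (\<lambda>z. z j) (path_step j) u z"
    unfolding Q_kernel_eq[OF u x] unfolding step_kernel_def distr_distr[OF m2 m1]
    by (simp add: o_def path_step_def[abs_def])
  then show "distr (if j = 0 then \<mu> else Q_kernel p R u (z j)) (PiM {1..Suc j} (\<lambda>_. E)) (\<lambda>y. z(Suc j := y))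
      = step_kernel (EE (Suc j)) (\<lambda>z. z j) (path_step j) u z"
    using j by simp
qed

lemma sum_weight_le:
  assumes j: "1 \<le> j"
  shows "sum_weight j (\<lambda>x. \<Sum>i=1..p. \<phi> (x i) powr d\<^sub>1) z \<le> real (j * p) * mxs j z powr ex 0"
proof -
  have "\<phi> (z a i) powr d\<^sub>1 \<le> mxs j z powr d\<^sub>1" if "a \<in> {1..j}" "i \<in> {1..p}" for a i
    using phi_le_mx[OF that(2), of "z a"] mx_le_mxs[OF that(1), of z] \<phi>_pos[of "z a i"] SCp3_constants(1)
    by (intro powr_mono2) auto
  then have "sum_weight j (\<lambda>x. \<Sum>i=1..p. \<phi> (x i) powr d\<^sub>1) z \<le> (\<Sum>a=1..j. \<Sum>i=1..p. mxs j z powr d\<^sub>1)"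
    unfolding sum_weight_def by (intro sum_mono)
  then show ?thesis by (simp add: ex_def mult.assoc)
qed

lemma sum_weight_nonneg: "0 \<le> sum_weight j (\<lambda>x. \<Sum>i=1..p. \<phi> (x i) powr d\<^sub>1) z"
  unfolding sum_weight_def by (intro sum_nonneg) auto

end

section \<open>Derivatives of the stationary path laws\<close>

context stationary_model
begin

text \<open>Index \<open>j\<close> refers to paths of \<open>Suc j\<close> blocks: the derivatives
  of the invariant law give the first block, and each transition enters through one Leibniz
  product.\<close>

fun path_family :: "nat \<Rightarrow> nat \<Rightarrow> real \<Rightarrow> ((nat \<Rightarrow> nat \<Rightarrow> 'a) \<Rightarrow> real) \<Rightarrow> real" where
  "path_family 0 = (\<lambda>l u g. inv.D l u (\<lambda>x. g (single x)))"
| "path_family (Suc j) = leibniz (path_family j) (step_op (\<lambda>z. z (Suc j)) (path_step (Suc j)))"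

abbreviation Vs :: "nat \<Rightarrow> nat \<Rightarrow> (nat \<Rightarrow> nat \<Rightarrow> 'a) \<Rightarrow> real" where
  "Vs j s \<equiv> (\<lambda>z. mxs j z powr ex s)"

abbreviation path_pi :: "nat \<Rightarrow> real \<Rightarrow> (nat \<Rightarrow> nat \<Rightarrow> 'a) measure" where
  "path_pi j u \<equiv> path_law E (\<pi> u) (Q_kernel p R u) j"

lemma smooth_path_family: "smooth_family k (EE (Suc j)) (Vs (Suc j)) (path_family j)"
proof (induction j)
  case 0
  have "smooth_family k (EE 1) (Vs 1) (\<lambda>l u g. inv.D l u (\<lambda>x. g (single x)))"
    by (rule smooth_family_pullback[OF inv.smooth_family_D single_measurable]) (simp add: mxs_single)
  then show ?case by (simp add: One_nat_def)
next
  case (Suc j)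
  have "smooth_family k (EE (Suc (Suc j))) (Vs (Suc (Suc j)))
      (leibniz (path_family j) (step_op (\<lambda>z. z (Suc j)) (path_step (Suc j))))"
    by (rule smooth_family_leibniz[OF Suc smooth_op_step[OF path_step_system]]) auto
  then show ?case by simp
qed

lemma path_pi:
  assumes u: "u \<in> {0..1}"
  shows "prob_space (path_pi (Suc j) u)" "sets (path_pi (Suc j) u) = sets (EE (Suc j))"
    "integrable (path_pi (Suc j) u) (\<lambda>z. mxs (Suc j) z powr d\<^sub>0)"
proof -
  have d0: "0 \<le> d\<^sub>0" using SCp1_constants(1) by simp
  have "prob_space (path_pi (Suc j) u) \<and> sets (path_pi (Suc j) u) = sets (EE (Suc j)) \<and>
    integrable (path_pi (Suc j) u) (\<lambda>z. mxs (Suc j) z powr d\<^sub>0)"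
  proof (induction j)
    case 0
    have 1: "path_pi 1 u = distr (\<pi> u) (EE 1) single"
      by (rule path_law_1[OF pi_prob[OF u] pi_sets[OF u]])
    have m: "single \<in> \<pi> u \<rightarrow>\<^sub>M EE 1"
      using single_measurable pi_sets[OF u] by (simp cong: measurable_cong_sets)
    have w: "(\<lambda>z. mxs 1 z powr d\<^sub>0) \<in> borel_measurable (EE 1)"
      using mxs_measurable by measurable
    have "integrable (distr (\<pi> u) (EE 1) single) (\<lambda>z. mxs 1 z powr d\<^sub>0)"
      using pi_integrable_V0[OF u] by (subst integrable_distr_eq[OF m w]) (simp add: mxs_single)
    then show ?case
      using 1 prob_space.prob_space_distr[OF pi_prob[OF u] m] by (simp add: One_nat_def del: path_law.simps)
  next
    case (Suc j)
    then have IH: "prob_space (path_pi (Suc j) u)" "sets (path_pi (Suc j) u) = sets (EE (Suc j))"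
      "integrable (path_pi (Suc j) u) (\<lambda>z. mxs (Suc j) z powr d\<^sub>0)" by blast+
    have j: "1 \<le> Suc j" by simp
    note sys = path_step_system[OF j]
    show ?case
      unfolding path_law_Suc[OF u j IH(2)]
      using prob_space_step_bind[OF sys u IH(1,2)] sets_step_bind[OF sys u IH(1,2)]
        integrable_step_bind[OF sys u IH(1,2) d0 order_refl IH(3)] by blast
  qed
  then show "prob_space (path_pi (Suc j) u)" "sets (path_pi (Suc j) u) = sets (EE (Suc j))"
    "integrable (path_pi (Suc j) u) (\<lambda>z. mxs (Suc j) z powr d\<^sub>0)" by blast+
qed

lemma mxs_powr_integrable:
  assumes "integrable \<mu> (\<lambda>z. mxs (Suc j) z powr d\<^sub>0)" "sets \<mu> = sets (EE (Suc j))" "d \<le> d\<^sub>0"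
  shows "integrable \<mu> (\<lambda>z. mxs (Suc j) z powr d)"
proof -
  have "wbound (EE (Suc j)) (\<lambda>z. mxs (Suc j) z powr d\<^sub>0) 1 (\<lambda>z. mxs (Suc j) z powr d)"
  proof (rule wboundI)
    show "(\<lambda>z. mxs (Suc j) z powr d) \<in> borel_measurable (EE (Suc j))"
      using mxs_measurable by measurable
    show "\<bar>mxs (Suc j) z powr d\<bar> \<le> 1 * mxs (Suc j) z powr d\<^sub>0" for z
      using mxs_ge_1[of "Suc j" z] assms(3) by (simp add: powr_mono)
  qed
  then show ?thesis by (rule cont_functional_integral(2)[OF assms(1,2)])
qed

lemma path_pi_Suc:
  assumes u: "u \<in> {0..1}" and d: "0 \<le> d" "d \<le> d\<^sub>0" and g: "wbound (EE (Suc (Suc j))) (\<lambda>z. mxs (Suc (Suc j)) z powr d) b g"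
  shows "(\<integral>z. g z \<partial>path_pi (Suc (Suc j)) u)
    = (\<integral>z. step_op (\<lambda>z. z (Suc j)) (path_step (Suc j)) 0 u g z \<partial>path_pi (Suc j) u)"
proof -
  have j: "1 \<le> Suc j" by simp
  show ?thesis
    unfolding path_law_Suc[OF u j path_pi(2)[OF u]]
    by (rule integral_step_bind[OF path_step_system[OF j] u path_pi(1,2)[OF u] d
          mxs_powr_integrable[OF path_pi(3)[OF u] path_pi(2)[OF u] d(2)] g])
qed

lemma path_pi_1:
  fixes g :: "_ \<Rightarrow> real"
  assumes u: "u \<in> {0..1}" and g: "g \<in> borel_measurable (EE 1)"
  shows "(\<integral>z. g z \<partial>path_pi 1 u) = (\<integral>x. g (single x) \<partial>\<pi> u)"
proof -
  have m: "single \<in> \<pi> u \<rightarrow>\<^sub>M EE 1"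
    using single_measurable pi_sets[OF u] by (simp cong: measurable_cong_sets)
  show ?thesis
    unfolding path_law_1[OF pi_prob[OF u] pi_sets[OF u]] by (rule integral_distr[OF m g])
qed

text \<open>At order 0 a Leibniz sum has a single term, the composition, so each level is one more
  integration against a transition.\<close>

lemma path_family_0:
  assumes u: "u \<in> {0..1}"
  shows "0 \<le> b \<Longrightarrow> wbound (EE (Suc j)) (Vs (Suc j) 0) b g \<Longrightarrow> path_family j 0 u g = (\<integral>z. g z \<partial>path_pi (Suc j) u)"
proof (induction j arbitrary: b g)
  case 0
  have g: "g \<in> borel_measurable (EE 1)" using wboundD(1)[OF 0(2)] by (simp add: One_nat_def)
  show ?case
    using path_pi_1[OF u g] by (simp add: One_nat_def del: path_law.simps)
next
  case (Suc j)
  have j: "1 \<le> Suc j" by simp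
  have d: "0 \<le> ex 0" "ex 0 \<le> d\<^sub>0" using ex_nonneg ex_le[of 0] by auto
  have "path_family (Suc j) 0 u g = path_family j 0 u (step_op (\<lambda>z. z (Suc j)) (path_step (Suc j)) 0 u g)"
    by (simp add: leibniz_def)
  also have "\<dots> = (\<integral>z. step_op (\<lambda>z. z (Suc j)) (path_step (Suc j)) 0 u g z \<partial>path_pi (Suc j) u)"
    by (rule Suc.IH[OF _ step_0_wbound[OF path_step_system[OF j] u d Suc.prems]])
      (use mass_bound_pos Suc.prems(1) in simp)
  also have "\<dots> = (\<integral>z. g z \<partial>path_pi (Suc (Suc j)) u)"
    by (rule path_pi_Suc[OF u d Suc.prems(2), symmetric])
  finally show ?case .
qed

theorem path_pi_Ck_weighted:
  "Ck_weighted k (EE (Suc j)) (sum_weight (Suc j) (\<lambda>x. \<Sum>i=1..p. \<phi> (x i) powr d\<^sub>1)) (\<lambda>u. measure (path_pi (Suc j) u))"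
proof (rule smooth_family_Ck_weighted[OF smooth_path_family])
  have j: "1 \<le> Suc j" by simp
  show w1: "1 \<le> Vs (Suc j) 0 z" for z
    using mxs_ge_1[OF j, of z] ex_nonneg by (simp add: ge_one_powr_ge_zero)
  show "Vs (Suc j) 0 \<in> borel_measurable (EE (Suc j))" using mxs_measurable by measurable
  show "sum_weight (Suc j) (\<lambda>x. \<Sum>i=1..p. \<phi> (x i) powr d\<^sub>1) z \<le> real (Suc j * p) * Vs (Suc j) 0 z" for z
    by (rule sum_weight_le[OF j])
  show "0 \<le> sum_weight (Suc j) (\<lambda>x. \<Sum>i=1..p. \<phi> (x i) powr d\<^sub>1) z" for z by (rule sum_weight_nonneg)
  show "0 \<le> real (Suc j * p)" by simp
  fix u :: real assume u: "u \<in> {0..1}"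
  have "functional_measure (EE (Suc j)) (path_family j 0 u) = functional_measure (EE (Suc j)) (\<lambda>g. \<integral>z. g z \<partial>path_pi (Suc j) u)"
    unfolding functional_measure_def
    using path_family_0[OF u zero_le_one wbound_indicator[OF w1]] by auto
  then show "measure (path_pi (Suc j) u) = functional_measure (EE (Suc j)) (path_family j 0 u)"
    using functional_measure_integral[OF path_pi(2)[OF u]] by simp
qed

end

section \<open>Triangular arrays\<close>

lemma abs_integral_le:
  fixes h w :: "'a \<Rightarrow> real"
  assumes "integrable M w" "\<And>x. x \<in> space M \<Longrightarrow> \<bar>h x\<bar> \<le> w x"
  shows "\<bar>\<integral>x. h x \<partial>M\<bar> \<le> (\<integral>x. w x \<partial>M)"
proof -
  have "0 \<le> w x" if "x \<in> space M" for x using assms(2)[OF that] by (meson abs_ge_zero order_trans)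
  then have "(\<integral>x. \<bar>h x\<bar> \<partial>M) \<le> (\<integral>x. w x \<partial>M)" by (intro integral_mono' assms)
  then show ?thesis using integral_abs_bound[of M h] by linarith
qed

text \<open>The series of \<open>real (Suc i) * \<kappa> ^ i\<close> sums to
  \<open>1 / (1 - \<kappa>)\<^sup>2\<close>, and a single term is at most a partial sum containing
  it.\<close>

lemma sum_index_power_le:
  fixes \<kappa> :: real
  assumes "0 < \<kappa>" "\<kappa> < 1"
  shows "(\<Sum>i<n. real i * \<kappa> ^ i) \<le> 1 / (1 - \<kappa>)\<^sup>2" "real n * \<kappa> ^ n \<le> 1 / (1 - \<kappa>)\<^sup>2"
proof -
  have s: "(\<lambda>i. real (Suc i) * \<kappa> ^ i) sums (1 / (1 - \<kappa>)\<^sup>2)"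
    using geometric_deriv_sums[of \<kappa>] assms by simp
  have le: "(\<Sum>i<n. real i * \<kappa> ^ i) \<le> 1 / (1 - \<kappa>)\<^sup>2" for n
  proof -
    have "(\<Sum>i<n. real i * \<kappa> ^ i) \<le> (\<Sum>i<n. real (Suc i) * \<kappa> ^ i)"
      using assms by (intro sum_mono mult_right_mono) auto
    also have "\<dots> \<le> (\<Sum>i. real (Suc i) * \<kappa> ^ i)"
      using assms by (intro sum_le_suminf sums_summable[OF s]) auto
    finally show ?thesis using sums_unique[OF s] by simp
  qed
  show "(\<Sum>i<n. real i * \<kappa> ^ i) \<le> 1 / (1 - \<kappa>)\<^sup>2" by (rule le)
  have "0 \<le> (\<Sum>i<n. real i * \<kappa> ^ i)" using assms by (intro sum_nonneg) auto
  then show "real n * \<kappa> ^ n \<le> 1 / (1 - \<kappa>)\<^sup>2"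
    using le[of "Suc n"] by simp
qed

section \<open>Approximation of the marginal laws of the array\<close>

context stationary_model
begin

text \<open>This is \<open>inv.D_difference\<close> at order 0. The increment of the transition
  operator is bounded by the next weight of the scale, whose moments under the invariant laws are
  bounded uniformly in the parameter.\<close>

lemma pi_lipschitz:
  obtains L where "0 \<le> L" "\<And>u v b g. u \<in> {0..1} \<Longrightarrow> v \<in> {0..1} \<Longrightarrow> 0 \<le> b \<Longrightarrow> wbound E (V (ex 0)) b g \<Longrightarrow>
    \<bar>(\<integral>x. g x \<partial>\<pi> v) - (\<integral>x. g x \<partial>\<pi> u)\<bar> \<le> L * b * \<bar>v - u\<bar>"
proof -
  have k: "1 \<le> k" "0 < k" "0 \<le> k" using SCp2(1) by auto
  obtain K where K: "0 \<le> K" "\<And>u g b. u \<in> {0..1} \<Longrightarrow> 0 \<le> b \<Longrightarrow> wbound E (V (ex 0)) b g \<Longrightarrow> wbound E (V (ex 0)) (K * b) (Z u g)"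
    using Z_wbound[OF ex_pos ex_le[OF k(3)]] by blast
  let ?L = "2 * mass_bound * K * (2 * real p * \<kappa>\<^sub>0)"
  show ?thesis
  proof (rule that[of ?L])
    show "0 \<le> ?L" using K(1) mass_bound_pos \<kappa>\<^sub>0(1) by simp
    fix u v b g assume u: "u \<in> {0..1::real}" and v: "v \<in> {0..1::real}" and b: "0 \<le> b" and g: "wbound E (V (ex 0)) b g"
    have Zb: "wbound E (V (ex 0)) (K * b) (Z v g)" by (rule K(2)[OF v b g])
    have Kb: "0 \<le> K * b" using K(1) b by simp
    let ?h = "\<lambda>x. Qop v (Z v g) x - Qop u (Z v g) x"
    let ?c = "2 * mass_bound * (K * b) * \<bar>v - u\<bar>"
    have ex1: "ex 0 + q = ex 1" by (simp add: ex_def)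
    have le: "\<bar>?h x\<bar> \<le> ?c * V (ex 1) x" if "x \<in> space E" for x
      using step_diff_bound[OF shift_system that u v k(2) ex_nonneg ex_mono Zb Kb] by (simp add: ex1)
    note i = pi_integrable[OF u ex_le[OF k(1)]]
    have eq: "(\<integral>x. g x \<partial>\<pi> v) - (\<integral>x. g x \<partial>\<pi> u) = (\<integral>x. ?h x \<partial>\<pi> u)"
      using inv.D_difference[of 0 0 u v b g] u v b g by (simp add: inv.A_def)
    have "\<bar>(\<integral>x. g x \<partial>\<pi> v) - (\<integral>x. g x \<partial>\<pi> u)\<bar> \<le> (\<integral>x. ?c * V (ex 1) x \<partial>\<pi> u)"
      unfolding eq
    proof (rule abs_integral_le)
      show "integrable (\<pi> u) (\<lambda>x. ?c * V (ex 1) x)" using i by simp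
      show "\<bar>?h x\<bar> \<le> ?c * V (ex 1) x" if "x \<in> space (\<pi> u)" for x
        using le[of x] that pi_space[OF u] by simp
    qed
    also have "\<dots> = ?c * (\<integral>x. V (ex 1) x \<partial>\<pi> u)" by simp
    also have "\<dots> \<le> ?c * (2 * real p * \<kappa>\<^sub>0)"
      using Kb mass_bound_pos by (intro mult_left_mono pi_V_le u ex_le k) auto
    finally show "\<bar>(\<integral>x. g x \<partial>\<pi> v) - (\<integral>x. g x \<partial>\<pi> u)\<bar> \<le> ?L * b * \<bar>v - u\<bar>"
      by (simp add: mult_ac)
  qed
qed

text \<open>The marginal laws of row \<open>n\<close> as a recursion on measures, detached from any
  underlying process.\<close>

definition row_law :: "nat \<Rightarrow> (nat \<Rightarrow> (nat \<Rightarrow> 'a) measure) \<Rightarrow> bool" where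
  "row_law n \<mu> \<longleftrightarrow> 1 \<le> n \<and> \<mu> 0 = \<pi> 0 \<and>
     (\<forall>t<n. \<mu> (Suc t) = \<mu> t \<bind> step_kernel E (\<lambda>x. x) shift (real (Suc t) / real n))"

text \<open>The bound \<open>2 * real p * \<kappa>\<^sub>0\<close>, which every coordinate keeps
  along a row, summed over the \<open>p\<close> coordinates.\<close>

definition moment_bound :: real where "moment_bound = real p * (2 * real p * \<kappa>\<^sub>0)"

lemma moment_bound_nonneg: "0 \<le> moment_bound"
  using \<kappa>\<^sub>0(1) by (simp add: moment_bound_def)

text \<open>Old coordinates are only shifted, and for the new one
  \<open>\<rho> * M + \<alpha>\<^sub>0 \<le> M\<close> because
  \<open>\<kappa>\<^sub>0 \<le> M\<close>. The coordinates are bounded separately because the bound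
  has to survive every single step with its own parameter, whereas the drift of the maximum is only
  visible after several steps.\<close>

lemma coord_eq_Qop:
  assumes i: "integrable \<mu> (V d\<^sub>0)" and \<mu>: "prob_space \<mu>" "sets \<mu> = sets E" and u: "u \<in> {0..1}"
    and M: "\<And>i. i \<in> {1..p} \<Longrightarrow> (\<integral>x. coord i x \<partial>\<mu>) \<le> M" "\<kappa>\<^sub>0 \<le> M" and l: "l \<in> {1..p}"
  shows "(\<integral>x. coord l x \<partial>(\<mu> \<bind> step_kernel E (\<lambda>x. x) shift u)) \<le> M"
proof -
  have d0: "0 \<le> d\<^sub>0" using SCp1_constants(1) by simp
  interpret prob_space \<mu> by fact
  have sp: "space \<mu> = space E" by (rule sets_eq_imp_space_eq[OF \<mu>(2)])
  have ci: "integrable \<mu> (coord j)" if "j \<in> {1..p}" for j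
    by (rule cont_functional_integral(2)[OF i \<mu>(2) coord_wbound[OF that]])
  have eq: "(\<integral>x. coord l x \<partial>(\<mu> \<bind> step_kernel E (\<lambda>x. x) shift u)) = (\<integral>x. Qop u (coord l) x \<partial>\<mu>)"
    by (rule integral_step_bind[OF shift_system u \<mu> d0 order_refl i coord_wbound[OF l]])
  show ?thesis
  proof (cases "l = p")
    case True
    have "(\<integral>x. Qop u (coord p) x \<partial>\<mu>) \<le> (\<integral>x. (\<Sum>j=1..p. \<alpha> j u * coord j x) + \<alpha>\<^sub>0 \<partial>\<mu>)"
    proof (rule integral_mono)
      show "integrable \<mu> (Qop u (coord p))"
        by (rule cont_functional_integral(2)[OF i \<mu>(2) step_0_wbound[OF shift_system u d0 order_refl zero_le_one coord_wbound]])
          (use True l in simp)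
      show "integrable \<mu> (\<lambda>x. (\<Sum>j=1..p. \<alpha> j u * coord j x) + \<alpha>\<^sub>0)"
        by (intro Bochner_Integration.integrable_add Bochner_Integration.integrable_sum integrable_mult_right ci integrable_const)
      show "Qop u (coord p) x \<le> (\<Sum>j=1..p. \<alpha> j u * coord j x) + \<alpha>\<^sub>0" if "x \<in> space \<mu>" for x
        by (rule Qop_coord_p[OF u]) (use that sp in simp)
    qed
    also have "\<dots> = (\<Sum>j=1..p. \<alpha> j u * (\<integral>x. coord j x \<partial>\<mu>)) + \<alpha>\<^sub>0"
    proof -
      have *: "integrable \<mu> (\<lambda>x. \<alpha> j u * coord j x)" if "j \<in> {1..p}" for j by (rule integrable_mult_right[OF ci[OF that]])
      show ?thesis
        by (subst Bochner_Integration.integral_add[OF Bochner_Integration.integrable_sum[OF *] integrable_const], assumption,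
            subst Bochner_Integration.integral_sum[OF *]) (simp_all add: prob_space)
    qed
    also have "\<dots> \<le> \<rho> * M + \<alpha>\<^sub>0"
    proof -
      obtain x where "x \<in> space E" using not_empty sp by blast
      then show ?thesis using M \<kappa>\<^sub>0(1) by (intro drift_max[OF u]) auto
    qed
    also have "\<dots> \<le> M"
    proof -
      have "(1 - \<rho>) * \<kappa>\<^sub>0 \<le> (1 - \<rho>) * M" using \<rho>(2) M(2) by (intro mult_left_mono) auto
      then show ?thesis using \<kappa>\<^sub>0(2) by (simp add: algebra_simps)
    qed
    finally show ?thesis using eq True by simp
  next
    case False
    then have l': "l < p" "Suc l \<in> {1..p}" using l by auto
    have "(\<integral>x. Qop u (coord l) x \<partial>\<mu>) = (\<integral>x. coord (Suc l) x \<partial>\<mu>)"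
      by (rule Bochner_Integration.integral_cong[OF refl]) (use Qop_coord_less[OF u l l'(1)] sp in simp)
    then show ?thesis using M(1)[OF l'(2)] eq by simp
  qed
qed

text \<open>The bound \<open>?M\<close> holds for the coordinates under \<open>\<pi> 0\<close> and
  is at least \<open>\<kappa>\<^sub>0\<close>, so \<open>coord_eq_Qop\<close> carries it along the
  row, uniformly in \<open>n\<close> and \<open>t\<close>.\<close>

lemma row_law:
  assumes r: "row_law n \<mu>" and t: "t \<le> n"
  shows "prob_space (\<mu> t)" "sets (\<mu> t) = sets E" "integrable (\<mu> t) (V d\<^sub>0)"
    "(\<integral>x. V d\<^sub>0 x \<partial>\<mu> t) \<le> moment_bound"
proof -
  have d0: "0 \<le> d\<^sub>0" using SCp1_constants(1) by simp
  let ?M = "2 * real p * \<kappa>\<^sub>0"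
  have M: "\<kappa>\<^sub>0 \<le> ?M" using mult_right_mono[of 1 "2 * real p" "\<kappa>\<^sub>0"] p \<kappa>\<^sub>0(1) by simp
  have ci: "integrable \<mu> (coord j)" if "integrable \<mu> (V d\<^sub>0)" "sets \<mu> = sets E" "j \<in> {1..p}" for j and \<mu> :: "(nat \<Rightarrow> 'a) measure"
    by (rule cont_functional_integral(2)[OF that(1,2) coord_wbound[OF that(3)]])
  have "prob_space (\<mu> t) \<and> sets (\<mu> t) = sets E \<and> integrable (\<mu> t) (V d\<^sub>0) \<and> (\<forall>i\<in>{1..p}. (\<integral>x. coord i x \<partial>\<mu> t) \<le> ?M)"
    using t
  proof (induction t)
    case 0
    have u: "(0::real) \<in> {0..1}" by simp
    have "(\<integral>x. coord i x \<partial>\<pi> 0) \<le> ?M" if "i \<in> {1..p}" for i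
    proof -
      have "(\<integral>x. coord i x \<partial>\<pi> 0) \<le> (\<integral>x. V d\<^sub>0 x \<partial>\<pi> 0)"
        by (rule integral_mono[OF ci[OF pi_integrable_V0[OF u] pi_sets[OF u] that] pi_integrable_V0[OF u] coord_le[OF that]])
      then show ?thesis using pi_V_le[OF u order_refl] by simp
    qed
    then show ?case
      using r pi_prob[OF u] pi_sets[OF u] pi_integrable_V0[OF u] by (simp add: row_law_def)
  next
    case (Suc t)
    then have IH: "prob_space (\<mu> t)" "sets (\<mu> t) = sets E" "integrable (\<mu> t) (V d\<^sub>0)"
      "\<And>i. i \<in> {1..p} \<Longrightarrow> (\<integral>x. coord i x \<partial>\<mu> t) \<le> ?M" by auto
    have u: "real (Suc t) / real n \<in> {0..1}" using Suc.prems by simp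
    have eq: "\<mu> (Suc t) = \<mu> t \<bind> step_kernel E (\<lambda>x. x) shift (real (Suc t) / real n)"
      using r Suc.prems by (simp add: row_law_def)
    show ?case
      unfolding eq
      using prob_space_step_bind[OF shift_system u IH(1,2)] sets_step_bind[OF shift_system u IH(1,2)]
        integrable_step_bind[OF shift_system u IH(1,2) d0 order_refl IH(3)]
        coord_eq_Qop[OF IH(3,1,2) u IH(4) M] by blast
  qed
  then have 1: "prob_space (\<mu> t)" "sets (\<mu> t) = sets E" "integrable (\<mu> t) (V d\<^sub>0)"
    and c: "\<And>i. i \<in> {1..p} \<Longrightarrow> (\<integral>x. coord i x \<partial>\<mu> t) \<le> ?M" by blast+
  show "prob_space (\<mu> t)" "sets (\<mu> t) = sets E" "integrable (\<mu> t) (V d\<^sub>0)" by (fact 1)+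
  have "(\<integral>x. V d\<^sub>0 x \<partial>\<mu> t) \<le> (\<integral>x. (\<Sum>i=1..p. coord i x) \<partial>\<mu> t)"
  proof (rule integral_mono[OF 1(3)])
    show "integrable (\<mu> t) (\<lambda>x. \<Sum>i=1..p. coord i x)"
      by (rule Bochner_Integration.integrable_sum) (rule ci[OF 1(3,2)])
    show "V d\<^sub>0 x \<le> (\<Sum>i=1..p. coord i x)" for x
      using V_le_sum by (simp add: coord_def)
  qed
  also have "\<dots> = (\<Sum>i=1..p. \<integral>x. coord i x \<partial>\<mu> t)"
    by (rule Bochner_Integration.integral_sum) (rule ci[OF 1(3,2)])
  also have "\<dots> \<le> (\<Sum>i=1..p. ?M)" by (rule sum_mono) (rule c)
  finally show "(\<integral>x. V d\<^sub>0 x \<partial>\<mu> t) \<le> moment_bound" by (simp add: moment_bound_def)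
qed

lemma row_integrable:
  assumes r: "row_law n \<mu>" and t: "t \<le> n" and d: "d \<le> d\<^sub>0"
  shows "integrable (\<mu> t) (V d)" "(\<integral>x. V d x \<partial>\<mu> t) \<le> moment_bound"
proof -
  note m = row_law[OF r t]
  have V_mono': "V d x \<le> V d\<^sub>0 x" for x by (rule powr_mono[OF d mx_ge_1])
  have "wbound E (V d\<^sub>0) 1 (V d)"
    by (rule wboundI[OF V_measurable]) (simp add: V_mono')
  then show i: "integrable (\<mu> t) (V d)" by (rule cont_functional_integral(2)[OF m(3,2)])
  show "(\<integral>x. V d x \<partial>\<mu> t) \<le> moment_bound"
    by (rule order_trans[OF integral_mono[OF i m(3) V_mono'] m(4)])
qed

lemma row_approx:
  obtains K where "0 \<le> K" "\<And>n \<mu> t g b. row_law n \<mu> \<Longrightarrow> t \<le> n \<Longrightarrow> 0 \<le> b \<Longrightarrow> wbound E (V (ex 0)) b g \<Longrightarrow>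
    \<bar>(\<integral>x. g x \<partial>\<mu> t) - (\<integral>x. g x \<partial>\<pi> (real t / real n))\<bar> \<le> K * b / real n"
proof -
  have k: "1 \<le> k" "0 < k" "0 \<le> k" using SCp2(1) by auto
  note e0 = ex_nonneg[of 0] and e0' = ex_le[OF k(3)]
  have ex1: "ex 0 + q = ex 1" by (simp add: ex_def)
  obtain L \<kappa> where L: "0 \<le> L" and \<kappa>: "0 < \<kappa>" "\<kappa> < 1"
    and erg: "\<And>u g b n x. u \<in> {0..1} \<Longrightarrow> 0 \<le> b \<Longrightarrow> wbound E (V (ex 0)) b g \<Longrightarrow> x \<in> space E \<Longrightarrow>
      \<bar>(Qop u ^^ n) g x - (\<integral>y. g y \<partial>\<pi> u)\<bar> \<le> L * b * \<kappa> ^ n * V (ex 0) x"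
    using geometric_ergodicity[OF ex_pos e0'] by blast
  obtain H where H: "0 \<le> H" and lip: "\<And>u v b g. u \<in> {0..1} \<Longrightarrow> v \<in> {0..1} \<Longrightarrow> 0 \<le> b \<Longrightarrow> wbound E (V (ex 0)) b g \<Longrightarrow>
    \<bar>(\<integral>x. g x \<partial>\<pi> v) - (\<integral>x. g x \<partial>\<pi> u)\<bar> \<le> H * b * \<bar>v - u\<bar>"
    using pi_lipschitz by blast
  define B where "B = 1 / (1 - \<kappa>)\<^sup>2"
  have B: "0 \<le> B" by (simp add: B_def)
  let ?K = "2 * mass_bound * L * moment_bound * B + H * L * B"
  show ?thesis
  proof (rule that[of ?K])
    show "0 \<le> ?K" using L H B mass_bound_pos moment_bound_nonneg by simp
    fix n \<mu> t g b
    assume r: "row_law n \<mu>" and t: "t \<le> n" and b: "0 \<le> b" and g: "wbound E (V (ex 0)) b g"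
    have n: "0 < real n" using r by (simp add: row_law_def)
    define v where "v = real t / real n"
    have v: "v \<in> {0..1}" using t n by (simp add: v_def)
    interpret \<pi>: prob_space "\<pi> v" by (rule pi_prob[OF v])
    define c where "c = (\<integral>x. g x \<partial>\<pi> v)"
    \<comment> \<open>Centring makes \<open>h i\<close> decay like \<open>\<kappa> ^ i\<close> in
      the weighted sense, and \<open>Qop v\<close> maps \<open>h i\<close> to
      \<open>h (Suc i)\<close>.\<close>
    define h where "h i = (\<lambda>x. (Qop v ^^ i) g x - c)" for i
    have Vc: "wbound E (V (ex 0)) \<bar>a\<bar> (\<lambda>_. a)" for a by (intro wbound_const V_ge_1 e0)
    have hb: "wbound E (V (ex 0)) (L * b * \<kappa> ^ i) (h i)" for i
    proof (rule wboundI)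
      show "h i \<in> borel_measurable E"
        using wboundD(1)[OF Qop_pow_wbound[OF v e0 e0' g b, of i]] by (simp add: h_def)
      show "\<bar>h i x\<bar> \<le> L * b * \<kappa> ^ i * V (ex 0) x" if "x \<in> space E" for x
        using erg[OF v b g that, of i] by (simp add: h_def c_def)
    qed
    have hb0: "0 \<le> L * b * \<kappa> ^ i" for i using L b \<kappa> by simp
    have hS: "Qop v (h i) x = h (Suc i) x" if "x \<in> space E" for i x
      using cont_functional_diff[OF step_0_cont_functional[OF shift_system that v e0 e0'] Qop_pow_wbound[OF v e0 e0' g b] Vc]
        step_0_one[OF shift_system that v] by (simp add: h_def)
    define G where "G = 2 * mass_bound * L * b * moment_bound / real n"
    have G: "0 \<le> G" using L b mass_bound_pos moment_bound_nonneg by (simp add: G_def)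
    \<comment> \<open>Going one step back in time exchanges \<open>Qop w\<close> for
      \<open>Qop v\<close> on \<open>h i\<close>. Along \<open>i + s = t\<close> the two parameters
      differ by \<open>i / n\<close>, which together with the decay of \<open>h i\<close> gives the
      summand \<open>real i * \<kappa> ^ i\<close>.\<close>
    have main: "\<bar>(\<integral>x. h i x \<partial>\<mu> s) - (\<integral>x. h (i + s) x \<partial>\<mu> 0)\<bar> \<le> G * (\<Sum>j\<in>{i..<i + s}. real j * \<kappa> ^ j)"
      if "i + s = t" for i s
      using that
    proof (induction s arbitrary: i)
      case 0
      then show ?case by simp
    next
      case (Suc s)
      define w where "w = real (Suc s) / real n"
      have sn: "s < n" "s \<le> n" using Suc.prems t by auto
      have w: "w \<in> {0..1}" using sn by (simp add: w_def)
      note m = row_law[OF r sn(2)] and iV = row_integrable[OF r sn(2)]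
      have sp: "space (\<mu> s) = space E" by (rule sets_eq_imp_space_eq[OF m(2)])
      have \<mu>S: "\<mu> (Suc s) = \<mu> s \<bind> step_kernel E (\<lambda>x. x) shift w"
        using r sn by (simp add: row_law_def w_def)
      have e1: "(\<integral>x. h i x \<partial>\<mu> (Suc s)) = (\<integral>x. Qop w (h i) x \<partial>\<mu> s)"
        unfolding \<mu>S by (rule integral_step_bind[OF shift_system w m(1,2) e0 e0' iV(1)[OF e0'] hb])
      have e2: "(\<integral>x. h (Suc i) x \<partial>\<mu> s) = (\<integral>x. Qop v (h i) x \<partial>\<mu> s)"
        by (rule Bochner_Integration.integral_cong[OF refl]) (simp add: hS sp)
      have qi: "integrable (\<mu> s) (Qop u (h i))" if "u \<in> {0..1}" for u
        by (rule cont_functional_integral(2)[OF iV(1)[OF e0'] m(2) step_0_wbound[OF shift_system that e0 e0' hb0 hb]])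
      have e3: "(\<integral>x. h i x \<partial>\<mu> (Suc s)) - (\<integral>x. h (Suc i) x \<partial>\<mu> s) = (\<integral>x. Qop w (h i) x - Qop v (h i) x \<partial>\<mu> s)"
        unfolding e1 e2 by (rule Bochner_Integration.integral_diff[OF qi[OF w] qi[OF v], symmetric])
      let ?c = "2 * mass_bound * (L * b * \<kappa> ^ i) * \<bar>w - v\<bar>"
      have c: "0 \<le> ?c" using hb0[of i] mass_bound_pos by simp
      have wv: "\<bar>w - v\<bar> = real i / real n"
      proof -
        have "real t = real i + real (Suc s)" using Suc.prems by simp
        then have "w - v = - (real i / real n)" by (simp add: w_def v_def add_divide_distrib)
        then show ?thesis using n by simp
      qed
      have "\<bar>(\<integral>x. h i x \<partial>\<mu> (Suc s)) - (\<integral>x. h (Suc i) x \<partial>\<mu> s)\<bar> \<le> (\<integral>x. ?c * V (ex 1) x \<partial>\<mu> s)"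
        unfolding e3
      proof (rule abs_integral_le)
        show "integrable (\<mu> s) (\<lambda>x. ?c * V (ex 1) x)" using iV(1)[OF ex_le[OF k(1)]] by simp
        show "\<bar>Qop w (h i) x - Qop v (h i) x\<bar> \<le> ?c * V (ex 1) x" if "x \<in> space (\<mu> s)" for x
          using step_diff_bound[OF shift_system _ v w k(2) ex_nonneg ex_mono hb hb0, of x i] that sp by (simp add: ex1)
      qed
      also have "\<dots> = ?c * (\<integral>x. V (ex 1) x \<partial>\<mu> s)" by simp
      also have "\<dots> \<le> ?c * moment_bound" by (intro mult_left_mono c iV ex_le k)
      also have "\<dots> = G * (real i * \<kappa> ^ i)" unfolding wv by (simp add: G_def)
      finally have "\<bar>(\<integral>x. h i x \<partial>\<mu> (Suc s)) - (\<integral>x. h (Suc i) x \<partial>\<mu> s)\<bar> \<le> G * (real i * \<kappa> ^ i)" .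
      moreover have "\<bar>(\<integral>x. h (Suc i) x \<partial>\<mu> s) - (\<integral>x. h (Suc i + s) x \<partial>\<mu> 0)\<bar>
          \<le> G * (\<Sum>j\<in>{Suc i..<Suc i + s}. real j * \<kappa> ^ j)"
        by (rule Suc.IH) (use Suc.prems in simp)
      moreover have "(\<Sum>j\<in>{i..<i + Suc s}. real j * \<kappa> ^ j) = real i * \<kappa> ^ i + (\<Sum>j\<in>{Suc i..<Suc i + s}. real j * \<kappa> ^ j)"
        by (subst sum.atLeast_Suc_lessThan) auto
      ultimately show ?case by (simp add: distrib_left)
    qed
    have \<mu>0: "\<mu> 0 = \<pi> 0" using r by (simp add: row_law_def)
    have z: "(0::real) \<in> {0..1}" by simp
    note i0 = pi_integrable[OF z e0'] and iv = pi_integrable[OF v e0']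
    have h_int: "(\<integral>x. h t x \<partial>\<pi> v) = 0"
    proof -
      have "(\<integral>x. h t x \<partial>\<pi> v) = (\<integral>x. (Qop v ^^ t) g x \<partial>\<pi> v) - c"
        unfolding h_def using cont_functional_integral(2)[OF iv pi_sets[OF v] Qop_pow_wbound[OF v e0 e0' g b]]
        by (simp add: \<pi>.prob_space)
      then show ?thesis using pi_invariant_pow[OF v e0 e0' iv g b] by (simp add: c_def)
    qed
    \<comment> \<open>The row starts from the invariant law at 0 rather than at \<open>v\<close>;
      the distance \<open>v = t / n\<close> is compensated by the factor
      \<open>\<kappa> ^ t\<close>.\<close>
    have "\<bar>\<integral>x. h t x \<partial>\<mu> 0\<bar> \<le> H * (L * b * \<kappa> ^ t) * \<bar>0 - v\<bar>"
      using lip[OF v z hb0 hb, of t] h_int \<mu>0 by simp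
    also have "\<dots> = H * L * b / real n * (real t * \<kappa> ^ t)" using n by (simp add: v_def)
    also have "\<dots> \<le> H * L * b / real n * B"
      unfolding B_def using H L b by (intro mult_left_mono sum_index_power_le \<kappa>) auto
    finally have 1: "\<bar>\<integral>x. h t x \<partial>\<mu> 0\<bar> \<le> H * L * b / real n * B" .
    have "\<bar>(\<integral>x. h 0 x \<partial>\<mu> t) - (\<integral>x. h t x \<partial>\<mu> 0)\<bar> \<le> G * (\<Sum>j<t. real j * \<kappa> ^ j)"
      using main[of 0 t] by (simp add: lessThan_atLeast0)
    also have "\<dots> \<le> G * B" unfolding B_def by (intro mult_left_mono sum_index_power_le \<kappa> G)
    finally have 2: "\<bar>(\<integral>x. h 0 x \<partial>\<mu> t) - (\<integral>x. h t x \<partial>\<mu> 0)\<bar> \<le> G * B" .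
    interpret \<mu>t: prob_space "\<mu> t" by (rule row_law(1)[OF r t])
    have "(\<integral>x. h 0 x \<partial>\<mu> t) = (\<integral>x. g x \<partial>\<mu> t) - c"
      unfolding h_def using cont_functional_integral(2)[OF row_integrable(1)[OF r t e0'] row_law(2)[OF r t] g]
      by (simp add: \<mu>t.prob_space)
    then have "\<bar>(\<integral>x. g x \<partial>\<mu> t) - c\<bar> \<le> G * B + H * L * b / real n * B"
      using 1 2 by linarith
    also have "\<dots> = ?K * b / real n" by (simp add: G_def add_divide_distrib algebra_simps)
    finally show "\<bar>(\<integral>x. g x \<partial>\<mu> t) - (\<integral>x. g x \<partial>\<pi> (real t / real n))\<bar> \<le> ?K * b / real n"
      by (simp add: c_def v_def)
  qed
qed

lemma row_local_approx:
  obtains K where "0 \<le> K" "\<And>n \<mu> t u g b. row_law n \<mu> \<Longrightarrow> t \<le> n \<Longrightarrow> u \<in> {0..1} \<Longrightarrow> 0 \<le> b \<Longrightarrow> wbound E (V (ex 0)) b g \<Longrightarrow>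
    \<bar>(\<integral>x. g x \<partial>\<mu> t) - (\<integral>x. g x \<partial>\<pi> u)\<bar> \<le> K * b * (\<bar>u - real t / real n\<bar> + 1 / real n)"
proof -
  obtain L where L: "0 \<le> L" and lip: "\<And>u v b g. u \<in> {0..1} \<Longrightarrow> v \<in> {0..1} \<Longrightarrow> 0 \<le> b \<Longrightarrow> wbound E (V (ex 0)) b g \<Longrightarrow>
    \<bar>(\<integral>x. g x \<partial>\<pi> v) - (\<integral>x. g x \<partial>\<pi> u)\<bar> \<le> L * b * \<bar>v - u\<bar>"
    using pi_lipschitz by blast
  obtain K where K: "0 \<le> K" and approx: "\<And>n \<mu> t g b. row_law n \<mu> \<Longrightarrow> t \<le> n \<Longrightarrow> 0 \<le> b \<Longrightarrow> wbound E (V (ex 0)) b g \<Longrightarrow>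
    \<bar>(\<integral>x. g x \<partial>\<mu> t) - (\<integral>x. g x \<partial>\<pi> (real t / real n))\<bar> \<le> K * b / real n"
    using row_approx by blast
  show ?thesis
  proof (rule that[of "L + K"])
    show "0 \<le> L + K" using L K by simp
    fix n \<mu> t u g b
    assume r: "row_law n \<mu>" and t: "t \<le> n" and u: "u \<in> {0..1::real}" and b: "0 \<le> b" and g: "wbound E (V (ex 0)) b g"
    have n: "0 < real n" using r by (simp add: row_law_def)
    have v: "real t / real n \<in> {0..1}" using t n by simp
    have 0: "0 \<le> K * b * \<bar>u - real t / real n\<bar>" "0 \<le> L * b * (1 / real n)" using K L b n by auto
    have "\<bar>(\<integral>x. g x \<partial>\<mu> t) - (\<integral>x. g x \<partial>\<pi> u)\<bar> \<le> K * b * (1 / real n) + L * b * \<bar>u - real t / real n\<bar>"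
      using approx[OF r t b g] lip[OF u v b g] by (simp add: abs_minus_commute)
    also have "\<dots> \<le> (L + K) * b * (\<bar>u - real t / real n\<bar> + 1 / real n)"
      unfolding distrib_right distrib_left using 0 by linarith
    finally show "\<bar>(\<integral>x. g x \<partial>\<mu> t) - (\<integral>x. g x \<partial>\<pi> u)\<bar> \<le> (L + K) * b * (\<bar>u - real t / real n\<bar> + 1 / real n)" .
  qed
qed

end

section \<open>Approximation of the path laws of the array\<close>

context stationary_model
begin

text \<open>\<open>L (Suc j)\<close> is meant as the law of the blocks at times \<open>t\<close> to
  \<open>t + j\<close>, so the next block is produced by the transition of time
  \<open>t + Suc j\<close>.\<close>

definition row_path_law :: "nat \<Rightarrow> nat \<Rightarrow> (nat \<Rightarrow> 'a) measure \<Rightarrow> (nat \<Rightarrow> (nat \<Rightarrow> nat \<Rightarrow> 'a) measure) \<Rightarrow> bool" where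
  "row_path_law n t \<mu> L \<longleftrightarrow> L 1 = distr \<mu> (EE 1) single \<and>
     (\<forall>j. t + Suc j \<le> n \<longrightarrow> L (Suc (Suc j)) =
        L (Suc j) \<bind> step_kernel (EE (Suc (Suc j))) (\<lambda>z. z (Suc j)) (path_step (Suc j)) (real (t + Suc j) / real n))"

lemma row_path_law:
  assumes r: "row_law n \<mu>" and L: "row_path_law n t (\<mu> t) L" and t: "t + j \<le> n"
  shows "prob_space (L (Suc j))" "sets (L (Suc j)) = sets (EE (Suc j))"
    "integrable (L (Suc j)) (\<lambda>z. mxs (Suc j) z powr d\<^sub>0)"
    "(\<integral>z. mxs (Suc j) z powr d\<^sub>0 \<partial>L (Suc j)) \<le> (2 * mass_bound) ^ j * moment_bound"
proof -
  have d0: "0 \<le> d\<^sub>0" using SCp1_constants(1) by simp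
  have w: "(\<lambda>z. mxs j z powr d\<^sub>0) \<in> borel_measurable (EE j)" for j
    using mxs_measurable by measurable
  have "prob_space (L (Suc j)) \<and> sets (L (Suc j)) = sets (EE (Suc j)) \<and>
    integrable (L (Suc j)) (\<lambda>z. mxs (Suc j) z powr d\<^sub>0) \<and>
    (\<integral>z. mxs (Suc j) z powr d\<^sub>0 \<partial>L (Suc j)) \<le> (2 * mass_bound) ^ j * moment_bound"
    using t
  proof (induction j)
    case 0
    then have t: "t \<le> n" by simp
    note m = row_law[OF r t]
    have 1: "L 1 = distr (\<mu> t) (EE 1) single" using L by (simp add: row_path_law_def)
    have s: "single \<in> \<mu> t \<rightarrow>\<^sub>M EE 1"
      using single_measurable m(2) by (simp cong: measurable_cong_sets)
    have "integrable (distr (\<mu> t) (EE 1) single) (\<lambda>z. mxs 1 z powr d\<^sub>0)"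
      using m(3) by (subst integrable_distr_eq[OF s w]) (simp add: mxs_single)
    moreover have "(\<integral>z. mxs 1 z powr d\<^sub>0 \<partial>distr (\<mu> t) (EE 1) single) = (\<integral>x. V d\<^sub>0 x \<partial>\<mu> t)"
      by (subst integral_distr[OF s w]) (simp add: mxs_single)
    ultimately show ?case
      using 1 prob_space.prob_space_distr[OF m(1) s] m(4) by (simp add: One_nat_def)
  next
    case (Suc j)
    then have IH: "prob_space (L (Suc j))" "sets (L (Suc j)) = sets (EE (Suc j))"
      "integrable (L (Suc j)) (\<lambda>z. mxs (Suc j) z powr d\<^sub>0)"
      "(\<integral>z. mxs (Suc j) z powr d\<^sub>0 \<partial>L (Suc j)) \<le> (2 * mass_bound) ^ j * moment_bound" by auto
    have j: "1 \<le> Suc j" by simp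
    note sys = path_step_system[OF j]
    define v where "v = real (t + Suc j) / real n"
    have v: "v \<in> {0..1}" using Suc.prems by (auto simp: v_def divide_le_eq_1)
    have eq: "L (Suc (Suc j)) = L (Suc j) \<bind> step_kernel (EE (Suc (Suc j))) (\<lambda>z. z (Suc j)) (path_step (Suc j)) v"
      using L Suc.prems by (simp add: row_path_law_def v_def)
    let ?w = "\<lambda>z. mxs (Suc (Suc j)) z powr d\<^sub>0"
    have ww: "wbound (EE (Suc (Suc j))) ?w 1 ?w" by (rule wboundI[OF w]) simp
    note Tw = step_0_wbound[OF sys v d0 order_refl zero_le_one ww]
    have "(\<integral>z. ?w z \<partial>L (Suc (Suc j))) = (\<integral>z. step_op (\<lambda>z. z (Suc j)) (path_step (Suc j)) 0 v ?w z \<partial>L (Suc j))"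
      unfolding eq by (rule integral_step_bind[OF sys v IH(1,2) d0 order_refl IH(3) ww])
    also have "\<dots> \<le> (\<integral>z. 2 * mass_bound * (mxs (Suc j) z powr d\<^sub>0) \<partial>L (Suc j))"
    proof (rule integral_mono[OF cont_functional_integral(2)[OF IH(3,2) Tw]])
      show "integrable (L (Suc j)) (\<lambda>z. 2 * mass_bound * (mxs (Suc j) z powr d\<^sub>0))" using IH(3) by simp
      fix z assume "z \<in> space (L (Suc j))"
      then have "z \<in> space (EE (Suc j))" using sets_eq_imp_space_eq[OF IH(2)] by simp
      from wboundD(2)[OF Tw this]
      show "step_op (\<lambda>z. z (Suc j)) (path_step (Suc j)) 0 v ?w z \<le> 2 * mass_bound * (mxs (Suc j) z powr d\<^sub>0)" by simp
    qed
    also have "\<dots> = 2 * mass_bound * (\<integral>z. mxs (Suc j) z powr d\<^sub>0 \<partial>L (Suc j))" by simp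
    also have "\<dots> \<le> 2 * mass_bound * ((2 * mass_bound) ^ j * moment_bound)"
      using mass_bound_pos by (intro mult_left_mono IH(4)) simp
    finally have "(\<integral>z. ?w z \<partial>L (Suc (Suc j))) \<le> (2 * mass_bound) ^ Suc j * moment_bound" by simp
    then show ?case
      unfolding eq
      using prob_space_step_bind[OF sys v IH(1,2)] sets_step_bind[OF sys v IH(1,2)]
        integrable_step_bind[OF sys v IH(1,2) d0 order_refl IH(3)] by blast
  qed
  then show "prob_space (L (Suc j))" "sets (L (Suc j)) = sets (EE (Suc j))"
    "integrable (L (Suc j)) (\<lambda>z. mxs (Suc j) z powr d\<^sub>0)"
    "(\<integral>z. mxs (Suc j) z powr d\<^sub>0 \<partial>L (Suc j)) \<le> (2 * mass_bound) ^ j * moment_bound" by blast+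
qed

text \<open>Induction on the path length: the last transition is replaced by the one at
  \<open>u\<close>, at a cost of order \<open>|v - u|\<close>; the remaining comparison concerns the
  shorter path and the test function integrated over the last transition at
  \<open>u\<close>.\<close>

lemma row_path_local_approx:
  "\<exists>K\<ge>0. \<forall>n \<mu> t L u g b. row_law n \<mu> \<longrightarrow> row_path_law n t (\<mu> t) L \<longrightarrow> t + j \<le> n \<longrightarrow> u \<in> {0..1} \<longrightarrow> 0 \<le> b \<longrightarrow>
     wbound (EE (Suc j)) (Vs (Suc j) 0) b g \<longrightarrow>
     \<bar>(\<integral>z. g z \<partial>L (Suc j)) - (\<integral>z. g z \<partial>path_pi (Suc j) u)\<bar> \<le> K * b * (\<bar>u - real t / real n\<bar> + 1 / real n)"
proof (induction j)
  case 0
  obtain K where K: "0 \<le> K" "\<And>n \<mu> t u g b. row_law n \<mu> \<Longrightarrow> t \<le> n \<Longrightarrow> u \<in> {0..1} \<Longrightarrow> 0 \<le> b \<Longrightarrow> wbound E (V (ex 0)) b g \<Longrightarrow>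
    \<bar>(\<integral>x. g x \<partial>\<mu> t) - (\<integral>x. g x \<partial>\<pi> u)\<bar> \<le> K * b * (\<bar>u - real t / real n\<bar> + 1 / real n)"
    using row_local_approx by blast
  show ?case
  proof (intro exI[of _ K] conjI K(1) allI impI)
    fix n \<mu> t L u g b
    assume r: "row_law n \<mu>" and L: "row_path_law n t (\<mu> t) L" and t: "t + 0 \<le> n" and u: "u \<in> {0..1::real}" and b: "0 \<le> b"
      and g: "wbound (EE (Suc 0)) (Vs (Suc 0) 0) b g"
    have t': "t \<le> n" using t by simp
    have g1: "wbound (EE 1) (Vs 1 0) b g" using g by (simp add: One_nat_def)
    have gm: "g \<in> borel_measurable (EE 1)" by (rule wboundD(1)[OF g1])
    have s: "single \<in> \<mu> t \<rightarrow>\<^sub>M EE 1"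
      using single_measurable row_law(2)[OF r t'] by (simp cong: measurable_cong_sets)
    have 1: "L 1 = distr (\<mu> t) (EE 1) single" using L by (simp add: row_path_law_def)
    have "wbound E (V (ex 0)) b (\<lambda>x. g (single x))"
    proof (rule wboundI)
      show "(\<lambda>x. g (single x)) \<in> borel_measurable E" by (rule measurable_compose[OF single_measurable gm])
      show "\<bar>g (single x)\<bar> \<le> b * V (ex 0) x" if "x \<in> space E" for x
        using wboundD(2)[OF g1 measurable_space[OF single_measurable that]] by (simp add: mxs_single)
    qed
    from K(2)[OF r t' u b this]
    have "\<bar>(\<integral>z. g z \<partial>L 1) - (\<integral>z. g z \<partial>path_pi 1 u)\<bar> \<le> K * b * (\<bar>u - real t / real n\<bar> + 1 / real n)"
      unfolding 1 path_pi_1[OF u gm] integral_distr[OF s gm] .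
    then show "\<bar>(\<integral>z. g z \<partial>L (Suc 0)) - (\<integral>z. g z \<partial>path_pi (Suc 0) u)\<bar> \<le> K * b * (\<bar>u - real t / real n\<bar> + 1 / real n)"
      unfolding One_nat_def .
  qed
next
  case (Suc j)
  then obtain K where K: "0 \<le> K"
    and IH: "\<And>n \<mu> t L u g b. row_law n \<mu> \<Longrightarrow> row_path_law n t (\<mu> t) L \<Longrightarrow> t + j \<le> n \<Longrightarrow> u \<in> {0..1} \<Longrightarrow> 0 \<le> b \<Longrightarrow>
     wbound (EE (Suc j)) (Vs (Suc j) 0) b g \<Longrightarrow>
     \<bar>(\<integral>z. g z \<partial>L (Suc j)) - (\<integral>z. g z \<partial>path_pi (Suc j) u)\<bar> \<le> K * b * (\<bar>u - real t / real n\<bar> + 1 / real n)"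
    by blast
  have k: "1 \<le> k" "0 < k" "0 \<le> k" using SCp2(1) by auto
  note e0 = ex_nonneg[of 0] and e0' = ex_le[OF k(3)]
  have ex1: "ex 0 + q = ex 1" by (simp add: ex_def)
  have j: "1 \<le> Suc j" by simp
  note sys = path_step_system[OF j]
  define B where "B = (2 * mass_bound) ^ j * moment_bound"
  have B: "0 \<le> B" using mass_bound_pos moment_bound_nonneg by (simp add: B_def)
  let ?K = "2 * mass_bound * K + 2 * mass_bound * B * real (Suc j)"
  show ?case
  proof (intro exI[of _ ?K] conjI allI impI)
    show "0 \<le> ?K" using K B mass_bound_pos by simp
    fix n \<mu> t L u g b
    assume r: "row_law n \<mu>" and L: "row_path_law n t (\<mu> t) L" and t: "t + Suc j \<le> n" and u: "u \<in> {0..1::real}" and b: "0 \<le> b"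
      and g: "wbound (EE (Suc (Suc j))) (Vs (Suc (Suc j)) 0) b g"
    have t': "t + j \<le> n" using t by simp
    have n: "0 < real n" using r by (simp add: row_law_def)
    note m = row_path_law[OF r L t']
    have sp: "space (L (Suc j)) = space (EE (Suc j))" by (rule sets_eq_imp_space_eq[OF m(2)])
    have iV: "integrable (L (Suc j)) (\<lambda>z. mxs (Suc j) z powr d)" if "d \<le> d\<^sub>0" for d
      by (rule mxs_powr_integrable[OF m(3,2) that])
    define v where "v = real (t + Suc j) / real n"
    have v: "v \<in> {0..1}" using t n by (simp add: v_def)
    define T where "T w = step_op (\<lambda>z. z (Suc j)) (path_step (Suc j)) 0 w g" for w
    have Tb: "wbound (EE (Suc j)) (Vs (Suc j) 0) (2 * mass_bound * b) (T w)" if "w \<in> {0..1}" for w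
      unfolding T_def by (rule step_0_wbound[OF sys that e0 e0' b g])
    have b': "0 \<le> 2 * mass_bound * b" using mass_bound_pos b by simp
    have Ti: "integrable (L (Suc j)) (T w)" if "w \<in> {0..1}" for w
      by (rule cont_functional_integral(2)[OF iV[OF e0'] m(2) Tb[OF that]])
    have eq: "L (Suc (Suc j)) = L (Suc j) \<bind> step_kernel (EE (Suc (Suc j))) (\<lambda>z. z (Suc j)) (path_step (Suc j)) v"
      using L t by (simp add: row_path_law_def v_def)
    have 1: "(\<integral>z. g z \<partial>L (Suc (Suc j))) = (\<integral>z. T v z \<partial>L (Suc j))"
      unfolding eq T_def by (rule integral_step_bind[OF sys v m(1,2) e0 e0' iV[OF e0'] g])
    have 2: "(\<integral>z. g z \<partial>path_pi (Suc (Suc j)) u) = (\<integral>z. T u z \<partial>path_pi (Suc j) u)"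
      unfolding T_def by (rule path_pi_Suc[OF u e0 e0' g])
    let ?\<delta> = "\<bar>u - real t / real n\<bar> + 1 / real n"
    have \<delta>: "0 \<le> ?\<delta>" using n by simp
    let ?c = "2 * mass_bound * b * \<bar>v - u\<bar>"
    have c: "0 \<le> ?c" using b' by simp
    have i1: "integrable (L (Suc j)) (\<lambda>z. mxs (Suc j) z powr ex 1)" by (rule iV[OF ex_le[OF k(1)]])
    have mono: "mxs (Suc j) z powr ex 1 \<le> mxs (Suc j) z powr d\<^sub>0" for z
      using mxs_ge_1[OF j, of z] ex_le[OF k(1)] by (simp add: powr_mono)
    have "\<bar>(\<integral>z. T v z \<partial>L (Suc j)) - (\<integral>z. T u z \<partial>L (Suc j))\<bar> = \<bar>\<integral>z. T v z - T u z \<partial>L (Suc j)\<bar>"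
      by (simp only: Bochner_Integration.integral_diff[OF Ti[OF v] Ti[OF u]])
    also have "\<dots> \<le> (\<integral>z. ?c * (mxs (Suc j) z powr ex 1) \<partial>L (Suc j))"
    proof (rule abs_integral_le)
      show "integrable (L (Suc j)) (\<lambda>z. ?c * (mxs (Suc j) z powr ex 1))" using i1 by simp
      show "\<bar>T v z - T u z\<bar> \<le> ?c * (mxs (Suc j) z powr ex 1)" if "z \<in> space (L (Suc j))" for z
        using step_diff_bound[OF sys _ u v k(2) ex_nonneg ex_mono g b, of z] that sp by (simp add: ex1 T_def)
    qed
    also have "\<dots> = ?c * (\<integral>z. mxs (Suc j) z powr ex 1 \<partial>L (Suc j))" by simp
    also have "\<dots> \<le> ?c * B"
      unfolding B_def by (intro mult_left_mono c order_trans[OF integral_mono[OF i1 m(3) mono] m(4)])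
    \<comment> \<open>The distance from \<open>u\<close> to the parameter of the last transition
      exceeds \<open>|u - t / n|\<close> by at most \<open>(j + 1) / n\<close>; both terms are
      enlarged to multiples of \<open>Suc j\<close>.\<close>
    also have "\<dots> \<le> 2 * mass_bound * b * (real (Suc j) * ?\<delta>) * B"
    proof (intro mult_right_mono mult_left_mono B b')
      have "\<bar>v - u\<bar> \<le> \<bar>u - real t / real n\<bar> + real (Suc j) / real n"
      proof -
        have "v = real t / real n + real (Suc j) / real n" "0 \<le> real (Suc j) / real n"
          by (simp_all add: v_def add_divide_distrib)
        then show ?thesis by linarith
      qed
      also have "\<dots> \<le> real (Suc j) * \<bar>u - real t / real n\<bar> + real (Suc j) / real n"
        using mult_right_mono[of 1 "real (Suc j)" "\<bar>u - real t / real n\<bar>"] by simp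
      also have "\<dots> = real (Suc j) * ?\<delta>" by (simp only: distrib_left times_divide_eq_right mult_1_right)
      finally show "\<bar>v - u\<bar> \<le> real (Suc j) * ?\<delta>" .
    qed
    finally have A1: "\<bar>(\<integral>z. T v z \<partial>L (Suc j)) - (\<integral>z. T u z \<partial>L (Suc j))\<bar> \<le> 2 * mass_bound * b * (real (Suc j) * ?\<delta>) * B" .
    have A2: "\<bar>(\<integral>z. T u z \<partial>L (Suc j)) - (\<integral>z. T u z \<partial>path_pi (Suc j) u)\<bar> \<le> K * (2 * mass_bound * b) * ?\<delta>"
      by (rule IH[OF r L t' u b' Tb[OF u]])
    have "\<bar>(\<integral>z. g z \<partial>L (Suc (Suc j))) - (\<integral>z. g z \<partial>path_pi (Suc (Suc j)) u)\<bar>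
        \<le> K * (2 * mass_bound * b) * ?\<delta> + 2 * mass_bound * b * (real (Suc j) * ?\<delta>) * B"
      unfolding 1 2 using A1 A2 by linarith
    also have "\<dots> = ?K * b * ?\<delta>"
    proof -
      have "K * (2 * m * b) * \<delta> + 2 * m * b * (J * \<delta>) * B = (2 * m * K + 2 * m * B * J) * b * \<delta>" for m J \<delta> :: real
        by (simp add: algebra_simps)
      then show ?thesis .
    qed
    finally show "\<bar>(\<integral>z. g z \<partial>L (Suc (Suc j))) - (\<integral>z. g z \<partial>path_pi (Suc (Suc j)) u)\<bar> \<le> ?K * b * ?\<delta>" .
  qed
qed

lemma row_path_weighted_norm:
  "\<exists>K>0. \<forall>n \<mu> t L. \<forall>u\<in>{0..1}. row_law n \<mu> \<longrightarrow> row_path_law n t (\<mu> t) L \<longrightarrow> t + j \<le> n \<longrightarrow>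
     weighted_norm (EE (Suc j)) (sum_weight (Suc j) (\<lambda>x. \<Sum>i=1..p. \<phi> (x i) powr d\<^sub>1))
       (\<lambda>A. measure (L (Suc j)) A - measure (path_pi (Suc j) u) A)
     \<le> ereal (K * (\<bar>u - real t / real n\<bar> + 1 / real n))"
proof -
  obtain K where K: "0 \<le> K"
    and approx: "\<And>n \<mu> t L u g b. row_law n \<mu> \<Longrightarrow> row_path_law n t (\<mu> t) L \<Longrightarrow> t + j \<le> n \<Longrightarrow> u \<in> {0..1} \<Longrightarrow> 0 \<le> b \<Longrightarrow>
     wbound (EE (Suc j)) (Vs (Suc j) 0) b g \<Longrightarrow>
     \<bar>(\<integral>z. g z \<partial>L (Suc j)) - (\<integral>z. g z \<partial>path_pi (Suc j) u)\<bar> \<le> K * b * (\<bar>u - real t / real n\<bar> + 1 / real n)"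
    using row_path_local_approx[of j] by blast
  have j: "1 \<le> Suc j" by simp
  let ?b = "real (Suc j * p)"
  \<comment> \<open>The added 1 makes the constant positive, as local stationarity requires.\<close>
  have K1: "0 < K * ?b + 1" using K by (simp add: add_nonneg_pos)
  show ?thesis
  proof (intro exI[of _ "K * ?b + 1"] conjI K1 allI ballI impI)
    fix n \<mu> t L and u :: real
    assume u: "u \<in> {0..1}" and r: "row_law n \<mu>" and L: "row_path_law n t (\<mu> t) L" and t: "t + j \<le> n"
    note m = row_path_law[OF r L t]
    let ?\<delta> = "\<bar>u - real t / real n\<bar> + 1 / real n"
    have \<delta>: "0 \<le> ?\<delta>" by simp
    let ?F = "\<lambda>g. 1 * (\<integral>z. g z \<partial>L (Suc j)) + (- 1) * (\<integral>z. g z \<partial>path_pi (Suc j) u)"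
    have e: "ex 0 \<le> d\<^sub>0" by (rule ex_le) simp
    have "weighted_norm (EE (Suc j)) (sum_weight (Suc j) (\<lambda>x. \<Sum>i=1..p. \<phi> (x i) powr d\<^sub>1)) (functional_measure (EE (Suc j)) ?F)
        \<le> ereal ((K * ?b + 1) * ?\<delta>)"
    proof (rule weighted_norm_le)
      show "cont_functional (EE (Suc j)) (Vs (Suc j) 0) ?F"
        by (rule cont_functional_comb[OF
              cont_functional_integral(1)[OF mxs_powr_integrable[OF m(3,2) e] m(2)]
              cont_functional_integral(1)[OF mxs_powr_integrable[OF path_pi(3)[OF u] path_pi(2)[OF u] e] path_pi(2)[OF u]]])
      show "1 \<le> Vs (Suc j) 0 z" for z
        using mxs_ge_1[OF j, of z] ex_nonneg by (simp add: ge_one_powr_ge_zero)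
      show "Vs (Suc j) 0 \<in> borel_measurable (EE (Suc j))" using mxs_measurable by measurable
      show "sum_weight (Suc j) (\<lambda>x. \<Sum>i=1..p. \<phi> (x i) powr d\<^sub>1) z \<le> ?b * Vs (Suc j) 0 z" for z
        by (rule sum_weight_le[OF j])
      fix g assume g: "wbound (EE (Suc j)) (Vs (Suc j) 0) ?b g"
      have "?F g \<le> K * ?b * ?\<delta>"
        using approx[OF r L t u _ g] by (simp del: of_nat_Suc of_nat_mult)
      also have "\<dots> \<le> (K * ?b + 1) * ?\<delta>" using \<delta> by (intro mult_right_mono) auto
      finally show "?F g \<le> (K * ?b + 1) * ?\<delta>" .
    qed
    moreover have "functional_measure (EE (Suc j)) ?F = (\<lambda>A. measure (L (Suc j)) A - measure (path_pi (Suc j) u) A)"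
      using functional_measure_comb[of "EE (Suc j)" 1 "\<lambda>g. \<integral>z. g z \<partial>L (Suc j)" "- 1" "\<lambda>g. \<integral>z. g z \<partial>path_pi (Suc j) u"]
      unfolding functional_measure_integral[OF m(2)] functional_measure_integral[OF path_pi(2)[OF u]] by (intro ext) simp
    ultimately show "weighted_norm (EE (Suc j)) (sum_weight (Suc j) (\<lambda>x. \<Sum>i=1..p. \<phi> (x i) powr d\<^sub>1))
        (\<lambda>A. measure (L (Suc j)) A - measure (path_pi (Suc j) u) A) \<le> ereal ((K * ?b + 1) * ?\<delta>)" by simp
  qed
qed

end

section \<open>Laws of processes with prescribed transitions\<close>

context
  fixes M :: "'w measure" and Y :: "int \<Rightarrow> 'w \<Rightarrow> 'e::topological_space" and t :: int
  assumes M: "prob_space M" and Y: "\<forall>s\<le>t. Y s \<in> M \<rightarrow>\<^sub>M borel"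
begin

lemma past_in_space: "(\<lambda>\<omega>. \<lambda>s\<in>{..<t}. Y s \<omega>) \<in> M \<rightarrow>\<^sub>M PiM {..<t} (\<lambda>_. borel)"
  by (rule measurable_restrict) (simp add: Y)

lemma past_subalgebra: "subalgebra M (past_algebra M Y t)"
  unfolding subalgebra_def past_algebra_def
  using sets_image_in_sets[OF refl past_in_space] by simp

lemma past_measurable:
  assumes "s < t"
  shows "Y s \<in> past_algebra M Y t \<rightarrow>\<^sub>M borel"
proof -
  have "(\<lambda>\<omega>. \<lambda>s\<in>{..<t}. Y s \<omega>) \<in> past_algebra M Y t \<rightarrow>\<^sub>M PiM {..<t} (\<lambda>_. borel)"
    unfolding past_algebra_def by (rule measurable_vimage_algebra1) (auto simp: space_PiM)
  from measurable_compose[OF this measurable_component_singleton[of s]] assms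
  show ?thesis by simp
qed

lemma block_past_measurable:
  assumes "s < t"
  shows "block p Y s \<in> past_algebra M Y t \<rightarrow>\<^sub>M E_pow p"
  unfolding block_def[abs_def]
proof (rule measurable_restrict)
  fix i assume "i \<in> {1..p}"
  then have "s - int p + int i < t" using assms by simp
  then show "Y (s - int p + int i) \<in> past_algebra M Y t \<rightarrow>\<^sub>M borel" by (rule past_measurable)
qed

lemma integral_transition:
  assumes tr: "transition_at p M Y K t" and A: "A \<in> sets (past_algebra M Y t)" and B: "B \<in> sets borel"
    and K: "K \<in> E_pow p \<rightarrow>\<^sub>M prob_algebra borel"
  shows "measure M (A \<inter> {\<omega> \<in> space M. Y t \<omega> \<in> B}) = (\<integral>\<omega>. indicator A \<omega> * measure (K (block p Y (t - 1) \<omega>)) B \<partial>M)"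
proof -
  interpret prob_space M by (rule M)
  interpret finite_measure_subalgebra M "past_algebra M Y t"
    by unfold_locales (rule past_subalgebra)
  let ?S = "{\<omega> \<in> space M. Y t \<omega> \<in> B}"
  have S: "?S \<in> sets M"
    using measurable_sets[OF Y[rule_format, OF order_refl] B] by (simp add: vimage_def Int_def conj_commute)
  have AM: "A \<in> sets M" using A past_subalgebra by (auto simp: subalgebra_def)
  have iS: "integrable M (indicator ?S :: 'w \<Rightarrow> real)"
    by (rule integrable_real_indicator[OF S]) (simp add: less_top[symmetric])
  have b: "block p Y (t - 1) \<in> M \<rightarrow>\<^sub>M E_pow p"
    by (rule measurable_from_subalg[OF past_subalgebra block_past_measurable]) simp
  have "K \<in> E_pow p \<rightarrow>\<^sub>M subprob_algebra borel" by (rule measurable_prob_algebraD[OF K])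
  from measurable_compose[OF b measurable_compose[OF this measurable_measure_subprob_algebra[OF B]]]
  have mK: "(\<lambda>\<omega>. measure (K (block p Y (t - 1) \<omega>)) B) \<in> borel_measurable M" .
  have "measure M (A \<inter> ?S) = (\<integral>\<omega>. indicator (A \<inter> ?S) \<omega> \<partial>M)" using AM S by simp
  also have "\<dots> = (\<integral>\<omega>\<in>A. indicator ?S \<omega> \<partial>M)"
    unfolding set_lebesgue_integral_def
    by (rule Bochner_Integration.integral_cong[OF refl]) (simp add: indicator_def)
  also have "\<dots> = (\<integral>\<omega>\<in>A. real_cond_exp M (past_algebra M Y t) (indicator ?S) \<omega> \<partial>M)"
    by (rule real_cond_exp_intA[OF iS A])
  also have "\<dots> = (\<integral>\<omega>. indicator A \<omega> * measure (K (block p Y (t - 1) \<omega>)) B \<partial>M)"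
    unfolding set_lebesgue_integral_def real_scaleR_def
  proof (rule integral_cong_AE)
    have "AE \<omega> in M. real_cond_exp M (past_algebra M Y t) (indicator ?S) \<omega> = measure (K (block p Y (t - 1) \<omega>)) B"
      using tr B by (simp add: transition_at_def)
    then show "AE \<omega> in M. indicator A \<omega> * real_cond_exp M (past_algebra M Y t) (indicator ?S) \<omega>
        = indicator A \<omega> * measure (K (block p Y (t - 1) \<omega>)) B" by auto
    show "(\<lambda>\<omega>. indicator A \<omega> * real_cond_exp M (past_algebra M Y t) (indicator ?S) \<omega>) \<in> borel_measurable M"
      using AM by (intro borel_measurable_times borel_measurable_indicator borel_measurable_cond_exp2)
    show "(\<lambda>\<omega>. indicator A \<omega> * measure (K (block p Y (t - 1) \<omega>)) B) \<in> borel_measurable M"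
      using AM mK by (intro borel_measurable_times borel_measurable_indicator)
  qed
  finally show ?thesis .
qed

text \<open>Rectangles determine the joint law, and on them the claim is
  \<open>integral_transition\<close>. \<open>H\<close> may be any statistic of the past from which
  \<tau> reads off the last block: below it is the block itself or a path of blocks.\<close>

lemma joint_law_transition:
  assumes tr: "transition_at p M Y K t" and K: "K \<in> E_pow p \<rightarrow>\<^sub>M prob_algebra borel"
    and H: "H \<in> past_algebra M Y t \<rightarrow>\<^sub>M N" and \<tau>: "\<tau> \<in> N \<rightarrow>\<^sub>M E_pow p"
    and \<tau>H: "\<And>\<omega>. \<tau> (H \<omega>) = block p Y (t - 1) \<omega>"
  shows "distr M (N \<Otimes>\<^sub>M borel) (\<lambda>\<omega>. (H \<omega>, Y t \<omega>))
    = distr M N H \<bind> (\<lambda>z. distr (K (\<tau> z)) (N \<Otimes>\<^sub>M borel) (Pair z))" (is "?L = ?R")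
proof -
  interpret prob_space M by (rule M)
  have HM: "H \<in> M \<rightarrow>\<^sub>M N" by (rule measurable_from_subalg[OF past_subalgebra H])
  have Yt: "Y t \<in> M \<rightarrow>\<^sub>M borel" using Y by simp
  have HY: "(\<lambda>\<omega>. (H \<omega>, Y t \<omega>)) \<in> M \<rightarrow>\<^sub>M N \<Otimes>\<^sub>M borel" by (rule measurable_Pair[OF HM Yt])
  interpret L: prob_space ?L by (rule prob_space_distr[OF HY])
  interpret H: prob_space "distr M N H" by (rule prob_space_distr[OF HM])
  let ?k = "\<lambda>z. distr (K (\<tau> z)) (N \<Otimes>\<^sub>M borel) (Pair z)"
  have "(\<lambda>(z, y). (z, y)) \<in> N \<Otimes>\<^sub>M borel \<rightarrow>\<^sub>M N \<Otimes>\<^sub>M (borel :: 'e measure)"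
    using measurable_Pair[OF measurable_fst measurable_snd, of N borel] by (simp add: case_prod_beta')
  from measurable_distr_prob_space2[OF measurable_compose[OF \<tau> K] this]
  have k: "?k \<in> N \<rightarrow>\<^sub>M prob_algebra (N \<Otimes>\<^sub>M borel)" by simp
  have k': "?k \<in> distr M N H \<rightarrow>\<^sub>M subprob_algebra (N \<Otimes>\<^sub>M borel)"
    using measurable_prob_algebraD[OF k] by (simp cong: measurable_cong_sets)
  have HP: "distr M N H \<in> space (prob_algebra N)"
    using H.prob_space_axioms by (simp add: space_prob_algebra)
  interpret R: prob_space ?R by (rule prob_space_bind'[OF HP k])
  have Rs: "sets ?R = sets (N \<Otimes>\<^sub>M borel)" by (rule sets_bind'[OF HP k])
  let ?G = "{a \<times> b |a b. a \<in> sets N \<and> b \<in> sets (borel :: 'e measure)}"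
  show ?thesis
  proof (rule measure_eqI_generator_eq[OF Int_stable_pair_measure_generator[of N borel]])
    show "?G \<subseteq> Pow (space N \<times> space borel)" by (rule pair_measure_closed)
    show "sets ?L = sigma_sets (space N \<times> space borel) ?G" by (simp add: sets_pair_measure)
    show "sets ?R = sigma_sets (space N \<times> space borel) ?G" unfolding Rs by (rule sets_pair_measure)
    show "range (\<lambda>_::nat. space N \<times> space borel) \<subseteq> ?G" by blast
    show "(\<Union>i::nat. space N \<times> space (borel :: 'e measure)) = space N \<times> space borel" by simp
    show "emeasure ?L (space N \<times> space borel) \<noteq> \<infinity>" for i :: nat by simp
    fix X assume "X \<in> ?G"
    then obtain A B where X: "X = A \<times> B" and A: "A \<in> sets N" and B: "B \<in> sets (borel :: 'e measure)" by blast
    have XS: "X \<in> sets (N \<Otimes>\<^sub>M borel)" unfolding X by (rule pair_measureI[OF A B])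
    let ?A = "H -` A \<inter> space M"
    have A': "?A \<in> sets (past_algebra M Y t)"
      using measurable_sets[OF H A] past_subalgebra by (simp add: subalgebra_def)
    have "measure ?L X = measure M (?A \<inter> {\<omega> \<in> space M. Y t \<omega> \<in> B})"
      unfolding measure_distr[OF HY XS] by (rule arg_cong[where f = "measure M"]) (auto simp: X)
    also have "\<dots> = (\<integral>\<omega>. indicator ?A \<omega> * measure (K (block p Y (t - 1) \<omega>)) B \<partial>M)"
      by (rule integral_transition[OF tr A' B K])
    also have "\<dots> = (\<integral>\<omega>. measure (?k (H \<omega>)) X \<partial>M)"
    proof (rule Bochner_Integration.integral_cong[OF refl])
      fix \<omega> assume \<omega>: "\<omega> \<in> space M"
      have z: "H \<omega> \<in> space N" by (rule measurable_space[OF HM \<omega>])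
      have "K (\<tau> (H \<omega>)) \<in> space (prob_algebra borel)"
        by (rule measurable_space[OF K measurable_space[OF \<tau> z]])
      then have s: "sets (K (\<tau> (H \<omega>))) = sets borel" by (simp add: space_prob_algebra)
      have P: "Pair (H \<omega>) \<in> K (\<tau> (H \<omega>)) \<rightarrow>\<^sub>M N \<Otimes>\<^sub>M borel"
        using measurable_Pair1'[OF z, of borel] s by (simp cong: measurable_cong_sets)
      show "indicator ?A \<omega> * measure (K (block p Y (t - 1) \<omega>)) B = measure (?k (H \<omega>)) X"
        unfolding measure_distr[OF P XS] using \<omega> sets_eq_imp_space_eq[OF s]
        by (auto simp: X vimage_def indicator_def Int_def \<tau>H)
    qed
    also have "\<dots> = (\<integral>z. measure (?k z) X \<partial>distr M N H)"
      by (rule integral_distr[symmetric, OF HM measurable_compose[OF measurable_prob_algebraD[OF k]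
              measurable_measure_subprob_algebra[OF XS]]])
    also have "\<dots> = measure ?R X" by (rule H.measure_bind[OF k' XS, symmetric])
    finally show "emeasure ?L X = emeasure ?R X"
      by (simp only: L.emeasure_eq_measure R.emeasure_eq_measure)
  qed
qed

end

context kernel_model
begin

text \<open>The image of \<open>joint_law_transition\<close> under the state update; it turns the
  conditional description of the process into a recursion on laws.\<close>

lemma law_step:
  assumes M: "prob_space M" and Y: "\<forall>s\<le>t. Y s \<in> M \<rightarrow>\<^sub>M borel"
    and u: "u \<in> {0..1}" and tr: "transition_at p M Y (R u) t"
    and sys: "step_system N m N' m' \<tau> \<psi>" and H: "H \<in> past_algebra M Y t \<rightarrow>\<^sub>M N"
    and \<tau>H: "\<And>\<omega>. \<tau> (H \<omega>) = block p Y (t - 1) \<omega>"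
  shows "distr M N' (\<lambda>\<omega>. \<psi> (H \<omega>) (Y t \<omega>)) = distr M N H \<bind> step_kernel N' \<tau> \<psi> u"
proof -
  interpret prob_space M by (rule M)
  note \<psi> = psi_measurable[OF sys] and \<tau> = tau_measurable[OF sys]
  have HM: "H \<in> M \<rightarrow>\<^sub>M N" by (rule measurable_from_subalg[OF past_subalgebra[OF M Y] H])
  have HY: "(\<lambda>\<omega>. (H \<omega>, Y t \<omega>)) \<in> M \<rightarrow>\<^sub>M N \<Otimes>\<^sub>M borel" by (rule measurable_Pair[OF HM]) (use Y in simp)
  let ?k = "\<lambda>z. distr (R u (\<tau> z)) (N \<Otimes>\<^sub>M borel) (Pair z)"
  have "(\<lambda>(z, y). (z, y)) \<in> N \<Otimes>\<^sub>M borel \<rightarrow>\<^sub>M N \<Otimes>\<^sub>M (borel :: 'e measure)"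
    using measurable_Pair[OF measurable_fst measurable_snd, of N borel] by (simp add: case_prod_beta')
  from measurable_distr_prob_space2[OF measurable_compose[OF \<tau> R_prob_kernel[OF u]] this]
  have "?k \<in> N \<rightarrow>\<^sub>M prob_algebra (N \<Otimes>\<^sub>M borel)" by simp
  then have k': "?k \<in> distr M N H \<rightarrow>\<^sub>M subprob_algebra (N \<Otimes>\<^sub>M borel)"
    using measurable_prob_algebraD by (simp cong: measurable_cong_sets)
  have ne: "space (distr M N H) \<noteq> {}" using not_empty measurable_space[OF HM] by auto
  have "distr M N' (\<lambda>\<omega>. \<psi> (H \<omega>) (Y t \<omega>)) = distr (distr M (N \<Otimes>\<^sub>M borel) (\<lambda>\<omega>. (H \<omega>, Y t \<omega>))) N' (\<lambda>(z, y). \<psi> z y)"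
    unfolding distr_distr[OF \<psi> HY] by (simp add: o_def)
  also have "distr M (N \<Otimes>\<^sub>M borel) (\<lambda>\<omega>. (H \<omega>, Y t \<omega>)) = distr M N H \<bind> ?k"
    by (rule joint_law_transition[OF M Y tr R_prob_kernel[OF u] H \<tau> \<tau>H])
  also have "distr \<dots> N' (\<lambda>(z, y). \<psi> z y) = distr M N H \<bind> (\<lambda>z. distr (?k z) N' (\<lambda>(z, y). \<psi> z y))"
    by (rule distr_bind[OF k' ne \<psi>])
  also have "\<dots> = distr M N H \<bind> step_kernel N' \<tau> \<psi> u"
  proof (rule bind_cong[OF refl])
    fix z assume "z \<in> space (distr M N H)"
    then have z: "z \<in> space N" by simp
    have "Pair z \<in> R u (\<tau> z) \<rightarrow>\<^sub>M N \<Otimes>\<^sub>M borel"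
      using measurable_Pair1'[OF z, of borel] by (simp add: sets_R cong: measurable_cong_sets)
    from distr_distr[OF \<psi> this]
    show "distr (?k z) N' (\<lambda>(z, y). \<psi> z y) = step_kernel N' \<tau> \<psi> u z"
      by (simp add: step_kernel_def o_def)
  qed
  finally show ?thesis .
qed

end

section \<open>From the process to the recursions of laws\<close>

context stationary_model
begin

context
  fixes M :: "'w measure" and Y :: "int \<Rightarrow> 'w \<Rightarrow> 'a" and n :: nat
  assumes n: "1 \<le> n" and M: "prob_space M"
    and Y: "\<And>t. t \<le> int n \<Longrightarrow> Y t \<in> M \<rightarrow>\<^sub>M borel"
    and tr: "\<And>t. 1 \<le> t \<Longrightarrow> t \<le> int n \<Longrightarrow> transition_at p M Y (R (real_of_int t / real n)) t"
    and tr0: "transition_at p M Y (R 0) 0"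
    and stat: "stationary_past M Y"
begin

lemma block_shift: "block p Y t \<omega> = shift (block p Y (t - 1) \<omega>) (Y t \<omega>)"
  by (auto simp: block_def shift_def fun_eq_iff intro!: arg_cong[where f = "\<lambda>s. Y s \<omega>"])

lemma block_measurable: "t \<le> int n \<Longrightarrow> block p Y t \<in> M \<rightarrow>\<^sub>M E"
  unfolding block_def[abs_def] by (rule measurable_restrict) (rule Y, simp)

lemma block_law_step:
  assumes u: "u \<in> {0..1}" and t: "t \<le> int n" and tr: "transition_at p M Y (R u) t"
  shows "distr M E (block p Y t) = distr M E (block p Y (t - 1)) \<bind> step_kernel E (\<lambda>x. x) shift u"
proof -
  have Yt: "\<forall>s\<le>t. Y s \<in> M \<rightarrow>\<^sub>M borel" using Y t by simp
  have "distr M E (\<lambda>\<omega>. shift (block p Y (t - 1) \<omega>) (Y t \<omega>))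
      = distr M E (block p Y (t - 1)) \<bind> step_kernel E (\<lambda>x. x) shift u"
    by (rule law_step[OF M Yt u tr shift_system block_past_measurable[OF M Yt]]) simp_all
  then show ?thesis by (simp add: block_shift[symmetric])
qed

text \<open>Stationarity of the past gives the blocks at times -1 and 0 the same law, and the
  transition at time 0 links them through \<open>R 0\<close>. So this law is invariant for the
  kernel at 0, and uniqueness identifies it.\<close>

lemma block_law_0: "distr M E (block p Y 0) = \<pi> 0"
proof (rule pi_unique)
  interpret prob_space M by (rule M)
  have b: "block p Y 0 \<in> M \<rightarrow>\<^sub>M E" by (rule block_measurable) simp
  show "prob_space (distr M E (block p Y 0))" by (rule prob_space_distr[OF b])
  let ?P = "PiM {..0::int} (\<lambda>_. borel :: 'a measure)"
  let ?g = "\<lambda>z. \<lambda>i\<in>{1..p}. z (int i - int p) :: 'a"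
  have g: "?g \<in> ?P \<rightarrow>\<^sub>M E"
    by (rule measurable_restrict) (rule measurable_component_singleton, simp)
  have s: "(\<lambda>\<omega>. \<lambda>s\<in>{..0}. Y (s - m) \<omega>) \<in> M \<rightarrow>\<^sub>M ?P" if "0 \<le> m" for m
    by (rule measurable_restrict) (rule Y, use that in simp)
  have eq: "distr M E (block p Y (- m)) = distr (distr M ?P (\<lambda>\<omega>. \<lambda>s\<in>{..0}. Y (s - m) \<omega>)) E ?g" if "0 \<le> m" for m
  proof -
    have "block p Y (- m) = ?g \<circ> (\<lambda>\<omega>. \<lambda>s\<in>{..0}. Y (s - m) \<omega>)"
      by (auto simp: block_def fun_eq_iff algebra_simps)
    then show ?thesis unfolding distr_distr[OF g s[OF that]] by simp
  qed
  have "distr M ?P (\<lambda>\<omega>. \<lambda>s\<in>{..0}. Y (s - 1) \<omega>) = distr M ?P (\<lambda>\<omega>. \<lambda>s\<in>{..0}. Y (s - 0) \<omega>)"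
    using stat[unfolded stationary_past_def, rule_format, of 1] by simp
  then have "distr M E (block p Y (- 1)) = distr M E (block p Y (- 0))"
    using eq[of 1] eq[of 0] by simp
  then show "distr M E (block p Y 0) \<bind> step_kernel E (\<lambda>x. x) shift 0 = distr M E (block p Y 0)"
    using block_law_step[OF _ _ tr0] by simp
qed simp_all

lemma row_law_block: "row_law n (\<lambda>t. distr M E (block p Y (int t)))"
  unfolding row_law_def
proof (intro conjI allI impI n)
  show "distr M E (block p Y (int 0)) = \<pi> 0" using block_law_0 by simp
  fix t assume "t < n"
  then have t: "int (Suc t) \<le> int n" and u: "real (Suc t) / real n \<in> {0..1}" by auto
  show "distr M E (block p Y (int (Suc t)))
      = distr M E (block p Y (int t)) \<bind> step_kernel E (\<lambda>x. x) shift (real (Suc t) / real n)"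
    using block_law_step[OF u t] tr[OF _ t] by simp
qed

lemma row_path_law_block:
  assumes t: "t \<le> n"
  shows "row_path_law n t (distr M E (block p Y (int t))) (block_path_law p M Y (int t))"
  unfolding row_path_law_def
proof (intro conjI allI impI)
  have "block_path_law p M Y (int t) 1 = distr M (EE 1) (single \<circ> block p Y (int t))"
    unfolding block_path_law_def
    by (rule arg_cong[where f = "distr M (EE 1)"]) (auto simp: single_def fun_eq_iff)
  then show "block_path_law p M Y (int t) 1 = distr (distr M E (block p Y (int t))) (EE 1) single"
    by (subst distr_distr[OF single_measurable block_measurable]) (use t in simp_all)
  fix j assume j: "t + Suc j \<le> n"
  let ?t = "int (t + Suc j)" and ?u = "real (t + Suc j) / real n"
  let ?H = "\<lambda>\<omega>. \<lambda>i\<in>{1..Suc j}. block p Y (int t + int i - 1) \<omega>"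
  have t': "?t \<le> int n" and u: "?u \<in> {0..1}" using j by auto
  have tru: "transition_at p M Y (R ?u) ?t" using tr[OF _ t'] by simp
  have Yt: "\<forall>s\<le>?t. Y s \<in> M \<rightarrow>\<^sub>M borel" using Y t' by simp
  \<comment> \<open>Blocks at times \<open>t\<close> to \<open>t + j\<close> involve letters up to
    time \<open>t + j\<close> only, so they belong to the strict past of
    \<open>t + Suc j\<close>.\<close>
  have H: "?H \<in> past_algebra M Y ?t \<rightarrow>\<^sub>M EE (Suc j)"
    by (rule measurable_restrict) (rule block_past_measurable[OF M Yt], auto)
  have "block_path_law p M Y (int t) (Suc (Suc j)) = distr M (EE (Suc (Suc j))) (\<lambda>\<omega>. path_step (Suc j) (?H \<omega>) (Y ?t \<omega>))"
    unfolding block_path_law_def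
  proof (rule arg_cong[where f = "distr M (EE (Suc (Suc j)))"], rule ext)
    fix \<omega>
    have "shift (block p Y (?t - 1) \<omega>) (Y ?t \<omega>) = block p Y ?t \<omega>" by (rule block_shift[symmetric])
    then show "(\<lambda>i\<in>{1..Suc (Suc j)}. block p Y (int t + int i - 1) \<omega>) = path_step (Suc j) (?H \<omega>) (Y ?t \<omega>)"
      by (auto simp: path_step_def fun_eq_iff algebra_simps)
  qed
  also have "\<dots> = distr M (EE (Suc j)) ?H \<bind> step_kernel (EE (Suc (Suc j))) (\<lambda>z. z (Suc j)) (path_step (Suc j)) ?u"
    by (rule law_step[OF M Yt u tru path_step_system H]) (simp_all add: algebra_simps)
  finally show "block_path_law p M Y (int t) (Suc (Suc j)) = block_path_law p M Y (int t) (Suc j) \<bind>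
      step_kernel (EE (Suc (Suc j))) (\<lambda>z. z (Suc j)) (path_step (Suc j)) (real (t + Suc j) / real n)"
    by (simp add: block_path_law_def)
qed

end

end

theorem corollary3:
  fixes p k :: nat
    and \<gamma> :: "'e::topological_space measure"
    and f :: "real \<Rightarrow> (nat \<Rightarrow> 'e) \<Rightarrow> 'e \<Rightarrow> real"
    and df :: "nat \<Rightarrow> real \<Rightarrow> (nat \<Rightarrow> 'e) \<Rightarrow> 'e \<Rightarrow> real"
    and R :: "real \<Rightarrow> (nat \<Rightarrow> 'e) \<Rightarrow> 'e measure"
    and Q :: "real \<Rightarrow> (nat \<Rightarrow> 'e) \<Rightarrow> (nat \<Rightarrow> 'e) measure"
    and \<pi> :: "real \<Rightarrow> (nat \<Rightarrow> 'e) measure"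
    and \<pi>j :: "real \<Rightarrow> nat \<Rightarrow> (nat \<Rightarrow> nat \<Rightarrow> 'e) measure"
    and M :: "nat \<Rightarrow> 'w measure"
    and Y :: "nat \<Rightarrow> int \<Rightarrow> 'w \<Rightarrow> 'e"
    and \<phi> :: "'e \<Rightarrow> real"
    and V\<^sub>0 :: "(nat \<Rightarrow> 'e) \<Rightarrow> real"
    and \<alpha> :: "nat \<Rightarrow> real \<Rightarrow> real"
    and \<alpha>\<^sub>0 d\<^sub>0 d\<^sub>1 q C :: real
  defines "R \<equiv> R_kernel \<gamma> f"
    and "Q \<equiv> Q_kernel p R"
    and "\<pi>j \<equiv> (\<lambda>u j. path_law (E_pow p) (\<pi> u) (Q u) j)"
    and "V\<^sub>0 \<equiv> (\<lambda>x. \<Sum>i=1..p. \<phi> (x i) powr d\<^sub>1)"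
  assumes p: "p \<ge> 1"
    and \<gamma>: "sets \<gamma> = sets borel"
    and f_measurable: "(\<lambda>(u, x, y). f u x y) \<in>
        borel_measurable (restrict_space borel {0..1} \<Otimes>\<^sub>M (E_pow p \<Otimes>\<^sub>M borel))"
    and f_nonneg: "\<And>u x y. u \<in> {0..1} \<Longrightarrow> x \<in> space (E_pow p) \<Longrightarrow> f u x y \<ge> 0"
    and R_prob_kernel: "\<And>u. u \<in> {0..1} \<Longrightarrow> R u \<in> E_pow p \<rightarrow>\<^sub>M prob_algebra borel"
    and \<pi>: "\<And>u \<mu>. u \<in> {0..1} \<Longrightarrow> invariant_prob (E_pow p) (Q u) \<mu> \<longleftrightarrow> \<mu> = \<pi> u"
    and M_prob: "\<And>n. n \<ge> 1 \<Longrightarrow> prob_space (M n)"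
    and Y_measurable: "\<And>n t. n \<ge> 1 \<Longrightarrow> t \<le> int n \<Longrightarrow> Y n t \<in> M n \<rightarrow>\<^sub>M borel"
    and Y_transition: "\<And>n t. n \<ge> 1 \<Longrightarrow> 1 \<le> t \<Longrightarrow> t \<le> int n \<Longrightarrow>
        transition_at p (M n) (Y n) (R (real_of_int t / real n)) t"
    and Y_past_transition: "\<And>n t. n \<ge> 1 \<Longrightarrow> t \<le> 0 \<Longrightarrow> transition_at p (M n) (Y n) (R 0) t"
    and Y_past_stationary: "\<And>n. n \<ge> 1 \<Longrightarrow> stationary_past (M n) (Y n)"
    and \<phi>_measurable: "\<phi> \<in> borel_measurable borel"
    and \<phi>_ge_1: "\<And>y. \<phi> y \<ge> 1"
    and SCp1_constants: "d\<^sub>0 \<ge> 1" "\<alpha>\<^sub>0 > 0"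
        "\<And>i u. i \<in> {1..p} \<Longrightarrow> u \<in> {0..1} \<Longrightarrow> \<alpha> i u > 0"
        "(SUP u\<in>{0..1}. ereal (\<Sum>i=1..p. \<alpha> i u)) < 1"
    and SCp1_drift: "\<And>u x. u \<in> {0..1} \<Longrightarrow> x \<in> space (E_pow p) \<Longrightarrow>
        (\<integral>\<^sup>+y. ennreal (\<phi> y powr d\<^sub>0) \<partial>R u x)
          \<le> ennreal ((\<Sum>i=1..p. \<alpha> i u * \<phi> (x i) powr d\<^sub>0) + \<alpha>\<^sub>0)"
    and SCp1_small: "\<And>r. r > 0 \<Longrightarrow> \<exists>\<eta>>0. \<exists>\<nu>. prob_space \<nu> \<and> sets \<nu> = sets borel \<and>
        (\<forall>u\<in>{0..1}. \<forall>A\<in>sets borel. \<forall>x\<in>space (E_pow p).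
           (MAX i\<in>{1..p}. \<phi> (x i) powr d\<^sub>0) \<le> r \<longrightarrow> measure (R u x) A \<ge> \<eta> * measure \<nu> A)"
    and SCp2: "k \<ge> 1"
        "\<And>u x y. u \<in> {0..1} \<Longrightarrow> x \<in> space (E_pow p) \<Longrightarrow> df 0 u x y = f u x y"
        "\<And>x y. x \<in> space (E_pow p) \<Longrightarrow> Ck_derivs k (\<lambda>l u. df l u x y)"
    and SCp3_constants: "d\<^sub>1 > 0" "q \<ge> 0" "C > 0" "d\<^sub>1 + real k * q \<le> d\<^sub>0"
    and SCp3_bound: "\<And>l d u x. 1 \<le> l \<Longrightarrow> l \<le> k \<Longrightarrow> 0 \<le> d \<Longrightarrow> d \<le> d\<^sub>1 + real (k - l) * q \<Longrightarrow>
        u \<in> {0..1} \<Longrightarrow> x \<in> space (E_pow p) \<Longrightarrow>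
        (\<integral>\<^sup>+y. ennreal (\<phi> y powr d * \<bar>df l u x y\<bar>) \<partial>\<gamma>)
          \<le> ennreal (C * (\<Sum>i=1..p. \<phi> (x i) powr (d + q * real l)))"
    and SCp3_continuity: "\<And>s u x. s \<le> k \<Longrightarrow> u \<in> {0..1} \<Longrightarrow> x \<in> space (E_pow p) \<Longrightarrow>
        ((\<lambda>h. \<integral>\<^sup>+y. ennreal (\<phi> y powr (d\<^sub>1 + q * real s) *
                 \<bar>df (k - s) (u + h) x y - df (k - s) u x y\<bar>) \<partial>\<gamma>) \<longlongrightarrow> 0) (increments u)"
  shows "locally_stationary p V\<^sub>0 M Y \<pi>j \<and>
    (\<forall>j\<ge>1. Ck_weighted k (E_pow_pow p j) (sum_weight j V\<^sub>0) (\<lambda>u. measure (\<pi>j u j)))"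
proof -
  interpret stationary_model p k \<gamma> f df \<phi> \<alpha> \<alpha>\<^sub>0 d\<^sub>0 d\<^sub>1 q C \<pi>
    by unfold_locales (fact assms[unfolded R_def Q_def])+
  have \<pi>j: "\<pi>j u j = path_pi j u" for u j unfolding \<pi>j_def Q_def R_def ..
  have "\<exists>K>0. \<forall>u\<in>{0..1}. \<forall>n\<ge>1. \<forall>t. 1 \<le> t \<longrightarrow> t \<le> int n - int j + 1 \<longrightarrow>
      weighted_norm (E_pow_pow p j) (sum_weight j V\<^sub>0)
        (\<lambda>A. measure (block_path_law p (M n) (Y n) t j) A - measure (\<pi>j u j) A)
      \<le> ereal (K * (\<bar>u - real_of_int t / real n\<bar> + 1 / real n))" if j: "1 \<le> j" for j
  proof -
    \<comment> \<open>Internally a path is indexed by its number of transitions, one less than its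
      number \<open>j\<close> of blocks.\<close>
    obtain i where i: "j = Suc i" using j by (cases j) auto
    obtain K where K: "0 < K"
      and le: "\<And>n \<mu> t L u. u \<in> {0..1} \<Longrightarrow> row_law n \<mu> \<Longrightarrow> row_path_law n t (\<mu> t) L \<Longrightarrow> t + i \<le> n \<Longrightarrow>
        weighted_norm (E_pow_pow p (Suc i)) (sum_weight (Suc i) V\<^sub>0)
          (\<lambda>A. measure (L (Suc i)) A - measure (path_pi (Suc i) u) A)
        \<le> ereal (K * (\<bar>u - real t / real n\<bar> + 1 / real n))"
      using row_path_weighted_norm[of i] unfolding V\<^sub>0_def by blast
    show ?thesis
    proof (intro exI[of _ K] conjI K ballI allI impI)
      fix u :: real and n :: nat and t :: int
      assume u: "u \<in> {0..1}" and n: "1 \<le> n" and t: "1 \<le> t" "t \<le> int n - int j + 1"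
      define s where "s = nat t"
      have s: "t = int s" "s + i \<le> n" "s \<le> n" using t i by (auto simp: s_def)
      have tr: "transition_at p (M n) (Y n) (R_kernel \<gamma> f (real_of_int t / real n)) t" if "1 \<le> t" "t \<le> int n" for t
        using Y_transition[OF n that] by (simp add: R_def)
      have tr0: "transition_at p (M n) (Y n) (R_kernel \<gamma> f 0) 0"
        using Y_past_transition[OF n] by (simp add: R_def)
      note prems = n M_prob[OF n] Y_measurable[OF n] tr tr0 Y_past_stationary[OF n]
      have "weighted_norm (E_pow_pow p (Suc i)) (sum_weight (Suc i) V\<^sub>0)
          (\<lambda>A. measure (block_path_law p (M n) (Y n) (int s) (Suc i)) A - measure (path_pi (Suc i) u) A)
        \<le> ereal (K * (\<bar>u - real s / real n\<bar> + 1 / real n))"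
      proof (rule le[OF u _ _ s(2)])
        show "row_law n (\<lambda>t. distr (M n) (E_pow p) (block p (Y n) (int t)))"
          by (rule row_law_block) (fact prems)+
        show "row_path_law n s (distr (M n) (E_pow p) (block p (Y n) (int s))) (block_path_law p (M n) (Y n) (int s))"
          by (rule row_path_law_block) (fact prems s(3))+
      qed
      then show "weighted_norm (E_pow_pow p j) (sum_weight j V\<^sub>0)
          (\<lambda>A. measure (block_path_law p (M n) (Y n) t j) A - measure (\<pi>j u j) A)
        \<le> ereal (K * (\<bar>u - real_of_int t / real n\<bar> + 1 / real n))"
        by (simp only: s(1) i \<pi>j of_int_of_nat_eq)
    qed
  qed
  moreover have "Ck_weighted k (E_pow_pow p j) (sum_weight j V\<^sub>0) (\<lambda>u. measure (\<pi>j u j))" if j: "1 \<le> j" for j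
  proof -
    obtain i where i: "j = Suc i" using j by (cases j) auto
    show ?thesis using path_pi_Ck_weighted[of i] unfolding i \<pi>j V\<^sub>0_def .
  qed
  ultimately show ?thesis unfolding locally_stationary_def by blast
qed

end
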